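(* Consider the following adaptive algorithm. Input: an initial guess $u_0\in L^2(0,T;U)$ and a tolerance $\varepsilon\ge0$. Set $S_0=\emptyset$. For $k=0,1,2,\dots$: (1) compute the full-order state $y(u_k)$ and adjoint state $p(y(u_k))$; (2) if $\bar\Delta(u_k)=\tfrac1\beta|\nabla\hat J(u_k)|_{L^2(0,T;U)}\le\varepsilon$, stop and return $u_k$; (3) set $S_{k+1}=S_k\cup\{y(u_k),p(y(u_k))\}$ and let $V_{r_{k+1}}$ be the POD space of maximal rank $r_{k+1}=\bar r_{S_{k+1}}$ for the snapshot set $S_{k+1}$; (4) let $U_{r_{k+1}}$ be the reduced control space induced by $V_{r_{k+1}}$; (5) let $u_{k+1}=\bar u^{r_{k+1}}$ be the unique minimizer of the reduced cost function $\hat J^{r_{k+1}}$ (with reduced state space $V_{r_{k+1}}$) over $L^2(0,T;U_{r_{k+1}})$. Let $\bar u$ be the unique minimizer of $\hat J$ over $L^2(0,T;U)$. Then: If $\varepsilon=0$, the algorithm constructs a sequence $(u_k)_{k\in\mathbb N}$ with $u_k\to\bar u$ in $L^2(0,T;U)$ as $k\to\infty$ (where, if the algorithm stops at some finite step $k^*$, convergence is understood as $u_{k^*}=\bar u$). If $\varepsilon>0$, the algorithm terminates after a finite number of steps $k^*\in\mathbb N$ with output $u_{k^*}$ satisfying $$|\nabla\hat J(u_{k^*})|_{L^2(0,T;U)}\le\beta\varepsilon$$ and $$0\le\underline\Delta(u_{k^*})\le|\bar u-u_{k^*}|_{L^2(0,T;U)}\le\bar\Delta(u_{k^*})\le\v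arepsilon.$$
   Context: Setting: $T>0$; $U,V,H$ are real separable Hilbert spaces with $V\subset H$ compactly and densely embedded; $H$ is identified with its dual, so $V\subset H\subset V'$. $\mathcal L(X,Y)$ is the space of bounded linear operators, $|\cdot|_X$ the norm of $X$, $\mathcal J_X:X\to X'$ the Riesz isomorphism, $W(0,T)=H^1(0,T;V')\cap L^2(0,T;V)$. For $B\in\mathcal L(U,V')$ the dual operator $B'\in\mathcal L(V,U')$ is defined by $\langle B'v,u\rangle_{U',U}=\langle Bu,v\rangle_{V',V}$; $A'(t)$ and $C'(t)$ are the dual (adjoint) operators of $A(t)$ and $C(t)$. Assumptions: (A1) $A\in L^\infty(0,T;\mathcal L(V,V'))$ and there is $\eta_V>0$ with $\langle A(t)v,v\rangle_{V',V}\ge\eta_V|v|_V^2$ for all $t\in(0,T)$, $v\in V$. (A2) $C\in L^\infty(0,T;\mathcal L(H,H))$, $B\in\mathcal L(U,V')$, $\beta>0$, $y_d\in L^2(0,T;H)$, $y_0\in H$. Measurability of $A$ means that $t\mapsto\langle A(t)v,w\rangle_{V',V}$ is measurable for all $v,w\in V$, and analogously for $C$. Cost: $J(y,u)=\int_0^T\tfrac12|C(t)y(t)-y_d(t)|_H^2+\tfrac\beta2|u(t)|_U^2\,dt$. Full-order problem: for $u\in L^2(0,T;U)$, $y=y(u)\in W(0,T)$ is the unique solution of $$\partial_t y(t)+A(t)y(t)=Bu(t)\ \text{ in }V'\text{ for a.e. }t\in(0,T),\qquad y(0)=y_0\ \text{ in }H,$$ and $\hat J(u)=J(y(u),u)$.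 For $y\in L^2(0,T;H)$, $p=p(y)\in W(0,T)$ is the unique solution of $$-\partial_t p(t)+A'(t)p(t)=C'(t)(C(t)y(t)-y_d(t))\ \text{ in }V'\text{ for a.e. }t\in(0,T),\qquad p(T)=0\ \text{ in }H.$$ The gradient is $\nabla\hat J(u)=\mathcal J_U^{-1}B'p(y(u))+\beta u\in L^2(0,T;U)$. Error bounds: $\mathcal S\in\mathcal L(L^2(0,T;U),W(0,T))$ is the linear solution operator $u\mapsto y$ of the state equation with $y_0=0$; $C\mathcal S\in\mathcal L(L^2(0,T;U),L^2(0,T;H))$, $(C\mathcal Su)(t)=C(t)(\mathcal Su)(t)$, with operator norm $\|C\mathcal S\|>0$ (an input constant of the algorithm). For $u\in L^2(0,T;U)$, $$\bar\Delta(u)=\tfrac1\beta|\nabla\hat J(u)|_{L^2(0,T;U)},\qquad\underline\Delta(u)=\tfrac{1}{\beta+\|C\mathcal S\|^2}|\nabla\hat J(u)|_{L^2(0,T;U)}.$$ POD spaces: for a snapshot set $S\subset L^2(0,T;V)$ (here always finite), let $\mathcal R_S:V\to V$, $\mathcal R_Sv=\sum_{s\in S}\int_0^T\langle s(t),v\rangle_V\,s(t)\,dt$, which is bounded, non-negative, self-adjoint and compact. Let $\mathcal W_S=\overline{\operatorname{range}(\mathcal R_S)}\subset V$ and $\bar r_S=\dim\mathcal W_S\in\mathbb N\cup\{\infty\}$ (maximal POD rank). Let $(v_i)$ be orthonormal eigenfunctions of $\mathcal R_S$ belonging to its positive eigenvalues $\lambda_1\ge\lambda_2\ge\dots$ (listed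 with multiplicity, $i=1,\dots,\bar r_S$). The POD space of maximal rank $r=\bar r_S$ is $V_r=\overline{\operatorname{span}\{v_i: i=1,\dots,\bar r_S\}}=\mathcal W_S$ (closure in $V$; this includes the case $\bar r_S=\infty$). Reduced control space induced by $V_r$: $U_r$ is the (closed) span in $U$ of $\mathcal J_U^{-1}B'v_i$, $i=1,\dots,r$, equipped with the inner product of $U$. Reduced problem for $V_r$: for $u\in L^2(0,T;U)$, $y^r=y^r(u)\in W^r(0,T)=H^1(0,T;V_r')\cap L^2(0,T;V_r)$ is the unique solution of $$\partial_t y^r(t)+A(t)y^r(t)=Bu(t)\ \text{ in }V_r'\text{ for a.e. }t\in(0,T),\qquad y^r(0)=y_0^r,$$ where equality in $V_r'$ means equality when tested with elements of $V_r$, and $y_0^r$ is the $H$-orthogonal projection of $y_0$ onto $V_r$ (onto the closure of $V_r$ in $H$ if $V_r$ is infinite-dimensional); $\hat J^r(u)=J(y^r(u),u)$. *)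

theory Defs
  imports "HOL-Analysis.Analysis" "HOL-Library.Extended_Nat"
begin

text \<open>
  Elements of the Bochner spaces are represented by functions on the real line, of which only the
  values on \<open>(0,T)\<close> matter, and equality in these spaces is equality almost everywhere.
\<close>

abbreviation time_measure :: "real \<Rightarrow> real measure" where
  "time_measure T \<equiv> lebesgue_on {0<..<T}"

text \<open>
  All target spaces below are separable (the dual of the separable Hilbert space \<open>V\<close> included), so
  that Borel measurability coincides with strong measurability.
\<close>

definition L2 :: "real \<Rightarrow> (real \<Rightarrow> 'a::real_normed_vector) set" where
  "L2 T = {f. f \<in> borel_measurable (time_measure T) \<and>
              integrable (time_measure T) (\<lambda>t. (norm (f t))\<^sup>2)}"

definition L2_norm :: "real \<Rightarrow> (real \<Rightarrow> 'a::real_normed_vector) \<Rightarrow> real" where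
  "L2_norm T f = sqrt (\<integral>t. (norm (f t))\<^sup>2 \<partial>time_measure T)"

definition L2_into :: "real \<Rightarrow> 'a::real_normed_vector set \<Rightarrow> (real \<Rightarrow> 'a) set" where
  "L2_into T X = {f \<in> L2 T. AE t in time_measure T. f t \<in> X}"

definition test_functions :: "real \<Rightarrow> (real \<Rightarrow> real) set" where
  "test_functions T = {\<phi>. (\<forall>n t. (deriv ^^ n) \<phi> field_differentiable at t) \<and>
                          (\<exists>a b. 0 < a \<and> b < T \<and> (\<forall>t. t \<notin> {a..b} \<longrightarrow> \<phi> t = 0))}"

definition unique_minimizer ::
    "real \<Rightarrow> (real \<Rightarrow> 'a) set \<Rightarrow> ((real \<Rightarrow> 'a) \<Rightarrow> real) \<Rightarrow> (real \<Rightarrow> 'a) \<Rightarrow> bool" where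
  "unique_minimizer T K F u \<longleftrightarrow>
     u \<in> K \<and> (\<forall>w\<in>K. F u \<le> F w) \<and>
     (\<forall>w\<in>K. F w = F u \<longrightarrow> (AE t in time_measure T. w t = u t))"

text \<open>The Riesz isomorphism of a Hilbert space onto its dual is \<^const>\<open>blinfun_inner_right\<close>.\<close>

definition riesz_inv :: "('a::real_inner \<Rightarrow>\<^sub>L real) \<Rightarrow> 'a" where
  "riesz_inv = inv blinfun_inner_right"

text \<open>For reflexive \<open>Y\<close>, the dual of an operator from \<open>X\<close> to \<open>Y'\<close> maps \<open>Y\<close> to \<open>X'\<close>.\<close>

definition dual_op ::
    "('x::real_normed_vector \<Rightarrow>\<^sub>L ('y::real_normed_vector \<Rightarrow>\<^sub>L real)) \<Rightarrow> 'y \<Rightarrow> ('x \<Rightarrow>\<^sub>L real)" where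
  "dual_op L y = Blinfun (\<lambda>x. L x y)"

definition orth_proj :: "'a::real_inner set \<Rightarrow> 'a \<Rightarrow> 'a" where
  "orth_proj K y = (THE x. x \<in> K \<and> (\<forall>w\<in>K. (y - x) \<bullet> w = 0))"

definition edim :: "'a::real_vector set \<Rightarrow> enat" where
  "edim X = (if \<exists>D. finite D \<and> X \<subseteq> span D then enat (dim X) else \<infinity>)"

text \<open>
  The inclusion of \<open>V\<close> in \<open>H\<close> is an injective operator \<open>emb\<close>; an element \<open>h\<close> of \<open>H\<close> acts on \<open>V\<close> as
  the functional mapping \<open>v\<close> to \<open>h \<bullet> emb v\<close>.
\<close>

definition compact_dense_embedding ::
    "('v::real_normed_vector \<Rightarrow>\<^sub>L 'h::real_normed_vector) \<Rightarrow> bool" where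
  "compact_dense_embedding i \<longleftrightarrow>
     inj (blinfun_apply i) \<and> closure (range (blinfun_apply i)) = UNIV \<and>
     compact (closure (blinfun_apply i ` cball 0 1))"

record (overloaded) ('u, 'v, 'h) control_problem =
  horizon :: real
  emb :: "'v::real_normed_vector \<Rightarrow>\<^sub>L 'h::real_normed_vector"
  opA :: "real \<Rightarrow> 'v \<Rightarrow>\<^sub>L ('v \<Rightarrow>\<^sub>L real)"
  opB :: "'u::real_normed_vector \<Rightarrow>\<^sub>L ('v \<Rightarrow>\<^sub>L real)"
  opC :: "real \<Rightarrow> 'h \<Rightarrow>\<^sub>L 'h"
  beta :: real
  y_target :: "real \<Rightarrow> 'h"
  y_init :: "'h"

definition assumption_A1 ::
    "('u::real_inner, 'v::real_inner, 'h::real_inner) control_problem \<Rightarrow> bool" where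
  "assumption_A1 P \<longleftrightarrow>
     (\<forall>v w. (\<lambda>t. opA P t v w) \<in> borel_measurable (time_measure (horizon P))) \<and>
     (\<exists>K. AE t in time_measure (horizon P). norm (opA P t) \<le> K) \<and>
     (\<exists>\<eta>>0. \<forall>t\<in>{0<..<horizon P}. \<forall>v. opA P t v v \<ge> \<eta> * (norm v)\<^sup>2)"

definition assumption_A2 ::
    "('u::real_inner, 'v::real_inner, 'h::real_inner) control_problem \<Rightarrow> bool" where
  "assumption_A2 P \<longleftrightarrow>
     (\<forall>x z. (\<lambda>t. opC P t x \<bullet> z) \<in> borel_measurable (time_measure (horizon P))) \<and>
     (\<exists>K. AE t in time_measure (horizon P). norm (opC P t) \<le> K) \<and>
     beta P > 0 \<and>
     y_target P \<in> L2 (horizon P)"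

text \<open>
  \<open>time_deriv P X y g\<close>: the function \<open>g\<close> is square integrable and is the distributional time
  derivative of \<open>y\<close> in \<open>X'\<close>, for a closed subspace \<open>X\<close> of \<open>V\<close>.  Functionals on \<open>X\<close> are represented
  by functionals on \<open>V\<close>, of which only the restrictions to \<open>X\<close> matter (composition with the
  orthogonal projection onto \<open>X\<close> extends \<open>X'\<close>-valued functions isometrically).  The identity
  of \<open>X'\<close>-valued Bochner integrals is written out by evaluating both sides at the elements of \<open>X\<close>.
\<close>

definition time_deriv ::
    "('u::real_inner, 'v::real_inner, 'h::real_inner) control_problem \<Rightarrow> 'v set \<Rightarrow>
     (real \<Rightarrow> 'v) \<Rightarrow> (real \<Rightarrow> ('v \<Rightarrow>\<^sub>L real)) \<Rightarrow> bool" where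
  "time_deriv P X y g \<longleftrightarrow>
     g \<in> L2 (horizon P) \<and>
     (\<forall>\<phi>\<in>test_functions (horizon P). \<forall>w\<in>X.
        (\<integral>t. deriv \<phi> t * (emb P (y t) \<bullet> emb P w) \<partial>time_measure (horizon P)) =
        - (\<integral>t. \<phi> t * g t w \<partial>time_measure (horizon P)))"

text \<open>Point values are those of the representative that is continuous with values in \<open>H\<close>.\<close>

definition has_value_at ::
    "('u::real_inner, 'v::real_inner, 'h::real_inner) control_problem \<Rightarrow>
     (real \<Rightarrow> 'v) \<Rightarrow> real \<Rightarrow> 'h \<Rightarrow> bool" where
  "has_value_at P y s h \<longleftrightarrow>
     (\<exists>c. continuous_on {0..horizon P} c \<and>
          (AE t in time_measure (horizon P). c t = emb P (y t)) \<and> c s = h)"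

text \<open>
  \<open>X = UNIV\<close> gives the full-order equation and \<open>X = V\<^sub>r\<close> the reduced one.
\<close>

definition solves_state_eq ::
    "('u::real_inner, 'v::real_inner, 'h::real_inner) control_problem \<Rightarrow> 'v set \<Rightarrow> 'h \<Rightarrow>
     (real \<Rightarrow> 'u) \<Rightarrow> (real \<Rightarrow> 'v) \<Rightarrow> bool" where
  "solves_state_eq P X h u y \<longleftrightarrow>
     y \<in> L2_into (horizon P) X \<and>
     (\<exists>g. time_deriv P X y g \<and>
          (AE t in time_measure (horizon P). \<forall>w\<in>X.
             g t w + opA P t (y t) w = opB P (u t) w)) \<and>
     has_value_at P y 0 h"

definition solves_adjoint_eq ::
    "('u::real_inner, 'v::real_inner, 'h::real_inner) control_problem \<Rightarrow>
     (real \<Rightarrow> 'h) \<Rightarrow> (real \<Rightarrow> 'v) \<Rightarrow> bool" where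
  "solves_adjoint_eq P y p \<longleftrightarrow>
     p \<in> L2 (horizon P) \<and>
     (\<exists>g. time_deriv P UNIV p g \<and>
          (AE t in time_measure (horizon P). \<forall>w.
             - g t w + dual_op (opA P t) (p t) w =
             adjoint (blinfun_apply (opC P t)) (opC P t (y t) - y_target P t) \<bullet> emb P w)) \<and>
     has_value_at P p (horizon P) 0"

text \<open>
  The solutions are unique up to null sets, and the predicates above do not distinguish functions
  that agree almost everywhere on \<open>(0,T)\<close>.  Hence the choices below single out one and the same
  representative whenever two solutions are equal as elements of a Bochner space, and sets of
  such functions may be used as sets of elements of \<open>L\<^sup>2(0,T;V)\<close>.
\<close>

definition state_from ::
    "('u::real_inner, 'v::real_inner, 'h::real_inner) control_problem \<Rightarrow> 'v set \<Rightarrow> 'h \<Rightarrow>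
     (real \<Rightarrow> 'u) \<Rightarrow> real \<Rightarrow> 'v" where
  "state_from P X h u = (SOME y. solves_state_eq P X h u y)"

definition state ::
    "('u::real_inner, 'v::real_inner, 'h::real_inner) control_problem \<Rightarrow>
     (real \<Rightarrow> 'u) \<Rightarrow> real \<Rightarrow> 'v" where
  "state P = state_from P UNIV (y_init P)"

definition lin_state ::
    "('u::real_inner, 'v::real_inner, 'h::real_inner) control_problem \<Rightarrow>
     (real \<Rightarrow> 'u) \<Rightarrow> real \<Rightarrow> 'v" where
  "lin_state P = state_from P UNIV 0"

definition red_state ::
    "('u::real_inner, 'v::real_inner, 'h::real_inner) control_problem \<Rightarrow> 'v set \<Rightarrow>
     (real \<Rightarrow> 'u) \<Rightarrow> real \<Rightarrow> 'v" where
  "red_state P X = state_from P X (orth_proj (closure (blinfun_apply (emb P) ` X)) (y_init P))"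

definition adjoint_state ::
    "('u::real_inner, 'v::real_inner, 'h::real_inner) control_problem \<Rightarrow>
     (real \<Rightarrow> 'h) \<Rightarrow> real \<Rightarrow> 'v" where
  "adjoint_state P y = (SOME p. solves_adjoint_eq P y p)"

definition adjoint_of_control ::
    "('u::real_inner, 'v::real_inner, 'h::real_inner) control_problem \<Rightarrow>
     (real \<Rightarrow> 'u) \<Rightarrow> real \<Rightarrow> 'v" where
  "adjoint_of_control P u = adjoint_state P (\<lambda>t. emb P (state P u t))"

definition cost ::
    "('u::real_inner, 'v::real_inner, 'h::real_inner) control_problem \<Rightarrow>
     (real \<Rightarrow> 'v) \<Rightarrow> (real \<Rightarrow> 'u) \<Rightarrow> real" where
  "cost P y u =
     (\<integral>t. 1/2 * (norm (opC P t (emb P (y t)) - y_target P t))\<^sup>2 + beta P / 2 * (norm (u t))\<^sup>2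
        \<partial>time_measure (horizon P))"

definition full_cost ::
    "('u::real_inner, 'v::real_inner, 'h::real_inner) control_problem \<Rightarrow>
     (real \<Rightarrow> 'u) \<Rightarrow> real" where
  "full_cost P u = cost P (state P u) u"

definition red_cost ::
    "('u::real_inner, 'v::real_inner, 'h::real_inner) control_problem \<Rightarrow> 'v set \<Rightarrow>
     (real \<Rightarrow> 'u) \<Rightarrow> real" where
  "red_cost P X u = cost P (red_state P X u) u"

definition gradient ::
    "('u::real_inner, 'v::real_inner, 'h::real_inner) control_problem \<Rightarrow>
     (real \<Rightarrow> 'u) \<Rightarrow> real \<Rightarrow> 'u" where
  "gradient P u = (\<lambda>t. riesz_inv (dual_op (opB P) (adjoint_of_control P u t)) + beta P *\<^sub>R u t)"

definition norm_CS ::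
    "('u::real_inner, 'v::real_inner, 'h::real_inner) control_problem \<Rightarrow> real" where
  "norm_CS P =
     Sup {L2_norm (horizon P) (\<lambda>t. opC P t (emb P (lin_state P u t))) | u.
            u \<in> L2 (horizon P) \<and> L2_norm (horizon P) u \<le> 1}"

definition Delta_upper ::
    "('u::real_inner, 'v::real_inner, 'h::real_inner) control_problem \<Rightarrow>
     (real \<Rightarrow> 'u) \<Rightarrow> real" where
  "Delta_upper P u = 1 / beta P * L2_norm (horizon P) (gradient P u)"

definition Delta_lower ::
    "('u::real_inner, 'v::real_inner, 'h::real_inner) control_problem \<Rightarrow>
     (real \<Rightarrow> 'u) \<Rightarrow> real" where
  "Delta_lower P u = 1 / (beta P + (norm_CS P)\<^sup>2) * L2_norm (horizon P) (gradient P u)"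

definition pod_operator ::
    "real \<Rightarrow> (real \<Rightarrow> 'v::{real_inner, banach, second_countable_topology}) set \<Rightarrow> 'v \<Rightarrow> 'v" where
  "pod_operator T S v = (\<Sum>s\<in>S. \<integral>t. (s t \<bullet> v) *\<^sub>R s t \<partial>time_measure T)"

definition max_pod_rank ::
    "real \<Rightarrow> (real \<Rightarrow> 'v::{real_inner, banach, second_countable_topology}) set \<Rightarrow> enat" where
  "max_pod_rank T S = edim (closure (range (pod_operator T S)))"

text \<open>
  \<open>(lam i, v i)\<close> for \<open>i < max_pod_rank T S\<close> lists the positive eigenvalues in decreasing order,
  with multiplicity, together with orthonormal eigenfunctions; indices start at \<open>0\<close>.  The last
  condition says that no positive eigenvalue is missing or listed with too small a multiplicity.
\<close>

definition pod_eigensystem ::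
    "real \<Rightarrow> (real \<Rightarrow> 'v::{real_inner, banach, second_countable_topology}) set \<Rightarrow>
     (nat \<Rightarrow> real) \<Rightarrow> (nat \<Rightarrow> 'v) \<Rightarrow> bool" where
  "pod_eigensystem T S lam v \<longleftrightarrow>
     (\<forall>i. enat i < max_pod_rank T S \<longrightarrow> lam i > 0 \<and> pod_operator T S (v i) = lam i *\<^sub>R v i) \<and>
     (\<forall>i j. i \<le> j \<and> enat j < max_pod_rank T S \<longrightarrow> lam j \<le> lam i) \<and>
     (\<forall>i j. enat i < max_pod_rank T S \<and> enat j < max_pod_rank T S \<longrightarrow>
            v i \<bullet> v j = (if i = j then 1 else 0)) \<and>
     (\<forall>\<mu> w. \<mu> > 0 \<and> pod_operator T S w = \<mu> *\<^sub>R w \<longrightarrow>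
            w \<in> span {v i | i. enat i < max_pod_rank T S \<and> lam i = \<mu>})"

definition pod_space :: "enat \<Rightarrow> (nat \<Rightarrow> 'v::real_normed_vector) \<Rightarrow> 'v set" where
  "pod_space r v = closure (span {v i | i. enat i < r})"

definition red_control_space ::
    "('u::real_inner, 'v::real_inner, 'h::real_inner) control_problem \<Rightarrow>
     enat \<Rightarrow> (nat \<Rightarrow> 'v) \<Rightarrow> 'u set" where
  "red_control_space P r v = closure (span {riesz_inv (dual_op (opB P) (v i)) | i. enat i < r})"

primrec snapshots ::
    "('u::real_inner, 'v::real_inner, 'h::real_inner) control_problem \<Rightarrow>
     (nat \<Rightarrow> real \<Rightarrow> 'u) \<Rightarrow> nat \<Rightarrow> (real \<Rightarrow> 'v) set" where
  "snapshots P u 0 = {}"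
| "snapshots P u (Suc k) = snapshots P u k \<union> {state P (u k), adjoint_of_control P (u k)}"

definition algorithm_step ::
    "('u::real_inner, 'v::{real_inner, banach, second_countable_topology}, 'h::real_inner)
       control_problem \<Rightarrow> (real \<Rightarrow> 'v) set \<Rightarrow> (real \<Rightarrow> 'u) \<Rightarrow> bool" where
  "algorithm_step P S u_next \<longleftrightarrow>
     (\<exists>lam v. pod_eigensystem (horizon P) S lam v \<and>
        (let r = max_pod_rank (horizon P) S in
           unique_minimizer (horizon P)
             (L2_into (horizon P) (red_control_space P r v))
             (red_cost P (pod_space r v)) u_next))"

text \<open>
  A complete run of the algorithm with iterates \<open>u\<close>: it stops at step \<open>k\<close> if \<open>N = enat k\<close> and
  never stops if \<open>N = \<infinity>\<close>.  The values \<open>u k\<close> with \<open>k > N\<close> are meaningless.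
\<close>

definition algorithm_run ::
    "('u::real_inner, 'v::{real_inner, banach, second_countable_topology}, 'h::real_inner)
       control_problem \<Rightarrow> real \<Rightarrow> (real \<Rightarrow> 'u) \<Rightarrow> (nat \<Rightarrow> real \<Rightarrow> 'u) \<Rightarrow> enat \<Rightarrow> bool" where
  "algorithm_run P \<epsilon> u\<^sub>0 u N \<longleftrightarrow>
     u 0 = u\<^sub>0 \<and>
     (\<forall>k. enat k < N \<longrightarrow>
        \<not> Delta_upper P (u k) \<le> \<epsilon> \<and> algorithm_step P (snapshots P u (Suc k)) (u (Suc k))) \<and>
     (\<forall>k. N = enat k \<longrightarrow> Delta_upper P (u k) \<le> \<epsilon>)"

end

theory Submission
  imports Defs "HOL-Library.Diagonal_Subsequence"
begin

text \<open>
  Every minimizer \<open>u k\<close> of a reduced cost function is a zero of the reduced gradient, and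
  so the reduced control spaces are no restriction. The POD spaces \<open>X k\<close> increase and
  contain the state and the adjoint state of all earlier iterates almost everywhere; on
  these iterates the reduced gradient agrees with the full one.

  Let \<open>X\<close> be the closure of the union of the \<open>X k\<close> and \<open>v\<close> the minimizer of the cost
  function reduced to \<open>X\<close>. Strong convexity bounds the distance of \<open>u k\<close> to \<open>v\<close> by the
  reduced gradient at \<open>v\<close>, which tends to zero by Galerkin convergence of the state and
  the adjoint state. Hence consecutive iterates approach each other, and since the reduced
  gradients are Lipschitz continuous uniformly in the subspace, the full gradient at \<open>u k\<close>
  tends to zero. The error bounds then give convergence to the optimal control, and
  termination for positive tolerance.

  For the evolution equations, the eigenvectors of the compact operator that represents
  the inner product of \<open>H\<close> on a closed subspace of \<open>V\<close> are orthogonal in both spaces. They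
  reduce integration by parts and the reference equation \<open>y' + l y = F\<close> to scalar
  statements; general coercive operators follow by a contraction argument.
\<close>

section \<open>Hilbert spaces\<close>

text \<open>The POD spaces are not known to become dense in V, so X may be a proper subspace and
  \<open>v\<close> is at this stage only the optimum of the problem on X. That the limit is the true
  optimum is read off from the full gradient alone, which at each iterate can be evaluated inside
  the next reduced space.

  The main analytic obstacle is Galerkin convergence on a merely increasing family of subspaces. The
  V-orthogonal projections need not be stable in the dual norm, so projecting the limit solution
  itself would give no control of its time derivative. Therefore the solution is truncated to
  finitely many basis vectors with scalar, absolutely continuous coefficients, and only these
  vectors are projected. Orthogonality in both V and H is what makes the truncation a contraction in
  either norm.

  Functionals on V are represented by elements of V throughout. Dual operators thereby become
  Hilbert space adjoints, and the vector valued equation can be tested and expanded like a family of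
  scalar ones.\<close>

text \<open>The midpoint inequality makes every minimizing sequence Cauchy. The distance
  \<open>d\<close> is abstract, and completeness enters only through convergence of the values,
  because the lemma serves both a Hilbert space and square integrable functions, where
  \<open>L2_norm\<close> of a difference is merely a pseudometric.\<close>

lemma strongly_convex_minimizer:
  fixes F :: "'a \<Rightarrow> real" and d :: "'a \<Rightarrow> 'a \<Rightarrow> real"
  assumes ne: "K \<noteq> {}" and bdd: "\<And>x. x \<in> K \<Longrightarrow> m \<le> F x" and kap: "\<kappa> > 0"
    and mid: "\<And>x y. x \<in> K \<Longrightarrow> y \<in> K \<Longrightarrow> \<exists>z\<in>K. F z + \<kappa> * (d x y)\<^sup>2 \<le> (F x + F y) / 2"
    and compl: "\<And>s. (\<And>n. s n \<in> K) \<Longrightarrow>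
        (\<And>e. e > 0 \<Longrightarrow> \<exists>N. \<forall>m\<ge>N. \<forall>n\<ge>N. d (s m) (s n) < e) \<Longrightarrow>
        \<exists>x\<in>K. (\<lambda>n. F (s n)) \<longlonglongrightarrow> F x"
  shows "\<exists>x\<in>K. \<forall>w\<in>K. F x \<le> F w"
proof -
  define I where "I = Inf (F ` K)"
  have bb: "bdd_below (F ` K)"
    using bdd by (intro bdd_belowI2) auto
  have I_le: "I \<le> F x" if "x \<in> K" for x
    unfolding I_def using bb that by (intro cInf_lower) auto
  have "\<exists>x\<in>K. F x < I + inverse (real (Suc n))" for n
  proof -
    have "Inf (F ` K) < I + inverse (real (Suc n))"
      unfolding I_def by simp
    from cInf_lessD[OF _ this] ne show ?thesis by auto
  qed
  then obtain s where s: "\<And>n. s n \<in> K" "\<And>n. F (s n) < I + inverse (real (Suc n))"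
    by metis
  \<comment> \<open>Both values exceed the infimum \<open>I\<close> by at most the stated inverse,
    while the value at \<open>z\<close> is at least \<open>I\<close>; the gap that remains must
    accommodate the convexity term.\<close>
  have d2: "\<kappa> * (d (s m) (s n))\<^sup>2 \<le> inverse (real (Suc N))" if mn: "m \<ge> N" "n \<ge> N" for m n N
  proof -
    obtain z where z: "z \<in> K" "F z + \<kappa> * (d (s m) (s n))\<^sup>2 \<le> (F (s m) + F (s n)) / 2"
      using mid s(1) by blast
    have "inverse (real (Suc m)) \<le> inverse (real (Suc N))"
         "inverse (real (Suc n)) \<le> inverse (real (Suc N))"
      using mn by (auto intro!: le_imp_inverse_le)
    moreover have "d \<le> c" if "x < I + a" "y < I + b" "w + d \<le> (x + y) / 2" "I \<le> w" "a \<le> c" "b \<le> c"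
      for a b c d x y w :: real
      using that by (simp add: field_simps)
    ultimately show ?thesis using s(2)[of m] s(2)[of n] z(2) I_le[OF z(1)] by blast
  qed
  have "\<exists>N. \<forall>m\<ge>N. \<forall>n\<ge>N. d (s m) (s n) < e" if e: "e > 0" for e
  proof -
    obtain N where N: "inverse (real (Suc N)) < \<kappa> * e\<^sup>2"
      using reals_Archimedean[of "\<kappa> * e\<^sup>2"] kap e by auto
    have "d (s m) (s n) < e" if "m \<ge> N" "n \<ge> N" for m n
    proof -
      have "\<kappa> * (d (s m) (s n))\<^sup>2 < \<kappa> * e\<^sup>2" using d2[OF that] N by linarith
      then have "(d (s m) (s n))\<^sup>2 < e\<^sup>2" using kap by simp
      then show ?thesis using e by (intro power2_less_imp_less[of _ e]) auto
    qed
    then show ?thesis by blast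
  qed
  from compl[OF s(1) this] obtain x where x: "x \<in> K" "(\<lambda>n. F (s n)) \<longlonglongrightarrow> F x" by blast
  have "(\<lambda>n. F (s n)) \<longlonglongrightarrow> I"
  proof (rule tendsto_sandwich[of "\<lambda>_. I" _ _ "\<lambda>n. I + inverse (real (Suc n))"])
    show "(\<lambda>n. I + inverse (real (Suc n))) \<longlonglongrightarrow> I"
      using LIMSEQ_inverse_real_of_nat_add[of I] by simp
    show "\<forall>\<^sub>F n in sequentially. F (s n) \<le> I + inverse (real (Suc n))"
      using s(2) by (intro always_eventually allI less_imp_le)
  qed (use I_le s(1) in \<open>auto intro!: always_eventually\<close>)
  with x(2) have "F x = I" by (rule LIMSEQ_unique)
  with x(1) I_le show ?thesis by auto
qed

text \<open>A first order condition along a line: \<open>b\<close> is the directional derivative at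
  a minimum, and no differentiability of the functional enters. At \<open>- b / k\<close> with
  \<open>k\<close> positive and larger than \<open>c\<close>, the polynomial would be
  negative.\<close>

lemma quadratic_nonneg_imp_linear_zero:
  fixes b c :: real
  assumes "\<And>t. b * t + c * t\<^sup>2 \<ge> 0"
  shows "b = 0"
proof (rule ccontr)
  assume b: "b \<noteq> 0"
  define k where "k = \<bar>c\<bar> + 1"
  have k: "k > 0" "c < k" by (auto simp: k_def)
  have "b * (- b / k) + c * (- b / k)\<^sup>2 = (b\<^sup>2 / k\<^sup>2) * (c - k)"
    using k by (simp add: field_simps power2_eq_square)
  moreover have "(b\<^sup>2 / k\<^sup>2) * (c - k) < 0"
    using b k by (intro mult_pos_neg) auto
  ultimately show False using assms[of "- b / k"] by linarith
qed

text \<open>The representative minimizes the energy \<open>F\<close> over \<open>K\<close>. Allowing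
  a closed subspace covers orthogonal projections, with an inner product as \<open>f\<close>,
  together with the Riesz isomorphism, where \<open>K\<close> is the whole space.\<close>

lemma riesz_subspace:
  fixes f :: "'a::{real_inner, banach} \<Rightarrow> real"
  assumes K: "subspace K" "closed K" and f: "bounded_linear f"
  shows "\<exists>x\<in>K. \<forall>w\<in>K. x \<bullet> w = f w"
proof -
  interpret f: bounded_linear f by fact
  obtain B where B: "\<And>x. norm (f x) \<le> norm x * B" using f.bounded by blast
  define F where "F x = (x \<bullet> x) / 2 - f x" for x
  have "\<exists>x\<in>K. \<forall>w\<in>K. F x \<le> F w"
  \<comment> \<open>The constant 1/8 is exact by the parallelogram law; the lower bound comes from
    completing the square in the norm of x.\<close>
  proof (rule strongly_convex_minimizer[where \<kappa> = "1/8" and d = "\<lambda>x y. norm (x - y)" and m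
    = "- B\<^sup>2 / 2"])
    show "K \<noteq> {}" using K subspace_0 by blast
    fix x assume "x \<in> K"
    have "f x \<le> norm x * B" using B[of x] by auto
    moreover have "0 \<le> (norm x - B)\<^sup>2" by simp
    ultimately show "- B\<^sup>2 / 2 \<le> F x"
      unfolding F_def power2_norm_eq_inner[symmetric] by (simp add: power2_diff)
  next
    fix x y assume xy: "x \<in> K" "y \<in> K"
    have "(1/2) *\<^sub>R (x + y) \<in> K" using xy K by (intro subspace_scale subspace_add)
    moreover have "F ((1/2) *\<^sub>R (x + y)) + 1/8 * (norm (x - y))\<^sup>2 \<le> (F x + F y) / 2"
      unfolding F_def power2_norm_eq_inner
      by (simp add: f.scaleR f.add inner_add_left inner_add_right inner_diff_left inner_diff_right
        inner_commute[of y x] diff_divide_distrib add_divide_distrib)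
    ultimately show "\<exists>z\<in>K. F z + 1/8 * (norm (x - y))\<^sup>2 \<le> (F x + F y) / 2" by blast
  next
    fix s :: "nat \<Rightarrow> 'a"
    assume s: "\<And>n. s n \<in> K" "\<And>e. e > 0 \<Longrightarrow> \<exists>N. \<forall>m\<ge>N. \<forall>n\<ge>N. norm (s m - s n) < e"
    then have "Cauchy s" by (simp add: Cauchy_def dist_norm)
    then obtain x where x: "s \<longlonglongrightarrow> x" using Cauchy_convergent_iff convergent_def by blast
    then have "x \<in> K" using K s(1) closed_sequentially by blast
    moreover have "(\<lambda>n. F (s n)) \<longlonglongrightarrow> F x"
      unfolding F_def by (intro tendsto_intros x f.tendsto)
        simp
    ultimately show "\<exists>x\<in>K. (\<lambda>n. F (s n)) \<longlonglongrightarrow> F x" by blast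
  qed simp
  then obtain x where x: "x \<in> K" "\<And>w. w \<in> K \<Longrightarrow> F x \<le> F w" by blast
  have "x \<bullet> w = f w" if w: "w \<in> K" for w
  proof -
    have "(x \<bullet> w - f w) * t + (w \<bullet> w / 2) * t\<^sup>2 \<ge> 0" for t
    proof -
      have "x + t *\<^sub>R w \<in> K" using x(1) w K by (intro subspace_scale subspace_add)
      from x(2)[OF this] show ?thesis unfolding F_def
        by (simp add: f.scaleR f.add inner_add_left inner_add_right inner_commute algebra_simps
          power2_eq_square)
    qed
    from quadratic_nonneg_imp_linear_zero[OF this] show ?thesis by simp
  qed
  with x(1) show ?thesis by blast
qed

section \<open>Orthogonal projections onto closed subspaces\<close>

lemma orth_proj_ex1:
  fixes K :: "'a::{real_inner, banach} set"
  assumes K: "subspace K" "closed K"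
  shows "\<exists>!x. x \<in> K \<and> (\<forall>w\<in>K. (y - x) \<bullet> w = 0)"
proof -
  obtain x where x: "x \<in> K" "\<And>w. w \<in> K \<Longrightarrow> x \<bullet> w = y \<bullet> w"
    using riesz_subspace[OF K bounded_linear_inner_right[of y]] by blast
  show ?thesis
  proof (rule ex1I[of _ x])
    show "x \<in> K \<and> (\<forall>w\<in>K. (y - x) \<bullet> w = 0)" using x by (simp add: inner_diff_left)
    fix x' assume x': "x' \<in> K \<and> (\<forall>w\<in>K. (y - x') \<bullet> w = 0)"
    then have "x' - x \<in> K" using x K by (simp add: subspace_diff)
    then have "x' \<bullet> (x' - x) = x \<bullet> (x' - x)" using x(2) x' by (simp add: inner_diff_left)
    then have "(x' - x) \<bullet> (x' - x) = 0" by (simp add: inner_diff_left)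
    then show "x' = x" by simp
  qed
qed

context
  fixes K :: "'a::{real_inner, banach} set"
  assumes K: "subspace K" "closed K"
begin

lemma orth_proj_mem: "orth_proj K y \<in> K"
  using theI'[OF orth_proj_ex1[OF K, of y]] unfolding orth_proj_def by blast

lemma orth_proj_inner: "w \<in> K \<Longrightarrow> orth_proj K y \<bullet> w = y \<bullet> w"
  using theI'[OF orth_proj_ex1[OF K, of y]] unfolding orth_proj_def by (auto simp: inner_diff_left)

lemma orth_proj_unique: "x \<in> K \<Longrightarrow> (\<And>w. w \<in> K \<Longrightarrow> x \<bullet> w = y \<bullet> w) \<Longrightarrow> orth_proj K y = x"
  unfolding orth_proj_def by (rule the1_equality[OF orth_proj_ex1[OF K]]) (auto simp: inner_diff_left)

lemma orth_proj_id: "x \<in> K \<Longrightarrow> orth_proj K x = x"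
  by (rule orth_proj_unique) auto

lemma orth_proj_add: "orth_proj K (x + y) = orth_proj K x + orth_proj K y"
  by (rule orth_proj_unique) (auto simp: inner_add_left orth_proj_inner orth_proj_mem K subspace_add)

lemma orth_proj_scale: "orth_proj K (c *\<^sub>R x) = c *\<^sub>R orth_proj K x"
  by (rule orth_proj_unique) (auto simp: orth_proj_inner orth_proj_mem K subspace_scale)

lemma orth_proj_norm_le: "norm (orth_proj K x) \<le> norm x"
proof -
  have "(norm (orth_proj K x))\<^sup>2 = x \<bullet> orth_proj K x"
    by (simp add: power2_norm_eq_inner orth_proj_inner orth_proj_mem)
  also have "\<dots> \<le> norm x * norm (orth_proj K x)" by (rule norm_cauchy_schwarz)
  finally show ?thesis by (cases "norm (orth_proj K x) = 0") (auto simp: power2_eq_square)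
qed

lemma orth_proj_bounded_linear: "bounded_linear (orth_proj K)"
  by (rule bounded_linear_intro[where K = 1]) (auto simp: orth_proj_add orth_proj_scale
    orth_proj_norm_le)

lemma orth_proj_diff: "orth_proj K (x - y) = orth_proj K x - orth_proj K y"
  using orth_proj_bounded_linear by (rule linear_diff[OF bounded_linear.linear])

lemma orth_proj_sym: "orth_proj K x \<bullet> y = x \<bullet> orth_proj K y"
  by (metis orth_proj_inner orth_proj_mem inner_commute)

lemma orth_proj_best: "w \<in> K \<Longrightarrow> norm (x - orth_proj K x) \<le> norm (x - w)"
proof -
  assume w: "w \<in> K"
  have "orth_proj K x - w \<in> K" using w orth_proj_mem K by (simp add: subspace_diff)
  then have "(x - orth_proj K x) \<bullet> (orth_proj K x - w) = 0"
    by (simp add: inner_diff_left orth_proj_inner)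
  then have "(norm (x - orth_proj K x + (orth_proj K x - w)))\<^sup>2 = (norm (x - orth_proj K x))\<^sup>2
    + (norm (orth_proj K x - w))\<^sup>2"
    unfolding power2_norm_eq_inner inner_add_left inner_add_right
    by (simp only: inner_commute[of "orth_proj K x - w" "x - orth_proj K x"])
  then have "(norm (x - orth_proj K x))\<^sup>2 \<le> (norm (x - w))\<^sup>2" by simp
  then show ?thesis by (rule power2_le_imp_le) simp
qed

end

lemma orth_proj_UNIV [simp]: "orth_proj UNIV (x::'a::{real_inner, banach}) = x"
  by (rule orth_proj_id) auto

section \<open>The Riesz isomorphism and adjoint operators\<close>

text \<open>As \<open>riesz_inv\<close> is defined by \<open>inv\<close>, its meaning rests on
  surjectivity of \<open>blinfun_inner_right\<close>, which is Riesz representation on the whole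
  space.\<close>

lemma riesz_inv_inner [simp]:
  fixes f :: "'a::{real_inner, banach} \<Rightarrow>\<^sub>L real"
  shows "riesz_inv f \<bullet> w = f w"
proof -
  obtain x where "\<And>w. x \<bullet> w = f w"
    using riesz_subspace[of UNIV "blinfun_apply f"] blinfun.bounded_linear_right by auto
  then have "blinfun_inner_right x = f" by (intro blinfun_eqI) simp
  then have "f \<in> range blinfun_inner_right" by blast
  then have "blinfun_inner_right (riesz_inv f) = f" unfolding riesz_inv_def by (rule f_inv_into_f)
  then show ?thesis by (metis blinfun_inner_right.rep_eq)
qed

lemma inner_eqI: "(\<And>w. x \<bullet> w = y \<bullet> w) \<Longrightarrow> x = (y::'a::real_inner)"
  by (metis inner_commute vector_eq_rdot)

lemma norm_riesz_inv [simp]: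
  fixes f :: "'a::{real_inner, banach} \<Rightarrow>\<^sub>L real"
  shows "norm (riesz_inv f) = norm f"
proof (rule antisym)
  have "(norm (riesz_inv f))\<^sup>2 = f (riesz_inv f)" by (simp add: power2_norm_eq_inner)
  also have "\<dots> \<le> norm f * norm (riesz_inv f)" using norm_blinfun[of f "riesz_inv f"] by simp
  finally show "norm (riesz_inv f) \<le> norm f"
    by (cases "norm (riesz_inv f) = 0") (auto simp: power2_eq_square)
  show "norm f \<le> norm (riesz_inv f)"
    by (rule norm_blinfun_bound) (auto simp: riesz_inv_inner[symmetric] Cauchy_Schwarz_ineq2 simp del:
      riesz_inv_inner)
qed

lemma bounded_linear_riesz_inv: "bounded_linear (riesz_inv :: ('a::{real_inner, banach} \<Rightarrow>\<^sub>L real) \<Rightarrow> 'a)"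
proof (rule bounded_linear_intro[where K = 1])
  fix x y :: "'a \<Rightarrow>\<^sub>L real" and r :: real
  show "riesz_inv (x + y) = riesz_inv x + riesz_inv y"
    by (rule inner_eqI) (simp add: inner_add_left blinfun.add_left)
  show "riesz_inv (r *\<^sub>R x) = r *\<^sub>R riesz_inv x"
    by (rule inner_eqI) (simp add: blinfun.scaleR_left)
qed simp

text \<open>\<open>adjoint\<close> is a choice that has its defining property only if some adjoint
  map exists; Riesz representation in the domain supplies one for each \<open>y\<close>.\<close>

lemma adjoint_bounded_linear:
  fixes f :: "'a::{real_inner, banach} \<Rightarrow> 'b::real_inner"
  assumes f: "bounded_linear f"
  shows "f x \<bullet> y = x \<bullet> adjoint f y"
proof -
  have "\<exists>z. \<forall>x. f x \<bullet> y = z \<bullet> x" for y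
  proof -
    have "bounded_linear (\<lambda>x. f x \<bullet> y)"
      by (rule bounded_linear_compose[OF bounded_linear_inner_left f])
    from riesz_subspace[OF _ _ this, of UNIV] show ?thesis by (metis UNIV_I closed_UNIV subspace_UNIV)
  qed
  then obtain g where "\<And>x y. f x \<bullet> y = g y \<bullet> x" by metis
  then have "\<exists>g. \<forall>x y. f x \<bullet> y = x \<bullet> g y" by (auto simp: inner_commute)
  from someI_ex[OF this] show ?thesis unfolding adjoint_def by blast
qed

lemma adjoint_norm_le:
  fixes f :: "'a::{real_inner, banach} \<Rightarrow>\<^sub>L 'b::real_inner"
  shows "norm (adjoint (blinfun_apply f) y) \<le> norm f * norm y"
proof -
  let ?g = "adjoint (blinfun_apply f) y"
  have "(norm ?g)\<^sup>2 = f ?g \<bullet> y"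
    by (simp add: power2_norm_eq_inner adjoint_bounded_linear[OF blinfun.bounded_linear_right])
  also have "\<dots> \<le> norm (f ?g) * norm y" by (rule norm_cauchy_schwarz)
  also have "\<dots> \<le> (norm f * norm ?g) * norm y" by (intro mult_right_mono norm_blinfun) auto
  finally show ?thesis by (cases "norm ?g = 0") (auto simp: power2_eq_square mult_ac)
qed

lemma adjoint_inner:
  fixes f :: "'a::{real_inner, banach} \<Rightarrow>\<^sub>L 'b::real_inner"
  shows "adjoint (blinfun_apply f) y \<bullet> x = y \<bullet> f x"
  using adjoint_bounded_linear[OF blinfun.bounded_linear_right, of f x y] by (simp add: inner_commute)

definition blinfun_adjoint :: "('a::{real_inner, banach} \<Rightarrow>\<^sub>L 'b::real_inner) \<Rightarrow> 'b \<Rightarrow>\<^sub>L 'a" where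
  "blinfun_adjoint f = Blinfun (adjoint (blinfun_apply f))"

lemma blinfun_adjoint_apply:
  fixes f :: "'a::{real_inner, banach} \<Rightarrow>\<^sub>L 'b::real_inner"
  shows "blinfun_apply (blinfun_adjoint f) = adjoint (blinfun_apply f)"
  unfolding blinfun_adjoint_def
proof (rule bounded_linear_Blinfun_apply, rule bounded_linear_intro[where K = "norm f"])
  fix x y r
  show "adjoint f (x + y) = adjoint f x + adjoint f y"
    by (rule inner_eqI) (simp add: adjoint_inner inner_add_left)
  show "adjoint f (r *\<^sub>R x) = r *\<^sub>R adjoint f x"
    by (rule inner_eqI) (simp add: adjoint_inner)
  show "norm (adjoint f x) \<le> norm x * norm f"
    using adjoint_norm_le[of f x] by (simp add: mult.commute)
qed

lemma blinfun_adjoint_inner: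
  fixes f :: "'a::{real_inner, banach} \<Rightarrow>\<^sub>L 'b::real_inner"
  shows "blinfun_adjoint f y \<bullet> x = y \<bullet> f x"
  by (simp add: blinfun_adjoint_apply adjoint_inner)

lemma norm_blinfun_adjoint_le:
  fixes f :: "'a::{real_inner, banach} \<Rightarrow>\<^sub>L 'b::real_inner"
  shows "norm (blinfun_adjoint f) \<le> norm f"
  by (rule norm_blinfun_bound) (auto simp: blinfun_adjoint_apply adjoint_norm_le)

text \<open>Cauchy-Schwarz for the semidefinite form \<open>R x \<bullet> y\<close>, applied to
  \<open>x\<close> and \<open>R x\<close>. The restriction to an invariant subspace \<open>Z\<close>
  is what the spectral theorem requires, since there the bound \<open>l\<close> holds only on an
  orthogonal complement.\<close>

lemma nonneg_operator_norm_le: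
  fixes R :: "'a::real_inner \<Rightarrow> 'a"
  assumes R: "linear R" and sym: "\<And>x y. R x \<bullet> y = x \<bullet> R y" and pos: "\<And>x. x \<in> Z \<Longrightarrow> R x \<bullet> x \<ge> 0"
    and Z: "subspace Z" and inv: "\<And>x. x \<in> Z \<Longrightarrow> R x \<in> Z"
    and le: "\<And>x. x \<in> Z \<Longrightarrow> R x \<bullet> x \<le> l * (norm x)\<^sup>2" and x: "x \<in> Z" and lam: "l \<ge> 0"
  shows "(norm (R x))\<^sup>2 \<le> l * (R x \<bullet> x)"
proof -
  interpret R: linear R by fact
  define a b c where "a = R x \<bullet> x" and "b = (norm (R x))\<^sup>2" and "c = R (R x) \<bullet> R x"
  \<comment> \<open>The direction \<open>R x\<close> is chosen because the mixed term of the form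
    then equals the squared norm of \<open>R x\<close>.\<close>
  have q: "a + 2 * b * t + c * t\<^sup>2 \<ge> 0" for t
  proof -
    have "x + t *\<^sub>R R x \<in> Z" using x inv Z by (intro subspace_add subspace_scale)
    from pos[OF this] show ?thesis
      unfolding a_def b_def c_def power2_norm_eq_inner
      by (simp add: R.add R.scaleR inner_add_left inner_add_right power2_eq_square algebra_simps
          sym[of "R x" x] inner_commute[of x])
  qed
  have c: "0 \<le> c" "c \<le> l * b" "0 \<le> a" "0 \<le> b"
    using le[OF inv[OF x]] pos[OF inv[OF x]] pos[OF x] by (auto simp: a_def b_def c_def)
  show ?thesis
  proof (cases "b = 0")
    case True then show ?thesis using c lam by (auto simp: a_def b_def)
  next
    case False
    then have b0: "b > 0" using c by auto
    show ?thesis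
    proof (cases "l = 0")
      case True
      then have "c = 0" using c by auto
      then have "a + 2 * b * t \<ge> 0" for t using q[of t] by simp
      from this[of "- (a + 1) / (2 * b)"] b0 show ?thesis by (simp add: field_simps)
    next
      case False
      note l = False
      have l0: "l > 0" using lam l by auto
      \<comment> \<open>The point \<open>- 1 / l\<close> is used instead of the exact minimum: the
        bound \<open>c \<le> l * b\<close> suffices there, and no division by \<open>c\<close>
        occurs.\<close>
      have "a - 2 * b / l + c / l\<^sup>2 \<ge> 0" using q[of "- 1 / l"] by (simp add: power_divide)
      moreover have "c / l\<^sup>2 \<le> b / l" using c(2) l0 by (simp add: field_simps power2_eq_square)
      ultimately have "a \<ge> b / l" by linarith
      then show ?thesis using l0 by (simp add: a_def b_def field_simps)
    qed
  qed
qed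

text \<open>Zero vectors are allowed, so that finite and infinite systems are indexed by \<^typ>\<open>nat\<close> alike.\<close>

definition ons :: "(nat \<Rightarrow> 'a::real_inner) \<Rightarrow> bool" where
  "ons e \<longleftrightarrow> (\<forall>i j. e i \<bullet> e j = (if i = j \<and> e i \<noteq> 0 then 1 else 0))"

definition fourier_sum :: "(nat \<Rightarrow> 'a::real_inner) \<Rightarrow> nat \<Rightarrow> 'a \<Rightarrow> 'a" where
  "fourier_sum e n x = (\<Sum>i<n. (x \<bullet> e i) *\<^sub>R e i)"

lemma ons_inner: "ons e \<Longrightarrow> e i \<bullet> e j = (if i = j \<and> e i \<noteq> 0 then 1 else 0)"
  by (simp add: ons_def)

lemma ons_sum_norm:
  assumes e: "ons e" and A: "finite A"
  shows "(norm (\<Sum>i\<in>A. c i *\<^sub>R e i))\<^sup>2 = (\<Sum>i\<in>A. (c i)\<^sup>2 * (e i \<bullet> e i))"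
proof -
  have "(norm (\<Sum>i\<in>A. c i *\<^sub>R e i))\<^sup>2 = (\<Sum>i\<in>A. \<Sum>k\<in>A. c i * c k * (e i \<bullet> e k))"
    by (simp add: power2_norm_eq_inner inner_sum_left inner_sum_right mult.assoc sum_distrib_left)
      (intro sum.cong refl, simp add: inner_commute)
  also have "\<dots> = (\<Sum>i\<in>A. \<Sum>k\<in>A. if k = i then c i * c i * (e i \<bullet> e i) else 0)"
    by (intro sum.cong refl) (auto simp: ons_inner[OF e])
  also have "\<dots> = (\<Sum>i\<in>A. (c i)\<^sup>2 * (e i \<bullet> e i))"
    using A by (simp add: power2_eq_square)
  finally show ?thesis .
qed

lemma ons_inner_self: "ons e \<Longrightarrow> (x \<bullet> e i)\<^sup>2 * (e i \<bullet> e i) = (x \<bullet> e i)\<^sup>2"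
  by (cases "e i = 0") (auto simp: ons_inner)

lemma ons_inner_self_le: "ons e \<Longrightarrow> 0 \<le> c \<Longrightarrow> c * (e i \<bullet> e i) \<le> c"
  by (cases "e i = 0") (auto simp: ons_inner)

lemma fourier_sum_norm: "ons e \<Longrightarrow> (norm (fourier_sum e n x))\<^sup>2 = (\<Sum>i<n. (x \<bullet> e i)\<^sup>2)"
  unfolding fourier_sum_def by (subst ons_sum_norm) (auto simp: ons_inner_self)

lemma fourier_sum_inner_self:
  "ons e \<Longrightarrow> fourier_sum e n x \<bullet> x = (norm (fourier_sum e n x))\<^sup>2"
  by (simp add: fourier_sum_norm) (simp add: fourier_sum_def inner_sum_left power2_eq_square
    inner_commute[of x])

lemma fourier_sum_norm_le: "ons e \<Longrightarrow> norm (fourier_sum e n x) \<le> norm x"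
proof -
  assume e: "ons e"
  have "(norm (fourier_sum e n x))\<^sup>2 \<le> norm (fourier_sum e n x) * norm x"
    unfolding fourier_sum_inner_self[OF e, symmetric] by (rule norm_cauchy_schwarz)
  then show ?thesis by (cases "norm (fourier_sum e n x) = 0") (auto simp: power2_eq_square)
qed

lemma bessel: "ons e \<Longrightarrow> (\<Sum>i<n. (x \<bullet> e i)\<^sup>2) \<le> (norm x)\<^sup>2"
  by (metis fourier_sum_norm fourier_sum_norm_le norm_ge_zero power_mono)

lemma bessel_summable: "ons e \<Longrightarrow> summable (\<lambda>i. (x \<bullet> e i)\<^sup>2)"
  by (rule summableI_nonneg_bounded[where x = "(norm x)\<^sup>2"]) (auto intro: bessel)

lemma fourier_sum_linear: "linear (fourier_sum e n)"
  by (rule linearI) (auto simp: fourier_sum_def inner_add_left scaleR_add_left sum.distrib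
    scaleR_sum_right)

lemma fourier_sum_fix:
  assumes e: "ons e" and x: "x \<in> span (e ` {..<n})"
  shows "fourier_sum e n x = x"
proof -
  have "(\<lambda>x. fourier_sum e n x) x = (\<lambda>x. x) x"
  proof (rule linear_eq_on_span[OF fourier_sum_linear linear_id[unfolded id_def] _ x])
    fix y assume "y \<in> e ` {..<n}"
    then obtain k where k: "k < n" "y = e k" by blast
    have "fourier_sum e n y = (\<Sum>i<n. if i = k then (e k \<bullet> e k) *\<^sub>R e k else 0)"
      unfolding fourier_sum_def k(2) by (rule sum.cong) (auto simp: ons_inner[OF e])
    also have "\<dots> = y" using k by (cases "e k = 0") (auto simp: ons_inner[OF e])
    finally show "fourier_sum e n y = y" .
  qed
  then show ?thesis .
qed

lemma span_range_nat:
  assumes "x \<in> span (range (e::nat \<Rightarrow> 'a::real_vector))"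
  shows "\<exists>n. x \<in> span (e ` {..<n})"
  using assms
proof (induction rule: span_induct_alt)
  case base then show ?case using span_0 by blast
next
  case (step c x y)
  then obtain n k where "y \<in> span (e ` {..<n})" "x = e k" by blast
  moreover have "span (e ` {..<n}) \<subseteq> span (e ` {..<max n (Suc k)})"
    by (intro span_mono image_mono) auto
  moreover have "x \<in> span (e ` {..<max n (Suc k)})" using \<open>x = e k\<close> by (intro span_base) auto
  ultimately have "c *\<^sub>R x + y \<in> span (e ` {..<max n (Suc k)})"
    by (auto intro!: span_add span_scale)
  then show ?case by blast
qed

text \<open>An approximation \<open>s\<close> from the span is eventually fixed by the partial sums.
  They are contractions, so the remaining error is at most twice the distance between
  \<open>s\<close> and \<open>h\<close>.\<close>

lemma fourier_tendsto:
  assumes e: "ons e" and h: "h \<in> closure (span (range e))"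
  shows "(\<lambda>n. fourier_sum e n h) \<longlonglongrightarrow> h"
proof (rule LIMSEQ_I)
  fix r :: real assume r: "r > 0"
  obtain s where s: "s \<in> span (range e)" "dist s h < r / 2"
    using h r unfolding closure_approachable by (metis half_gt_zero)
  obtain N where N: "s \<in> span (e ` {..<N})" using span_range_nat[OF s(1)] by blast
  have "norm (fourier_sum e n h - h) < r" if n: "n \<ge> N" for n
  proof -
    have "s \<in> span (e ` {..<n})"
      using N span_mono[of "e ` {..<N}" "e ` {..<n}"] n by (auto simp: image_mono)
    then have "fourier_sum e n s = s" by (rule fourier_sum_fix[OF e])
    then have "fourier_sum e n h - h = fourier_sum e n (h - s) - (h - s)"
      by (simp add: linear_diff[OF fourier_sum_linear])
    also have "norm \<dots> \<le> norm (h - s) + norm (h - s)"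
      using norm_triangle_ineq4 fourier_sum_norm_le[OF e] by (meson add_right_mono order_trans)
    also have "\<dots> < r" using s(2) by (simp add: dist_norm norm_minus_commute)
    finally show ?thesis .
  qed
  then show "\<exists>N. \<forall>n\<ge>N. norm (fourier_sum e n h - h) < r" by blast
qed

section \<open>Square integrable functions\<close>

lemma L2_measurable [measurable_dest]: "f \<in> L2 T \<Longrightarrow> f \<in> borel_measurable (time_measure T)"
  by (simp add: L2_def)

lemma L2_integrable: "f \<in> L2 T \<Longrightarrow> integrable (time_measure T) (\<lambda>t. (norm (f t))\<^sup>2)"
  by (simp add: L2_def)

lemma L2_norm_nonneg [simp]: "0 \<le> L2_norm T f"
  by (simp add: L2_norm_def)

lemma L2_norm_sq: "(L2_norm T f)\<^sup>2 = (\<integral>t. (norm (f t))\<^sup>2 \<partial>time_measure T)"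
  by (simp add: L2_norm_def)

lemma L2_norm_cong_AE:
  assumes "f \<in> borel_measurable (time_measure T)" "g \<in> borel_measurable (time_measure T)"
    and "AE t in time_measure T. f t = g t"
  shows "L2_norm T f = L2_norm T g"
proof -
  have "(\<integral>t. (norm (f t))\<^sup>2 \<partial>time_measure T) = (\<integral>t. (norm (g t))\<^sup>2 \<partial>time_measure T)"
  proof (rule integral_cong_AE)
    show "(\<lambda>t. (norm (f t))\<^sup>2) \<in> borel_measurable (time_measure T)" using assms(1) by measurable
    show "(\<lambda>t. (norm (g t))\<^sup>2) \<in> borel_measurable (time_measure T)" using assms(2) by measurable
  qed (use assms(3) in auto)
  then show ?thesis by (simp add: L2_norm_def)
qed

lemma L2_norm_minus_commute: "L2_norm T (\<lambda>t. f t - g t) = L2_norm T (\<lambda>t. g t - f t)"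
  by (simp add: L2_norm_def norm_minus_commute)

lemma finite_measure_time: "finite_measure (time_measure T)"
  by (rule finite_measure_lebesgue_on) auto

lemma measure_time: "0 \<le> T \<Longrightarrow> measure (time_measure T) (space (time_measure T)) = T"
  by (simp add: space_restrict_space measure_restrict_space)

lemma AE_time: "(AE t in time_measure T. t \<in> {0<..<T})"
  by (rule AE_I2) (simp add: space_restrict_space)

text \<open>The common source of all mapping properties: a pointwise bound by a multiple of
  \<open>g\<close> yields membership and the operator bound together.\<close>

lemma L2_bound:
  assumes g: "g \<in> L2 T" and f: "f \<in> borel_measurable (time_measure T)"
    and le: "AE t in time_measure T. norm (f t) \<le> C * norm (g t)" and C: "C \<ge> 0"
  shows "f \<in> L2 T" "L2_norm T f \<le> C * L2_norm T g"
proof -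
  have le': "AE t in time_measure T. (norm (f t))\<^sup>2 \<le> C\<^sup>2 * (norm (g t))\<^sup>2"
    using le by eventually_elim (metis norm_ge_zero power_mono power_mult_distrib)
  have i: "integrable (time_measure T) (\<lambda>t. C\<^sup>2 * (norm (g t))\<^sup>2)"
    using L2_integrable[OF g] by simp
  have m: "(\<lambda>t. (norm (f t))\<^sup>2) \<in> borel_measurable (time_measure T)" using f by measurable
  have i2: "integrable (time_measure T) (\<lambda>t. (norm (f t))\<^sup>2)"
    by (rule Bochner_Integration.integrable_bound[OF i m]) (use le' in eventually_elim, auto)
  with f show "f \<in> L2 T" by (simp add: L2_def)
  have "(\<integral>t. (norm (f t))\<^sup>2 \<partial>time_measure T) \<le> (\<integral>t. C\<^sup>2 * (norm (g t))\<^sup>2 \<partial>time_measure T)"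
    by (rule integral_mono_AE[OF i2 i le'])
  then have "(L2_norm T f)\<^sup>2 \<le> (C * L2_norm T g)\<^sup>2"
    unfolding L2_norm_sq power_mult_distrib by (simp only: integral_mult_right_zero)
  then show "L2_norm T f \<le> C * L2_norm T g" by (rule power2_le_imp_le) (simp add: C)
qed

lemma L2_zero [simp]: "(\<lambda>t. 0) \<in> L2 T"
  by (simp add: L2_def)

lemma L2_norm_zero [simp]: "L2_norm T (\<lambda>t. 0) = 0"
  by (simp add: L2_norm_def)

lemma L2_const [simp]: "(\<lambda>t. c) \<in> L2 T"
  using finite_measure.integrable_const[OF finite_measure_time] by (simp add: L2_def)

lemma L2_norm_const: "0 \<le> T \<Longrightarrow> L2_norm T (\<lambda>t. c) = sqrt T * norm c"
proof -
  assume T: "0 \<le> T"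
  have "(\<integral>t. (norm c)\<^sup>2 \<partial>time_measure T) = T * (norm c)\<^sup>2"
    using measure_time[OF T] by simp
  then show ?thesis by (simp add: L2_norm_def real_sqrt_mult)
qed

lemma L2_scaleR [intro]:
  fixes f :: "real \<Rightarrow> 'a::{real_normed_vector, second_countable_topology}"
  shows "f \<in> L2 T \<Longrightarrow> (\<lambda>t. c *\<^sub>R f t) \<in> L2 T"
  by (rule L2_bound(1)[where C = "\<bar>c\<bar>" and g = f]) (auto dest: L2_measurable)

lemma L2_add [intro]:
  fixes f g :: "real \<Rightarrow> 'a::{real_normed_vector, second_countable_topology}"
  assumes "f \<in> L2 T" "g \<in> L2 T"
  shows "(\<lambda>t. f t + g t) \<in> L2 T"
proof -
  have "integrable (time_measure T) (\<lambda>t. 2 * (norm (f t))\<^sup>2 + 2 * (norm (g t))\<^sup>2)"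
    by (intro Bochner_Integration.integrable_add integrable_mult_right L2_integrable assms)
  moreover have "norm ((norm (f t + g t))\<^sup>2) \<le> norm (2 * (norm (f t))\<^sup>2 + 2 * (norm (g t))\<^sup>2)" for t
  proof -
    have "(norm (f t + g t))\<^sup>2 \<le> (norm (f t) + norm (g t))\<^sup>2"
      by (intro power_mono norm_triangle_ineq) auto
    moreover have "0 \<le> (norm (f t) - norm (g t))\<^sup>2" by simp
    ultimately show ?thesis by (simp add: power2_sum power2_diff)
  qed
  moreover have [measurable]: "f \<in> borel_measurable (time_measure T)" "g \<in> borel_measurable
    (time_measure T)"
    using assms by (auto dest: L2_measurable)
  ultimately have "integrable (time_measure T) (\<lambda>t. (norm (f t + g t))\<^sup>2)"
    by (intro Bochner_Integration.integrable_bound[where g = "\<lambda>t. (norm (f t + g t))\<^sup>2"]) auto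
  then show ?thesis by (simp add: L2_def)
qed

lemma L2_uminus [intro]:
  fixes f :: "real \<Rightarrow> 'a::{real_normed_vector, second_countable_topology}"
  shows "f \<in> L2 T \<Longrightarrow> (\<lambda>t. - f t) \<in> L2 T"
  using L2_scaleR[of f T "-1"] by simp

lemma L2_diff [intro]:
  fixes f g :: "real \<Rightarrow> 'a::{real_normed_vector, second_countable_topology}"
  shows "f \<in> L2 T \<Longrightarrow> g \<in> L2 T \<Longrightarrow> (\<lambda>t. f t - g t) \<in> L2 T"
  using L2_add[of f T "\<lambda>t. - g t"] L2_uminus by auto

lemma L2_sum [intro]:
  fixes f :: "'i \<Rightarrow> real \<Rightarrow> 'a::{real_normed_vector, second_countable_topology}"
  shows "(\<And>i. i \<in> A \<Longrightarrow> f i \<in> L2 T) \<Longrightarrow> (\<lambda>t. \<Sum>i\<in>A. f i t) \<in> L2 T"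
  by (induction A rule: infinite_finite_induct) auto

lemma L2_bounded_linear:
  assumes f: "f \<in> L2 T" and B: "bounded_linear B"
  shows "(\<lambda>t. B (f t)) \<in> L2 T"
proof -
  obtain K where K: "\<And>x. norm (B x) \<le> norm x * K" "K \<ge> 0"
    using bounded_linear.nonneg_bounded[OF B] by blast
  have "B \<in> borel_measurable borel"
    by (intro borel_measurable_continuous_onI linear_continuous_on B)
  then have "(\<lambda>t. B (f t)) \<in> borel_measurable (time_measure T)"
    using L2_measurable[OF f] by measurable
  then show ?thesis
    using K by (intro L2_bound(1)[OF f, where C = K]) (auto simp: mult.commute)
qed

lemma L2_norm_scaleR: "L2_norm T (\<lambda>t. c *\<^sub>R f t) = \<bar>c\<bar> * L2_norm T f"
  by (simp add: L2_norm_def power_mult_distrib real_sqrt_mult)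

lemma L2_inner_integrable:
  fixes f g :: "real \<Rightarrow> 'a::{real_inner, second_countable_topology}"
  assumes "f \<in> L2 T" "g \<in> L2 T"
  shows "integrable (time_measure T) (\<lambda>t. f t \<bullet> g t)"
proof -
  have [measurable]: "f \<in> borel_measurable (time_measure T)" "g \<in> borel_measurable (time_measure T)"
    using assms by (auto dest: L2_measurable)
  have "integrable (time_measure T) (\<lambda>t. (norm (f t))\<^sup>2 + (norm (g t))\<^sup>2)"
    by (intro Bochner_Integration.integrable_add integrable_mult_right L2_integrable assms)
  moreover have "norm (f t \<bullet> g t) \<le> norm ((norm (f t))\<^sup>2 + (norm (g t))\<^sup>2)" for t
  proof -
    have "\<bar>f t \<bullet> g t\<bar> \<le> norm (f t) * norm (g t)" by (rule Cauchy_Schwarz_ineq2)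
    moreover have "0 \<le> (norm (f t) - norm (g t))\<^sup>2" "0 \<le> norm (f t) * norm (g t)" by simp_all
    ultimately show ?thesis by (simp add: power2_diff)
  qed
  ultimately show ?thesis
    by (intro Bochner_Integration.integrable_bound[where g = "\<lambda>t. f t \<bullet> g t"]) auto
qed

section \<open>The inner product of square integrable functions\<close>

definition L2_inner :: "real \<Rightarrow> (real \<Rightarrow> 'a::real_inner) \<Rightarrow> (real \<Rightarrow> 'a) \<Rightarrow> real" where
  "L2_inner T f g = (\<integral>t. f t \<bullet> g t \<partial>time_measure T)"

lemma L2_inner_self: "L2_inner T f f = (L2_norm T f)\<^sup>2"
  by (simp add: L2_inner_def L2_norm_sq power2_norm_eq_inner)

lemma L2_inner_commute: "L2_inner T f g = L2_inner T g f"
  by (simp add: L2_inner_def inner_commute)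

context
  fixes f g h :: "real \<Rightarrow> 'a::{real_inner, second_countable_topology}" and T :: real
  assumes f: "f \<in> L2 T" and g: "g \<in> L2 T" and h: "h \<in> L2 T"
begin

lemma L2_inner_add_left: "L2_inner T (\<lambda>t. f t + g t) h = L2_inner T f h + L2_inner T g h"
  unfolding L2_inner_def inner_add_left
  by (intro Bochner_Integration.integral_add L2_inner_integrable f g h)

lemma L2_inner_add_right: "L2_inner T h (\<lambda>t. f t + g t) = L2_inner T h f + L2_inner T h g"
  unfolding L2_inner_def inner_add_right
  by (intro Bochner_Integration.integral_add L2_inner_integrable f g h)

lemma L2_inner_diff_left: "L2_inner T (\<lambda>t. f t - g t) h = L2_inner T f h - L2_inner T g h"
  unfolding L2_inner_def inner_diff_left
  by (intro Bochner_Integration.integral_diff L2_inner_integrable f g h)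

lemma L2_inner_diff_right: "L2_inner T h (\<lambda>t. f t - g t) = L2_inner T h f - L2_inner T h g"
  unfolding L2_inner_def inner_diff_right
  by (intro Bochner_Integration.integral_diff L2_inner_integrable f g h)

end

lemma L2_inner_scaleR_left: "L2_inner T (\<lambda>t. c *\<^sub>R f t) h = c * L2_inner T f h"
  by (simp add: L2_inner_def)

lemma L2_inner_scaleR_right: "L2_inner T h (\<lambda>t. c *\<^sub>R f t) = c * L2_inner T h f"
  by (simp add: L2_inner_def)

lemma L2_norm_add_sq:
  fixes f g :: "real \<Rightarrow> 'a::{real_inner, second_countable_topology}"
  assumes f: "f \<in> L2 T" and g: "g \<in> L2 T"
  shows "(L2_norm T (\<lambda>t. f t + g t))\<^sup>2 = (L2_norm T f)\<^sup>2 + 2 * L2_inner T f g + (L2_norm T g)\<^sup>2"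
  unfolding L2_inner_self[symmetric]
  using f g L2_inner_commute[of T g f] by (simp add: L2_inner_add_left L2_inner_add_right L2_add)

text \<open>The discriminant argument for the squared norm of \<open>f + t *\<^sub>R g\<close> as a
  polynomial in \<open>t\<close>. The case \<open>c = 0\<close> must be separate, as it occurs for
  functions that vanish only almost everywhere.\<close>

lemma L2_cauchy_schwarz:
  fixes f g :: "real \<Rightarrow> 'a::{real_inner, second_countable_topology}"
  assumes f: "f \<in> L2 T" and g: "g \<in> L2 T"
  shows "\<bar>L2_inner T f g\<bar> \<le> L2_norm T f * L2_norm T g"
proof -
  define a b c where "a = (L2_norm T f)\<^sup>2" and "b = L2_inner T f g" and "c = (L2_norm T g)\<^sup>2"
  have q: "a + 2 * b * t + c * t\<^sup>2 \<ge> 0" for t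
    using L2_norm_add_sq[OF f L2_scaleR[OF g, of t]]
      zero_le_power2[of "L2_norm T (\<lambda>s. f s + t *\<^sub>R g s)"]
    by (simp add: a_def b_def c_def L2_norm_scaleR L2_inner_scaleR_right power_mult_distrib mult_ac)
  have "b\<^sup>2 \<le> a * c"
  proof (cases "c = 0")
    case True
    have "b = 0"
    proof (rule ccontr)
      assume "b \<noteq> 0"
      then show False using q[of "- (a + 1) / (2 * b)"] True by (simp add: field_simps)
    qed
    then show ?thesis using True by simp
  next
    case False
    then have "c > 0" by (simp add: c_def)
    then show ?thesis using q[of "- b / c"] by (simp add: field_simps power2_eq_square)
  qed
  then have "\<bar>b\<bar>\<^sup>2 \<le> (L2_norm T f * L2_norm T g)\<^sup>2" by (simp add: a_def c_def power_mult_distrib)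
  then show ?thesis unfolding b_def by (rule power2_le_imp_le) simp
qed

lemma L2_norm_triangle:
  fixes f g :: "real \<Rightarrow> 'a::{real_inner, second_countable_topology}"
  assumes f: "f \<in> L2 T" and g: "g \<in> L2 T"
  shows "L2_norm T (\<lambda>t. f t + g t) \<le> L2_norm T f + L2_norm T g"
proof -
  have "(L2_norm T (\<lambda>t. f t + g t))\<^sup>2 \<le> (L2_norm T f + L2_norm T g)\<^sup>2"
    unfolding L2_norm_add_sq[OF f g] power2_sum using L2_cauchy_schwarz[OF f g] by linarith
  then show ?thesis by (rule power2_le_imp_le) simp
qed

lemma L2_norm_uminus [simp]: "L2_norm T (\<lambda>t. - f t) = L2_norm T f"
  by (simp add: L2_norm_def)

lemma L2_norm_triangle_diff:
  fixes f g :: "real \<Rightarrow> 'a::{real_inner, second_countable_topology}"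
  assumes f: "f \<in> L2 T" and g: "g \<in> L2 T"
  shows "L2_norm T (\<lambda>t. f t - g t) \<le> L2_norm T f + L2_norm T g"
  using L2_norm_triangle[OF f L2_uminus[OF g]] by simp

lemma L2_norm_diff_triangle:
  fixes f g h :: "real \<Rightarrow> 'a::{real_inner, second_countable_topology}"
  assumes f: "f \<in> L2 T" and g: "g \<in> L2 T" and h: "h \<in> L2 T"
  shows "L2_norm T (\<lambda>t. f t - h t) \<le> L2_norm T (\<lambda>t. f t - g t) + L2_norm T (\<lambda>t. g t - h t)"
  using L2_norm_triangle[OF L2_diff[OF f g] L2_diff[OF g h]] by simp

lemma L2_norm_sum_le:
  fixes f :: "'i \<Rightarrow> real \<Rightarrow> 'a::{real_inner, second_countable_topology}"
  assumes "\<And>i. i \<in> A \<Longrightarrow> f i \<in> L2 T"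
  shows "L2_norm T (\<lambda>t. \<Sum>i\<in>A. f i t) \<le> (\<Sum>i\<in>A. L2_norm T (f i))"
  using assms
proof (induction A rule: infinite_finite_induct)
  case (insert x F)
  have "L2_norm T (\<lambda>t. f x t + (\<Sum>i\<in>F. f i t)) \<le> L2_norm T (f x) + L2_norm T (\<lambda>t. \<Sum>i\<in>F. f i t)"
    using insert by (intro L2_norm_triangle L2_sum) auto
  with insert show ?case by fastforce
qed auto

lemma L2_norm_zero_iff:
  fixes f :: "real \<Rightarrow> 'a::real_normed_vector"
  assumes "f \<in> L2 T"
  shows "L2_norm T f = 0 \<longleftrightarrow> (AE t in time_measure T. f t = 0)"
  using integral_nonneg_eq_0_iff_AE[OF L2_integrable[OF assms]] by (simp add: L2_norm_def)

lemma AE_eq_if_L2_norm_le_zero: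
  fixes f g :: "real \<Rightarrow> 'a::{real_inner, second_countable_topology}"
  assumes f: "f \<in> L2 T" and g: "g \<in> L2 T" and le: "L2_norm T (\<lambda>t. f t - g t) \<le> 0"
  shows "AE t in time_measure T. f t = g t"
proof -
  have "L2_norm T (\<lambda>t. f t - g t) = 0" using le by (simp add: order_antisym)
  then have "AE t in time_measure T. f t - g t = 0" using L2_norm_zero_iff[OF L2_diff[OF f g]] by blast
  then show ?thesis by eventually_elim simp
qed

section \<open>Completeness and limits of square integrable functions\<close>

text \<open>Lower semicontinuity of the norm under pointwise convergence. It also delivers
  integrability of the limit, which in the completeness proof is not known beforehand.\<close>

lemma L2_fatou:
  fixes h :: "nat \<Rightarrow> real \<Rightarrow> 'a::{real_normed_vector, second_countable_topology}"
  assumes h: "\<And>k. h k \<in> L2 T" and le: "\<forall>\<^sub>F k in sequentially. L2_norm T (h k) \<le> C"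
    and lim: "AE t in time_measure T. (\<lambda>k. h k t) \<longlonglongrightarrow> f t"
    and f: "f \<in> borel_measurable (time_measure T)"
  shows "f \<in> L2 T" "L2_norm T f \<le> C"
proof -
  let ?M = "time_measure T"
  have C: "C \<ge> 0"
    using le L2_norm_nonneg by (metis (mono_tags, lifting) eventually_happens' order_trans
      sequentially_bot)
  have [measurable]: "f \<in> borel_measurable ?M" "\<And>k. h k \<in> borel_measurable ?M"
    using h f by (auto dest: L2_measurable)
  have nn: "(\<integral>\<^sup>+t. ennreal ((norm (h k t))\<^sup>2) \<partial>?M) = ennreal ((L2_norm T (h k))\<^sup>2)" for k
    unfolding L2_norm_sq by (rule nn_integral_eq_integral) (auto intro: L2_integrable h)
  have "(\<integral>\<^sup>+t. ennreal ((norm (f t))\<^sup>2) \<partial>?M) = (\<integral>\<^sup>+t. liminf (\<lambda>k. ennreal ((norm (h k t))\<^sup>2)) \<partial>?M)"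
  proof (rule nn_integral_cong_AE, use lim in eventually_elim)
    fix t assume "(\<lambda>k. h k t) \<longlonglongrightarrow> f t"
    then have "(\<lambda>k. ennreal ((norm (h k t))\<^sup>2)) \<longlonglongrightarrow> ennreal ((norm (f t))\<^sup>2)"
      by (intro tendsto_intros) auto
    then show "ennreal ((norm (f t))\<^sup>2) = liminf (\<lambda>k. ennreal ((norm (h k t))\<^sup>2))"
      by (intro lim_imp_Liminf[symmetric]) auto
  qed
  also have "\<dots> \<le> liminf (\<lambda>k. \<integral>\<^sup>+t. ennreal ((norm (h k t))\<^sup>2) \<partial>?M)"
    by (rule nn_integral_liminf) measurable
  also have "\<dots> \<le> limsup (\<lambda>k. \<integral>\<^sup>+t. ennreal ((norm (h k t))\<^sup>2) \<partial>?M)"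
    by (rule Liminf_le_Limsup) simp
  also have "\<dots> \<le> ennreal (C\<^sup>2)"
    unfolding nn
    by (rule Limsup_bounded) (use le in eventually_elim, simp add: C ennreal_leI power_mono)
  finally have nnle: "(\<integral>\<^sup>+t. ennreal ((norm (f t))\<^sup>2) \<partial>?M) \<le> ennreal (C\<^sup>2)" .
  then have int: "integrable ?M (\<lambda>t. (norm (f t))\<^sup>2)"
    by (intro integrableI_bounded) (auto intro: le_less_trans[OF _ ennreal_less_top])
  then show "f \<in> L2 T" by (simp add: L2_def f)
  have "ennreal ((L2_norm T f)\<^sup>2) \<le> ennreal (C\<^sup>2)"
    using nnle unfolding L2_norm_sq by (subst nn_integral_eq_integral[OF int, symmetric]) auto
  then have "(L2_norm T f)\<^sup>2 \<le> C\<^sup>2" by simp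
  then show "L2_norm T f \<le> C" using C by (rule power2_le_imp_le)
qed

text \<open>Cauchy-Schwarz against the constant 1, whose norm is \<open>sqrt T\<close>.\<close>

lemma L2_integral_norm_le:
  fixes f :: "real \<Rightarrow> 'a::{real_normed_vector, second_countable_topology}"
  assumes f: "f \<in> L2 T" and T: "0 \<le> T"
  shows "integrable (time_measure T) (\<lambda>t. norm (f t))"
    "(\<integral>t. norm (f t) \<partial>time_measure T) \<le> sqrt T * L2_norm T f"
proof -
  have n: "(\<lambda>t. norm (f t)) \<in> L2 T" and c: "(\<lambda>t. 1::real) \<in> L2 T"
    using f L2_measurable[OF f] L2_const[of "1::real" T] by (auto simp: L2_def)
  show "integrable (time_measure T) (\<lambda>t. norm (f t))"
    using L2_inner_integrable[OF n c] by simp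
  have "L2_norm T (\<lambda>t. norm (f t)) = L2_norm T f" by (simp add: L2_norm_def)
  with L2_cauchy_schwarz[OF n c] show "(\<integral>t. norm (f t) \<partial>time_measure T) \<le> sqrt T * L2_norm T f"
    by (simp add: L2_inner_def L2_norm_const[OF T] mult.commute)
qed

text \<open>The Riesz-Fischer argument along a rapidly convergent subsequence. The almost everywhere
  convergent subsequence is part of the conclusion, because closed pointwise constraints and values
  of continuous representatives are identified along it.\<close>

lemma L2_complete:
  fixes s :: "nat \<Rightarrow> real \<Rightarrow> 'a::{real_inner, banach, second_countable_topology}"
  assumes T: "0 \<le> T" and s: "\<And>n. s n \<in> L2 T"
    and cau: "\<And>e. e > 0 \<Longrightarrow> \<exists>N. \<forall>m\<ge>N. \<forall>n\<ge>N. L2_norm T (\<lambda>t. s m t - s n t) < e"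
  shows "\<exists>f\<in>L2 T. (\<lambda>n. L2_norm T (\<lambda>t. s n t - f t)) \<longlonglongrightarrow> 0 \<and>
     (\<exists>r. strict_mono r \<and> (AE t in time_measure T. (\<lambda>n. s (r n) t) \<longlonglongrightarrow> f t))"
proof -
  let ?M = "time_measure T"
  have [measurable]: "s n \<in> borel_measurable ?M" for n using s by (auto dest: L2_measurable)
  have "\<exists>r. \<forall>n. (\<forall>m\<ge>r n. \<forall>k\<ge>r n. L2_norm T (\<lambda>t. s m t - s k t) < (1/2)^n) \<and> r n < r (Suc n)"
  proof (rule dependent_nat_choice)
    show "\<exists>x. \<forall>m\<ge>x. \<forall>k\<ge>x. L2_norm T (\<lambda>t. s m t - s k t) < (1/2)^0"
      using cau[of 1] by auto
    fix x n
    obtain N where N: "\<forall>m\<ge>N. \<forall>k\<ge>N. L2_norm T (\<lambda>t. s m t - s k t) < (1/2)^Suc n"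
      using cau[of "(1/2)^Suc n"] by auto
    show "\<exists>y. (\<forall>m\<ge>y. \<forall>k\<ge>y. L2_norm T (\<lambda>t. s m t - s k t) < (1/2)^Suc n) \<and> x < y"
      by (rule exI[of _ "max N (Suc x)"]) (use N in auto)
  qed
  then obtain r where r: "\<And>n m k. m \<ge> r n \<Longrightarrow> k \<ge> r n \<Longrightarrow> L2_norm T (\<lambda>t. s m t - s k t) < (1/2)^n"
      "\<And>n. r n < r (Suc n)" by blast
  have sm: "strict_mono r" using r(2) by (simp add: strict_mono_Suc_iff)
  define d where "d n t = s (r (Suc n)) t - s (r n) t" for n t
  have d: "d n \<in> L2 T" for n unfolding d_def using s by auto
  have [measurable]: "d n \<in> borel_measurable ?M" for n using d by (auto dest: L2_measurable)
  \<comment> \<open>On a finite interval the square norm controls the integral of the norm, so the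
    increments have summable integrals and hence are almost everywhere absolutely summable.\<close>
  have dn: "(\<integral>\<^sup>+t. ennreal (norm (d n t)) \<partial>?M) \<le> ennreal (sqrt T * (1/2)^n)" for n
  proof -
    have "(\<integral>\<^sup>+t. ennreal (norm (d n t)) \<partial>?M) = ennreal (\<integral>t. norm (d n t) \<partial>?M)"
      by (rule nn_integral_eq_integral) (use L2_integral_norm_le(1)[OF d T] in auto)
    also have "\<dots> \<le> ennreal (sqrt T * L2_norm T (d n))"
      by (intro ennreal_leI L2_integral_norm_le d T)
    also have "\<dots> \<le> ennreal (sqrt T * (1/2)^n)"
      using less_imp_le[OF r(1)[of n "r (Suc n)" "r n"]] r(2)[of n] T
      unfolding d_def by (intro ennreal_leI mult_left_mono) auto
    finally show ?thesis .
  qed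
  have "(\<integral>\<^sup>+t. (\<Sum>n. ennreal (norm (d n t))) \<partial>?M) = (\<Sum>n. \<integral>\<^sup>+t. ennreal (norm (d n t)) \<partial>?M)"
    by (rule nn_integral_suminf) measurable
  also have "\<dots> \<le> (\<Sum>n. ennreal (sqrt T * (1/2)^n))"
    by (intro suminf_le dn) auto
  also have "\<dots> = ennreal (\<Sum>n. sqrt T * (1/2)^n)"
    using T by (intro suminf_ennreal2) (auto intro!: summable_mult summable_geometric)
  also have "\<dots> < \<infinity>" by simp
  finally have "AE t in ?M. (\<Sum>n. ennreal (norm (d n t))) \<noteq> \<infinity>"
    by (intro nn_integral_PInf_AE) auto
  then have conv: "AE t in ?M. convergent (\<lambda>n. s (r n) t)"
  proof eventually_elim
    fix t assume "(\<Sum>n. ennreal (norm (d n t))) \<noteq> \<infinity>"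
    then have "summable (\<lambda>n. norm (d n t))" by (intro summable_suminf_not_top) auto
    then have "summable (\<lambda>n. d n t)" by (rule summable_norm_cancel)
    then have "convergent (\<lambda>n. \<Sum>i<n. d i t)" by (simp add: summable_iff_convergent)
    moreover have "(\<Sum>i<n. d i t) = s (r n) t - s (r 0) t" for n
      unfolding d_def by (rule sum_lessThan_telescope)
    ultimately have "convergent (\<lambda>n. (s (r n) t - s (r 0) t) + s (r 0) t)"
      by (intro convergent_add convergent_const) simp
    then show "convergent (\<lambda>n. s (r n) t)" by simp
  qed
  define f where "f t = lim (\<lambda>n. s (r n) t)" for t
  have f: "f \<in> borel_measurable ?M" unfolding f_def by (rule borel_measurable_lim_metric) simp
  have limf: "AE t in ?M. (\<lambda>n. s (r n) t) \<longlonglongrightarrow> f t"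
    using conv unfolding f_def by eventually_elim (simp add: convergent_LIMSEQ_iff)
  \<comment> \<open>With \<open>m\<close> fixed, the second index runs through the subsequence to
    infinity; Fatou keeps the Cauchy bound for the difference to the limit, and so for the whole
    sequence.\<close>
  have key: "(\<lambda>t. s m t - f t) \<in> L2 T \<and> L2_norm T (\<lambda>t. s m t - f t) \<le> (1/2)^n" if m: "m \<ge> r n" for m n
  proof -
    have "\<forall>\<^sub>F k in sequentially. L2_norm T (\<lambda>t. s m t - s (r k) t) \<le> (1/2)^n"
      using eventually_ge_at_top[of n]
      by eventually_elim (use r(1) m sm in \<open>auto intro!: less_imp_le simp: strict_mono_less_eq\<close>)
    moreover have "AE t in ?M. (\<lambda>k. s m t - s (r k) t) \<longlonglongrightarrow> s m t - f t"
      using limf by eventually_elim (intro tendsto_intros)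
    ultimately show ?thesis
      using L2_fatou[of "\<lambda>k t. s m t - s (r k) t" T "(1/2)^n" "\<lambda>t. s m t - f t"] s f by auto
  qed
  \<comment> \<open>Membership of \<open>f\<close> is recovered from its difference to one member of
    the sequence.\<close>
  have "(\<lambda>t. s (r 0) t - (s (r 0) t - f t)) \<in> L2 T"
    by (rule L2_diff[OF s]) (use key[of 0 "r 0"] in auto)
  then have fL: "f \<in> L2 T" by simp
  have "(\<lambda>n. L2_norm T (\<lambda>t. s n t - f t)) \<longlonglongrightarrow> 0"
  proof (rule LIMSEQ_I)
    fix e :: real assume e: "e > 0"
    obtain n where n: "(1/2)^n < e" using real_arch_pow_inv[OF e, of "1/2"] by auto
    have "norm (L2_norm T (\<lambda>t. s m t - f t) - 0) < e" if "m \<ge> r n" for m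
      using key[OF that] n by simp
    then show "\<exists>no. \<forall>m\<ge>no. norm (L2_norm T (\<lambda>t. s m t - f t) - 0) < e" by blast
  qed
  with fL sm limf show ?thesis by blast
qed

lemma L2_into_D: "f \<in> L2_into T X \<Longrightarrow> f \<in> L2 T" "f \<in> L2_into T X \<Longrightarrow> AE t in time_measure T. f t \<in> X"
  by (auto simp: L2_into_def)

lemma L2_into_UNIV [simp]: "L2_into T UNIV = L2 T"
  by (simp add: L2_into_def)

lemma L2_into_complete:
  fixes s :: "nat \<Rightarrow> real \<Rightarrow> 'a::{real_inner, banach, second_countable_topology}"
  assumes T: "0 \<le> T" and K: "closed K" and s: "\<And>n. s n \<in> L2_into T K"
    and cau: "\<And>e. e > 0 \<Longrightarrow> \<exists>N. \<forall>m\<ge>N. \<forall>n\<ge>N. L2_norm T (\<lambda>t. s m t - s n t) < e"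
  shows "\<exists>f\<in>L2_into T K. (\<lambda>n. L2_norm T (\<lambda>t. s n t - f t)) \<longlonglongrightarrow> 0"
proof -
  have sL: "s n \<in> L2 T" for n using s L2_into_D(1) by blast
  obtain f r where f: "f \<in> L2 T" "(\<lambda>n. L2_norm T (\<lambda>t. s n t - f t)) \<longlonglongrightarrow> 0"
      "AE t in time_measure T. (\<lambda>n. s (r n) t) \<longlonglongrightarrow> f t"
    using L2_complete[OF T sL cau] by auto
  have "AE t in time_measure T. \<forall>n. s n t \<in> K"
    unfolding AE_all_countable using L2_into_D(2)[OF s] by blast
  with f(3) have "AE t in time_measure T. f t \<in> K"
    by eventually_elim (rule closed_sequentially[OF K], blast)
  with f(1) have "f \<in> L2_into T K" by (simp add: L2_into_def)
  with f(2) show ?thesis by blast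
qed

lemma L2_into_closed:
  fixes s :: "nat \<Rightarrow> real \<Rightarrow> 'a::{real_inner, banach, second_countable_topology}"
  assumes T: "0 \<le> T" and K: "closed K" and s: "\<And>n. s n \<in> L2_into T K" and f: "f \<in> L2 T"
    and lim: "(\<lambda>n. L2_norm T (\<lambda>t. s n t - f t)) \<longlonglongrightarrow> 0"
  shows "f \<in> L2_into T K"
proof -
  have sL: "s n \<in> L2 T" for n using s L2_into_D by blast
  have "\<exists>N. \<forall>m\<ge>N. \<forall>n\<ge>N. L2_norm T (\<lambda>t. s m t - s n t) < e" if e: "e > 0" for e
  proof -
    obtain N where N: "\<And>n. n \<ge> N \<Longrightarrow> L2_norm T (\<lambda>t. s n t - f t) < e/2"
      using LIMSEQ_D[OF lim, of "e/2"] e by auto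
    have "L2_norm T (\<lambda>t. s m t - s n t) < e" if "m \<ge> N" "n \<ge> N" for m n
      using L2_norm_diff_triangle[OF sL[of m] f sL[of n]] N[OF that(1)] N[OF that(2)]
      by (simp add: L2_norm_minus_commute[of T f])
    then show ?thesis by blast
  qed
  from L2_into_complete[OF T K s this] obtain g where g: "g \<in> L2_into T K"
      "(\<lambda>n. L2_norm T (\<lambda>t. s n t - g t)) \<longlonglongrightarrow> 0" by blast
  have gL: "g \<in> L2 T" using g(1) L2_into_D by blast
  have "(\<lambda>n. L2_norm T (\<lambda>t. s n t - f t) + L2_norm T (\<lambda>t. s n t - g t)) \<longlonglongrightarrow> 0"
    using tendsto_add[OF lim g(2)] by simp
  moreover have "L2_norm T (\<lambda>t. f t - g t) \<le> L2_norm T (\<lambda>t. s n t - f t) + L2_norm T (\<lambda>t. s n t - g t)"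
    for n
    using L2_norm_diff_triangle[OF f sL[of n] gL] by (simp add: L2_norm_minus_commute[of T f])
  ultimately have "L2_norm T (\<lambda>t. f t - g t) \<le> 0" by (intro LIMSEQ_le_const) auto
  then have "AE t in time_measure T. f t = g t" by (rule AE_eq_if_L2_norm_le_zero[OF f gL])
  with L2_into_D(2)[OF g(1)] have "AE t in time_measure T. f t \<in> K" by eventually_elim auto
  with f show ?thesis by (simp add: L2_into_def)
qed

lemma L2_dominated:
  fixes f :: "real \<Rightarrow> 'a::{real_normed_vector, second_countable_topology}"
  assumes s: "\<And>n. s n \<in> borel_measurable (time_measure T)"
    and f: "f \<in> borel_measurable (time_measure T)"
    and lim: "AE t in time_measure T. (\<lambda>n. s n t) \<longlonglongrightarrow> f t"
    and dom: "\<And>n. AE t in time_measure T. norm (s n t - f t) \<le> norm (g t)" and g: "g \<in> L2 T"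
  shows "(\<lambda>n. L2_norm T (\<lambda>t. s n t - f t)) \<longlonglongrightarrow> 0"
proof -
  let ?M = "time_measure T"
  have [measurable]: "\<And>n. s n \<in> borel_measurable ?M" "f \<in> borel_measurable ?M" using s f by auto
  have "(\<lambda>n. \<integral>t. (norm (s n t - f t))\<^sup>2 \<partial>?M) \<longlonglongrightarrow> (\<integral>t. 0 \<partial>?M)"
  proof (rule integral_dominated_convergence[where w = "\<lambda>t. (norm (g t))\<^sup>2"])
    show "integrable ?M (\<lambda>t. (norm (g t))\<^sup>2)" using g by (rule L2_integrable)
    show "AE t in ?M. (\<lambda>n. (norm (s n t - f t))\<^sup>2) \<longlonglongrightarrow> 0"
      using lim
    proof eventually_elim
      fix t assume "(\<lambda>n. s n t) \<longlonglongrightarrow> f t"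
      then have "(\<lambda>n. (norm (s n t - f t))\<^sup>2) \<longlonglongrightarrow> (norm (f t - f t))\<^sup>2" by (intro tendsto_intros)
      then show "(\<lambda>n. (norm (s n t - f t))\<^sup>2) \<longlonglongrightarrow> 0" by simp
    qed
    show "AE t in ?M. norm ((norm (s n t - f t))\<^sup>2) \<le> (norm (g t))\<^sup>2" for n
      using dom[of n] by eventually_elim (simp add: power_mono)
  qed measurable
  then show ?thesis unfolding L2_norm_def using tendsto_real_sqrt by fastforce
qed

section \<open>Weak and strong measurability\<close>

text \<open>Pettis' theorem for a separable inner product space. Membership in a closed ball is a
  condition on countably many inner products, and an open set is a countable union of such balls
  with centres in a dense set and rational radii. It upgrades the weak measurability assumed of the
  coefficient operators.\<close>

lemma borel_measurable_weak:
  fixes f :: "'b \<Rightarrow> 'a::{real_inner, second_countable_topology}"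
  assumes f: "\<And>w. (\<lambda>t. f t \<bullet> w) \<in> borel_measurable M"
  shows "f \<in> borel_measurable M"
proof -
  obtain D :: "'a set" where D: "countable D" "\<And>X. open X \<Longrightarrow> X \<noteq> {} \<Longrightarrow> \<exists>d\<in>D. d \<in> X"
    using countable_dense_setE by blast
  have le_iff: "norm x \<le> q \<longleftrightarrow> (\<forall>w\<in>D. x \<bullet> w \<le> q * norm w)" if q: "0 \<le> q" for x :: 'a and q
  proof
    assume "norm x \<le> q"
    then show "\<forall>w\<in>D. x \<bullet> w \<le> q * norm w"
      by (meson norm_cauchy_schwarz mult_right_mono norm_ge_zero order_trans)
  next
    assume r: "\<forall>w\<in>D. x \<bullet> w \<le> q * norm w"
    have cl: "closed {w. x \<bullet> w \<le> q * norm w}"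
      by (intro closed_Collect_le continuous_intros)
    have "x \<in> {w. x \<bullet> w \<le> q * norm w}"
    proof (rule ccontr)
      assume "x \<notin> {w. x \<bullet> w \<le> q * norm w}"
      then obtain d where "d \<in> D" "d \<in> - {w. x \<bullet> w \<le> q * norm w}"
        using D(2)[of "- {w. x \<bullet> w \<le> q * norm w}"] cl by blast
      with r show False by auto
    qed
    then have "norm x * norm x \<le> q * norm x" by (simp add: power2_norm_eq_inner[symmetric]
      power2_eq_square)
    then show "norm x \<le> q" using q by (cases "x = 0") auto
  qed
  have cb: "f -` cball d q \<inter> space M \<in> sets M" for d q
  proof (cases "0 \<le> q")
    case True
    have "f -` cball d q \<inter> space M = {t \<in> space M. \<forall>w\<in>D. d \<bullet> w - f t \<bullet> w \<le> q * norm w}"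
      using le_iff[OF True] by (auto simp: dist_norm inner_diff_left)
    also have "\<dots> \<in> sets M"
      by (intro sets.sets_Collect_countable_All'[OF _ D(1)] borel_measurable_le
          borel_measurable_diff borel_measurable_const f)
    finally show ?thesis .
  next
    case False
    then show ?thesis by simp
  qed
  show ?thesis
  proof (rule borel_measurableI)
    fix U :: "'a set" assume U: "open U"
    define I where "I = {(d, q). d \<in> D \<and> q \<in> \<rat> \<and> cball d q \<subseteq> U}"
    have "U = (\<Union>(d, q)\<in>I. cball d q)"
    proof
      show "U \<subseteq> (\<Union>(d, q)\<in>I. cball d q)"
      proof
        fix x assume "x \<in> U"
        then obtain e where e: "e > 0" "cball x e \<subseteq> U" using U open_contains_cball by blast
        obtain q where q: "q \<in> \<rat>" "0 < q" "q < e/2"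
          using Rats_dense_in_real[of 0 "e/2"] e by auto
        obtain d where d: "d \<in> D" "d \<in> ball x q" using D(2)[of "ball x q"] q by auto
        have "cball d q \<subseteq> cball x e"
        proof
          fix z assume "z \<in> cball d q"
          then show "z \<in> cball x e"
            using dist_triangle[of x z d] d q by (auto simp: dist_commute)
        qed
        then have "(d, q) \<in> I" "x \<in> cball d q" using d q e by (auto simp: I_def dist_commute)
        then show "x \<in> (\<Union>(d, q)\<in>I. cball d q)" by blast
      qed
    qed (auto simp: I_def)
    then have "f -` U \<inter> space M = (\<Union>p\<in>I. f -` cball (fst p) (snd p) \<inter> space M)"
      by (simp add: case_prod_unfold vimage_UN UN_extend_simps del: UN_simps)
    moreover have "countable I"
    proof (rule countable_subset)
      show "I \<subseteq> D \<times> \<rat>" by (auto simp: I_def)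
      show "countable (D \<times> (\<rat>::real set))" using D(1) countable_rat by blast
    qed
    ultimately show "f -` U \<inter> space M \<in> sets M"
      using cb by (simp only:) (rule sets.countable_UN', auto)
  qed
qed

text \<open>The operators are measurable only at fixed arguments, not in operator norm. Hence
  \<open>y\<close> is approximated by simple functions, for which only finitely many arguments
  occur, and continuity of each \<open>f t\<close> passes to the limit.\<close>

lemma borel_measurable_compose_linear:
  fixes f :: "'b \<Rightarrow> 'a::{real_normed_vector, second_countable_topology} \<Rightarrow> 'c::{real_normed_vector,
    second_countable_topology}"
  assumes f: "\<And>x. (\<lambda>t. f t x) \<in> borel_measurable M" and lin: "\<And>t. bounded_linear (f t)"
    and y: "y \<in> borel_measurable M"
  shows "(\<lambda>t. f t (y t)) \<in> borel_measurable M"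
proof -
  obtain s where s: "\<And>i. simple_function M (s i)" "\<And>t. t \<in> space M \<Longrightarrow> (\<lambda>i. s i t) \<longlonglongrightarrow> y t"
    using borel_measurable_implies_sequence_metric[OF y, of 0] by metis
  show ?thesis
  proof (rule borel_measurable_LIMSEQ_metric[where f = "\<lambda>i t. f t (s i t)"])
    fix i
    show "(\<lambda>t. f t (s i t)) \<in> borel_measurable M"
    proof (rule measurable_compose_countable'[where I = "s i ` space M" and g = "s i" and f
      = "\<lambda>x t. f t x"])
      show "(\<lambda>t. f t x) \<in> borel_measurable M" for x by (rule f)
      show "s i \<in> measurable M (count_space (s i ` space M))"
        using s(1)[of i] by (auto simp: simple_function_def intro!: measurable_count_space_eq2[THEN
          iffD2])
      show "countable (s i ` space M)" using s(1)[of i]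
        by (auto simp: simple_function_def intro: countable_finite)
    qed
  next
    fix t assume "t \<in> space M"
    then show "(\<lambda>i. f t (s i t)) \<longlonglongrightarrow> f t (y t)"
      by (intro bounded_linear.tendsto[OF lin] s)
  qed
qed

section \<open>Primitives of integrable functions\<close>

text \<open>Truncation by an indicator keeps one fixed measure for every \<open>t\<close>, so that
  dominated convergence and Fubini apply directly. The function is constant to the left of 0 and to
  the right of \<open>T\<close>.\<close>

definition prim :: "real \<Rightarrow> (real \<Rightarrow> real) \<Rightarrow> real \<Rightarrow> real" where
  "prim T g t = (\<integral>s. indicator {0<..<t} s * g s \<partial>time_measure T)"

lemma id_time_measurable [measurable]: "(\<lambda>s. s) \<in> borel_measurable (time_measure T)"
  by (intro measurable_restrict_space1 measurable_completion) auto

lemma interval_time_measurable [measurable]: "A \<in> sets borel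
  \<Longrightarrow> (indicator A :: real \<Rightarrow> real) \<in> borel_measurable (time_measure T)"
  using borel_measurable_indicator[of A borel] measurable_compose[OF id_time_measurable] by blast

lemma AE_time_neq: "AE s in time_measure T. s \<noteq> t"
proof -
  have "{t} \<in> null_sets lebesgue" by (simp add: negligible_iff_null_sets[symmetric])
  then have "AE s in lebesgue. s \<notin> {t}" by (rule AE_not_in)
  then show ?thesis by (subst AE_restrict_space_iff) (auto elim: eventually_mono)
qed

lemma AE_time_interval:
  assumes ae: "AE t in time_measure T. P t" and ab: "0 \<le> a" "a < b" "b \<le> T"
  shows "\<exists>t\<in>{a<..<b}. P t"
proof (rule ccontr)
  assume "\<not> (\<exists>t\<in>{a<..<b}. P t)"
  then have "AE t in time_measure T. indicator {a<..<b} t = (0::real)"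
    using ae by (auto elim!: eventually_mono)
  then have "(\<integral>t. indicator {a<..<b} t \<partial>time_measure T) = (\<integral>t. (0::real) \<partial>time_measure T)"
    by (intro integral_cong_AE) auto
  moreover have "measure (time_measure T) {a<..<b} = b - a"
    using ab by (subst measure_restrict_space) auto
  moreover have "{a<..<b} \<inter> {0<..<T} = {a<..<b}" using ab by auto
  ultimately show False using ab by (simp add: space_restrict_space)
qed

lemma integrable_indicator_mult:
  assumes "integrable (time_measure T) g" "A \<in> sets borel"
  shows "integrable (time_measure T) (\<lambda>s. indicator A s * g s :: real)"
proof -
  have [measurable]: "g \<in> borel_measurable (time_measure T)" using assms by auto
  have [measurable]: "(indicator A :: real \<Rightarrow> real) \<in> borel_measurable (time_measure T)"
    using assms by (rule_tac interval_time_measurable)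
  have "(\<lambda>s. indicator A s * g s) \<in> borel_measurable (time_measure T)" by measurable
  then show ?thesis
    by (rule Bochner_Integration.integrable_bound[OF assms(1)]) (auto simp: indicator_def)
qed

lemma prim_0 [simp]: "prim T g 0 = 0"
  by (simp add: prim_def)

lemma prim_T: "prim T g T = (\<integral>s. g s \<partial>time_measure T)"
  unfolding prim_def by (rule Bochner_Integration.integral_cong) (auto simp: space_restrict_space)

lemma prim_add:
  assumes "integrable (time_measure T) g" "integrable (time_measure T) h"
  shows "prim T (\<lambda>s. g s + h s) t = prim T g t + prim T h t"
  unfolding prim_def using assms by (simp add: distrib_left integrable_indicator_mult)

lemma prim_diff:
  assumes "integrable (time_measure T) g" "integrable (time_measure T) h"
  shows "prim T (\<lambda>s. g s - h s) t = prim T g t - prim T h t"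
  unfolding prim_def using assms by (simp add: right_diff_distrib integrable_indicator_mult)

lemma prim_cmult: "prim T (\<lambda>s. c * g s) t = c * prim T g t"
  unfolding prim_def by (simp add: mult.left_commute)

lemma prim_cong_AE:
  assumes "g \<in> borel_measurable (time_measure T)" "h \<in> borel_measurable (time_measure T)"
    "AE s in time_measure T. g s = h s"
  shows "prim T g t = prim T h t"
  unfolding prim_def
proof (rule integral_cong_AE)
  have [measurable]: "(indicator {0<..<t} :: real \<Rightarrow> real) \<in> borel_measurable (time_measure T)"
    by (rule interval_time_measurable) auto
  show "(\<lambda>s. indicator {0<..<t} s * g s) \<in> borel_measurable (time_measure T)"
       "(\<lambda>s. indicator {0<..<t} s * h s) \<in> borel_measurable (time_measure T)"
    using assms by measurable
qed (use assms in auto)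

lemma prim_mono:
  assumes "integrable (time_measure T) g" "integrable (time_measure T) h"
    "AE s in time_measure T. g s \<le> h s"
  shows "prim T g t \<le> prim T h t"
  unfolding prim_def
  by (rule integral_mono_AE)
    (use assms(3) in \<open>auto intro!: integrable_indicator_mult assms mult_left_mono elim!:
      eventually_mono\<close>)

lemma prim_nonneg:
  assumes "\<And>s. 0 \<le> g s"
  shows "0 \<le> prim T g t"
  unfolding prim_def using assms by (intro integral_nonneg_AE) auto

lemma prim_le_total:
  assumes "integrable (time_measure T) g" "\<And>s. 0 \<le> g s"
  shows "prim T g t \<le> (\<integral>s. g s \<partial>time_measure T)"
  unfolding prim_def using assms
  by (intro integral_mono integrable_indicator_mult) (auto simp: indicator_def)

lemma prim_norm_le:
  assumes "integrable (time_measure T) g"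
  shows "\<bar>prim T g t\<bar> \<le> (\<integral>s. \<bar>g s\<bar> \<partial>time_measure T)"
proof -
  have "\<bar>prim T g t\<bar> \<le> prim T (\<lambda>s. \<bar>g s\<bar>) t"
    unfolding prim_def using integral_abs_bound[of "time_measure T" "\<lambda>s. indicator {0<..<t} s * g s"]
    by (simp add: abs_mult)
  also have "\<dots> \<le> (\<integral>s. \<bar>g s\<bar> \<partial>time_measure T)" using assms by (intro prim_le_total) auto
  finally show ?thesis .
qed

lemma prim_continuous:
  assumes g: "integrable (time_measure T) g"
  shows "continuous_on S (prim T g)"
proof -
  have "isCont (prim T g) t" for t
    unfolding continuous_at_sequentially comp_def prim_def
  proof (intro allI impI)
    fix x :: "nat \<Rightarrow> real" assume x: "x \<longlonglongrightarrow> t"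
    show "(\<lambda>n. \<integral>s. indicator {0<..<x n} s * g s \<partial>time_measure T)
      \<longlonglongrightarrow> (\<integral>s. indicator {0<..<t} s * g s \<partial>time_measure T)"
    proof (rule integral_dominated_convergence[where w = "\<lambda>s. \<bar>g s\<bar>"])
      show "AE s in time_measure T. (\<lambda>n. indicator {0<..<x n} s * g s) \<longlonglongrightarrow> indicator {0<..<t} s * g s"
        using AE_time_neq[of t T]
      proof eventually_elim
        fix s assume s: "s \<noteq> t"
        have "\<forall>\<^sub>F n in sequentially. indicator {0<..<x n} s * g s = indicator {0<..<t} s * g s"
        proof (cases "s < t")
          case True
          from order_tendstoD(1)[OF x True] show ?thesis
            by eventually_elim (use True in \<open>auto simp: indicator_def\<close>)
        next
          case False
          then have "t < s" using s by auto
          from order_tendstoD(2)[OF x this] show ?thesis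
            by eventually_elim (use \<open>t < s\<close> in \<open>auto simp: indicator_def\<close>)
        qed
        then show "(\<lambda>n. indicator {0<..<x n} s * g s) \<longlonglongrightarrow> indicator {0<..<t} s * g s"
          by (rule tendsto_eventually)
      qed
      show "integrable (time_measure T) (\<lambda>s. \<bar>g s\<bar>)" using g by auto
      show "(\<lambda>s. indicator {0<..<t} s * g s) \<in> borel_measurable (time_measure T)" for t
        using integrable_indicator_mult[OF g, of "{0<..<t}"] by auto
      show "AE s in time_measure T. norm (indicator {0<..<x n} s * g s) \<le> \<bar>g s\<bar>" for n
        by (auto simp: indicator_def)
      show "(\<lambda>s. indicator {0<..<x n} s * g s) \<in> borel_measurable (time_measure T)" for n
        using integrable_indicator_mult[OF g, of "{0<..<x n}"] by auto
    qed
  qed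
  then show ?thesis by (simp add: continuous_at_imp_continuous_on)
qed

lemma prim_measurable:
  assumes g: "integrable (time_measure T) g"
  shows "prim T g \<in> borel_measurable (time_measure T)"
  using measurable_compose[OF id_time_measurable borel_measurable_continuous_onI[OF prim_continuous[OF
    g]]] .

lemma continuous_time_measurable:
  assumes "continuous_on {0..T} f"
  shows "f \<in> borel_measurable (time_measure T)"
proof -
  have "f \<in> borel_measurable (restrict_space borel {0<..<T})"
    using assms by (intro borel_measurable_continuous_on_restrict) (auto intro: continuous_on_subset)
  moreover have "(\<lambda>s. s) \<in> measurable (time_measure T) (restrict_space borel {0<..<T})"
    by (rule measurable_restrict_space2) (auto simp: space_restrict_space)
  ultimately show ?thesis using measurable_compose by blast
qed

lemma integrable_bounded_mult:
  assumes f: "integrable (time_measure T) f" and h: "h \<in> borel_measurable (time_measure T)"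
    and b: "\<And>s. s \<in> {0<..<T} \<Longrightarrow> \<bar>h s\<bar> \<le> B"
  shows "integrable (time_measure T) (\<lambda>s. h s * f s :: real)"
proof (rule Bochner_Integration.integrable_bound[where f = "\<lambda>s. B * f s"])
  have [measurable]: "f \<in> borel_measurable (time_measure T)" using f by auto
  show "(\<lambda>s. h s * f s) \<in> borel_measurable (time_measure T)" using h by measurable
  show "AE s in time_measure T. norm (h s * f s) \<le> norm (B * f s)"
    using AE_time
  proof eventually_elim
    fix s assume "s \<in> {0<..<T}"
    from b[OF this] show "norm (h s * f s) \<le> norm (B * f s)"
      by (simp add: abs_mult mult_right_mono)
  qed
qed (use f in auto)

lemma integrable_continuous_mult:
  assumes f: "integrable (time_measure T) f" and h: "continuous_on {0..T} h"
  shows "integrable (time_measure T) (\<lambda>s. h s * f s :: real)"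
proof -
  obtain B where "\<forall>x\<in>h ` {0..T}. norm x \<le> B"
    using compact_imp_bounded[OF compact_continuous_image[OF h]] unfolding bounded_iff by auto
  then show ?thesis by (intro integrable_bounded_mult[where B = B] f continuous_time_measurable h) auto
qed

lemma integrable_continuous_time: "continuous_on {0..T} h
  \<Longrightarrow> integrable (time_measure T) (h :: real \<Rightarrow> real)"
  using integrable_continuous_mult[OF finite_measure.integrable_const[OF finite_measure_time, of T 1],
    of h] by simp

lemma continuous_on_L2:
  fixes f :: "real \<Rightarrow> 'a::{real_normed_vector, second_countable_topology}"
  assumes "continuous_on {0..T} f"
  shows "f \<in> L2 T"
  unfolding L2_def using assms
  by (auto intro!: continuous_time_measurable integrable_continuous_time continuous_intros)

section \<open>Integration by parts for primitives\<close>

text \<open>Fubini on the square: it is cut along the diagonal, and each of the two triangles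
  produces one term. The functions are merely integrable, so no classical product rule is at
  hand.\<close>

lemma prim_product_core:
  assumes g: "integrable (time_measure T) g" and h: "integrable (time_measure T) h"
  shows "(\<integral>s. g s \<partial>time_measure T) * (\<integral>s. h s \<partial>time_measure T)
    = (\<integral>s. g s * prim T h s \<partial>time_measure T) + (\<integral>s. prim T g s * h s \<partial>time_measure T)"
proof -
  let ?M = "time_measure T"
  interpret M: finite_measure ?M by (rule finite_measure_time)
  interpret P: pair_sigma_finite ?M ?M ..
  have [measurable]: "g \<in> borel_measurable ?M" "h \<in> borel_measurable ?M" using g h by auto
  have gh: "integrable (?M \<Otimes>\<^sub>M ?M) (\<lambda>p. g (fst p) * h (snd p))"
    by (rule P.Fubini_integrable) (use g h in \<open>auto simp: abs_mult\<close>)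
  \<comment> \<open>This is the integrand on the triangle where the variable of \<open>g\<close>
    precedes that of \<open>h\<close>.\<close>
  define F where "F s r = indicator {p. fst p < snd p} (s, r) * (g s * h r)" for s r :: real
  have "(\<lambda>p. fst p) \<in> borel_measurable (?M \<Otimes>\<^sub>M ?M)" "(\<lambda>p. snd p) \<in> borel_measurable (?M \<Otimes>\<^sub>M ?M)"
    using measurable_compose[OF measurable_fst id_time_measurable] measurable_compose[OF measurable_snd
      id_time_measurable]
    by auto
  then have "{p \<in> space (?M \<Otimes>\<^sub>M ?M). fst p < snd p} \<in> sets (?M \<Otimes>\<^sub>M ?M)" by (rule borel_measurable_less)
  then have [measurable]: "(\<lambda>p. indicator {p. fst p < snd p} p :: real) \<in> borel_measurable (?M \<Otimes>\<^sub>M ?M)"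
    by (subst borel_measurable_indicator_iff) (simp add: Int_def conj_commute)
  have F: "integrable (?M \<Otimes>\<^sub>M ?M) (case_prod F)"
    by (rule Bochner_Integration.integrable_bound[OF gh])
      (auto simp: F_def case_prod_unfold indicator_def)
  have 1: "(\<integral>r. h r \<partial>?M) = prim T h s + (\<integral>r. indicator {p. fst p < snd p} (s, r) * h r \<partial>?M)"
    if s: "s \<in> {0<..<T}" for s
  proof -
    have i: "integrable ?M (\<lambda>r. indicator {s<..} r * h r)"
      by (rule integrable_indicator_mult[OF h]) auto
    have "(\<integral>r. h r \<partial>?M) = (\<integral>r. indicator {0<..<s} r * h r + indicator {s<..} r * h r \<partial>?M)"
    proof (rule integral_cong_AE)
      show "(\<lambda>r. indicator {0<..<s} r * h r + indicator {s<..} r * h r) \<in> borel_measurable ?M"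
        using i integrable_indicator_mult[OF h, of "{0<..<s}"] by auto
      show "AE r in ?M. h r = indicator {0<..<s} r * h r + indicator {s<..} r * h r"
        using AE_time_neq[of s T] AE_time[of T] by eventually_elim (auto simp: indicator_def)
    qed simp
    also have "\<dots> = prim T h s + (\<integral>r. indicator {s<..} r * h r \<partial>?M)"
      unfolding prim_def by (intro Bochner_Integration.integral_add i integrable_indicator_mult[OF h])
        auto
    finally show ?thesis by (simp add: indicator_def)
  qed
  have pm: "integrable ?M (\<lambda>s. g s * prim T h s)"
    using integrable_continuous_mult[OF g prim_continuous[OF h]] by (simp add: mult.commute)
  have i2: "integrable ?M (\<lambda>s. \<integral>r. F s r \<partial>?M)" using P.integrable_fst[OF F] .
  have "(\<integral>s. g s \<partial>?M) * (\<integral>s. h s \<partial>?M) = (\<integral>s. g s * (\<integral>r. h r \<partial>?M) \<partial>?M)" by simp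
  also have "\<dots> = (\<integral>s. g s * prim T h s + (\<integral>r. F s r \<partial>?M) \<partial>?M)"
  proof (rule Bochner_Integration.integral_cong[OF refl])
    fix s assume "s \<in> space ?M"
    then have s: "s \<in> {0<..<T}" by (simp add: space_restrict_space)
    have "(\<integral>r. F s r \<partial>?M) = g s * (\<integral>r. indicator {p. fst p < snd p} (s, r) * h r \<partial>?M)"
      unfolding F_def by (subst integral_mult_right_zero[symmetric]) (simp add: mult_ac)
    with 1[OF s] show "g s * (\<integral>r. h r \<partial>?M) = g s * prim T h s + (\<integral>r. F s r \<partial>?M)"
      by (simp add: distrib_left)
  qed
  also have "\<dots> = (\<integral>s. g s * prim T h s \<partial>?M) + (\<integral>s. (\<integral>r. F s r \<partial>?M) \<partial>?M)"
    by (rule Bochner_Integration.integral_add[OF pm i2])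
  also have "(\<integral>s. (\<integral>r. F s r \<partial>?M) \<partial>?M) = (\<integral>r. (\<integral>s. F s r \<partial>?M) \<partial>?M)"
    by (rule P.Fubini_integral[OF F, symmetric])
  also have "\<dots> = (\<integral>r. prim T g r * h r \<partial>?M)"
  proof (rule Bochner_Integration.integral_cong[OF refl])
    fix r assume "r \<in> space ?M"
    have "(\<integral>s. F s r \<partial>?M) = (\<integral>s. (indicator {0<..<r} s * g s) * h r \<partial>?M)"
      by (rule Bochner_Integration.integral_cong) (auto simp: F_def indicator_def space_restrict_space)
    then show "(\<integral>s. F s r \<partial>?M) = prim T g r * h r" by (simp add: prim_def)
  qed
  finally show ?thesis .
qed

lemma prim_product_T:
  assumes g: "integrable (time_measure T) g" and h: "integrable (time_measure T) h"
  shows "(a + prim T g T) * (b + prim T h T) = a * b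
    + (\<integral>s. g s * (b + prim T h s) + (a + prim T g s) * h s \<partial>time_measure T)"
proof -
  have i: "integrable (time_measure T) (\<lambda>s. g s * prim T h s)" "integrable (time_measure T) (\<lambda>s. prim T
    g s * h s)"
    using integrable_continuous_mult[OF g prim_continuous[OF h]]
      integrable_continuous_mult[OF h prim_continuous[OF g]] by (auto simp: mult.commute)
  have "(\<integral>s. g s * (b + prim T h s) + (a + prim T g s) * h s \<partial>time_measure T)
    = (\<integral>s. (b * g s + g s * prim T h s) + (a * h s + prim T g s * h s) \<partial>time_measure T)"
    by (simp add: algebra_simps)
  also have "\<dots> = (b * (\<integral>s. g s \<partial>time_measure T) + (\<integral>s. g s * prim T h s \<partial>time_measure T))
     + (a * (\<integral>s. h s \<partial>time_measure T) + (\<integral>s. prim T g s * h s \<partial>time_measure T))"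
    using i g h by simp
  finally show ?thesis
    using prim_product_core[OF g h] by (simp add: prim_T algebra_simps)
qed

lemma prim_product:
  assumes g: "integrable (time_measure T) g" and h: "integrable (time_measure T) h" and t: "t \<in> {0..T}"
  shows "(a + prim T g t) * (b + prim T h t) = a * b
    + prim T (\<lambda>s. g s * (b + prim T h s) + (a + prim T g s) * h s) t"
proof -
  \<comment> \<open>Truncating the integrands at \<open>t\<close> freezes their primitives from
    \<open>t\<close> on, which reduces the formula at \<open>t\<close> to the one at the end point
    \<open>T\<close>.\<close>
  have r: "prim T (\<lambda>s. indicator {0<..<t} s * f s) r = prim T f (min r t)" for f r
    unfolding prim_def by (rule Bochner_Integration.integral_cong) (auto simp: indicator_def)
  have "prim T (\<lambda>s. g s * (b + prim T h s) + (a + prim T g s) * h s) t =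
     (\<integral>s. indicator {0<..<t} s * g s * (b + prim T (\<lambda>s. indicator {0<..<t} s * h s) s)
       + (a + prim T (\<lambda>s. indicator {0<..<t} s * g s) s) * (indicator {0<..<t} s * h s) \<partial>time_measure
         T)"
    unfolding r prim_def[of T _ t]
    by (rule Bochner_Integration.integral_cong) (auto simp: indicator_def min_def)
  moreover have "min T t = t" using t by auto
  ultimately show ?thesis
    using prim_product_T[OF integrable_indicator_mult[OF g, of "{0<..<t}"] integrable_indicator_mult[OF
      h, of "{0<..<t}"], of a b]
    by (simp add: r)
qed

lemma prim_FTC:
  assumes F: "\<And>x. x \<in> {0..T} \<Longrightarrow> (F has_real_derivative f x) (at x)" and f: "continuous_on {0..T} f"
    and t: "t \<in> {0..T}"
  shows "F t = F 0 + prim T f t"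
proof -
  have 1: "has_bochner_integral lborel (\<lambda>x. indicator {0..t} x *\<^sub>R f x) (F t - F 0)"
  proof (rule has_bochner_integral_FTC_Icc)
    show "0 \<le> t" using t by auto
    show "(F has_vector_derivative f x) (at x within {0..t})" if "0 \<le> x" "x \<le> t" for x
      using F[of x] that t by (auto simp: has_real_derivative_iff_has_vector_derivative intro:
        has_vector_derivative_at_within)
    show "continuous_on {0..t} f" using f t by (auto intro: continuous_on_subset)
  qed
  have m: "(\<lambda>x. indicator {0..t} x *\<^sub>R f x) \<in> borel_measurable lborel" using 1
    by (auto simp: has_bochner_integral_iff)
  have "prim T f t = (\<integral>x. indicator {0<..<T} x *\<^sub>R (indicator {0<..<t} x * f x) \<partial>lebesgue)"
    unfolding prim_def by (subst integral_restrict_space) auto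
  also have "\<dots> = (\<integral>x. indicator {0..t} x *\<^sub>R f x \<partial>lebesgue)"
  proof (rule integral_cong_AE)
    show m1: "(\<lambda>x. indicator {0..t} x *\<^sub>R f x) \<in> borel_measurable lebesgue" using m
      by (rule measurable_completion)
    have "(\<lambda>x. indicator {0<..<t} x * (indicator {0..t} x *\<^sub>R f x)) \<in> borel_measurable lebesgue"
      by (intro borel_measurable_times borel_measurable_indicator m1) auto
    moreover have "(\<lambda>x. indicator {0<..<t} x * (indicator {0..t} x *\<^sub>R f x))
      = (\<lambda>x. indicator {0<..<T} x *\<^sub>R (indicator {0<..<t} x * f x))"
      using t by (auto simp: indicator_def fun_eq_iff)
    ultimately show "(\<lambda>x. indicator {0<..<T} x *\<^sub>R (indicator {0<..<t} x * f x)) \<in> borel_measurable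
      lebesgue"
      by (simp only:)
    have "{0, t} \<in> null_sets lebesgue" by (simp add: negligible_iff_null_sets[symmetric])
    from AE_not_in[OF this] show "AE x in lebesgue. indicator {0<..<T} x *\<^sub>R (indicator {0<..<t} x * f
      x) = indicator {0..t} x *\<^sub>R f x"
      by eventually_elim (use t in \<open>auto simp: indicator_def\<close>)
  qed
  also have "\<dots> = F t - F 0" using 1 m by (simp add: integral_completion has_bochner_integral_iff)
  finally show ?thesis by simp
qed

text \<open>Variation of constants. As \<open>f\<close> is only integrable, the formula is verified
  by the product rule for primitives; for this the exponential, too, is written as a primitive, of
  \<open>h\<close>.\<close>

lemma scalar_ode_exists:
  fixes \<kappa> c0 :: real
  assumes f: "integrable (time_measure T) f"
  shows "\<exists>c. continuous_on UNIV c \<and> c 0 = c0 \<and> (\<forall>t\<in>{0..T}. c t = c0 + prim T (\<lambda>s. f s - \<kappa> * c s) t)"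
proof -
  let ?M = "time_measure T"
  define g where "g s = exp (\<kappa> * s) * f s" for s
  have g: "integrable ?M g" unfolding g_def
    by (intro integrable_continuous_mult f continuous_intros)
  define h where "h s = - \<kappa> * exp (- \<kappa> * s)" for s
  have hc: "continuous_on S h" for S unfolding h_def by (intro continuous_intros)
  have h: "integrable ?M h" by (rule integrable_continuous_time[OF hc])
  have E: "exp (- \<kappa> * t) = 1 + prim T h t" if "t \<in> {0..T}" for t
  proof -
    have "((\<lambda>t. exp (- \<kappa> * t)) has_real_derivative h x) (at x)" for x
      unfolding h_def by (auto intro!: derivative_eq_intros)
    from prim_FTC[OF this hc that] show ?thesis by simp
  qed
  define c where "c t = (c0 + prim T g t) * exp (- \<kappa> * t)" for t
  have cc: "continuous_on UNIV c" unfolding c_def by (intro continuous_intros prim_continuous g)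
  have "c t = c0 + prim T (\<lambda>s. f s - \<kappa> * c s) t" if t: "t \<in> {0..T}" for t
  proof -
    have "c t = c0 + prim T (\<lambda>s. g s * (1 + prim T h s) + (c0 + prim T g s) * h s) t"
      unfolding c_def E[OF t] using prim_product[OF g h t, of c0 1] by simp
    also have "prim T (\<lambda>s. g s * (1 + prim T h s) + (c0 + prim T g s) * h s) t
      = prim T (\<lambda>s. f s - \<kappa> * c s) t"
      unfolding prim_def[of T _ t]
    proof (rule Bochner_Integration.integral_cong[OF refl])
      fix s assume "s \<in> space ?M"
      then have s: "s \<in> {0..T}" by (auto simp: space_restrict_space)
      have "g s * (1 + prim T h s) = f s"
        using E[OF s] by (simp add: g_def mult.commute mult.left_commute exp_minus_inverse flip: E[OF s]
          exp_add)
      moreover have "(c0 + prim T g s) * h s = - \<kappa> * c s" by (simp add: c_def h_def)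
      ultimately show "indicator {0<..<t} s * (g s * (1 + prim T h s) + (c0 + prim T g s) * h s)
        = indicator {0<..<t} s * (f s - \<kappa> * c s)"
        by simp
    qed
    finally show ?thesis .
  qed
  moreover have "c 0 = c0" by (simp add: c_def)
  ultimately show ?thesis using cc by blast
qed

section \<open>Smooth functions and the lemma of du Bois-Reymond\<close>

definition smooth :: "(real \<Rightarrow> real) \<Rightarrow> bool" where
  "smooth f \<longleftrightarrow> (\<forall>n t. (deriv ^^ n) f field_differentiable at t)"

lemma smooth_deriv: "smooth f \<Longrightarrow> smooth (deriv f)"
  unfolding smooth_def by (metis funpow_Suc_right comp_apply)

lemma smooth_DERIV: "smooth f \<Longrightarrow> (f has_real_derivative deriv f t) (at t)"
  unfolding smooth_def using DERIV_deriv_iff_field_differentiable by (metis funpow_0)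

lemma smooth_continuous: "smooth f \<Longrightarrow> continuous_on S f"
  using smooth_DERIV by (meson DERIV_isCont continuous_at_imp_continuous_on)

text \<open>Any set of functions closed under differentiation consists of smooth functions. This
  replaces inductions on the order of the derivative, for which explicit formulas would be
  required.\<close>

lemma smooth_coinduct:
  assumes "f \<in> S" and "\<And>g. g \<in> S \<Longrightarrow> \<exists>g'\<in>S. \<forall>t. (g has_real_derivative g' t) (at t)"
  shows "smooth f"
proof -
  have d: "deriv g \<in> S" if g: "g \<in> S" for g
  proof -
    obtain g' where g': "g' \<in> S" "\<And>t. (g has_real_derivative g' t) (at t)" using assms(2)[OF g] by blast
    then have "deriv g = g'" by (intro ext DERIV_imp_deriv)
    with g' show ?thesis by simp
  qed
  have "(deriv ^^ n) f \<in> S" for n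
    by (induction n) (use assms(1) d in auto)
  with assms(2) show ?thesis unfolding smooth_def field_differentiable_def by blast
qed

lemma smooth_affine:
  assumes "smooth f"
  shows "smooth (\<lambda>t. c * f (a * t + b))"
proof (rule smooth_coinduct[where S = "{\<lambda>t. c * f (a * t + b) | c f. smooth f}"])
  show "(\<lambda>t. c * f (a * t + b)) \<in> {\<lambda>t. c * f (a * t + b) | c f. smooth f}" using assms by blast
  fix g assume "g \<in> {\<lambda>t. c * f (a * t + b) | c f. smooth f}"
  then obtain d h where h: "g = (\<lambda>t. d * h (a * t + b))" "smooth h" by blast
  have "(g has_real_derivative (d * a) * deriv h (a * t + b)) (at t)" for t
    unfolding h(1) by (auto intro!: derivative_eq_intros DERIV_chain2[OF smooth_DERIV[OF h(2)]])
  moreover have "(\<lambda>t. (d * a) * deriv h (a * t + b)) \<in> {\<lambda>t. c * f (a * t + b) | c f. smooth f}"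
    using smooth_deriv[OF h(2)] by blast
  ultimately show "\<exists>g'\<in>{\<lambda>t. c * f (a * t + b) | c f. smooth f}. \<forall>t. (g has_real_derivative g' t) (at t)"
    by (intro bexI[where x = "\<lambda>t. (d * a) * deriv h (a * t + b)"]) auto
qed

lemma smooth_diff:
  assumes "smooth f" "smooth g"
  shows "smooth (\<lambda>t. f t - g t)"
proof (rule smooth_coinduct[where S = "{\<lambda>t. f t - g t | f g. smooth f \<and> smooth g}"])
  show "(\<lambda>t. f t - g t) \<in> {\<lambda>t. f t - g t | f g. smooth f \<and> smooth g}" using assms by blast
  fix h assume "h \<in> {\<lambda>t. f t - g t | f g. smooth f \<and> smooth g}"
  then obtain f g where h: "h = (\<lambda>t. f t - g t)" "smooth f" "smooth g" by blast
  show "\<exists>g'\<in>{\<lambda>t. f t - g t | f g. smooth f \<and> smooth g}. \<forall>t. (h has_real_derivative g' t) (at t)"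
    by (rule bexI[where x = "\<lambda>t. deriv f t - deriv g t"])
      (use h smooth_deriv in \<open>auto intro!: derivative_eq_intros smooth_DERIV\<close>)
qed

text \<open>Products alone are not closed under differentiation; sums of products are, by the
  Leibniz rule, and so they form a set to which coinduction applies.\<close>

inductive_set smooth_products :: "(real \<Rightarrow> real) set" where
  mult: "smooth f \<Longrightarrow> smooth g \<Longrightarrow> (\<lambda>t. f t * g t) \<in> smooth_products"
| add: "p \<in> smooth_products \<Longrightarrow> q \<in> smooth_products \<Longrightarrow> (\<lambda>t. p t + q t) \<in> smooth_products"

lemma smooth_mult:
  assumes "smooth f" "smooth g"
  shows "smooth (\<lambda>t. f t * g t)"
proof (rule smooth_coinduct[where S = smooth_products])
  show "(\<lambda>t. f t * g t) \<in> smooth_products" using assms by (rule smooth_products.mult)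
  fix p assume "p \<in> smooth_products"
  then show "\<exists>p'\<in>smooth_products. \<forall>t. (p has_real_derivative p' t) (at t)"
  proof induction
    case (mult f g)
    have "(\<lambda>t. f t * deriv g t + deriv f t * g t) \<in> smooth_products"
      using mult smooth_deriv by (intro smooth_products.intros)
    moreover have "((\<lambda>t. f t * g t) has_real_derivative f t * deriv g t + deriv f t * g t) (at t)" for t
      using DERIV_mult'[OF smooth_DERIV[OF mult(1)] smooth_DERIV[OF mult(2)]] .
    ultimately show ?case by (rule_tac bexI[where x = "\<lambda>t. f t * deriv g t + deriv f t * g t"]) auto
  next
    case (add p q)
    then obtain p' q' where pq: "p' \<in> smooth_products" "q' \<in> smooth_products"
      "\<And>t. (p has_real_derivative p' t) (at t)" "\<And>t. (q has_real_derivative q' t) (at t)" by blast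
    then show ?case
      by (intro bexI[where x = "\<lambda>t. p' t + q' t"]) (auto intro: smooth_products.add DERIV_add)
  qed
qed

section \<open>Bump functions and their pointwise limits\<close>

definition smooth_step :: "real \<Rightarrow> real" where
  "smooth_step x = (if x > 0 then exp (- (1 / x)) else 0)"

lemma poly_times_exp_tendsto_0: "((\<lambda>x. poly p x * exp (- x)) \<longlongrightarrow> (0::real)) at_top"
proof -
  have "((\<lambda>x. \<Sum>i\<le>degree p. coeff p i * (x ^ i / exp x)) \<longlongrightarrow> (\<Sum>i\<le>degree p. coeff p i * 0)) at_top"
    by (intro tendsto_intros tendsto_power_div_exp_0)
  moreover have "(\<Sum>i\<le>degree p. coeff p i * (x ^ i / exp x)) = poly p x * exp (- x)" for x
    by (simp add: poly_altdef sum_distrib_right exp_minus divide_inverse mult.assoc)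
  ultimately show ?thesis by simp
qed

text \<open>The coinduction set contains all p(1/x) exp(-1/x), extended by zero, with a polynomial
  p. Differentiation only changes p, and at the origin the exponential beats every polynomial in
  1/x.\<close>

lemma smooth_smooth_step: "smooth smooth_step"
proof (rule smooth_coinduct[where S = "{\<lambda>x. if x > 0 then poly p (1 / x) * exp (- (1 / x)) else 0 | p.
  True}"])
  let ?S = "{\<lambda>x::real. if x > 0 then poly p (1 / x) * exp (- (1 / x)) else 0 | p. True}"
  have "smooth_step = (\<lambda>x. if x > 0 then poly 1 (1 / x) * exp (- (1 / x)) else 0)"
    by (auto simp: smooth_step_def)
  then show "smooth_step \<in> ?S" by blast
  fix g assume "g \<in> ?S"
  then obtain p where g: "g = (\<lambda>x. if x > 0 then poly p (1 / x) * exp (- (1 / x)) else 0)" by blast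
  \<comment> \<open>With z = 1/x the chain rule contributes the factor -z^2 to the derivative of p,
    and z^2 arises from the exponential; hence (p - p') z^2.\<close>
  define q where "q = (p - pderiv p) * [:0, 0, 1:]"
  have "(g has_real_derivative (if x > 0 then poly q (1 / x) * exp (- (1 / x)) else 0)) (at x)" for x
  proof (cases x "0::real" rule: linorder_cases)
    case less
    have "(g has_real_derivative 0) (at x)"
      by (rule has_field_derivative_transform_within_open[of "\<lambda>_. 0" _ _ "{..<0}"])
        (use less in \<open>auto simp: g\<close>)
    with less show ?thesis by simp
  next
    case greater
    have "((\<lambda>x. poly p (1 / x) * exp (- (1 / x))) has_real_derivative poly q (1 / x) * exp (- (1 / x)))
      (at x)"
      by (rule derivative_eq_intros DERIV_chain2[OF poly_DERIV] refl | use greater in \<open>simp; fail\<close>)+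
        (use greater in \<open>simp add: q_def field_simps power2_eq_square\<close>)
    then have "(g has_real_derivative poly q (1 / x) * exp (- (1 / x))) (at x)"
      by (rule has_field_derivative_transform_within_open[of _ _ _ "{0<..}"])
        (use greater in \<open>auto simp: g\<close>)
    with greater show ?thesis by simp
  next
    case equal
    have "((\<lambda>h. (g (0 + h) - g 0) / h) \<longlongrightarrow> 0) (at 0)"
    proof (rule filterlim_split_at)
      show "((\<lambda>h. (g (0 + h) - g 0) / h) \<longlongrightarrow> 0) (at_left 0)"
      proof (rule tendsto_eventually)
        show "\<forall>\<^sub>F h in at_left 0. (g (0 + h) - g 0) / h = 0"
          by (auto simp: eventually_at_filter g)
      qed
      \<comment> \<open>The division by h in the difference quotient becomes multiplication by z =
        1/h, that is, \<open>pCons 0 p\<close> in place of \<open>p\<close>.\<close>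
      have "((\<lambda>h. poly (pCons 0 p) (inverse h) * exp (- inverse h)) \<longlongrightarrow> 0) (at_right (0::real))"
        by (rule filterlim_compose[OF poly_times_exp_tendsto_0 filterlim_inverse_at_top_right])
      moreover have "\<forall>\<^sub>F h in at_right 0. poly (pCons 0 p) (inverse h) * exp (- inverse h) = (g (0
        + h) - g 0) / h"
        using eventually_at_right_less[of "0::real"] by eventually_elim (simp add: g divide_inverse)
      ultimately show "((\<lambda>h. (g (0 + h) - g 0) / h) \<longlongrightarrow> 0) (at_right 0)"
        by (rule Lim_transform_eventually)
    qed
    then show ?thesis using equal by (simp add: DERIV_def)
  qed
  then show "\<exists>g'\<in>?S. \<forall>t. (g has_real_derivative g' t) (at t)"
    by (intro bexI[where x = "\<lambda>x. if x > 0 then poly q (1 / x) * exp (- (1 / x)) else 0"]) auto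
qed

text \<open>The factor \<open>Suc n\<close> steepens both flanks without moving the interval of
  positivity, so that the bumps tend to the indicator of the open interval.\<close>

definition bump :: "real \<Rightarrow> real \<Rightarrow> nat \<Rightarrow> real \<Rightarrow> real" where
  "bump a b n t = smooth_step (real (Suc n) * (t - a)) * smooth_step (real (Suc n) * (b - t))"

lemma smooth_bump: "smooth (bump a b n)"
proof -
  have "smooth (\<lambda>t. (1 * smooth_step (real (Suc n) * t + - (real (Suc n) * a))) *
      (1 * smooth_step (- real (Suc n) * t + real (Suc n) * b)))"
    by (intro smooth_mult smooth_affine smooth_smooth_step)
  then show ?thesis unfolding bump_def by (simp add: algebra_simps)
qed

lemma smooth_step_bounds: "0 \<le> smooth_step x" "smooth_step x \<le> 1"
  by (auto simp: smooth_step_def)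

lemma smooth_step_pos: "0 < smooth_step x \<longleftrightarrow> 0 < x"
  by (auto simp: smooth_step_def)

lemma bump_bounds: "0 \<le> bump a b n t" "bump a b n t \<le> 1"
  using smooth_step_bounds by (auto simp: bump_def intro: mult_le_one)

lemma bump_pos: "a < t \<Longrightarrow> t < b \<Longrightarrow> 0 < bump a b n t"
  unfolding bump_def by (intro mult_pos_pos) (auto simp: smooth_step_pos zero_less_mult_iff)

lemma bump_zero: "t \<le> a \<or> b \<le> t \<Longrightarrow> bump a b n t = 0"
  by (auto simp: bump_def smooth_step_def zero_less_mult_iff)

lemma bump_tendsto: "(\<lambda>n. bump a b n t) \<longlonglongrightarrow> indicator {a<..<b} t"
proof -
  have st: "(\<lambda>n. smooth_step (real (Suc n) * x)) \<longlonglongrightarrow> indicator {0<..} x" for x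
  proof (cases "0 < x")
    case True
    have "(\<lambda>n. exp (- ((1 / x) * inverse (real (Suc n))))) \<longlonglongrightarrow> exp (- ((1 / x) * 0))"
      by (intro tendsto_intros LIMSEQ_inverse_real_of_nat)
    moreover have "exp (- ((1 / x) * inverse (real (Suc n)))) = smooth_step (real (Suc n) * x)" for n
      using True by (simp add: smooth_step_def divide_inverse mult.commute zero_less_mult_iff)
    ultimately show ?thesis using True by simp
  next
    case False
    then have "smooth_step (real (Suc n) * x) = 0" for n
      by (auto simp: smooth_step_def zero_less_mult_iff)
    then show ?thesis using False by simp
  qed
  have "(\<lambda>n. bump a b n t) \<longlonglongrightarrow> indicator {0<..} (t - a) * indicator {0<..} (b - t)"
    unfolding bump_def by (intro tendsto_mult st)
  moreover have "indicator {0<..} (t - a) * indicator {0<..} (b - t) = (indicator {a<..<b} t :: real)"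
    by (auto simp: indicator_def)
  ultimately show ?thesis by simp
qed

lemma test_functions_iff:
  "\<phi> \<in> test_functions T \<longleftrightarrow> smooth \<phi> \<and> (\<exists>a b. 0 < a \<and> b < T \<and> (\<forall>t. t \<notin> {a..b} \<longrightarrow> \<phi> t = 0))"
  by (simp add: test_functions_def smooth_def)

lemma test_function_prim:
  assumes \<phi>: "\<phi> \<in> test_functions T" and T: "0 < T"
  shows "\<phi> 0 = 0" "\<phi> T = 0" "\<And>t. t \<in> {0..T} \<Longrightarrow> \<phi> t = prim T (deriv \<phi>) t"
    "integrable (time_measure T) (deriv \<phi>)" "continuous_on UNIV (deriv \<phi>)"
proof -
  obtain a b where ab: "0 < a" "b < T" "\<And>t. t \<notin> {a..b} \<Longrightarrow> \<phi> t = 0"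
    using \<phi> by (auto simp: test_functions_iff)
  show 0: "\<phi> 0 = 0" "\<phi> T = 0" using ab(1,2) by (auto intro!: ab(3))
  have sm: "smooth \<phi>" using \<phi> by (simp add: test_functions_iff)
  show c: "continuous_on UNIV (deriv \<phi>)" by (intro smooth_continuous smooth_deriv sm)
  show "integrable (time_measure T) (deriv \<phi>)"
    by (intro integrable_continuous_time smooth_continuous smooth_deriv sm)
  show "\<phi> t = prim T (deriv \<phi>) t" if "t \<in> {0..T}" for t
    using prim_FTC[OF smooth_DERIV[OF sm] smooth_continuous[OF smooth_deriv[OF sm]] that] 0 by simp
qed

section \<open>Weak derivatives of scalar functions\<close>

text \<open>A test function is the primitive of its derivative and vanishes at both ends, so the
  product formula at \<open>T\<close> has no boundary term.\<close>

lemma prim_weak_deriv: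
  assumes \<phi>: "\<phi> \<in> test_functions T" and T: "0 < T" and g: "integrable (time_measure T) g"
    and c: "AE t in time_measure T. c t = a + prim T g t" "c \<in> borel_measurable (time_measure T)"
  shows "(\<integral>t. deriv \<phi> t * c t \<partial>time_measure T) = - (\<integral>t. \<phi> t * g t \<partial>time_measure T)"
proof -
  let ?M = "time_measure T"
  note t = test_function_prim[OF \<phi> T]
  have m: "(\<lambda>s. prim T g s) \<in> borel_measurable ?M" by (rule prim_measurable[OF g])
  have [measurable]: "deriv \<phi> \<in> borel_measurable ?M" "c \<in> borel_measurable ?M" using t(4) c by auto
  have i1: "integrable ?M (\<lambda>s. deriv \<phi> s * (a + prim T g s))"
    using integrable_continuous_mult[OF t(4), of "\<lambda>s. a + prim T g s"] prim_continuous[OF g]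
    by (simp add: mult.commute continuous_intros)
  have i2: "integrable ?M (\<lambda>s. prim T (deriv \<phi>) s * g s)"
    by (intro integrable_continuous_mult g prim_continuous t(4))
  have "(\<integral>t. deriv \<phi> t * c t \<partial>?M) = (\<integral>t. deriv \<phi> t * (a + prim T g t) \<partial>?M)"
    by (rule integral_cong_AE) (use c m in \<open>auto intro!: borel_measurable_times borel_measurable_add\<close>)
  moreover have "(\<integral>t. \<phi> t * g t \<partial>?M) = (\<integral>t. prim T (deriv \<phi>) t * g t \<partial>?M)"
    by (rule Bochner_Integration.integral_cong) (use t(3) in \<open>auto simp: space_restrict_space\<close>)
  moreover have "(\<integral>s. deriv \<phi> s * (a + prim T g s) + prim T (deriv \<phi>) s * g s \<partial>?M) = 0"
    using prim_product_T[OF t(4) g, of 0 a] t(2) t(3)[of T] T by simp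
  ultimately show ?thesis using i1 i2 by simp
qed

text \<open>A monotone class argument. The integrals of \<open>k\<close> over initial rays vanish,
  the rays are stable under intersection and generate the Borel sets, and a Lebesgue set differs
  from a Borel set only inside a null set.\<close>

lemma AE_zero_if_prim_zero:
  assumes k: "integrable (time_measure T) k" and T: "0 < T" and z: "\<And>t. t \<in> {0..T} \<Longrightarrow> prim T k t = 0"
  shows "AE t in time_measure T. k t = 0"
proof -
  let ?M = "time_measure T"
  interpret finite_measure ?M by (rule finite_measure_time)
  have [measurable]: "k \<in> borel_measurable ?M" using k by auto
  have inds: "integrable ?M (\<lambda>s. indicator A s * k s)" if "A \<in> sets borel" for A
    by (rule integrable_indicator_mult[OF k that])
  have tot: "(\<integral>s. k s \<partial>?M) = 0" using z[of T] T by (simp add: prim_T)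
  have borel: "(\<integral>s. indicator A s * k s \<partial>?M) = 0" if "A \<in> sets borel" for A
  proof -
    have G: "Int_stable (range lessThan :: real set set)"
      unfolding Int_stable_def
    proof (intro ballI)
      fix A B :: "real set" assume "A \<in> range lessThan" "B \<in> range lessThan"
      then obtain a b where "A = {..<a}" "B = {..<b}" by blast
      then have "A \<inter> B = {..<min a b}" by auto
      then show "A \<inter> B \<in> range lessThan" by blast
    qed
    have "range lessThan \<subseteq> Pow (UNIV :: real set)" "A \<in> sigma_sets UNIV (range lessThan)"
      using that by (auto simp: borel_Iio)
    with G show ?thesis
    proof (induction rule: sigma_sets_induct_disjoint)
      case (basic A)
      then obtain t where A: "A = {..<t}" by blast
      have "(\<integral>s. indicator A s * k s \<partial>?M) = prim T k (min T (max 0 t))"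
        unfolding prim_def A
        by (rule Bochner_Integration.integral_cong) (auto simp: indicator_def space_restrict_space)
      then show ?case using z T by simp
    next
      case empty then show ?case by simp
    next
      case (compl A)
      have "A \<in> sets borel" using compl by (simp add: borel_Iio)
      have "(\<integral>s. indicator (UNIV - A) s * k s \<partial>?M) = (\<integral>s. k s - indicator A s * k s \<partial>?M)"
        by (rule Bochner_Integration.integral_cong) (auto simp: indicator_def)
      also have "\<dots> = 0" using k inds[OF \<open>A \<in> sets borel\<close>] tot compl by simp
      finally show ?case .
    next
      case (union A)
      have Ab: "A i \<in> sets borel" for i using union(2) by (auto simp: borel_Iio)
      have "(\<lambda>n. \<integral>s. indicator (\<Union>i<n. A i) s * k s \<partial>?M) \<longlonglongrightarrow> (\<integral>s. indicator (\<Union>i. A i) s * k s \<partial>?M)"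
      proof (rule integral_dominated_convergence[where w = "\<lambda>s. \<bar>k s\<bar>"])
        show "(\<lambda>s. indicator (\<Union>i. A i) s * k s) \<in> borel_measurable ?M"
          using inds[of "\<Union>i. A i"] Ab by auto
        show "(\<lambda>s. indicator (\<Union>i<n. A i) s * k s) \<in> borel_measurable ?M" for n
          using inds[of "\<Union>i<n. A i"] Ab by auto
        show "AE s in ?M. (\<lambda>n. indicator (\<Union>i<n. A i) s * k s) \<longlonglongrightarrow> indicator (\<Union>i. A i) s * k s"
          by (intro AE_I2 tendsto_intros LIMSEQ_indicator_UN)
      qed (use k in \<open>auto simp: indicator_def\<close>)
      moreover have "(\<integral>s. indicator (\<Union>i<n. A i) s * k s \<partial>?M) = 0" for n
      proof -
        have "indicator (\<Union>i<n. A i) s * k s = (\<Sum>i<n. indicator (A i) s * k s)" for s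
          using union(1) by (subst indicator_UN_disjoint)
            (auto simp: sum_distrib_right disjoint_family_on_def)
        then have "(\<integral>s. indicator (\<Union>i<n. A i) s * k s \<partial>?M) = (\<integral>s. (\<Sum>i<n. indicator (A i) s * k s) \<partial>?M)"
          by (simp only:)
        also have "\<dots> = (\<Sum>i<n. \<integral>s. indicator (A i) s * k s \<partial>?M)"
          by (intro Bochner_Integration.integral_sum inds Ab)
        finally show ?thesis by (simp add: union(3))
      qed
      ultimately show ?case by (simp add: LIMSEQ_const_iff)
    qed
  qed
  have "set_lebesgue_integral ?M A k = 0" if "A \<in> sets ?M" for A
  proof -
    have "A \<in> sets (completion lborel)" using that by (simp add: sets_restrict_space_iff)
    then obtain S N N' where SN: "A = S \<union> N" "N \<subseteq> N'" "N' \<in> null_sets lborel" "S \<in> sets borel"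
      by (auto simp: sets_completion elim: completionE)
    have "AE s in lebesgue. s \<notin> N'" using SN(3) by (intro AE_not_in null_sets_completionI)
    then have ae: "AE s in ?M. s \<notin> N'" by (subst AE_restrict_space_iff) (auto elim: eventually_mono)
    have "set_lebesgue_integral ?M A k = (\<integral>s. indicator S s * k s \<partial>?M)"
      unfolding set_lebesgue_integral_def
    proof (rule integral_cong_AE)
      show "(\<lambda>s. indicator S s * k s) \<in> borel_measurable ?M" using inds[OF SN(4)] by auto
      show "(\<lambda>s. indicator A s *\<^sub>R k s) \<in> borel_measurable ?M"
        using that by measurable
      show "AE s in ?M. indicator A s *\<^sub>R k s = indicator S s * k s"
        using ae by eventually_elim (use SN in \<open>auto simp: indicator_def\<close>)
    qed
    then show ?thesis using borel[OF SN(4)] by simp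
  qed
  from density_zero[OF k this] show ?thesis .
qed

lemma smooth_antiderivative:
  assumes "smooth q" "\<And>t. (F has_real_derivative q t) (at t)"
  shows "smooth F"
proof (rule smooth_coinduct[where S = "insert F {q. smooth q}"])
  fix g assume "g \<in> insert F {q. smooth q}"
  then show "\<exists>g'\<in>insert F {q. smooth q}. \<forall>t. (g has_real_derivative g' t) (at t)"
    using assms smooth_DERIV smooth_deriv by blast
qed simp

text \<open>Vanishing of the mean is exactly what lets the antiderivative return to zero to the
  right of the support, hence the condition on \<open>int\<close>.\<close>

lemma test_function_antiderivative:
  assumes q: "smooth q" and T: "0 < T" and z: "\<And>t. t \<notin> {a..b} \<Longrightarrow> q t = 0" and ab: "0 < a" "b < T"
    and int: "(\<integral>t. q t \<partial>time_measure T) = 0"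
  shows "\<exists>\<phi>\<in>test_functions T. deriv \<phi> = q"
proof -
  \<comment> \<open>The lower limit -1 lies to the left of the support, which keeps 0 in the
    interior of the interval of integration.\<close>
  define \<phi> where "\<phi> t = integral {-1..t} q" for t
  have qc: "continuous_on S q" for S by (rule smooth_continuous[OF q])
  have \<phi>0: "\<phi> t = 0" if "t < a" for t
    unfolding \<phi>_def using that z by (intro integral_unique has_integral_is_0) auto
  have D: "(\<phi> has_real_derivative q t) (at t)" for t
  proof (cases "t < a")
    case True
    have "(\<phi> has_real_derivative 0) (at t)"
      by (rule has_field_derivative_transform_within_open[of "\<lambda>_. 0" _ _ "{..<a}"])
        (use True \<phi>0 in auto)
    then show ?thesis using z True by auto
  next
    case False
    then have "(\<phi> has_real_derivative q t) (at t within {-1..t+1})"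
      unfolding \<phi>_def using ab by (intro integral_has_real_derivative qc) auto
    moreover have "t \<in> interior {-1..t+1}" using False ab by auto
    ultimately show ?thesis using at_within_interior by metis
  qed
  have "\<phi> T = \<phi> 0 + prim T q T" by (rule prim_FTC[OF D qc]) (use T in auto)
  then have \<phi>T: "\<phi> T = 0" using \<phi>0[of 0] ab int by (simp add: prim_T)
  have "\<phi> t = 0" if "t > b" for t
  proof -
    have "\<phi> x = \<phi> y" if xy: "b < x" "x < y" for x y
    proof -
      obtain z' where "z' > x" "z' < y" "\<phi> y - \<phi> x = (y - x) * q z'"
        using MVT2[OF xy(2), of \<phi> q] D by blast
      then show ?thesis using z[of z'] xy by auto
    qed
    then show ?thesis using \<phi>T ab that by (metis linorder_neqE_linordered_idom)
  qed
  then have "\<phi> t = 0" if "t \<notin> {a..b}" for t using \<phi>0 that by fastforce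
  then have "\<phi> \<in> test_functions T"
    unfolding test_functions_iff using ab smooth_antiderivative[OF q D] by blast
  moreover have "deriv \<phi> = q" using D by (intro ext DERIV_imp_deriv)
  ultimately show ?thesis by blast
qed

text \<open>The difference \<open>F\<close> of \<open>c\<close> and the primitive has zero weak
  derivative, so it is orthogonal to every test function of mean zero. Subtracting a suitable
  constant makes it orthogonal to all bumps, and therefore its integrals over inner intervals
  vanish.\<close>

lemma du_bois_reymond:
  assumes T: "0 < T" and c: "integrable (time_measure T) c" and g: "integrable (time_measure T) g"
    and weak: "\<And>\<phi>. \<phi> \<in> test_functions T \<Longrightarrow>
      (\<integral>t. deriv \<phi> t * c t \<partial>time_measure T) = - (\<integral>t. \<phi> t * g t \<partial>time_measure T)"
  shows "\<exists>a. AE t in time_measure T. c t = a + prim T g t"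
proof -
  let ?M = "time_measure T"
  define F where "F t = c t - prim T g t" for t
  have pg: "integrable ?M (prim T g)" by (rule integrable_continuous_time[OF prim_continuous[OF g]])
  have F: "integrable ?M F" unfolding F_def using c pg by auto
  have weakF: "(\<integral>t. deriv \<phi> t * F t \<partial>?M) = 0" if \<phi>: "\<phi> \<in> test_functions T" for \<phi>
  proof -
    have "continuous_on {0..T} (deriv \<phi>)"
      using test_function_prim(5)[OF \<phi> T] by (rule continuous_on_subset) simp
    then have "integrable ?M (\<lambda>t. deriv \<phi> t * c t)" "integrable ?M (\<lambda>t. deriv \<phi> t * prim T g t)"
      using integrable_continuous_mult c pg by blast+
    then have "(\<integral>t. deriv \<phi> t * F t \<partial>?M) = (\<integral>t. deriv \<phi> t * c t \<partial>?M) - (\<integral>t. deriv \<phi> t * prim T g t \<partial>?M)"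
      unfolding F_def right_diff_distrib by simp
    also have "\<dots> = 0"
      using weak[OF \<phi>] prim_weak_deriv[OF \<phi> T g, of "prim T g" 0] prim_measurable[OF g] by simp
    finally show ?thesis .
  qed
  \<comment> \<open>A fixed bump of nonzero integral; multiples of it correct the mean of any other
    bump.\<close>
  define \<rho> where "\<rho> = bump (T/3) (2*T/3) 0"
  have bump_c: "continuous_on S (bump a b n)" for S a b n by (rule smooth_continuous[OF smooth_bump])
  have bump_i: "integrable ?M (bump a b n)" for a b n by (rule integrable_continuous_time[OF bump_c])
  have bump_Fi: "integrable ?M (\<lambda>t. bump a b n t * F t)" for a b n
    by (intro integrable_continuous_mult F bump_c)
  define m0 where "m0 = (\<integral>t. \<rho> t \<partial>?M)"
  have m0: "m0 \<noteq> 0"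
  proof
    assume "m0 = 0"
    then have "AE t in ?M. \<rho> t = 0"
      unfolding m0_def using integral_nonneg_eq_0_iff_AE[of ?M \<rho>] bump_bounds bump_i
        by (auto simp: \<rho>_def)
    from AE_time_interval[OF this, of "T/3" "2*T/3"] T
    obtain t where "t \<in> {T/3<..<2*T/3}" "\<rho> t = 0" by auto
    then show False using bump_pos[of "T/3" t "2*T/3" 0] by (simp add: \<rho>_def)
  qed
  \<comment> \<open>The mean of \<open>F\<close> weighted by \<open>\<rho>\<close> is the only
    constant for which \<open>F\<close> minus it is orthogonal to \<open>\<rho>\<close>.\<close>
  define a where "a = (\<integral>t. \<rho> t * F t \<partial>?M) / m0"
  define k where "k t = F t - a" for t
  have k: "integrable ?M k" unfolding k_def
    by (intro Bochner_Integration.integrable_diff F finite_measure.integrable_const[OF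
      finite_measure_time])
  have bk: "(\<integral>t. bump \<alpha> \<beta> n t * k t \<partial>?M) = 0" if ab: "0 < \<alpha>" "\<alpha> < \<beta>" "\<beta> < T" for \<alpha> \<beta> n
  proof -
    define m where "m = (\<integral>t. bump \<alpha> \<beta> n t \<partial>?M)"
    \<comment> \<open>This difference has mean zero, hence is the derivative of a test function. The
      affine argument of \<open>\<rho>\<close> has the shape that the smoothness rule for affine
      substitutions expects.\<close>
    define q where "q t = bump \<alpha> \<beta> n t - (m / m0) * \<rho> (1 * t + 0)" for t
    have "smooth q" unfolding q_def \<rho>_def by (intro smooth_diff smooth_affine smooth_bump)
    moreover have "q t = 0" if "t \<notin> {min \<alpha> (T/3)..max \<beta> (2*T/3)}" for t
    proof -
      have "(t \<le> \<alpha> \<or> \<beta> \<le> t) \<and> (t \<le> T/3 \<or> 2*T/3 \<le> t)" using that by auto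
      then show ?thesis by (simp add: q_def \<rho>_def bump_zero)
    qed
    moreover have "(\<integral>t. q t \<partial>?M) = 0"
      unfolding q_def using bump_i m0 by (simp add: \<rho>_def m_def m0_def)
    ultimately obtain \<phi> where \<phi>: "\<phi> \<in> test_functions T" "deriv \<phi> = q"
      using test_function_antiderivative[of q T "min \<alpha> (T/3)" "max \<beta> (2*T/3)"] ab T by auto
    have "0 = (\<integral>t. q t * F t \<partial>?M)" using weakF[OF \<phi>(1)] \<phi>(2) by simp
    also have "\<dots> = (\<integral>t. bump \<alpha> \<beta> n t * F t - (m / m0) * (\<rho> t * F t) \<partial>?M)"
      by (simp add: q_def left_diff_distrib mult.assoc)
    also have "\<dots> = (\<integral>t. bump \<alpha> \<beta> n t * F t \<partial>?M) - m * a"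
      using bump_Fi by (simp add: \<rho>_def a_def)
    finally have "(\<integral>t. bump \<alpha> \<beta> n t * F t \<partial>?M) = m * a" by simp
    moreover have "(\<integral>t. bump \<alpha> \<beta> n t * k t \<partial>?M) = (\<integral>t. bump \<alpha> \<beta> n t * F t \<partial>?M) - m * a"
      unfolding k_def right_diff_distrib m_def using bump_Fi bump_i by simp
    ultimately show ?thesis by simp
  qed
  have ik: "(\<integral>t. indicator {\<alpha><..<\<beta>} t * k t \<partial>?M) = 0" if ab: "0 < \<alpha>" "\<alpha> < \<beta>" "\<beta> < T" for \<alpha> \<beta>
  proof -
    have "(\<lambda>n. \<integral>t. bump \<alpha> \<beta> n t * k t \<partial>?M) \<longlonglongrightarrow> (\<integral>t. indicator {\<alpha><..<\<beta>} t * k t \<partial>?M)"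
    proof (rule integral_dominated_convergence[where w = "\<lambda>t. \<bar>k t\<bar>"])
      show "(\<lambda>t. indicator {\<alpha><..<\<beta>} t * k t) \<in> borel_measurable ?M"
        using integrable_indicator_mult[OF k, of "{\<alpha><..<\<beta>}"] by auto
      show "(\<lambda>t. bump \<alpha> \<beta> n t * k t) \<in> borel_measurable ?M" for n
        using integrable_continuous_mult[OF k bump_c] by blast
      show "AE t in ?M. norm (bump \<alpha> \<beta> n t * k t) \<le> \<bar>k t\<bar>" for n
        by (rule AE_I2) (simp add: abs_mult bump_bounds mult_left_le_one_le)
      show "AE t in ?M. (\<lambda>n. bump \<alpha> \<beta> n t * k t) \<longlonglongrightarrow> indicator {\<alpha><..<\<beta>} t * k t"
        by (intro AE_I2 tendsto_intros bump_tendsto)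
    qed (use k in auto)
    then show ?thesis by (simp add: bk[OF that] LIMSEQ_const_iff)
  qed
  have const: "prim T k \<beta> = prim T k \<alpha>" if ab: "0 < \<alpha>" "\<alpha> < \<beta>" "\<beta> < T" for \<alpha> \<beta>
  proof -
    have i: "integrable ?M (\<lambda>t. indicator {x<..<y} t * k t)" for x y
      by (rule integrable_indicator_mult[OF k]) auto
    have "prim T k \<beta> = (\<integral>t. indicator {0<..<\<alpha>} t * k t + indicator {\<alpha><..<\<beta>} t * k t \<partial>?M)"
      unfolding prim_def
    proof (rule integral_cong_AE)
      show "AE t in ?M. indicator {0<..<\<beta>} t * k t = indicator {0<..<\<alpha>} t * k t
        + indicator {\<alpha><..<\<beta>} t * k t"
        using AE_time_neq[of \<alpha> T] by eventually_elim (use ab in \<open>auto simp: indicator_def\<close>)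
    qed (use i in auto)
    also have "\<dots> = prim T k \<alpha> + 0" using i ik[OF that] by (simp add: prim_def)
    finally show ?thesis by simp
  qed
  \<comment> \<open>The primitive is constant inside the interval and continuous up to its ends,
    where it starts from zero.\<close>
  have eq: "prim T k t = prim T k (T/2)" if "t \<in> {0..T}" for t
  proof -
    have "closure {0<..<T} = {0..T}" using T by simp
    then have cc: "continuous_on (closure {0<..<T}) (prim T k)" by (intro prim_continuous k)
    have "prim T k s = prim T k (T/2)" if "s \<in> {0<..<T}" for s
      using const[of s "T/2"] const[of "T/2" s] that T by (cases s "T/2" rule: linorder_cases) auto
    then show ?thesis
      by (rule continuous_constant_on_closure[OF cc]) (use that T in auto)
  qed
  have "prim T k t = 0" if "t \<in> {0..T}" for t
    using eq[OF that] eq[of 0] T by simp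
  from AE_zero_if_prim_zero[OF k T this] have "AE t in ?M. k t = 0" .
  then have "AE t in ?M. c t = a + prim T g t" by eventually_elim (simp add: k_def F_def)
  then show ?thesis by blast
qed

section \<open>The spectral theorem for compact nonnegative operators\<close>

lemma subspace_closure:
  fixes S :: "'a::real_normed_vector set"
  assumes S: "subspace S"
  shows "subspace (closure S)"
proof (rule subspaceI)
  show "0 \<in> closure S" using subspace_0[OF S] closure_subset by blast
next
  fix x y assume "x \<in> closure S" "y \<in> closure S"
  then obtain f g where "\<And>n. f n \<in> S" "f \<longlonglongrightarrow> x" "\<And>n. g n \<in> S" "g \<longlonglongrightarrow> y"
    unfolding closure_sequential by blast
  then show "x + y \<in> closure S"
    unfolding closure_sequential by (intro exI[of _ "\<lambda>n. f n
      + g n"]) (auto intro: tendsto_add subspace_add[OF S])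
next
  fix c :: real and x assume "x \<in> closure S"
  then obtain f where "\<And>n. f n \<in> S" "f \<longlonglongrightarrow> x" unfolding closure_sequential by blast
  then show "c *\<^sub>R x \<in> closure S"
    unfolding closure_sequential by (intro exI[of _ "\<lambda>n. c *\<^sub>R f n"]) (auto intro: tendsto_scaleR
      subspace_scale[OF S])
qed

text \<open>Compactness is stated through sequences, the form in which it is verified for both
  instances: the POD operator and the operator that represents the inner product of \<open>H\<close>
  on a subspace of \<open>V\<close>.\<close>

locale compact_nonneg_operator =
  fixes R :: "'a::{real_inner, banach} \<Rightarrow> 'a"
  assumes bounded_linear: "bounded_linear R"
    and sym: "\<And>x y. R x \<bullet> y = x \<bullet> R y"
    and nonneg: "\<And>x. 0 \<le> R x \<bullet> x"
    and compact: "\<And>x::nat \<Rightarrow> 'a. (\<And>n. norm (x n) \<le> 1) \<Longrightarrow>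
      \<exists>l r. strict_mono (r::nat \<Rightarrow> nat) \<and> (\<lambda>n. R (x (r n))) \<longlonglongrightarrow> l"
begin

sublocale R: bounded_linear R by (rule bounded_linear)

lemma quadratic_form_bounded:
  obtains B where "B \<ge> 0" "\<And>x. R x \<bullet> x \<le> B * (norm x)\<^sup>2"
proof -
  obtain B where B: "\<And>x. norm (R x) \<le> norm x * B" "B \<ge> 0" using R.nonneg_bounded by blast
  have "R x \<bullet> x \<le> B * (norm x)\<^sup>2" for x
  proof -
    have "R x \<bullet> x \<le> norm (R x) * norm x" by (rule norm_cauchy_schwarz)
    also have "\<dots> \<le> (norm x * B) * norm x" by (intro mult_right_mono B) auto
    finally show ?thesis by (simp add: power2_eq_square mult_ac)
  qed
  then show ?thesis using B(2) that by blast
qed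

lemma quadratic_form_zero:
  assumes "R x \<bullet> x = 0"
  shows "R x = 0"
proof -
  obtain B where B: "B \<ge> 0" "\<And>x. R x \<bullet> x \<le> B * (norm x)\<^sup>2" using quadratic_form_bounded by blast
  have "(norm (R x))\<^sup>2 \<le> B * (R x \<bullet> x)"
    by (rule nonneg_operator_norm_le[of R UNIV B x]) (use R.linear_axioms sym nonneg B in auto)
  then show ?thesis using assms by simp
qed

text \<open>The supremum \<open>l\<close> of the quadratic form on the unit sphere of
  \<open>Z\<close> is attained. Along a maximizing sequence \<open>R x - l *\<^sub>R x\<close> tends
  to zero, so convergence of \<open>R x\<close> along a subsequence forces that of \<open>x\<close>
  itself.\<close>

lemma top_eigenvector:
  assumes Z: "subspace Z" "closed Z" "\<And>x. x \<in> Z \<Longrightarrow> R x \<in> Z" and ex: "x0 \<in> Z" "R x0 \<noteq> 0"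
  shows "\<exists>e\<in>Z. \<exists>l>0. norm e = 1 \<and> R e = l *\<^sub>R e \<and> (\<forall>x\<in>Z. R x \<bullet> x \<le> l * (norm x)\<^sup>2)"
proof -
  obtain B where RB: "\<And>x. R x \<bullet> x \<le> B * (norm x)\<^sup>2" using quadratic_form_bounded by blast
  define S where "S = {R x \<bullet> x | x. x \<in> Z \<and> norm x = 1}"
  have normalize: "(1 / norm x) *\<^sub>R x \<in> Z \<and> norm ((1 / norm x) *\<^sub>R x) = 1 \<and>
      R ((1 / norm x) *\<^sub>R x) \<bullet> ((1 / norm x) *\<^sub>R x) = (R x \<bullet> x) / (norm x)\<^sup>2" if "x \<in> Z" "x \<noteq> 0" for x
    using that Z(1) by (simp add: subspace_scale R.scaleR power2_eq_square)
  have bdd: "bdd_above S"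
  proof (rule bdd_aboveI[of _ B])
    fix y assume "y \<in> S"
    then obtain x where "y = R x \<bullet> x" "norm x = 1" unfolding S_def by blast
    then show "y \<le> B" using RB[of x] by simp
  qed
  have x0: "R x0 \<bullet> x0 > 0"
  proof (rule ccontr)
    assume "\<not> R x0 \<bullet> x0 > 0"
    then have "R x0 \<bullet> x0 = 0" using nonneg[of x0] by simp
    then show False using quadratic_form_zero ex by blast
  qed
  then have x0n: "x0 \<noteq> 0" by auto
  define l where "l = Sup S"
  have le_l: "R x \<bullet> x \<le> l * (norm x)\<^sup>2" if "x \<in> Z" for x
  proof (cases "x = 0")
    case False
    have "(R x \<bullet> x) / (norm x)\<^sup>2 \<in> S" unfolding S_def using normalize[OF that False] by force
    from cSup_upper[OF this bdd] False show ?thesis by (simp add: l_def field_simps)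
  qed auto
  have l: "l > 0"
  proof -
    have "l * (norm x0)\<^sup>2 > 0" using le_l[OF ex(1)] x0 by linarith
    then show ?thesis by (simp add: zero_less_mult_iff)
  qed
  have Sne: "S \<noteq> {}" unfolding S_def using normalize[OF ex(1) x0n] by blast
  have "\<exists>x. x \<in> Z \<and> norm x = 1 \<and> l - inverse (real (Suc n)) < R x \<bullet> x" for n
  proof -
    have "l - inverse (real (Suc n)) < Sup S" unfolding l_def by simp
    from less_cSupD[OF Sne this] show ?thesis unfolding S_def by blast
  qed
  then obtain x where x: "\<And>n. x n \<in> Z" "\<And>n. norm (x n)
    = 1" "\<And>n. l - inverse (real (Suc n)) < R (x n) \<bullet> x n"
    by metis
  obtain z r where r: "strict_mono (r::nat\<Rightarrow>nat)" "(\<lambda>n. R (x (r n))) \<longlonglongrightarrow> z"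
    using compact[of x] x(2) by auto
  \<comment> \<open>Expanding the square leaves \<open>l\<close> times the gap to the supremum,
    because the norm of \<open>R x\<close> is estimated by the quadratic form.\<close>
  have d: "(norm (R (x n) - l *\<^sub>R x n))\<^sup>2 \<le> l * inverse (real (Suc n))" for n
  proof -
    have 1: "(norm (R (x n)))\<^sup>2 \<le> l * (R (x n) \<bullet> x n)"
      by (rule nonneg_operator_norm_le[of R Z]) (use R.linear_axioms sym nonneg Z le_l l x in auto)
    have "(norm (R (x n) - l *\<^sub>R x n))\<^sup>2 = (norm (R (x n)))\<^sup>2 - 2 * l * (R (x n) \<bullet> x n)
      + l\<^sup>2 * (norm (x n))\<^sup>2"
      unfolding power2_norm_eq_inner by (simp add: inner_diff_left inner_diff_right inner_commute[of "x
        n" "R (x n)"] power2_eq_square algebra_simps)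
    also have "\<dots> \<le> l * (l - R (x n) \<bullet> x n)" using 1 x(2) by (simp add: algebra_simps power2_eq_square)
    also have "\<dots> \<le> l * inverse (real (Suc n))" using x(3)[of n] l by (intro mult_left_mono) auto
    finally show ?thesis .
  qed
  have "(\<lambda>n. (norm (R (x n) - l *\<^sub>R x n))\<^sup>2) \<longlonglongrightarrow> 0"
  proof (rule tendsto_sandwich[of "\<lambda>_. 0" _ _ "\<lambda>n. l * inverse (real (Suc n))"])
    show "(\<lambda>n. l * inverse (real (Suc n))) \<longlonglongrightarrow> 0"
      using tendsto_mult[OF tendsto_const[of l] LIMSEQ_inverse_real_of_nat] by simp
  qed (use d in auto)
  then have "(\<lambda>n. sqrt ((norm (R (x n) - l *\<^sub>R x n))\<^sup>2)) \<longlonglongrightarrow> sqrt 0" by (rule tendsto_real_sqrt)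
  then have "(\<lambda>n. R (x n) - l *\<^sub>R x n) \<longlonglongrightarrow> 0" by (simp add: tendsto_norm_zero_iff)
  from LIMSEQ_subseq_LIMSEQ[OF this r(1)] have "(\<lambda>n. R (x (r n)) - l *\<^sub>R x (r n)) \<longlonglongrightarrow> 0"
    by (simp add: comp_def)
  with r(2) have "(\<lambda>n. (1/l) *\<^sub>R (R (x (r n)) - (R (x (r n)) - l *\<^sub>R x (r n)))) \<longlonglongrightarrow> (1/l) *\<^sub>R (z - 0)"
    by (intro tendsto_intros)
  then have lim: "(\<lambda>n. x (r n)) \<longlonglongrightarrow> (1/l) *\<^sub>R z" using l by simp
  define e where "e = (1/l) *\<^sub>R z"
  have lim: "(\<lambda>n. x (r n)) \<longlonglongrightarrow> e" using lim by (simp add: e_def)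
  have "e \<in> Z" using closed_sequentially[OF Z(2) _ lim] x(1) by blast
  moreover have "norm e = 1"
    using tendsto_norm[OF lim] x(2) LIMSEQ_unique[OF _ tendsto_const] by fastforce
  moreover have "R e = l *\<^sub>R e"
  proof -
    have "(\<lambda>n. R (x (r n))) \<longlonglongrightarrow> R e" by (intro R.tendsto lim)
    then have "R e = z" using r(2) LIMSEQ_unique by blast
    then show ?thesis using l by (simp add: e_def)
  qed
  ultimately show ?thesis using l le_l by blast
qed

section \<open>Successive construction of the eigenvectors\<close>

text \<open>Besides being an eigenvector, \<open>e\<close> maximizes the quadratic form on the unit
  sphere of the orthogonal complement of \<open>D\<close>; this yields the ordering of the
  eigenvalues and the description of the kernel.\<close>

definition good_vector :: "'a set \<Rightarrow> 'a \<Rightarrow> bool" where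
  "good_vector D e \<longleftrightarrow> (\<forall>d\<in>D. e \<bullet> d = 0) \<and> norm e = 1 \<and>
     (\<exists>l>0. R e = l *\<^sub>R e \<and> (\<forall>x. (\<forall>d\<in>D. x \<bullet> d = 0) \<longrightarrow> R x \<bullet> x \<le> l * (norm x)\<^sup>2))"

text \<open>The default 0 is returned once \<open>R\<close> vanishes on the complement, so that an
  operator of finite rank also has an infinite sequence of eigenvectors.\<close>

definition next_vector :: "'a set \<Rightarrow> 'a" where
  "next_vector D = (if \<exists>x. (\<forall>d\<in>D. x \<bullet> d = 0) \<and> R x \<noteq> 0 then SOME e. good_vector D e else 0)"

text \<open>Each vector depends on all its predecessors, whereas primitive recursion passes on only
  the last value; hence the recursion accumulates the set of vectors.\<close>

primrec eigen_set :: "nat \<Rightarrow> 'a set" where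
  "eigen_set 0 = {}"
| "eigen_set (Suc n) = insert (next_vector (eigen_set n)) (eigen_set n)"

definition eigenvec :: "nat \<Rightarrow> 'a" where
  "eigenvec n = next_vector (eigen_set n)"

text \<open>The eigenvectors vanish beyond the rank; there the value 1 keeps all eigenvalues positive.\<close>

definition eigenval :: "nat \<Rightarrow> real" where
  "eigenval n = (if eigenvec n = 0 then 1 else R (eigenvec n) \<bullet> eigenvec n)"

lemma eigen_set_eq: "eigen_set n = eigenvec ` {..<n}"
  by (induction n) (auto simp: eigenvec_def lessThan_Suc)

definition orth_upto :: "nat \<Rightarrow> 'a set" where
  "orth_upto n = {x. \<forall>i<n. x \<bullet> eigenvec i = 0}"

lemma subspace_orth_upto: "subspace (orth_upto n)"
  by (auto simp: orth_upto_def subspace_def inner_add_left)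

lemma closed_orth_upto: "closed (orth_upto n)"
proof -
  have "orth_upto n = (\<Inter>i\<in>{..<n}. {x. x \<bullet> eigenvec i = 0})" by (auto simp: orth_upto_def)
  moreover have "closed {x. x \<bullet> eigenvec i = 0}" for i by (intro closed_Collect_eq continuous_intros)
  ultimately show ?thesis by (simp only:) (intro closed_INT ballI)
qed

lemma eigenvec_eq:
  "eigenvec n = (if \<exists>x\<in>orth_upto n. R x \<noteq> 0 then SOME e. good_vector (eigenvec ` {..<n}) e else 0)"
proof -
  have "(\<exists>x. (\<forall>d\<in>eigen_set n. x \<bullet> d = 0) \<and> R x \<noteq> 0) \<longleftrightarrow> (\<exists>x\<in>orth_upto n. R x \<noteq> 0)"
    unfolding eigen_set_eq orth_upto_def by blast
  then show ?thesis unfolding eigenvec_def[of n] next_vector_def eigen_set_eq by (simp only:)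
qed

text \<open>Both statements are proved in one induction: the complement of the earlier vectors is
  invariant under \<open>R\<close> only because these are already known to be eigenvectors.\<close>

lemma eigenvec_cases:
  "(eigenvec n = 0 \<and> (\<forall>x\<in>orth_upto n. R x = 0)) \<or> good_vector (eigenvec ` {..<n}) (eigenvec n)"
  and eigenvec_eigen: "\<exists>l. R (eigenvec n) = l *\<^sub>R eigenvec n"
proof (induction n rule: less_induct)
  case (less n)
  {
    case 1
    show ?case
    proof (cases "\<exists>x\<in>orth_upto n. R x \<noteq> 0")
      case False
      then have "eigenvec n = 0" by (simp only: eigenvec_eq if_False)
      with False show ?thesis by blast
    next
      case True
      then have ev: "eigenvec n = (SOME e. good_vector (eigenvec ` {..<n}) e)"
        by (simp only: eigenvec_eq[of n] if_True)
      have inv: "R x \<in> orth_upto n" if "x \<in> orth_upto n" for x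
        unfolding orth_upto_def
      proof safe
        fix i assume i: "i < n"
        then obtain l where "R (eigenvec i) = l *\<^sub>R eigenvec i" using less(2) by blast
        with that i show "R x \<bullet> eigenvec i = 0" by (simp add: sym orth_upto_def)
      qed
      from True obtain x0 where "x0 \<in> orth_upto n" "R x0 \<noteq> 0" by blast
      from top_eigenvector[OF subspace_orth_upto closed_orth_upto inv this]
      obtain e l where e: "e \<in> orth_upto n" "l > 0" "norm e = 1" "R e = l *\<^sub>R e"
        "\<And>x. x \<in> orth_upto n \<Longrightarrow> R x \<bullet> x \<le> l * (norm x)\<^sup>2" by blast
      have "good_vector (eigenvec ` {..<n}) e"
        unfolding good_vector_def using e by (auto simp: orth_upto_def)
      from someI[of "good_vector (eigenvec ` {..<n})", OF this] ev show ?thesis by simp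
    qed
  } note 1 = this
  {
    case 2
    show ?case
    proof (cases "eigenvec n = 0")
      case True
      then show ?thesis by (simp add: R.zero)
    next
      case False
      with 1 have "good_vector (eigenvec ` {..<n}) (eigenvec n)" by blast
      then show ?thesis unfolding good_vector_def by blast
    qed
  }
qed

lemma eigenvec_zero: "eigenvec n = 0 \<Longrightarrow> x \<in> orth_upto n \<Longrightarrow> R x = 0"
  using eigenvec_cases[of n] by (auto simp: good_vector_def)

lemma eigenvec_good:
  assumes "eigenvec n \<noteq> 0"
  shows "eigenvec n \<in> orth_upto n" "norm (eigenvec n) = 1" "eigenval n > 0"
    "x \<in> orth_upto n \<Longrightarrow> R x \<bullet> x \<le> eigenval n * (norm x)\<^sup>2"
proof -
  have g: "good_vector (eigenvec ` {..<n}) (eigenvec n)" using eigenvec_cases[of n] assms by blast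
  then obtain l where l: "l > 0" "R (eigenvec n) = l *\<^sub>R eigenvec n"
     "\<And>x. x \<in> orth_upto n \<Longrightarrow> R x \<bullet> x \<le> l * (norm x)\<^sup>2" "norm (eigenvec n) = 1"
    by (auto simp: good_vector_def orth_upto_def)
  have "eigenval n = l" using l assms by (simp add: eigenval_def power2_norm_eq_inner[symmetric])
  with l g show "eigenvec n \<in> orth_upto n" "norm (eigenvec n) = 1" "eigenval n > 0"
    "x \<in> orth_upto n \<Longrightarrow> R x \<bullet> x \<le> eigenval n * (norm x)\<^sup>2"
    by (auto simp: good_vector_def orth_upto_def)
qed

lemma eigenval_pos: "eigenval n > 0"
  using eigenvec_good(3)[of n] by (cases "eigenvec n = 0") (auto simp: eigenval_def)

lemma R_eigenvec: "R (eigenvec n) = eigenval n *\<^sub>R eigenvec n"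
proof (cases "eigenvec n = 0")
  case False
  obtain l where "R (eigenvec n) = l *\<^sub>R eigenvec n" using eigenvec_eigen by blast
  with eigenvec_good(2)[OF False] False show ?thesis
    by (simp add: eigenval_def power2_norm_eq_inner[symmetric])
qed (simp add: R.zero)

lemma orth_upto_mono: "m \<le> n \<Longrightarrow> orth_upto n \<subseteq> orth_upto m"
  by (auto simp: orth_upto_def)

lemma eigenvec_zero_mono:
  assumes "eigenvec m = 0" "m \<le> n"
  shows "eigenvec n = 0"
proof (rule ccontr)
  assume n: "eigenvec n \<noteq> 0"
  then have "eigenvec n \<in> orth_upto m" using eigenvec_good(1) orth_upto_mono[OF assms(2)] by blast
  then have "R (eigenvec n) = 0" by (rule eigenvec_zero[OF assms(1)])
  then show False using R_eigenvec[of n] eigenval_pos[of n] n by simp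
qed

lemma ons_eigenvec: "ons eigenvec"
proof -
  have lt: "eigenvec j \<bullet> eigenvec i = 0" if "i < j" for i j
    using eigenvec_good(1)[of j] that by (cases "eigenvec j = 0") (auto simp: orth_upto_def)
  have "eigenvec i \<bullet> eigenvec j = 0" if "i \<noteq> j" for i j
    using lt[of i j] lt[of j i] that by (metis inner_commute linorder_neqE_nat)
  moreover have "eigenvec i \<bullet> eigenvec i = 1" if "eigenvec i \<noteq> 0" for i
    using eigenvec_good(2)[OF that] by (simp add: power2_norm_eq_inner[symmetric])
  ultimately show ?thesis unfolding ons_def by auto
qed

lemma eigenval_decreasing:
  assumes "i \<le> j" "eigenvec j \<noteq> 0"
  shows "eigenval j \<le> eigenval i"
proof -
  have i: "eigenvec i \<noteq> 0" using eigenvec_zero_mono assms by blast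
  have "eigenvec j \<in> orth_upto i" using eigenvec_good(1)[OF assms(2)] orth_upto_mono[OF assms(1)]
    by blast
  from eigenvec_good(4)[OF i this] assms(2) eigenvec_good(2)[OF assms(2)] show ?thesis
    by (simp add: eigenval_def)
qed

text \<open>If all eigenvalues were at least \<delta>, the images of the orthonormal eigenvectors
  would be pairwise at least \<delta> apart, since the squared distance is the sum of two squared
  eigenvalues. Compactness excludes this.\<close>

lemma eigenval_tendsto:
  assumes "\<And>i. eigenvec i \<noteq> 0"
  shows "\<And>\<delta>. \<delta> > 0 \<Longrightarrow> \<exists>n. eigenval n < \<delta>"
proof (rule ccontr)
  fix \<delta> :: real assume d: "\<delta> > 0" "\<nexists>n. eigenval n < \<delta>"
  then have ge: "eigenval n \<ge> \<delta>" for n by (meson not_less)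
  obtain l r where r: "strict_mono (r::nat\<Rightarrow>nat)" "(\<lambda>n. R (eigenvec (r n))) \<longlonglongrightarrow> l"
    using compact[of eigenvec] eigenvec_good(2)[OF assms] by auto
  from LIMSEQ_imp_Cauchy[OF r(2)] obtain M where M: "\<And>m n. m \<ge> M \<Longrightarrow> n \<ge> M
    \<Longrightarrow> dist (R (eigenvec (r m))) (R (eigenvec (r n))) < \<delta>"
    using d(1) unfolding Cauchy_def by blast
  define a b where "a = r M" and "b = r (Suc M)"
  have ab: "a \<noteq> b" using r(1) by (auto simp: a_def b_def strict_mono_eq)
  have "(norm (R (eigenvec a) - R (eigenvec b)))\<^sup>2 = (eigenval a)\<^sup>2 + (eigenval b)\<^sup>2"
    unfolding R_eigenvec power2_norm_eq_inner
    using ab assms by (simp add: inner_diff_left inner_diff_right ons_inner[OF ons_eigenvec]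
      power2_eq_square)
  moreover have "norm (R (eigenvec a) - R (eigenvec b)) < \<delta>"
    using M[of M "Suc M"] by (simp add: a_def b_def dist_norm)
  then have "(norm (R (eigenvec a) - R (eigenvec b)))\<^sup>2 < \<delta>\<^sup>2" by (intro power_strict_mono) auto
  moreover have "\<delta>\<^sup>2 \<le> (eigenval a)\<^sup>2" using ge[of a] d(1) by (intro power_mono) auto
  ultimately show False by (smt (verit) zero_le_power2)
qed

text \<open>The Rayleigh quotient of such an \<open>x\<close> is bounded by every eigenvalue, and
  these become arbitrarily small; if the sequence of eigenvectors ends, the terminating condition
  gives the claim.\<close>

lemma orthogonal_eigenvecs_kernel:
  assumes x: "\<And>i. x \<bullet> eigenvec i = 0"
  shows "R x = 0"
proof (cases "\<exists>n. eigenvec n = 0")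
  case True
  then show ?thesis using eigenvec_zero x by (auto simp: orth_upto_def)
next
  case False
  have "R x \<bullet> x \<le> 0"
  proof (rule ccontr)
    assume a: "\<not> R x \<bullet> x \<le> 0"
    then have xn: "x \<noteq> 0" by auto
    then have "R x \<bullet> x / (norm x)\<^sup>2 > 0" using a by auto
    then obtain n where n: "eigenval n < R x \<bullet> x / (norm x)\<^sup>2" using eigenval_tendsto False by blast
    have "R x \<bullet> x \<le> eigenval n * (norm x)\<^sup>2"
      using eigenvec_good(4)[of n x] False x by (auto simp: orth_upto_def)
    with n xn show False by (simp add: field_simps)
  qed
  then show ?thesis using quadratic_form_zero nonneg[of x] by simp
qed

text \<open>Only finitely many indices \<open>I\<close> share the eigenvalue \<mu>. Removing their
  components leaves a vector orthogonal to all \<open>eigenvec i\<close>, hence in the kernel, yet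
  still satisfying the eigenvalue equation for a positive \<mu>.\<close>

lemma eigenvector_in_span:
  assumes \<mu>: "\<mu> > 0" and w: "R w = \<mu> *\<^sub>R w"
  shows "w \<in> span {eigenvec i | i. eigenvec i \<noteq> 0 \<and> eigenval i = \<mu>}"
proof -
  define I where "I = {i. eigenvec i \<noteq> 0 \<and> eigenval i = \<mu>}"
  have "finite I"
  proof (cases "\<exists>n. eigenvec n = 0")
    case True
    then obtain n where "eigenvec n = 0" by blast
    then have "I \<subseteq> {..<n}" unfolding I_def using eigenvec_zero_mono
      by (metis (mono_tags, lifting) lessThan_iff mem_Collect_eq not_le subsetI)
    then show ?thesis using finite_subset by blast
  next
    case False
    then obtain n where n: "eigenval n < \<mu>" using eigenval_tendsto \<mu> by blast
    have "I \<subseteq> {..<n}"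
    proof
      fix i assume i: "i \<in> I"
      show "i \<in> {..<n}"
      proof (rule ccontr)
        assume "i \<notin> {..<n}"
        then have "eigenval i \<le> eigenval n" using False by (intro eigenval_decreasing) auto
        with n i show False by (simp add: I_def)
      qed
    qed
    then show ?thesis using finite_subset by blast
  qed
  have z: "w \<bullet> eigenvec i = 0" if "i \<notin> I" for i
  proof (cases "eigenvec i = 0")
    case False
    have "\<mu> * (w \<bullet> eigenvec i) = R w \<bullet> eigenvec i" by (simp add: w)
    also have "\<dots> = eigenval i * (w \<bullet> eigenvec i)" by (simp add: sym R_eigenvec)
    finally show ?thesis using that False by (auto simp: I_def)
  qed simp
  define w' where "w' = w - (\<Sum>i\<in>I. (w \<bullet> eigenvec i) *\<^sub>R eigenvec i)"
  have "w' \<bullet> eigenvec k = 0" for k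
  proof -
    have "w' \<bullet> eigenvec k = w \<bullet> eigenvec k - (\<Sum>i\<in>I. if i
      = k then (w \<bullet> eigenvec k) * (eigenvec k \<bullet> eigenvec k) else 0)"
      unfolding w'_def inner_diff_left inner_sum_left
      by (intro arg_cong2[where f = "(-)"] sum.cong refl) (auto simp: ons_inner[OF ons_eigenvec])
    also have "\<dots> = 0"
      using \<open>finite I\<close> z[of k] by (cases "k \<in> I") (auto simp: I_def ons_inner[OF ons_eigenvec])
    finally show ?thesis .
  qed
  then have "R w' = 0" by (rule orthogonal_eigenvecs_kernel)
  moreover have "R w' = \<mu> *\<^sub>R w'"
    unfolding w'_def by (simp add: R.diff R.sum R.scaleR R_eigenvec w scaleR_diff_right
      scaleR_sum_right)
      (intro sum.cong refl, simp add: I_def mult.commute)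
  ultimately have "w' = 0" using \<mu> by simp
  then have "w = (\<Sum>i\<in>I. (w \<bullet> eigenvec i) *\<^sub>R eigenvec i)" by (simp add: w'_def)
  moreover have "\<dots> \<in> span {eigenvec i | i. eigenvec i \<noteq> 0 \<and> eigenval i = \<mu>}"
    by (intro span_sum span_scale span_base) (auto simp: I_def)
  ultimately show ?thesis by simp
qed

text \<open>The component \<open>y\<close> of \<open>x\<close> orthogonal to \<open>X\<close> lies
  in the kernel, so it is orthogonal to \<open>x\<close> and thus to itself. \<open>X\<close> is
  arbitrary in order to cover the eigensystem that a run of the algorithm happens to choose, not
  just \<open>eigenvec\<close>.\<close>

lemma orthogonal_closed_span_kernel:
  assumes X: "subspace X" "closed X" and eig: "\<And>\<mu> w. \<mu> > 0 \<Longrightarrow> R w = \<mu> *\<^sub>R w \<Longrightarrow> w \<in> X"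
    and x: "\<And>z. R z = 0 \<Longrightarrow> x \<bullet> z = 0"
  shows "x \<in> X"
proof -
  define y where "y = x - orth_proj X x"
  have yX: "y \<bullet> w = 0" if "w \<in> X" for w
    using that by (simp add: y_def inner_diff_left orth_proj_inner[OF X])
  have "y \<bullet> eigenvec i = 0" for i using yX eig[OF eigenval_pos R_eigenvec] by blast
  then have "R y = 0" by (rule orthogonal_eigenvecs_kernel)
  then have "x \<bullet> y = 0" by (rule x)
  moreover have "orth_proj X x \<bullet> y = 0" using yX orth_proj_mem[OF X] by (metis inner_commute)
  ultimately have "y \<bullet> y = 0" by (simp add: y_def inner_diff_left)
  then show ?thesis using orth_proj_mem[OF X, of x] by (simp add: y_def)
qed

definition rank :: enat where
  "rank = (if \<exists>n. eigenvec n = 0 then enat (LEAST n. eigenvec n = 0) else \<infinity>)"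

lemma less_rank_iff: "enat i < rank \<longleftrightarrow> eigenvec i \<noteq> 0"
proof (cases "\<exists>n. eigenvec n = 0")
  case True
  then have "eigenvec (LEAST n. eigenvec n = 0) = 0" by (rule LeastI_ex)
  then have "eigenvec i \<noteq> 0 \<longleftrightarrow> i < (LEAST n. eigenvec n = 0)"
    using eigenvec_zero_mono[of "LEAST n. eigenvec n = 0" i] not_less_Least[of i "\<lambda>n. eigenvec n = 0"]
    by linarith
  with True show ?thesis by (simp add: rank_def)
qed (simp add: rank_def)

lemma independent_eigenvecs:
  assumes "\<And>i. i < n \<Longrightarrow> eigenvec i \<noteq> 0"
  shows "independent (eigenvec ` {..<n})" "card (eigenvec ` {..<n}) = n"
proof -
  have "pairwise orthogonal (eigenvec ` {..<n})"
    unfolding pairwise_def orthogonal_def by (auto simp: ons_inner[OF ons_eigenvec])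
  then show "independent (eigenvec ` {..<n})"
    by (rule pairwise_orthogonal_independent) (use assms in force)
  have "inj_on eigenvec {..<n}"
  proof (rule inj_onI)
    fix i k assume ik: "i \<in> {..<n}" "k \<in> {..<n}" "eigenvec i = eigenvec k"
    then have "eigenvec i \<bullet> eigenvec k = 1" using assms[of i] ons_inner[OF ons_eigenvec, of i i] by simp
    then show "i = k" using ons_inner[OF ons_eigenvec, of i k] by (metis zero_neq_one)
  qed
  then show "card (eigenvec ` {..<n}) = n" by (simp add: card_image)
qed

lemma eigenvec_in_range: "eigenvec i \<in> range R"
proof -
  have "eigenvec i = R ((1 / eigenval i) *\<^sub>R eigenvec i)"
    using eigenval_pos[of i] by (simp add: R.scaleR R_eigenvec)
  then show ?thesis by blast
qed

text \<open>This connects the dimension in the definition of the maximal POD rank with the number of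
  eigenvectors constructed. With infinitely many of them, arbitrarily large independent families
  rule out a finite spanning set.\<close>

lemma edim_range: "edim (closure (range R)) = rank"
proof (cases "\<exists>n. eigenvec n = 0")
  case True
  define n where "n = (LEAST n. eigenvec n = 0)"
  have n: "eigenvec n = 0" unfolding n_def using True by (rule LeastI_ex)
  have lt: "eigenvec i \<noteq> 0" if "i < n" for i using not_less_Least that unfolding n_def by blast
  \<comment> \<open>The span of finitely many of the vectors is already closed, because the Fourier
    sums become constant once the vectors vanish.\<close>
  have cl: "h \<in> span (eigenvec ` {..<n})" if h: "h \<in> closure (span (range eigenvec))" for h
  proof -
    have "(\<lambda>m. fourier_sum eigenvec m h) \<longlonglongrightarrow> h" by (rule fourier_tendsto[OF ons_eigenvec h])
    moreover have "fourier_sum eigenvec m h = fourier_sum eigenvec n h" if "m \<ge> n" for m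
      unfolding fourier_sum_def
      by (rule sum.mono_neutral_right) (use that n eigenvec_zero_mono in \<open>auto simp: not_less\<close>)
    then have "(\<lambda>m. fourier_sum eigenvec m h) \<longlonglongrightarrow> fourier_sum eigenvec n h"
      by (intro tendsto_eventually eventually_sequentiallyI[of n])
    ultimately have "h = fourier_sum eigenvec n h" by (rule LIMSEQ_unique)
    moreover have "fourier_sum eigenvec n h \<in> span (eigenvec ` {..<n})"
      unfolding fourier_sum_def by (intro span_sum span_scale span_base) auto
    ultimately show ?thesis by simp
  qed
  have "range R \<subseteq> closure (span (range eigenvec))"
  proof
    fix y assume "y \<in> range R"
    then obtain x where y: "y = R x" by blast
    show "y \<in> closure (span (range eigenvec))"
    proof (rule orthogonal_closed_span_kernel)
      show "subspace (closure (span (range eigenvec)))" by (intro subspace_closure subspace_span)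
      fix \<mu> w assume "\<mu> > 0" "R w = \<mu> *\<^sub>R w"
      from eigenvector_in_span[OF this] show "w \<in> closure (span (range eigenvec))"
        using span_mono[of "{eigenvec i |i. eigenvec i \<noteq> 0 \<and> eigenval i
          = \<mu>}" "range eigenvec"] closure_subset by blast
    qed (auto simp: y sym)
  qed
  then have "closure (range R) \<subseteq> closure (span (range eigenvec))" by (simp add: closure_minimal)
  then have 1: "closure (range R) \<subseteq> span (eigenvec ` {..<n})" using cl by blast
  have "subspace (closure (range R))"
    by (intro subspace_closure linear_subspace_image[OF R.linear_axioms] subspace_UNIV)
  then have 2: "span (eigenvec ` {..<n}) \<subseteq> closure (range R)"
    by (intro span_minimal) (use eigenvec_in_range closure_subset in blast)
  have "dim (span (eigenvec ` {..<n})) = n"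
    using dim_span_eq_card_independent[OF independent_eigenvecs(1)[of n]] independent_eigenvecs(2)[of n]
      lt by simp
  with 1 2 have "edim (closure (range R)) = enat n" unfolding edim_def
    by (metis finite_imageI finite_lessThan subset_antisym)
  then show ?thesis using True by (simp add: rank_def n_def)
next
  case False
  have "\<not> (\<exists>D. finite D \<and> closure (range R) \<subseteq> span D)"
  proof
    assume "\<exists>D. finite D \<and> closure (range R) \<subseteq> span D"
    then obtain D where D: "finite D" "closure (range R) \<subseteq> span D" by blast
    have "eigenvec ` {..<Suc (card D)} \<subseteq> span D"
      using D(2) closure_subset[of "range R"] eigenvec_in_range by blast
    from independent_span_bound[OF D(1) independent_eigenvecs(1) this] False
    have "card (eigenvec ` {..<Suc (card D)}) \<le> card D" by blast
    then show False using independent_eigenvecs(2)[of "Suc (card D)"] False by simp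
  qed
  then show ?thesis using False by (simp add: edim_def rank_def)
qed

end

text \<open>The operator \<open>K\<close> is the compression to \<open>X\<close> of the operator
  that represents the inner product of \<open>H\<close>. It is compact because \<open>j\<close> is,
  and its kernel is the orthogonal complement of \<open>X\<close> because \<open>j\<close> is
  injective. Its eigenvectors are orthogonal in both spaces, with \<mu> as the ratio of the two
  inner products.\<close>

lemma adapted_basis:
  fixes j :: "'v::{real_inner, banach} \<Rightarrow>\<^sub>L 'h::{real_inner, banach}"
  assumes inj: "inj (blinfun_apply j)" and comp: "compact (closure (blinfun_apply j ` cball 0 1))"
    and X: "subspace X" "closed X"
  shows "\<exists>e \<mu>. ons e \<and> (\<forall>i. e i \<in> X \<and> \<mu> i > 0 \<and> (\<forall>w\<in>X. j (e i) \<bullet> j w = \<mu> i * (e i \<bullet> w))) \<and>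
     (\<forall>x\<in>X. x \<in> closure (span (range e)))"
proof -
  let ?P = "orth_proj X"
  define K where "K x = ?P (blinfun_adjoint j (j (?P x)))" for x
  note Pb = orth_proj_bounded_linear[OF X]
  have Kin: "K x \<bullet> y = j (?P x) \<bullet> j (?P y)" for x y
    unfolding K_def by (simp add: orth_proj_sym[OF X] blinfun_adjoint_inner)
  have Kb: "bounded_linear K"
    unfolding K_def[abs_def]
    by (intro bounded_linear_compose[OF Pb] bounded_linear_compose[OF blinfun.bounded_linear_right] Pb)
  have Kc: "\<exists>l r. strict_mono (r::nat\<Rightarrow>nat) \<and> (\<lambda>n. K (x (r n))) \<longlonglongrightarrow> l"
    if x: "\<And>n. norm (x n) \<le> 1" for x :: "nat \<Rightarrow> 'v"
  proof -
    have "j (?P (x n)) \<in> closure (blinfun_apply j ` cball 0 1)" for n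
    proof -
      have "norm (?P (x n)) \<le> 1" using orth_proj_norm_le[OF X, of "x n"] x[of n] by linarith
      then show ?thesis using closure_subset by force
    qed
    then obtain l r where lr: "strict_mono (r::nat\<Rightarrow>nat)" "((\<lambda>n. j (?P (x n))) \<circ> r) \<longlonglongrightarrow> l"
      using comp unfolding compact_def by metis
    have "(\<lambda>n. K (x (r n))) \<longlonglongrightarrow> ?P (blinfun_adjoint j l)"
      unfolding K_def using lr(2)
      by (intro bounded_linear.tendsto[OF Pb] blinfun.tendsto tendsto_const) (simp add: comp_def)
    then show ?thesis using lr(1) by blast
  qed
  interpret compact_nonneg_operator K
  proof (rule compact_nonneg_operator.intro[OF Kb _ _ Kc])
    show "K x \<bullet> y = x \<bullet> K y" for x y by (metis Kin inner_commute)
    show "0 \<le> K x \<bullet> x" for x by (simp add: Kin)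
  qed
  have eX: "eigenvec i \<in> X" for i
    using eigenvec_in_range[of i] orth_proj_mem[OF X] by (auto simp: K_def)
  have "j (eigenvec i) \<bullet> j w = eigenval i * (eigenvec i \<bullet> w)" if "w \<in> X" for i w
    using Kin[of "eigenvec i" w] that eX by (simp add: R_eigenvec orth_proj_id[OF X])
  moreover have "x \<in> closure (span (range eigenvec))" if x: "x \<in> X" for x
  proof (rule orthogonal_closed_span_kernel)
    show "subspace (closure (span (range eigenvec)))" by (intro subspace_closure subspace_span)
    fix \<mu> w assume "\<mu> > 0" "K w = \<mu> *\<^sub>R w"
    from eigenvector_in_span[OF this] show "w \<in> closure (span (range eigenvec))"
      using span_mono[of "{eigenvec i |i. eigenvec i \<noteq> 0 \<and> eigenval i
        = \<mu>}" "range eigenvec"] closure_subset by blast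
  next
    fix z assume "K z = 0"
    then have "j (?P z) = 0" using Kin[of z z] by simp
    then have "?P z = 0" using inj by (metis blinfun.zero_right injD)
    then show "x \<bullet> z = 0" using orth_proj_inner[OF X x, of z] by (simp add: inner_commute)
  qed auto
  ultimately show ?thesis using ons_eigenvec eX eigenval_pos by blast
qed

section \<open>Functions with a weak time derivative\<close>

text \<open>A value outside the closed set would persist on a whole interval, and an interval is not
  null.\<close>

lemma AE_continuous_closed:
  fixes c :: "real \<Rightarrow> 'a::metric_space"
  assumes c: "continuous_on {0..T} c" and ae: "AE t in time_measure T. c t \<in> C" and C: "closed C"
    and T: "0 < T" and t: "t \<in> {0..T}"
  shows "c t \<in> C"
proof (rule ccontr)
  assume "c t \<notin> C"
  then obtain e where e: "e > 0" "ball (c t) e \<subseteq> - C"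
    using C open_Compl[OF C] unfolding open_contains_ball by blast
  obtain d where d: "d > 0" "\<And>s. s \<in> {0..T} \<Longrightarrow> dist s t < d \<Longrightarrow> dist (c s) (c t) < e"
    using c t e(1) unfolding continuous_on_iff by blast
  define a b where "a = max 0 (t - d)" and "b = min T (t + d)"
  have "0 \<le> a" "a < b" "b \<le> T" using t d(1) T by (auto simp: a_def b_def)
  from AE_time_interval[OF ae this] obtain s where s: "s \<in> {a<..<b}" "c s \<in> C" by blast
  then have "dist (c s) (c t) < e" by (intro d(2)) (auto simp: a_def b_def dist_real_def)
  then show False using e(2) s(2) by (auto simp: dist_commute)
qed

section \<open>Reversal of time\<close>

text \<open>Reversing time turns the adjoint equation, which has a terminal condition, into an
  evolution equation with an initial condition; the transfer rests on this invariance of the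
  measure.\<close>

lemma distr_reflect: "distr (time_measure T) (time_measure T) (\<lambda>t. T - t) = time_measure T"
  and reflect_measurable: "(\<lambda>t. T - t) \<in> measurable (time_measure T) (time_measure T)"
proof -
  have m: "(\<lambda>t. T - t) \<in> measurable lebesgue lebesgue"
    using lebesgue_affine_measurable[of "\<lambda>_. -1::real" T] by simp
  have L: "distr lebesgue lebesgue (\<lambda>t. T - t) = lebesgue"
    using lebesgue_real_affine[of "-1" T] by (simp add: density_1)
  show mm: "(\<lambda>t. T - t) \<in> measurable (time_measure T) (time_measure T)"
    by (rule measurable_restrict_space3[OF m]) auto
  show "distr (time_measure T) (time_measure T) (\<lambda>t. T - t) = time_measure T"
  proof (rule measure_eqI)
    fix A assume "A \<in> sets (distr (time_measure T) (time_measure T) (\<lambda>t. T - t))"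
    then have A: "A \<in> sets (time_measure T)" by simp
    then have A': "A \<in> sets lebesgue" "A \<subseteq> {0<..<T}" by (auto simp: sets_restrict_space_iff)
    have eq: "(\<lambda>t. T - t) -` A \<inter> {0<..<T} = (\<lambda>t. T - t) -` A" using A'(2) by fastforce
    have "emeasure (distr (time_measure T) (time_measure T) (\<lambda>t. T - t)) A
       = emeasure (time_measure T) ((\<lambda>t. T - t) -` A \<inter> {0<..<T})"
      using emeasure_distr[OF mm A] by (simp add: space_restrict_space)
    also have "\<dots> = emeasure lebesgue ((\<lambda>t. T - t) -` A)"
      unfolding eq using eq by (subst emeasure_restrict_space) auto
    also have "\<dots> = emeasure (distr lebesgue lebesgue (\<lambda>t. T - t)) A"
      using emeasure_distr[OF m A'(1)] by simp
    also have "\<dots> = emeasure (time_measure T) A"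
      unfolding L using A' by (subst emeasure_restrict_space) auto
    finally show "emeasure (distr (time_measure T) (time_measure T) (\<lambda>t. T - t)) A
      = emeasure (time_measure T) A" .
  qed simp
qed

lemma integral_reflect:
  fixes f :: "real \<Rightarrow> 'a::{banach, second_countable_topology}"
  assumes "f \<in> borel_measurable (time_measure T)"
  shows "(\<integral>t. f (T - t) \<partial>time_measure T) = (\<integral>t. f t \<partial>time_measure T)"
  using integral_distr[OF reflect_measurable assms] by (simp add: distr_reflect)

lemma measurable_reflect:
  "f \<in> borel_measurable (time_measure T) \<Longrightarrow> (\<lambda>t. f (T - t)) \<in> borel_measurable (time_measure T)"
  using measurable_compose[OF reflect_measurable] .

lemma integrable_reflect:
  fixes f :: "real \<Rightarrow> 'a::{banach, second_countable_topology}"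
  assumes "integrable (time_measure T) f"
  shows "integrable (time_measure T) (\<lambda>t. f (T - t))"
  using integrable_distr[OF reflect_measurable[of T], of f] assms by (simp add: distr_reflect)

lemma AE_reflect:
  assumes "AE t in time_measure T. P t"
  shows "AE t in time_measure T. P (T - t)"
proof -
  obtain N where N: "{t \<in> space (time_measure T). \<not> P t} \<subseteq> N" "emeasure (time_measure T) N
    = 0" "N \<in> sets (time_measure T)"
    using assms by (auto elim: AE_E)
  let ?N = "(\<lambda>t. T - t) -` N \<inter> space (time_measure T)"
  have "emeasure (time_measure T) ?N = emeasure (distr (time_measure T) (time_measure T) (\<lambda>t. T - t)) N"
    by (rule emeasure_distr[OF reflect_measurable N(3), symmetric])
  then have "emeasure (time_measure T) ?N = 0" using N(2) by (simp add: distr_reflect)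
  moreover have "?N \<in> sets (time_measure T)" by (rule measurable_sets[OF reflect_measurable N(3)])
  moreover have "{t \<in> space (time_measure T). \<not> P (T - t)} \<subseteq> ?N"
  proof
    fix t assume "t \<in> {t \<in> space (time_measure T). \<not> P (T - t)}"
    then have t: "t \<in> space (time_measure T)" "\<not> P (T - t)" by auto
    then have "T - t \<in> space (time_measure T)" by (auto simp: space_restrict_space)
    with t N(1) show "t \<in> ?N" by auto
  qed
  ultimately show ?thesis by (intro AE_I)
qed

lemma L2_reflect: "f \<in> L2 T \<Longrightarrow> (\<lambda>t. f (T - t)) \<in> L2 T"
  using measurable_reflect[of f T] integrable_reflect[of T "\<lambda>t. (norm (f t))\<^sup>2"] by (simp add: L2_def)

lemma L2_norm_reflect:
  fixes f :: "real \<Rightarrow> 'a::{real_normed_vector}"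
  assumes "f \<in> L2 T" shows "L2_norm T (\<lambda>t. f (T - t)) = L2_norm T f"
  unfolding L2_norm_def
  by (subst integral_reflect[of "\<lambda>t. (norm (f t))\<^sup>2"]) (use L2_integrable[OF assms] in auto)

lemma L2_into_reflect: "f \<in> L2_into T X \<Longrightarrow> (\<lambda>t. f (T - t)) \<in> L2_into T X"
  using L2_reflect AE_reflect[of "\<lambda>t. f t \<in> X" T] by (auto simp: L2_into_def)

lemma prim_reflect:
  assumes g: "integrable (time_measure T) g" and t: "t \<in> {0..T}"
  shows "prim T (\<lambda>s. g (T - s)) t = prim T g T - prim T g (T - t)"
proof -
  have i: "integrable (time_measure T) (\<lambda>s. indicator {a<..<b} s * g s)" for a b
    by (rule integrable_indicator_mult[OF g]) auto
  have "prim T g T = (\<integral>s. indicator {0<..<T - t} s * g s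
    + indicator {T - t<..<T} s * g s \<partial>time_measure T)"
    unfolding prim_T
  proof (rule integral_cong_AE)
    show "g \<in> borel_measurable (time_measure T)" using g by auto
    show "(\<lambda>s. indicator {0<..<T - t} s * g s + indicator {T - t<..<T} s * g s) \<in> borel_measurable
      (time_measure T)"
      using borel_measurable_integrable[OF i[of 0 "T - t"]] borel_measurable_integrable[OF i[of "T - t"
        T]]
      by (rule borel_measurable_add)
    show "AE s in time_measure T. g s = indicator {0<..<T - t} s * g s + indicator {T - t<..<T} s * g s"
      using AE_time_neq[of "T - t" T] AE_time[of T]
        by eventually_elim (use t in \<open>auto simp: indicator_def\<close>)
  qed
  also have "\<dots> = prim T g (T - t) + (\<integral>s. indicator {T - t<..<T} s * g s \<partial>time_measure T)"
    using i by (simp add: prim_def)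
  also have "(\<integral>s. indicator {T - t<..<T} s * g s \<partial>time_measure T)
    = (\<integral>s. indicator {T - t<..<T} (T - s) * g (T - s) \<partial>time_measure T)"
    by (rule integral_reflect[symmetric]) (rule borel_measurable_integrable[OF i])
  also have "\<dots> = prim T (\<lambda>s. g (T - s)) t"
    unfolding prim_def by (rule Bochner_Integration.integral_cong) (auto simp: indicator_def)
  finally show ?thesis by simp
qed

locale gelfand =
  fixes T :: real and j :: "'v::{real_inner, banach, second_countable_topology} \<Rightarrow>\<^sub>L 'h::{real_inner,
    banach, second_countable_topology}"
  assumes T: "0 < T" and inj_j: "inj (blinfun_apply j)"
    and compact_j: "compact (closure (blinfun_apply j ` cball 0 1))"
begin

lemma T0: "0 \<le> T" using T by simp

text \<open>
  \<open>g\<close> represents, through the Riesz isomorphism of \<open>V\<close>, the derivative of \<open>y\<close> as a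
  functional on \<open>X\<close>, and \<open>c\<close> is the continuous representative of \<open>y\<close> with values in \<open>H\<close>.
\<close>

definition wpair :: "'v set \<Rightarrow> (real \<Rightarrow> 'v) \<Rightarrow> (real \<Rightarrow> 'v) \<Rightarrow> (real \<Rightarrow> 'h) \<Rightarrow> bool" where
  "wpair X y g c \<longleftrightarrow> y \<in> L2_into T X \<and> g \<in> L2 T \<and> continuous_on {0..T} c \<and>
     (AE t in time_measure T. c t = j (y t)) \<and>
     (\<forall>w\<in>X. \<forall>t\<in>{0..T}. c t \<bullet> j w = c 0 \<bullet> j w + prim T (\<lambda>s. g s \<bullet> w) t)"

lemma wpairD:
  assumes "wpair X y g c"
  shows "y \<in> L2_into T X" "y \<in> L2 T" "AE t in time_measure T. y t \<in> X" "g \<in> L2 T" "continuous_on {0..T}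
    c"
    "AE t in time_measure T. c t = j (y t)"
    "\<And>w t. w \<in> X \<Longrightarrow> t \<in> {0..T} \<Longrightarrow> c t \<bullet> j w = c 0 \<bullet> j w + prim T (\<lambda>s. g s \<bullet> w) t"
  using assms unfolding wpair_def L2_into_def by blast+

lemma inner_const_integrable: "g \<in> L2 T \<Longrightarrow> integrable (time_measure T) (\<lambda>s. g s \<bullet>
  (w::'a::{real_inner,second_countable_topology}))"
  by (rule L2_inner_integrable) auto

lemma L2_into_add:
  assumes "subspace X" "y \<in> L2_into T X" "z \<in> L2_into T (X :: 'v set)"
  shows "(\<lambda>t. y t + z t) \<in> L2_into T X"
proof -
  have "AE t in time_measure T. y t \<in> X" "AE t in time_measure T. z t \<in> X" using assms L2_into_D
    by blast+
  then have "AE t in time_measure T. y t + z t \<in> X" by eventually_elim (rule subspace_add[OF assms(1)])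
  then show ?thesis using assms by (auto simp: L2_into_def)
qed

lemma L2_into_scaleR:
  assumes "subspace X" "y \<in> L2_into T (X :: 'v set)"
  shows "(\<lambda>t. r *\<^sub>R y t) \<in> L2_into T X"
proof -
  have "AE t in time_measure T. y t \<in> X" using assms L2_into_D by blast
  then have "AE t in time_measure T. r *\<^sub>R y t \<in> X"
    by eventually_elim (rule subspace_scale[OF assms(1)])
  then show ?thesis using assms by (auto simp: L2_into_def)
qed

lemma wpair_add:
  assumes X: "subspace X" and 1: "wpair X y1 g1 c1" and 2: "wpair X y2 g2 c2"
  shows "wpair X (\<lambda>t. y1 t + y2 t) (\<lambda>t. g1 t + g2 t) (\<lambda>t. c1 t + c2 t)"
  unfolding wpair_def
proof (intro conjI ballI)
  show "AE t in time_measure T. c1 t + c2 t = j (y1 t + y2 t)"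
    using wpairD(6)[OF 1] wpairD(6)[OF 2] by eventually_elim (simp add: blinfun.add_right)
  show "(c1 t + c2 t) \<bullet> j w = (c1 0 + c2 0) \<bullet> j w + prim T (\<lambda>s. (g1 s + g2 s) \<bullet> w) t"
    if "w \<in> X" "t \<in> {0..T}" for w t
    using wpairD(7)[OF 1 that] wpairD(7)[OF 2 that]
    by (simp add: inner_add_left prim_add inner_const_integrable wpairD(4)[OF 1] wpairD(4)[OF 2])
qed (use wpairD(1-6)[OF 1] wpairD(1-6)[OF 2] X in \<open>auto intro!: L2_into_add L2_add continuous_on_add\<close>)

lemma wpair_scaleR:
  assumes X: "subspace X" and 1: "wpair X y g c"
  shows "wpair X (\<lambda>t. r *\<^sub>R y t) (\<lambda>t. r *\<^sub>R g t) (\<lambda>t. r *\<^sub>R c t)"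
  unfolding wpair_def
proof (intro conjI ballI)
  show "AE t in time_measure T. r *\<^sub>R c t = j (r *\<^sub>R y t)"
    using wpairD(6)[OF 1] by eventually_elim (simp add: blinfun.scaleR_right)
  show "(r *\<^sub>R c t) \<bullet> j w = (r *\<^sub>R c 0) \<bullet> j w + prim T (\<lambda>s. (r *\<^sub>R g s) \<bullet> w) t" if "w \<in> X" "t \<in> {0..T}"
    for w t
    using wpairD(7)[OF 1 that] by (simp add: prim_cmult distrib_left)
qed (use wpairD(1-6)[OF 1] X in \<open>auto intro!: L2_into_scaleR L2_scaleR continuous_intros\<close>)

lemma wpair_diff:
  assumes X: "subspace X" and 1: "wpair X y1 g1 c1" and 2: "wpair X y2 g2 c2"
  shows "wpair X (\<lambda>t. y1 t - y2 t) (\<lambda>t. g1 t - g2 t) (\<lambda>t. c1 t - c2 t)"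
  using wpair_add[OF X 1 wpair_scaleR[OF X 2, of "-1"]] by simp

text \<open>Testing with fewer vectors. This is how a full solution that happens to take values in a
  reduced space is recognized as a solution of the reduced equation.\<close>

lemma wpair_restrict:
  assumes 1: "wpair X y g c" and X': "X' \<subseteq> X" "AE t in time_measure T. y t \<in> X'"
  shows "wpair X' y g c"
  unfolding wpair_def
proof (intro conjI ballI)
  show "y \<in> L2_into T X'" using wpairD(2)[OF 1] X'(2) by (simp add: L2_into_def)
  show "c t \<bullet> j w = c 0 \<bullet> j w + prim T (\<lambda>s. g s \<bullet> w) t" if "w \<in> X'" "t \<in> {0..T}" for w t
    using wpairD(7)[OF 1 _ that(2)] that(1) X'(1) by blast
qed (use wpairD(1-6)[OF 1] in auto)

text \<open>The derivative is meant as a functional on \<open>X\<close>, so only its inner products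
  with elements of \<open>X\<close> are determined.\<close>

lemma wpair_cong_derivative:
  assumes 1: "wpair X y g c" and g': "g' \<in> L2 T" and eq: "AE t in time_measure T. \<forall>w\<in>X. g t \<bullet> w
    = g' t \<bullet> w"
  shows "wpair X y g' c"
  unfolding wpair_def
proof (intro conjI ballI)
  show "c t \<bullet> j w = c 0 \<bullet> j w + prim T (\<lambda>s. g' s \<bullet> w) t" if w: "w \<in> X" "t \<in> {0..T}" for w t
  proof -
    have "prim T (\<lambda>s. g s \<bullet> w) t = prim T (\<lambda>s. g' s \<bullet> w) t"
    proof (rule prim_cong_AE)
      show "AE s in time_measure T. g s \<bullet> w = g' s \<bullet> w" using eq by eventually_elim (use w in auto)
    qed (use inner_const_integrable[OF wpairD(4)[OF 1]] inner_const_integrable[OF g'] in auto)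
    then show ?thesis using wpairD(7)[OF 1 w] by simp
  qed
qed (use wpairD(1-6)[OF 1] g' in auto)

lemma wpair_reflect:
  assumes 1: "wpair X y g c"
  shows "wpair X (\<lambda>t. y (T - t)) (\<lambda>t. - g (T - t)) (\<lambda>t. c (T - t))"
  unfolding wpair_def
proof (intro conjI ballI)
  show "(\<lambda>t. y (T - t)) \<in> L2_into T X" by (intro L2_into_reflect wpairD(1)[OF 1])
  show "(\<lambda>t. - g (T - t)) \<in> L2 T" by (intro L2_uminus L2_reflect wpairD(4)[OF 1])
  show "continuous_on {0..T} (\<lambda>t. c (T - t))"
    by (rule continuous_on_compose2[OF wpairD(5)[OF 1]]) (auto intro!: continuous_intros)
  show "AE t in time_measure T. c (T - t) = j (y (T - t))" by (rule AE_reflect[OF wpairD(6)[OF 1]])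
  fix w t assume w: "w \<in> X" and t: "t \<in> {0..T}"
  have gi: "integrable (time_measure T) (\<lambda>s. g s \<bullet> w)"
    by (rule inner_const_integrable[OF wpairD(4)[OF 1]])
  have "c (T - t) \<bullet> j w = c 0 \<bullet> j w + prim T (\<lambda>s. g s \<bullet> w) (T - t)"
    using wpairD(7)[OF 1 w, of "T - t"] t by auto
  moreover have "c T \<bullet> j w = c 0 \<bullet> j w + prim T (\<lambda>s. g s \<bullet> w) T"
    using wpairD(7)[OF 1 w, of T] T by auto
  moreover have "prim T (\<lambda>s. g (T - s) \<bullet> w) t = prim T (\<lambda>s. g s \<bullet> w) T - prim T (\<lambda>s. g s \<bullet> w) (T - t)"
    by (rule prim_reflect[OF gi t])
  moreover have "prim T (\<lambda>s. - g (T - s) \<bullet> w) t = - prim T (\<lambda>s. g (T - s) \<bullet> w) t"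
    using prim_cmult[of T "-1" "\<lambda>s. g (T - s) \<bullet> w" t] by simp
  ultimately show "c (T - t) \<bullet> j w = c (T - 0) \<bullet> j w + prim T (\<lambda>s. - g (T - s) \<bullet> w) t" by simp
qed

lemma wpair_closure:
  assumes 1: "wpair X y g c" and t: "t \<in> {0..T}"
  shows "c t \<in> closure (j ` X)"
proof (rule AE_continuous_closed[OF wpairD(5)[OF 1] _ closed_closure T t])
  show "AE t in time_measure T. c t \<in> closure (j ` X)"
    using wpairD(6)[OF 1] wpairD(3)[OF 1]
  proof eventually_elim
    fix s assume "c s = j (y s)" "y s \<in> X"
    then have "c s \<in> j ` X" by simp
    then show "c s \<in> closure (j ` X)" using closure_subset[of "j ` X"] by (rule_tac subsetD)
  qed
qed

end

locale gelfand_basis = gelfand T j for T and j :: "'v::{real_inner, banach, second_countable_topology}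
  \<Rightarrow>\<^sub>L 'h::{real_inner, banach, second_countable_topology}" +
  fixes X :: "'v set" and e :: "nat \<Rightarrow> 'v" and \<mu> :: "nat \<Rightarrow> real"
  assumes X: "subspace X" "closed X" and ons_e: "ons e" and eX: "\<And>i. e i \<in> X" and \<mu>: "\<And>i. \<mu> i > 0"
    and je: "\<And>i w. w \<in> X \<Longrightarrow> j (e i) \<bullet> j w = \<mu> i * (e i \<bullet> w)"
    and complete_e: "\<And>x. x \<in> X \<Longrightarrow> x \<in> closure (span (range e))"
begin

text \<open>The image of \<open>e i\<close> normalized in \<open>H\<close>: the squared norm of
  \<open>j (e i)\<close> is \<open>\<mu> i\<close> when \<open>e i\<close> is not zero.\<close>

definition hbasis :: "nat \<Rightarrow> 'h" where
  "hbasis i = (1 / sqrt (\<mu> i)) *\<^sub>R j (e i)"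

lemma je_hbasis: "j (e i) = sqrt (\<mu> i) *\<^sub>R hbasis i"
  using \<mu>[of i] by (simp add: hbasis_def)

lemma je_zero: "j (e i) = 0 \<longleftrightarrow> e i = 0"
  using inj_j by (metis blinfun.zero_right injD)

lemma ons_hbasis: "ons hbasis"
  unfolding ons_def
proof (intro allI)
  fix i k
  have "hbasis i \<bullet> hbasis k = (1 / (sqrt (\<mu> i) * sqrt (\<mu> k))) * (\<mu> i * (e i \<bullet> e k))"
    unfolding hbasis_def by (simp add: je[OF eX])
  moreover have "hbasis i = 0 \<longleftrightarrow> e i = 0" using \<mu>[of i] by (simp add: hbasis_def je_zero)
  moreover have "sqrt (\<mu> i) * sqrt (\<mu> i) = \<mu> i" using \<mu>[of i] by simp
  ultimately show "hbasis i \<bullet> hbasis k = (if i = k \<and> hbasis i \<noteq> 0 then 1 else 0)"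
    using \<mu>[of i] by (auto simp: ons_inner[OF ons_e])
qed

lemma complete_hbasis: "h \<in> closure (j ` X) \<Longrightarrow> h \<in> closure (span (range hbasis))"
proof -
  assume h: "h \<in> closure (j ` X)"
  have "j ` X \<subseteq> closure (span (range hbasis))"
  proof
    fix z assume "z \<in> j ` X"
    then obtain x where x: "x \<in> X" "z = j x" by blast
    have "(\<lambda>n. fourier_sum e n x) \<longlonglongrightarrow> x" by (rule fourier_tendsto[OF ons_e complete_e[OF x(1)]])
    then have "(\<lambda>n. j (fourier_sum e n x)) \<longlonglongrightarrow> z" unfolding x(2) by (intro blinfun.tendsto tendsto_const)
    moreover have "j (fourier_sum e n x) \<in> span (range hbasis)" for n
      unfolding fourier_sum_def blinfun.sum_right blinfun.scaleR_right je_hbasis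
      by (intro span_sum span_scale span_base) auto
    ultimately show "z \<in> closure (span (range hbasis))"
      unfolding closure_sequential by (intro exI[of _ "\<lambda>n. j (fourier_sum e n x)"] conjI allI)
  qed
  then show ?thesis using h closure_minimal by blast
qed

lemma fourier_X: "x \<in> X \<Longrightarrow> (\<lambda>n. fourier_sum e n x) \<longlonglongrightarrow> x"
  by (rule fourier_tendsto[OF ons_e complete_e])

lemma fourier_H: "h \<in> closure (j ` X) \<Longrightarrow> (\<lambda>n. fourier_sum hbasis n h) \<longlonglongrightarrow> h"
  by (rule fourier_tendsto[OF ons_hbasis complete_hbasis])

lemma fourier_L2: "y \<in> L2 T \<Longrightarrow> (\<lambda>t. fourier_sum e n (y t)) \<in> L2 T"
  by (rule L2_bounded_linear)
    (auto intro!: bounded_linear_intro[where K = 1] simp: fourier_sum_norm_le[OF ons_e]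
      linear_add[OF fourier_sum_linear] linear_scale[OF fourier_sum_linear])

lemma fourier_L2_tendsto:
  assumes y: "y \<in> L2_into T X"
  shows "(\<lambda>n. L2_norm T (\<lambda>t. fourier_sum e n (y t) - y t)) \<longlonglongrightarrow> 0"
proof (rule L2_dominated[where g = "\<lambda>t. 2 *\<^sub>R y t"])
  have yL: "y \<in> L2 T" using y L2_into_D by blast
  show "(\<lambda>t. fourier_sum e n (y t)) \<in> borel_measurable (time_measure T)" for n
    using fourier_L2[OF yL] L2_measurable by blast
  show "y \<in> borel_measurable (time_measure T)" using yL L2_measurable by blast
  show "AE t in time_measure T. (\<lambda>n. fourier_sum e n (y t)) \<longlonglongrightarrow> y t"
    using L2_into_D(2)[OF y] by eventually_elim (rule fourier_X)
  show "AE t in time_measure T. norm (fourier_sum e n (y t) - y t) \<le> norm (2 *\<^sub>R y t)" for n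
  proof (rule AE_I2)
    fix t
    have "norm (fourier_sum e n (y t) - y t) \<le> norm (fourier_sum e n (y t)) + norm (y t)"
      by (rule norm_triangle_ineq4)
    also have "\<dots> \<le> norm (y t) + norm (y t)" using fourier_sum_norm_le[OF ons_e] by simp
    finally show "norm (fourier_sum e n (y t) - y t) \<le> norm (2 *\<^sub>R y t)" by simp
  qed
  show "(\<lambda>t. 2 *\<^sub>R y t) \<in> L2 T" using yL by (rule L2_scaleR)
qed

text \<open>Coefficient by coefficient this is the scalar product rule. Summation turns the boundary
  terms into Fourier sums in \<open>H\<close> and the integrals into Fourier sums in
  \<open>V\<close>, and both converge since the same vectors are orthogonal in either space.\<close>

lemma wpair_product_basis:
  assumes 1: "wpair X y g c" and 2: "wpair X y' g' c'"
  shows "c T \<bullet> c' T - c 0 \<bullet> c' 0 = L2_inner T g y' + L2_inner T y g'"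
proof -
  let ?M = "time_measure T"
  note d1 = wpairD[OF 1] and d2 = wpairD[OF 2]
  have t0T: "0 \<in> {0..T}" "T \<in> {0..T}" using T by auto
  \<comment> \<open>Dividing by \<open>\<mu> i\<close> serves both sides: the pairings with
    \<open>j (e i)\<close> become coefficients for \<open>hbasis\<close>, and the weight cancels
    against the one that relates \<open>c\<close> to \<open>y\<close>.\<close>
  have coeff: "(1 / \<mu> i) * ((c T \<bullet> j (e i)) * (c' T \<bullet> j (e i)) - (c 0 \<bullet> j (e i)) * (c' 0 \<bullet> j (e i)))
     = (\<integral>s. (g s \<bullet> e i) * (y' s \<bullet> e i) + (y s \<bullet> e i) * (g' s \<bullet> e i) \<partial>?M)" for i
  proof -
    have gi: "integrable ?M (\<lambda>s. g s \<bullet> e i)" "integrable ?M (\<lambda>s. g' s \<bullet> e i)"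
      using inner_const_integrable d1 d2 by blast+
    let ?a = "c 0 \<bullet> j (e i)" and ?b = "c' 0 \<bullet> j (e i)"
    have A: "c t \<bullet> j (e i) = ?a + prim T (\<lambda>s. g s \<bullet> e i) t" if "t \<in> {0..T}" for t
      using d1(7)[OF eX that] .
    have B: "c' t \<bullet> j (e i) = ?b + prim T (\<lambda>s. g' s \<bullet> e i) t" if "t \<in> {0..T}" for t
      using d2(7)[OF eX that] .
    have "(c T \<bullet> j (e i)) * (c' T \<bullet> j (e i)) = ?a * ?b + (\<integral>s. (g s \<bullet> e i) * (?b
      + prim T (\<lambda>s. g' s \<bullet> e i) s) + (?a + prim T (\<lambda>s. g s \<bullet> e i) s) * (g' s \<bullet> e i) \<partial>?M)"
      using prim_product_T[OF gi, of ?a ?b] A[OF t0T(2)] B[OF t0T(2)] by simp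
    also have "(\<integral>s. (g s \<bullet> e i) * (?b + prim T (\<lambda>s. g' s \<bullet> e i) s) + (?a
      + prim T (\<lambda>s. g s \<bullet> e i) s) * (g' s \<bullet> e i) \<partial>?M)
       = (\<integral>s. \<mu> i * ((g s \<bullet> e i) * (y' s \<bullet> e i) + (y s \<bullet> e i) * (g' s \<bullet> e i)) \<partial>?M)"
    proof (rule integral_cong_AE)
      have [measurable]: "(\<lambda>s. g s \<bullet> e i) \<in> borel_measurable ?M" "(\<lambda>s. g' s \<bullet> e i) \<in> borel_measurable
        ?M"
        "(\<lambda>s. y s \<bullet> e i) \<in> borel_measurable ?M" "(\<lambda>s. y' s \<bullet> e i) \<in> borel_measurable ?M"
        "prim T (\<lambda>s. g s \<bullet> e i) \<in> borel_measurable ?M" "prim T (\<lambda>s. g' s \<bullet> e i) \<in> borel_measurable ?M"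
        using gi inner_const_integrable[OF d1(2)] inner_const_integrable[OF d2(2)] prim_measurable[OF
          gi(1)] prim_measurable[OF gi(2)] by auto
      show "(\<lambda>s. (g s \<bullet> e i) * (?b + prim T (\<lambda>s. g' s \<bullet> e i) s) + (?a
        + prim T (\<lambda>s. g s \<bullet> e i) s) * (g' s \<bullet> e i)) \<in> borel_measurable ?M"
        by (intro borel_measurable_add borel_measurable_times borel_measurable_const) fact+
      show "(\<lambda>s. \<mu> i * ((g s \<bullet> e i) * (y' s \<bullet> e i) + (y s \<bullet> e i) * (g' s \<bullet> e i))) \<in> borel_measurable ?M"
        by (intro borel_measurable_add borel_measurable_times borel_measurable_const) fact+
      show "AE s in ?M. (g s \<bullet> e i) * (?b + prim T (\<lambda>s. g' s \<bullet> e i) s) + (?a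
        + prim T (\<lambda>s. g s \<bullet> e i) s) * (g' s \<bullet> e i)
         = \<mu> i * ((g s \<bullet> e i) * (y' s \<bullet> e i) + (y s \<bullet> e i) * (g' s \<bullet> e i))"
        using AE_time d1(3,6) d2(3,6)
      proof eventually_elim
        fix s assume s: "s \<in> {0<..<T}" and y: "y s \<in> X" "c s = j (y s)" "y' s \<in> X" "c' s = j (y' s)"
        have "c s \<bullet> j (e i) = \<mu> i * (y s \<bullet> e i)" "c' s \<bullet> j (e i) = \<mu> i * (y' s \<bullet> e i)"
          using je[OF y(1), of i] je[OF y(3), of i] y by (auto simp: inner_commute)
        then have E: "?a + prim T (\<lambda>s. g s \<bullet> e i) s = \<mu> i * (y s \<bullet> e i)"
            "?b + prim T (\<lambda>s. g' s \<bullet> e i) s = \<mu> i * (y' s \<bullet> e i)"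
          using A[of s] B[of s] s by auto
        show "(g s \<bullet> e i) * (?b + prim T (\<lambda>s. g' s \<bullet> e i) s) + (?a
          + prim T (\<lambda>s. g s \<bullet> e i) s) * (g' s \<bullet> e i)
         = \<mu> i * ((g s \<bullet> e i) * (y' s \<bullet> e i) + (y s \<bullet> e i) * (g' s \<bullet> e i))"
          unfolding E by (simp add: algebra_simps)
      qed
    qed
    also have "\<dots> = \<mu> i * (\<integral>s. (g s \<bullet> e i) * (y' s \<bullet> e i) + (y s \<bullet> e i) * (g' s \<bullet> e i) \<partial>?M)"
      by (rule integral_mult_right_zero)
    finally have "(c T \<bullet> j (e i)) * (c' T \<bullet> j (e i)) - ?a * ?b =
        \<mu> i * (\<integral>s. (g s \<bullet> e i) * (y' s \<bullet> e i) + (y s \<bullet> e i) * (g' s \<bullet> e i) \<partial>?M)" by simp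
    then show ?thesis using \<mu>[of i] by simp
  qed
  have split: "(\<integral>s. (g s \<bullet> e i) * (y' s \<bullet> e i) + (y s \<bullet> e i) * (g' s \<bullet> e i) \<partial>?M)
     = L2_inner T g (\<lambda>s. (y' s \<bullet> e i) *\<^sub>R e i) + L2_inner T (\<lambda>s. (y s \<bullet> e i) *\<^sub>R e i) g'" for i
  proof -
    have b: "bounded_linear (\<lambda>x. (x \<bullet> e i) *\<^sub>R e i)"
      by (intro bounded_linear_intros)
    have "integrable ?M (\<lambda>s. g s \<bullet> ((y' s \<bullet> e i) *\<^sub>R e i))" "integrable ?M (\<lambda>s. ((y s \<bullet> e i) *\<^sub>R e i) \<bullet>
      g' s)"
      using L2_bounded_linear[OF d1(2) b] L2_bounded_linear[OF d2(2) b] d1 d2 L2_inner_integrable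
        by blast+
    then show ?thesis unfolding L2_inner_def
      by (subst Bochner_Integration.integral_add[symmetric]) (auto simp: mult.commute inner_commute
        intro!: Bochner_Integration.integral_cong)
  qed
  have comb: "(fourier_sum hbasis n (c T) \<bullet> c' T - fourier_sum hbasis n (c 0) \<bullet> c' 0)
      = L2_inner T g (\<lambda>s. fourier_sum e n (y' s)) + L2_inner T (\<lambda>s. fourier_sum e n (y s)) g'" for n
  proof -
    have b: "bounded_linear (\<lambda>x. (x \<bullet> e i) *\<^sub>R e i)" for i by (intro bounded_linear_intros)
    have i1: "integrable ?M (\<lambda>s. g s \<bullet> ((y' s \<bullet> e i) *\<^sub>R e i))" "integrable ?M (\<lambda>s. ((y s \<bullet> e i) *\<^sub>R e
      i) \<bullet> g' s)" for i
      using L2_bounded_linear[OF d1(2) b[of i]] L2_bounded_linear[OF d2(2) b[of i]] d1 d2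
        L2_inner_integrable by blast+
    have h: "fourier_sum hbasis n h \<bullet> h' = (\<Sum>i<n. (1 / \<mu> i) * ((h \<bullet> j (e i)) * (h' \<bullet> j (e i))))"
      for h h'
    proof -
      have "(h \<bullet> hbasis i) * (hbasis i \<bullet> h') = (1 / \<mu> i) * ((h \<bullet> j (e i)) * (h' \<bullet> j (e i)))" for i
        using \<mu>[of i] by (simp add: hbasis_def inner_commute[of _ h'])
      then show ?thesis by (simp add: fourier_sum_def inner_sum_left)
    qed
    have "fourier_sum hbasis n (c T) \<bullet> c' T - fourier_sum hbasis n (c 0) \<bullet> c' 0
       = (\<Sum>i<n. (\<integral>s. (g s \<bullet> e i) * (y' s \<bullet> e i) + (y s \<bullet> e i) * (g' s \<bullet> e i) \<partial>?M))"
      unfolding h coeff[symmetric] by (simp add: sum_subtractf right_diff_distrib)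
    also have "\<dots> = (\<Sum>i<n. L2_inner T g (\<lambda>s. (y' s \<bullet> e i) *\<^sub>R e i))
      + (\<Sum>i<n. L2_inner T (\<lambda>s. (y s \<bullet> e i) *\<^sub>R e i) g')"
      unfolding split by (rule sum.distrib)
    also have "(\<Sum>i<n. L2_inner T g (\<lambda>s. (y' s \<bullet> e i) *\<^sub>R e i))
      = L2_inner T g (\<lambda>s. fourier_sum e n (y' s))"
      unfolding L2_inner_def fourier_sum_def inner_sum_right
        by (rule Bochner_Integration.integral_sum[symmetric]) (rule i1)
    also have "(\<Sum>i<n. L2_inner T (\<lambda>s. (y s \<bullet> e i) *\<^sub>R e i) g')
      = L2_inner T (\<lambda>s. fourier_sum e n (y s)) g'"
      unfolding L2_inner_def fourier_sum_def inner_sum_left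
        by (rule Bochner_Integration.integral_sum[symmetric]) (rule i1)
    finally show ?thesis .
  qed
  have lim: "(\<lambda>n. L2_inner T g (\<lambda>s. fourier_sum e n (y' s))) \<longlonglongrightarrow> L2_inner T g y'"
    if g: "g \<in> L2 T" and y': "y' \<in> L2_into T X" for g y'
  proof -
    have yL: "y' \<in> L2 T" using y' L2_into_D by blast
    have "(\<lambda>n. L2_inner T g (\<lambda>s. fourier_sum e n (y' s)) - L2_inner T g y') \<longlonglongrightarrow> 0"
    proof (rule Lim_null_comparison)
      show "(\<lambda>n. L2_norm T g * L2_norm T (\<lambda>t. fourier_sum e n (y' t) - y' t)) \<longlonglongrightarrow> 0"
        using tendsto_mult[OF tendsto_const fourier_L2_tendsto[OF y']] by simp
      show "\<forall>\<^sub>F n in sequentially. norm (L2_inner T g (\<lambda>s. fourier_sum e n (y' s)) - L2_inner T g y')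
        \<le> L2_norm T g * L2_norm T (\<lambda>t. fourier_sum e n (y' t) - y' t)"
        using L2_cauchy_schwarz[OF g L2_diff[OF fourier_L2[OF yL] yL]]
        by (simp add: L2_inner_diff_right[OF fourier_L2[OF yL] yL g])
    qed
    then show ?thesis by (simp add: LIM_zero_iff)
  qed
  have "(\<lambda>n. fourier_sum hbasis n (c T) \<bullet> c' T - fourier_sum hbasis n (c 0) \<bullet> c' 0)
    \<longlonglongrightarrow> c T \<bullet> c' T - c 0 \<bullet> c' 0"
    by (intro tendsto_intros fourier_H wpair_closure[OF 1] t0T)
  moreover have "(\<lambda>n. L2_inner T g (\<lambda>s. fourier_sum e n (y' s))
    + L2_inner T (\<lambda>s. fourier_sum e n (y s)) g') \<longlonglongrightarrow> L2_inner T g y' + L2_inner T y g'"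
    using lim[OF d1(4) d2(1)] lim[OF d2(4) d1(1)]
      by (intro tendsto_add) (simp_all add: L2_inner_commute)
  ultimately show ?thesis unfolding comb by (rule LIMSEQ_unique)
qed

end

context gelfand
begin

lemma obtain_basis:
  assumes "subspace X" "closed X"
  obtains e \<mu> where "gelfand_basis T j X e \<mu>"
proof -
  from adapted_basis[OF inj_j compact_j assms] obtain e \<mu> where
    "ons e" "\<And>i. e i \<in> X \<and> \<mu> i > 0 \<and> (\<forall>w\<in>X. j (e i) \<bullet> j w = \<mu> i * (e i \<bullet> w))"
    "\<And>x. x \<in> X \<Longrightarrow> x \<in> closure (span (range e))" by blast
  then have "gelfand_basis T j X e \<mu>" by unfold_locales (use assms in auto)
  then show ?thesis by (rule that)
qed

lemma wpair_product:
  assumes "subspace X" "closed X" "wpair X y g c" "wpair X y' g' c'"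
  shows "c T \<bullet> c' T - c 0 \<bullet> c' 0 = L2_inner T g y' + L2_inner T y g'"
proof -
  obtain e \<mu> where "gelfand_basis T j X e \<mu>" using obtain_basis assms by blast
  then interpret gelfand_basis T j X e \<mu> .
  show ?thesis by (rule wpair_product_basis) fact+
qed

text \<open>The product rule of \<open>y\<close> with itself, where the value at \<open>T\<close> is
  dropped by its sign. The assumption \<open>le\<close> is what coercivity gives when the derivative
  is \<open>F\<close> minus a coercive term.\<close>

lemma wpair_energy:
  assumes X: "subspace X" "closed X" and 1: "wpair X y g c" and F: "F \<in> L2 T" and \<eta>: "\<eta> > 0"
    and le: "AE t in time_measure T. g t \<bullet> y t \<le> F t \<bullet> y t - \<eta> * (norm (y t))\<^sup>2"
  shows "\<eta>\<^sup>2 * (L2_norm T y)\<^sup>2 \<le> (L2_norm T F)\<^sup>2 + \<eta> * (norm (c 0))\<^sup>2"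
    "2 * \<eta> * (L2_norm T y)\<^sup>2 \<le> (norm (c 0))\<^sup>2 + 2 * L2_norm T F * L2_norm T y"
proof -
  note d = wpairD[OF 1]
  let ?N = "L2_norm T y"
  have "(norm (c T))\<^sup>2 - (norm (c 0))\<^sup>2 = 2 * L2_inner T g y"
    using wpair_product[OF X 1 1] by (simp add: power2_norm_eq_inner L2_inner_commute[of T y])
  moreover have "L2_inner T g y \<le> (\<integral>t. F t \<bullet> y t - \<eta> * (norm (y t))\<^sup>2 \<partial>time_measure T)"
    unfolding L2_inner_def
    by (rule integral_mono_AE[OF L2_inner_integrable[OF d(4,2)] _ le])
      (intro Bochner_Integration.integrable_diff L2_inner_integrable[OF F d(2)] integrable_mult_right
        L2_integrable[OF d(2)])
  moreover have "(\<integral>t. F t \<bullet> y t - \<eta> * (norm (y t))\<^sup>2 \<partial>time_measure T) = L2_inner T F y - \<eta> * ?N\<^sup>2"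
    using L2_inner_integrable[OF F d(2)] L2_integrable[OF d(2)] by (simp add: L2_inner_def L2_norm_sq)
  moreover have "L2_inner T F y \<le> L2_norm T F * ?N" using L2_cauchy_schwarz[OF F d(2)] by linarith
  moreover have "0 \<le> (norm (c T))\<^sup>2" by simp
  ultimately show 2: "2 * \<eta> * ?N\<^sup>2 \<le> (norm (c 0))\<^sup>2 + 2 * L2_norm T F * ?N" by linarith
  \<comment> \<open>Young's inequality with weights chosen such that half of the coercive term
    absorbs the mixed product.\<close>
  have "0 \<le> (L2_norm T F - \<eta> * ?N)\<^sup>2" by simp
  then have "2 * L2_norm T F * ?N * \<eta> \<le> (L2_norm T F)\<^sup>2 + \<eta>\<^sup>2 * ?N\<^sup>2"
    by (simp add: power2_diff power_mult_distrib mult_ac)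
  moreover have "\<eta> * (2 * \<eta> * ?N\<^sup>2) \<le> \<eta> * ((norm (c 0))\<^sup>2 + 2 * L2_norm T F * ?N)"
    using 2 \<eta> by (intro mult_left_mono) auto
  ultimately show "\<eta>\<^sup>2 * ?N\<^sup>2 \<le> (L2_norm T F)\<^sup>2 + \<eta> * (norm (c 0))\<^sup>2"
    by (simp add: power2_eq_square algebra_simps)
qed

lemma wpair_energy_zero:
  assumes X: "subspace X" "closed X" and 1: "wpair X y g c" and F: "F \<in> L2 T" and \<eta>: "\<eta> > 0"
    and c0: "c 0 = 0"
    and le: "AE t in time_measure T. g t \<bullet> y t \<le> F t \<bullet> y t - \<eta> * (norm (y t))\<^sup>2"
  shows "\<eta> * L2_norm T y \<le> L2_norm T F"
proof -
  have "(\<eta> * L2_norm T y)\<^sup>2 \<le> (L2_norm T F)\<^sup>2"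
    using wpair_energy(1)[OF X 1 F \<eta> le] c0 by (simp add: power_mult_distrib)
  then show ?thesis by (rule power2_le_imp_le) simp
qed

end

section \<open>Evolution equations\<close>

lemma prim_sum:
  assumes "\<And>i. i \<in> A \<Longrightarrow> integrable (time_measure T) (g i)"
  shows "prim T (\<lambda>s. \<Sum>i\<in>A. g i s) t = (\<Sum>i\<in>A. prim T (g i) t)"
  unfolding prim_def sum_distrib_left
  by (rule Bochner_Integration.integral_sum) (auto intro!: integrable_indicator_mult assms)

lemma prim_L2_bound:
  fixes u :: "real \<Rightarrow> 'a::{real_inner, banach, second_countable_topology}"
  assumes u: "u \<in> L2 T" and T: "0 \<le> T"
  shows "\<bar>prim T (\<lambda>s. u s \<bullet> w) t\<bar> \<le> sqrt T * L2_norm T u * norm w"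
proof -
  have i: "integrable (time_measure T) (\<lambda>s. u s \<bullet> w)" by (rule L2_inner_integrable[OF u]) simp
  have "\<bar>prim T (\<lambda>s. u s \<bullet> w) t\<bar> \<le> (\<integral>s. \<bar>u s \<bullet> w\<bar> \<partial>time_measure T)" by (rule prim_norm_le[OF i])
  also have "\<dots> \<le> (\<integral>s. norm (u s) * norm w \<partial>time_measure T)"
    using i L2_integral_norm_le(1)[OF u T] by (intro integral_mono) (auto simp: Cauchy_Schwarz_ineq2)
  also have "\<dots> \<le> (sqrt T * L2_norm T u) * norm w"
    using L2_integral_norm_le(2)[OF u T] by (simp add: mult_right_mono)
  finally show ?thesis .
qed

text \<open>For bounds in which \<open>k\<close> can be sent to infinity only after a truncation
  index \<open>n\<close> has been fixed.\<close>

lemma null_two_parameters: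
  fixes x :: "nat \<Rightarrow> real"
  assumes x: "\<And>k. 0 \<le> x k" and le: "\<And>n k. x k \<le> K n + L n k" and K: "K \<longlonglongrightarrow> 0" and L: "\<And>n. L n \<longlonglongrightarrow> 0"
  shows "x \<longlonglongrightarrow> 0"
proof (rule LIMSEQ_I)
  fix r :: real assume r: "r > 0"
  obtain n where n: "norm (K n - 0) < r / 2" using LIMSEQ_D[OF K, of "r/2"] r by auto
  obtain k0 where k0: "\<And>k. k \<ge> k0 \<Longrightarrow> norm (L n k - 0) < r / 2" using LIMSEQ_D[OF L, of "r/2" n] r by auto
  have "norm (x k - 0) < r" if "k \<ge> k0" for k
    using x[of k] le[of k n] n k0[OF that] by simp
  then show "\<exists>no. \<forall>k\<ge>no. norm (x k - 0) < r" by blast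
qed

context gelfand_basis
begin

text \<open>A multiple of the identity in \<open>V\<close> is diagonal in the adapted basis, so each
  coefficient solves its own scalar equation. The energy bounds are summable over the index, which
  makes the partial sums Cauchy in \<open>L\<^sup>2(0,T;V)\<close> and uniformly Cauchy in
  \<open>H\<close>.\<close>

lemma reference_solution:
  assumes l: "l > 0" and F: "F \<in> L2 T" and h: "h \<in> closure (j ` X)"
  shows "\<exists>y c. wpair X y (\<lambda>t. F t - l *\<^sub>R y t) c \<and> c 0 = h"
proof -
  let ?M = "time_measure T"
  have Fi: "integrable ?M (\<lambda>s. F s \<bullet> e i)" for i by (rule inner_const_integrable[OF F])
  \<comment> \<open>Testing the expansion with \<open>e i\<close> produces the weight
    \<open>\<mu> i\<close> in front of the derivative; the equation is stated after division by it.
    The initial value is the coefficient of \<open>h\<close> in the expansion by the vectors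
    \<open>e i\<close>.\<close>
  define Q where "Q i \<gamma> \<longleftrightarrow> continuous_on UNIV \<gamma> \<and> \<gamma> 0 = (h \<bullet> j (e i)) / \<mu> i \<and>
     (\<forall>t\<in>{0..T}. \<gamma> t = (h \<bullet> j (e i)) / \<mu> i + prim T (\<lambda>s. (F s \<bullet> e i) / \<mu> i - (l / \<mu> i) * \<gamma> s) t)"
    for i and \<gamma> :: "real \<Rightarrow> real"
  have "\<exists>\<gamma>. Q i \<gamma>" for i
  proof -
    have "integrable ?M (\<lambda>s. (F s \<bullet> e i) / \<mu> i)" using Fi by simp
    from scalar_ode_exists[OF this, of "(h \<bullet> j (e i)) / \<mu> i" "l / \<mu> i"] show ?thesis unfolding Q_def
      by blast
  qed
  then obtain \<gamma> where "\<And>i. Q i (\<gamma> i)" by metis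
  then have \<gamma>: "\<And>i. continuous_on UNIV (\<gamma> i)" "\<And>i. \<gamma> i 0 = (h \<bullet> j (e i)) / \<mu> i"
     "\<And>i t. t \<in> {0..T} \<Longrightarrow> \<gamma> i t = (h \<bullet> j (e i)) / \<mu> i
       + prim T (\<lambda>s. (F s \<bullet> e i) / \<mu> i - (l / \<mu> i) * \<gamma> i s) t"
    unfolding Q_def by blast+
  have \<gamma>c: "continuous_on S (\<gamma> i)" for S i using \<gamma>(1) by (rule continuous_on_subset) simp
  have \<gamma>i: "integrable ?M (\<gamma> i)" "integrable ?M (\<lambda>s. (\<gamma> i s)\<^sup>2)" for i
    by (intro integrable_continuous_time continuous_intros \<gamma>c)+
  have \<gamma>\<mu>: "\<mu> i * \<gamma> i t = \<mu> i * \<gamma> i 0 + prim T (\<lambda>s. F s \<bullet> e i - l * \<gamma> i s) t" if "t \<in> {0..T}" for i t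
  proof -
    have "prim T (\<lambda>s. (F s \<bullet> e i) / \<mu> i - (l / \<mu> i) * \<gamma> i s) t
      = (1 / \<mu> i) * prim T (\<lambda>s. F s \<bullet> e i - l * \<gamma> i s) t"
      unfolding prim_cmult[symmetric] by (simp add: diff_divide_distrib)
    then show ?thesis using \<gamma>(3)[OF that, of i] \<mu>[of i] by (simp add: \<gamma>(2) field_simps)
  qed
  \<comment> \<open>An upper bound for the energy of the coefficient with index \<open>i\<close>; it
    is summable by Bessel's inequality, in \<open>H\<close> for the initial value and in
    \<open>V\<close> for the source.\<close>
  define A where "A i = (h \<bullet> hbasis i)\<^sup>2 + (1 / l) * (\<integral>s. (F s \<bullet> e i)\<^sup>2 \<partial>?M)" for i
  have F2i: "integrable ?M (\<lambda>s. (F s \<bullet> e i)\<^sup>2)" for i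
  proof -
    have "(\<lambda>s. (F s \<bullet> e i) *\<^sub>R e i) \<in> L2 T"
      by (rule L2_bounded_linear[OF F]) (intro bounded_linear_intros)
    from L2_inner_integrable[OF F this] show ?thesis by (simp add: power2_eq_square)
  qed
  have energy: "\<mu> i * (\<gamma> i t)\<^sup>2 + l * prim T (\<lambda>s. (\<gamma> i s)\<^sup>2) t \<le> A i" if t: "t \<in> {0..T}" for i t
  proof -
    let ?G = "\<lambda>s. F s \<bullet> e i - l * \<gamma> i s" and ?a = "\<mu> i * \<gamma> i 0"
    have G: "integrable ?M ?G" using Fi \<gamma>i by auto
    have "(\<mu> i * \<gamma> i t) * (\<mu> i * \<gamma> i t) = ?a * ?a + prim T (\<lambda>s. ?G s * (?a + prim T ?G s) + (?a
      + prim T ?G s) * ?G s) t"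
      using prim_product[OF G G t, of ?a ?a] \<gamma>\<mu>[OF t, of i] by simp
    also have "prim T (\<lambda>s. ?G s * (?a + prim T ?G s) + (?a + prim T ?G s) * ?G s) t
      = prim T (\<lambda>s. \<mu> i * (2 * (F s \<bullet> e i) * \<gamma> i s - 2 * l * (\<gamma> i s)\<^sup>2)) t"
      unfolding prim_def[of T _ t]
    proof (rule Bochner_Integration.integral_cong[OF refl])
      fix s assume "s \<in> space ?M"
      then have s: "s \<in> {0..T}" by (auto simp: space_restrict_space)
      show "indicator {0<..<t} s * (?G s * (?a + prim T ?G s) + (?a + prim T ?G s) * ?G s)
        = indicator {0<..<t} s * (\<mu> i * (2 * (F s \<bullet> e i) * \<gamma> i s - 2 * l * (\<gamma> i s)\<^sup>2))"
        unfolding \<gamma>\<mu>[OF s, of i, symmetric] by (simp add: algebra_simps power2_eq_square)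
    qed
    also have "\<dots> = \<mu> i * prim T (\<lambda>s. 2 * (F s \<bullet> e i) * \<gamma> i s - 2 * l * (\<gamma> i s)\<^sup>2) t"
      by (rule prim_cmult)
    finally have "\<mu> i * (\<mu> i * (\<gamma> i t)\<^sup>2) = \<mu> i * (\<mu> i * (\<gamma> i 0)\<^sup>2
      + prim T (\<lambda>s. 2 * (F s \<bullet> e i) * \<gamma> i s - 2 * l * (\<gamma> i s)\<^sup>2) t)"
      by (simp add: power2_eq_square algebra_simps)
    then have eq: "\<mu> i * (\<gamma> i t)\<^sup>2 = \<mu> i * (\<gamma> i 0)\<^sup>2
      + prim T (\<lambda>s. 2 * (F s \<bullet> e i) * \<gamma> i s - 2 * l * (\<gamma> i s)\<^sup>2) t"
      using \<mu>[of i] by simp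
    have Fg: "integrable ?M (\<lambda>s. (F s \<bullet> e i) * \<gamma> i s)"
      using integrable_continuous_mult[OF Fi \<gamma>c] by (simp add: mult.commute)
    have "prim T (\<lambda>s. 2 * (F s \<bullet> e i) * \<gamma> i s - 2 * l * (\<gamma> i s)\<^sup>2) t
      \<le> prim T (\<lambda>s. (1 / l) * (F s \<bullet> e i)\<^sup>2 - l * (\<gamma> i s)\<^sup>2) t"
    proof (rule prim_mono)
      show "integrable ?M (\<lambda>s. 2 * (F s \<bullet> e i) * \<gamma> i s - 2 * l * (\<gamma> i s)\<^sup>2)"
        using Fg \<gamma>i by (auto simp: mult.assoc)
      show "integrable ?M (\<lambda>s. (1 / l) * (F s \<bullet> e i)\<^sup>2 - l * (\<gamma> i s)\<^sup>2)" using F2i \<gamma>i by auto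
      show "AE s in ?M. 2 * (F s \<bullet> e i) * \<gamma> i s - 2 * l * (\<gamma> i s)\<^sup>2
        \<le> (1 / l) * (F s \<bullet> e i)\<^sup>2 - l * (\<gamma> i s)\<^sup>2"
      proof (rule AE_I2)
        fix s
        \<comment> \<open>Young's inequality with weight \<open>l\<close>, so that half of the
          damping survives as the bound in \<open>V\<close>.\<close>
        have "0 \<le> (1 / l) * (F s \<bullet> e i - l * \<gamma> i s)\<^sup>2" using l by simp
        also have "\<dots> = (1 / l) * (F s \<bullet> e i)\<^sup>2 - 2 * (F s \<bullet> e i) * \<gamma> i s + l * (\<gamma> i s)\<^sup>2"
          using l by (simp add: power2_eq_square field_simps)
        finally show "2 * (F s \<bullet> e i) * \<gamma> i s - 2 * l * (\<gamma> i s)\<^sup>2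
          \<le> (1 / l) * (F s \<bullet> e i)\<^sup>2 - l * (\<gamma> i s)\<^sup>2"
          by linarith
      qed
    qed
    also have "\<dots> = (1 / l) * prim T (\<lambda>s. (F s \<bullet> e i)\<^sup>2) t - l * prim T (\<lambda>s. (\<gamma> i s)\<^sup>2) t"
      using F2i \<gamma>i by (simp only: prim_diff prim_cmult integrable_mult_right)
    also have "\<dots> \<le> (1 / l) * (\<integral>s. (F s \<bullet> e i)\<^sup>2 \<partial>?M) - l * prim T (\<lambda>s. (\<gamma> i s)\<^sup>2) t"
      using prim_le_total[OF F2i, of i t] l by (simp add: divide_right_mono)
    finally have "\<mu> i * (\<gamma> i t)\<^sup>2 + l * prim T (\<lambda>s. (\<gamma> i s)\<^sup>2) t \<le> \<mu> i * (\<gamma> i 0)\<^sup>2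
      + (1 / l) * (\<integral>s. (F s \<bullet> e i)\<^sup>2 \<partial>?M)"
      using eq by linarith
    moreover have "\<mu> i * (\<gamma> i 0)\<^sup>2 = (h \<bullet> hbasis i)\<^sup>2"
    proof -
      have "(sqrt (\<mu> i))\<^sup>2 = \<mu> i" using \<mu>[of i] by simp
      then show ?thesis using \<mu>[of i] by (simp add: \<gamma>(2) hbasis_def power_divide field_simps
        power2_eq_square)
    qed
    ultimately show ?thesis by (simp add: A_def)
  qed
  have A0: "0 \<le> A i" for i using l by (auto simp: A_def intro!: add_nonneg_nonneg divide_nonneg_pos
    integral_nonneg_AE)
  have Asum: "summable A"
  proof -
    have "summable (\<lambda>i. \<integral>s. (F s \<bullet> e i)\<^sup>2 \<partial>?M)"
    proof (rule summableI_nonneg_bounded[where x = "(L2_norm T F)\<^sup>2"])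
      fix n
      have "(\<Sum>i<n. \<integral>s. (F s \<bullet> e i)\<^sup>2 \<partial>?M) = (\<integral>s. (\<Sum>i<n. (F s \<bullet> e i)\<^sup>2) \<partial>?M)"
        using F2i by simp
      also have "\<dots> \<le> (\<integral>s. (norm (F s))\<^sup>2 \<partial>?M)"
        by (intro integral_mono Bochner_Integration.integrable_sum F2i L2_integrable[OF F] bessel[OF
          ons_e])
      finally show "(\<Sum>i<n. \<integral>s. (F s \<bullet> e i)\<^sup>2 \<partial>?M) \<le> (L2_norm T F)\<^sup>2" by (simp add: L2_norm_sq)
    qed (auto intro!: integral_nonneg_AE)
    then show ?thesis unfolding A_def by (intro summable_add summable_mult bessel_summable[OF
      ons_hbasis])
  qed
  define yn where "yn n t = (\<Sum>i<n. \<gamma> i t *\<^sub>R e i)" for n t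
  have ync: "continuous_on S (yn n)" for S n unfolding yn_def by (intro continuous_intros \<gamma>c)
  have ynX: "yn n t \<in> X" for n t unfolding yn_def using X eX by (intro subspace_sum subspace_scale) auto
  have ynL: "yn n \<in> L2 T" for n by (rule continuous_on_L2[OF ync])
  have ynLX: "yn n \<in> L2_into T X" for n using ynL ynX by (simp add: L2_into_def)
  have yn_diff: "yn n t - yn m t = (\<Sum>i=m..<n. \<gamma> i t *\<^sub>R e i)" if "m \<le> n" for m n t
    unfolding yn_def lessThan_atLeast0 using sum_diff_nat_ivl[of 0 m n] that by auto
  have jyn_diff: "(norm (j (yn n t) - j (yn m t)))\<^sup>2 \<le> (\<Sum>i=m..<n. A i)"
    if mn: "m \<le> n" and t: "t \<in> {0..T}" for m n t
  proof -
    have "j (yn n t) - j (yn m t) = (\<Sum>i=m..<n. (\<gamma> i t * sqrt (\<mu> i)) *\<^sub>R hbasis i)"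
      unfolding blinfun.diff_right[symmetric] yn_diff[OF mn]
        by (simp add: blinfun.sum_right blinfun.scaleR_right je_hbasis)
    then have "(norm (j (yn n t) - j (yn m t)))\<^sup>2
      = (\<Sum>i=m..<n. (\<gamma> i t * sqrt (\<mu> i))\<^sup>2 * (hbasis i \<bullet> hbasis i))"
      by (simp add: ons_sum_norm[OF ons_hbasis])
    also have "\<dots> \<le> (\<Sum>i=m..<n. A i)"
    proof (rule sum_mono)
      fix i
      have "(\<gamma> i t * sqrt (\<mu> i))\<^sup>2 * (hbasis i \<bullet> hbasis i) \<le> (\<gamma> i t * sqrt (\<mu> i))\<^sup>2"
        by (rule ons_inner_self_le[OF ons_hbasis]) simp
      also have "\<dots> = \<mu> i * (\<gamma> i t)\<^sup>2" using \<mu>[of i] by (simp add: power_mult_distrib)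
      also have "\<dots> \<le> A i" using energy[OF t, of i] l prim_nonneg[of "\<lambda>s. (\<gamma> i s)\<^sup>2" T t]
        by (smt (verit) mult_nonneg_nonneg zero_le_power2)
      finally show "(\<gamma> i t * sqrt (\<mu> i))\<^sup>2 * (hbasis i \<bullet> hbasis i) \<le> A i" .
    qed
    finally show ?thesis .
  qed
  have yn_L2: "(L2_norm T (\<lambda>t. yn n t - yn m t))\<^sup>2 \<le> (1 / l) * (\<Sum>i=m..<n. A i)" if mn: "m \<le> n" for m n
  proof -
    have "(L2_norm T (\<lambda>t. yn n t - yn m t))\<^sup>2 \<le> (\<integral>s. (\<Sum>i=m..<n. (\<gamma> i s)\<^sup>2) \<partial>?M)"
      unfolding L2_norm_sq
    proof (rule integral_mono)
      show "integrable ?M (\<lambda>t. (norm (yn n t - yn m t))\<^sup>2)" by (intro L2_integrable L2_diff ynL)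
      show "integrable ?M (\<lambda>s. \<Sum>i=m..<n. (\<gamma> i s)\<^sup>2)" by (intro Bochner_Integration.integrable_sum \<gamma>i)
      show "(norm (yn n s - yn m s))\<^sup>2 \<le> (\<Sum>i=m..<n. (\<gamma> i s)\<^sup>2)" for s
        unfolding yn_diff[OF mn] by (subst ons_sum_norm[OF ons_e]) (auto intro!: sum_mono
          ons_inner_self_le[OF ons_e])
    qed
    also have "\<dots> = (\<Sum>i=m..<n. \<integral>s. (\<gamma> i s)\<^sup>2 \<partial>?M)" using \<gamma>i by simp
    also have "\<dots> \<le> (\<Sum>i=m..<n. (1 / l) * A i)"
    proof (rule sum_mono)
      fix i
      have "0 \<le> \<mu> i * (\<gamma> i T)\<^sup>2" using \<mu>[of i] by simp
      then have "l * (\<integral>s. (\<gamma> i s)\<^sup>2 \<partial>?M) \<le> A i" using energy[of T i] T by (simp add: prim_T)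
      then show "(\<integral>s. (\<gamma> i s)\<^sup>2 \<partial>?M) \<le> (1 / l) * A i" using l by (simp add: field_simps)
    qed
    finally show ?thesis by (simp add: sum_distrib_left)
  qed
  have tail: "\<exists>N. \<forall>m\<ge>N. \<forall>n. (\<Sum>i=m..<n. A i) < d" if "d > 0" for d
    using Asum that A0 unfolding summable_Cauchy by (metis abs_of_nonneg real_norm_def sum_nonneg)
  have cauchy: "\<exists>N. \<forall>m\<ge>N. \<forall>n\<ge>N. L2_norm T (\<lambda>t. yn m t - yn n t) < d" if d: "d > 0" for d
  proof -
    obtain N where N: "\<And>m n. m \<ge> N \<Longrightarrow> (\<Sum>i=m..<n. A i) < l * d\<^sup>2" using tail[of "l * d\<^sup>2"] l d by auto
    have lt: "L2_norm T (\<lambda>t. yn n t - yn m t) < d" if "N \<le> m" "m \<le> n" for m n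
    proof -
      have "l * (L2_norm T (\<lambda>t. yn n t - yn m t))\<^sup>2 \<le> (\<Sum>i=m..<n. A i)"
        using yn_L2[OF that(2)] l by (simp add: field_simps)
      then have "l * (L2_norm T (\<lambda>t. yn n t - yn m t))\<^sup>2 < l * d\<^sup>2"
        using N[OF that(1), of n] by linarith
      then have "(L2_norm T (\<lambda>t. yn n t - yn m t))\<^sup>2 < d\<^sup>2"
        using l by simp
      then show ?thesis using d by (rule_tac power2_less_imp_less[of _ d]) auto
    qed
    have "L2_norm T (\<lambda>t. yn m t - yn n t) < d" if "m \<ge> N" "n \<ge> N" for m n
      using lt[of m n] lt[of n m] that by (cases "m
        \<le> n") (auto simp: L2_norm_minus_commute[of T "yn m"])
    then show ?thesis by blast
  qed
  from L2_complete[OF T0 ynL cauchy] obtain y r where y: "y \<in> L2 T" "(\<lambda>n. L2_norm T (\<lambda>t. yn n t - y t))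
    \<longlonglongrightarrow> 0"
    "strict_mono r" "AE t in ?M. (\<lambda>n. yn (r n) t) \<longlonglongrightarrow> y t" by blast
  have yX: "y \<in> L2_into T X" by (rule L2_into_closed[OF T0 X(2) ynLX y(1,2)])
  \<comment> \<open>Uniform convergence in \<open>H\<close> provides the continuous representative,
    including its value at time 0; convergence in \<open>L\<^sup>2(0,T;V)\<close> would not.\<close>
  have "uniformly_Cauchy_on {0..T} (\<lambda>n t. j (yn n t))"
    unfolding uniformly_Cauchy_on_def
  proof (intro allI impI)
    fix d :: real assume d: "d > 0"
    obtain N where N: "\<And>m n. m \<ge> N \<Longrightarrow> (\<Sum>i=m..<n. A i) < d\<^sup>2" using tail[of "d\<^sup>2"] d by auto
    have lt: "dist (j (yn n t)) (j (yn m t)) < d" if "N \<le> m" "m \<le> n" "t \<in> {0..T}" for m n t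
    proof -
      have "(norm (j (yn n t) - j (yn m t)))\<^sup>2 < d\<^sup>2" using jyn_diff[OF that(2,3)] N[OF that(1), of n]
        by simp
      then show ?thesis unfolding dist_norm using d by (rule_tac power2_less_imp_less[of _ d]) auto
    qed
    have "dist (j (yn m t)) (j (yn n t)) < d" if "t \<in> {0..T}" "m \<ge> N" "n \<ge> N" for m n t
      using lt[of m n t] lt[of n m t] that by (cases "m \<le> n") (auto simp: dist_commute[of "j (yn m t)"])
    then show "\<exists>M. \<forall>t\<in>{0..T}. \<forall>m\<ge>M. \<forall>n\<ge>M. dist (j (yn m t)) (j (yn n t)) < d" by blast
  qed
  then obtain c where c: "uniform_limit {0..T} (\<lambda>n t. j (yn n t)) c sequentially"
    using Cauchy_uniformly_convergent uniformly_convergent_on_def by blast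
  have cc: "continuous_on {0..T} c"
    by (rule uniform_limit_theorem[OF _ c]) (auto intro!: always_eventually continuous_intros ync)
  have cpt: "(\<lambda>n. j (yn n t)) \<longlonglongrightarrow> c t" if "t \<in> {0..T}" for t by (rule tendsto_uniform_limitI[OF c that])
  have cAE: "AE t in ?M. c t = j (y t)"
    using y(4) AE_time
  proof eventually_elim
    fix t assume lim: "(\<lambda>n. yn (r n) t) \<longlonglongrightarrow> y t" and "t \<in> {0<..<T}"
    then have "(\<lambda>n. j (yn n t)) \<longlonglongrightarrow> c t" using cpt by auto
    from LIMSEQ_subseq_LIMSEQ[OF this y(3)] have "(\<lambda>n. j (yn (r n) t)) \<longlonglongrightarrow> c t" by (simp add: comp_def)
    moreover have "(\<lambda>n. j (yn (r n) t)) \<longlonglongrightarrow> j (y t)" by (intro blinfun.tendsto tendsto_const lim)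
    ultimately show "c t = j (y t)" by (rule LIMSEQ_unique)
  qed
  have c0: "c 0 = h"
  proof -
    have "j (yn n 0) = fourier_sum hbasis n h" for n
      unfolding yn_def fourier_sum_def blinfun.sum_right
    proof (rule sum.cong[OF refl])
      fix i
      have "sqrt (\<mu> i) * sqrt (\<mu> i) = \<mu> i" using \<mu>[of i] by simp
      then show "j (\<gamma> i 0 *\<^sub>R e i) = (h \<bullet> hbasis i) *\<^sub>R hbasis i"
        by (simp add: \<gamma>(2) hbasis_def blinfun.scaleR_right divide_inverse
          inverse_mult_distrib[symmetric] mult.assoc)
    qed
    then have "(\<lambda>n. j (yn n 0)) \<longlonglongrightarrow> h" using fourier_H[OF h] by simp
    with cpt[of 0] T show ?thesis using LIMSEQ_unique by auto
  qed
  have eqn: "c t \<bullet> j w = c 0 \<bullet> j w + prim T (\<lambda>s. (F s - l *\<^sub>R y s) \<bullet> w) t"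
    if w: "w \<in> X" and t: "t \<in> {0..T}" for w t
  proof -
    have jw: "j (yn n t) \<bullet> j w = (\<Sum>i<n. (\<mu> i * \<gamma> i t) * (e i \<bullet> w))" for n t
      unfolding yn_def by (simp add: blinfun.sum_right blinfun.scaleR_right inner_sum_left je[OF w]
        mult_ac)
    have yni: "integrable ?M (\<lambda>s. yn n s \<bullet> w)" for n by (rule inner_const_integrable[OF ynL])
    \<comment> \<open>Testing a partial sum with \<open>w\<close> shifts the truncation onto
      \<open>w\<close> in the source term, whose limit then depends only on the Fourier sums of the
      fixed vector \<open>w\<close>.\<close>
    have step: "j (yn n t) \<bullet> j w = j (yn n 0) \<bullet> j w
      + (prim T (\<lambda>s. F s \<bullet> fourier_sum e n w) t - l * prim T (\<lambda>s. yn n s \<bullet> w) t)" for n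
    proof -
      have "j (yn n t) \<bullet> j w = (\<Sum>i<n. (\<mu> i * \<gamma> i 0) * (e i \<bullet> w)
        + prim T (\<lambda>s. (e i \<bullet> w) * (F s \<bullet> e i - l * \<gamma> i s)) t)"
        unfolding jw \<gamma>\<mu>[OF t] by (simp add: distrib_left prim_cmult mult.commute)
      also have "\<dots> = j (yn n 0) \<bullet> j w + prim T (\<lambda>s. \<Sum>i<n. (e i \<bullet> w) * (F s \<bullet> e i - l * \<gamma> i s)) t"
        unfolding jw by (subst prim_sum) (use Fi \<gamma>i in \<open>auto simp: sum.distrib\<close>)
      also have "(\<lambda>s. \<Sum>i<n. (e i \<bullet> w) * (F s \<bullet> e i - l * \<gamma> i s))
        = (\<lambda>s. F s \<bullet> fourier_sum e n w - l * (yn n s \<bullet> w))"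
        by (rule ext) (simp add: fourier_sum_def yn_def inner_sum_left inner_sum_right
          right_diff_distrib sum_subtractf sum_distrib_left inner_commute[of w] mult_ac)
      also have "prim T (\<lambda>s. F s \<bullet> fourier_sum e n w - l * (yn n s \<bullet> w)) t
        = prim T (\<lambda>s. F s \<bullet> fourier_sum e n w) t - l * prim T (\<lambda>s. yn n s \<bullet> w) t"
        using inner_const_integrable[OF F] yni
          by (simp only: prim_diff prim_cmult integrable_mult_right)
      finally show ?thesis .
    qed
    have l1: "(\<lambda>n. prim T (\<lambda>s. F s \<bullet> fourier_sum e n w) t) \<longlonglongrightarrow> prim T (\<lambda>s. F s \<bullet> w) t"
    proof -
      have "(\<lambda>n. prim T (\<lambda>s. F s \<bullet> fourier_sum e n w) t - prim T (\<lambda>s. F s \<bullet> w) t) \<longlonglongrightarrow> 0"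
      proof (rule Lim_null_comparison)
        show "(\<lambda>n. sqrt T * L2_norm T F * norm (fourier_sum e n w - w)) \<longlonglongrightarrow> 0"
          using tendsto_mult[OF tendsto_const tendsto_norm_zero[OF LIM_zero[OF fourier_X[OF w]]]]
            by simp
        show "\<forall>\<^sub>F n in sequentially. norm (prim T (\<lambda>s. F s \<bullet> fourier_sum e n w) t - prim T (\<lambda>s. F s \<bullet> w)
          t) \<le> sqrt T * L2_norm T F * norm (fourier_sum e n w - w)"
        proof (rule always_eventually, rule allI)
          fix n
          show "norm (prim T (\<lambda>s. F s \<bullet> fourier_sum e n w) t - prim T (\<lambda>s. F s \<bullet> w) t)
            \<le> sqrt T * L2_norm T F * norm (fourier_sum e n w - w)"
            using prim_L2_bound[OF F T0, of "fourier_sum e n w - w" t]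
            by (simp add: inner_diff_right prim_diff inner_const_integrable[OF F])
        qed
      qed
      then show ?thesis by (simp add: LIM_zero_iff)
    qed
    have l2: "(\<lambda>n. prim T (\<lambda>s. yn n s \<bullet> w) t) \<longlonglongrightarrow> prim T (\<lambda>s. y s \<bullet> w) t"
    proof -
      have "(\<lambda>n. prim T (\<lambda>s. yn n s \<bullet> w) t - prim T (\<lambda>s. y s \<bullet> w) t) \<longlonglongrightarrow> 0"
      proof (rule Lim_null_comparison)
        show "(\<lambda>n. sqrt T * L2_norm T (\<lambda>t. yn n t - y t) * norm w) \<longlonglongrightarrow> 0"
          using tendsto_mult_left_zero[OF tendsto_mult_right_zero[OF y(2)]] by simp
        show "\<forall>\<^sub>F n in sequentially. norm (prim T (\<lambda>s. yn n s \<bullet> w) t - prim T (\<lambda>s. y s \<bullet> w) t)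
          \<le> sqrt T * L2_norm T (\<lambda>t. yn n t - y t) * norm w"
        proof (rule always_eventually, rule allI)
          fix n
          show "norm (prim T (\<lambda>s. yn n s \<bullet> w) t - prim T (\<lambda>s. y s \<bullet> w) t)
            \<le> sqrt T * L2_norm T (\<lambda>t. yn n t - y t) * norm w"
            using prim_L2_bound[OF L2_diff[OF ynL y(1)] T0, of n w t]
            by (simp add: inner_diff_left prim_diff inner_const_integrable[OF ynL]
              inner_const_integrable[OF y(1)])
        qed
      qed
      then show ?thesis by (simp add: LIM_zero_iff)
    qed
    have "(\<lambda>n. j (yn n t) \<bullet> j w) \<longlonglongrightarrow> c t \<bullet> j w" by (intro tendsto_intros cpt t)
    moreover have "(\<lambda>n. j (yn n t) \<bullet> j w) \<longlonglongrightarrow> c 0 \<bullet> j w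
      + (prim T (\<lambda>s. F s \<bullet> w) t - l * prim T (\<lambda>s. y s \<bullet> w) t)"
      unfolding step using T by (intro tendsto_intros cpt l1 l2) auto
    ultimately have "c t \<bullet> j w = c 0 \<bullet> j w + (prim T (\<lambda>s. F s \<bullet> w) t - l * prim T (\<lambda>s. y s \<bullet> w) t)"
      by (rule LIMSEQ_unique)
    also have "prim T (\<lambda>s. F s \<bullet> w) t - l * prim T (\<lambda>s. y s \<bullet> w) t
      = prim T (\<lambda>s. (F s - l *\<^sub>R y s) \<bullet> w) t"
      using inner_const_integrable[OF F] inner_const_integrable[OF y(1)]
      by (simp only: prim_diff prim_cmult integrable_mult_right inner_diff_left inner_scaleR_left)
    finally show ?thesis .
  qed
  have "wpair X y (\<lambda>t. F t - l *\<^sub>R y t) c"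
    unfolding wpair_def by (intro conjI ballI yX cc cAE eqn L2_diff F L2_scaleR y(1))
  then show ?thesis using c0 by blast
qed

end

text \<open>The operators act in \<open>V\<close> and stand for the Riesz representatives of the
  functionals \<open>A(t)v\<close>. Enlarging the bound \<open>Ma\<close> achieves
  \<open>\<eta> \<le> Ma\<close>, which makes the shift in the fixed point argument at least as
  large as the norm of the operators.\<close>

locale evolution = gelfand T j for T and j :: "'v::{real_inner, banach, second_countable_topology} \<Rightarrow>\<^sub>L
  'h::{real_inner, banach, second_countable_topology}" +
  fixes a :: "real \<Rightarrow> 'v \<Rightarrow>\<^sub>L 'v" and Ma \<eta> :: real
  assumes a_measurable: "\<And>v w. (\<lambda>t. a t v \<bullet> w) \<in> borel_measurable (time_measure T)"
    and a_bounded: "AE t in time_measure T. norm (a t) \<le> Ma"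
    and coercive: "\<And>t v. t \<in> {0<..<T} \<Longrightarrow> \<eta> * (norm v)\<^sup>2 \<le> a t v \<bullet> v"
    and \<eta>: "\<eta> > 0" and Ma: "\<eta> \<le> Ma"
begin

lemma a_apply_bound: "AE t in time_measure T. \<forall>v. norm (a t v) \<le> Ma * norm v"
  using a_bounded by eventually_elim (meson mult_right_mono norm_blinfun norm_ge_zero order_trans)

lemma a_apply_measurable:
  assumes "y \<in> borel_measurable (time_measure T)"
  shows "(\<lambda>t. a t (y t)) \<in> borel_measurable (time_measure T)"
  by (rule borel_measurable_compose_linear[OF _ blinfun.bounded_linear_right assms])
    (rule borel_measurable_weak[OF a_measurable])

lemma a_L2:
  assumes "y \<in> L2 T"
  shows "(\<lambda>t. a t (y t)) \<in> L2 T" "L2_norm T (\<lambda>t. a t (y t)) \<le> Ma * L2_norm T y"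
proof -
  have m: "(\<lambda>t. a t (y t)) \<in> borel_measurable (time_measure T)"
    by (rule a_apply_measurable[OF L2_measurable[OF assms]])
  have le: "AE t in time_measure T. norm (a t (y t)) \<le> Ma * norm (y t)"
    using a_apply_bound by eventually_elim blast
  have M0: "0 \<le> Ma" using Ma \<eta> by linarith
  from L2_bound[OF assms m le M0] show "(\<lambda>t. a t (y t)) \<in> L2 T" "L2_norm T (\<lambda>t. a t (y t))
    \<le> Ma * L2_norm T y" .
qed

text \<open>Stability with respect to the right hand side, with a constant that does not depend on
  the subspace. For equal sources it is uniqueness.\<close>

lemma solution_unique:
  assumes X: "subspace X" "closed X" and 1: "wpair X y1 (\<lambda>t. F1 t - a t (y1 t)) c1"
    and 2: "wpair X y2 (\<lambda>t. F2 t - a t (y2 t)) c2" and F: "F1 \<in> L2 T" "F2 \<in> L2 T" and c: "c1 0 = c2 0"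
  shows "\<eta> * L2_norm T (\<lambda>t. y1 t - y2 t) \<le> L2_norm T (\<lambda>t. F1 t - F2 t)"
proof (rule wpair_energy_zero[OF X wpair_diff[OF X(1) 1 2] _ \<eta>])
  show "(\<lambda>t. F1 t - F2 t) \<in> L2 T" using F by auto
  show "c1 0 - c2 0 = 0" using c by simp
  show "AE t in time_measure T. (F1 t - a t (y1 t) - (F2 t - a t (y2 t))) \<bullet> (y1 t - y2 t)
        \<le> (F1 t - F2 t) \<bullet> (y1 t - y2 t) - \<eta> * (norm (y1 t - y2 t))\<^sup>2"
    using AE_time
  proof eventually_elim
    fix t assume t: "t \<in> {0<..<T}"
    have "\<eta> * (norm (y1 t - y2 t))\<^sup>2 \<le> a t (y1 t - y2 t) \<bullet> (y1 t - y2 t)" by (rule coercive[OF t])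
    moreover have "F1 t - a t (y1 t) - (F2 t - a t (y2 t)) = (F1 t - F2 t) - a t (y1 t - y2 t)"
      by (simp add: blinfun.diff_right)
    ultimately show "(F1 t - a t (y1 t) - (F2 t - a t (y2 t))) \<bullet> (y1 t - y2 t)
        \<le> (F1 t - F2 t) \<bullet> (y1 t - y2 t) - \<eta> * (norm (y1 t - y2 t))\<^sup>2"
      by (simp only: inner_diff_left)
  qed
qed

text \<open>
  Since \<open>l *\<^sub>R v - a t v\<close> has norm at most \<open>q * norm v\<close> with \<open>q < l\<close>, moving this
  difference to the right hand side turns the equation into a fixed point problem for the
  reference solution operator, which is a contraction.
\<close>

lemma solution_exists:
  assumes X: "subspace X" "closed X" and F: "F \<in> L2 T" and h: "h \<in> closure (j ` X)"
  shows "\<exists>y c. wpair X y (\<lambda>t. F t - a t (y t)) c \<and> c 0 = h"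
proof -
  let ?M = "time_measure T"
  \<comment> \<open>With this \<open>l\<close> one has \<open>l * \<eta> = Ma\<^sup>2\<close>. The
    squared norm of \<open>l *\<^sub>R v - a t v\<close> is at most that of \<open>v\<close> times
    \<open>l\<^sup>2 - 2 * l * \<eta> + Ma\<^sup>2\<close>, which is then
    \<open>l\<^sup>2 - Ma\<^sup>2\<close>; this explains \<open>q\<close>.\<close>
  define l where "l = Ma\<^sup>2 / \<eta>"
  have Ma0: "Ma > 0" using \<eta> Ma by linarith
  have lMa: "Ma \<le> l" using \<eta> Ma Ma0 by (simp add: l_def power2_eq_square pos_le_divide_eq)
  have l: "l > 0" using lMa Ma0 by linarith
  define q where "q = sqrt (l\<^sup>2 - Ma\<^sup>2)"
  have ll: "Ma\<^sup>2 \<le> l\<^sup>2" using lMa Ma0 by (intro power_mono) auto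
  have q0: "0 \<le> q" using ll by (simp add: q_def)
  have q2: "q\<^sup>2 = l\<^sup>2 - Ma\<^sup>2" using ll by (simp add: q_def)
  have ql: "q < l"
  proof -
    have "q\<^sup>2 < l\<^sup>2" using q2 Ma0 by simp
    then show ?thesis using l by (rule_tac power2_less_imp_less[of _ l]) auto
  qed
  define k where "k = q / l"
  have k: "0 \<le> k" "k < 1" using q0 ql l by (auto simp: k_def)
  have shift: "(\<lambda>t. l *\<^sub>R y t - a t (y t)) \<in> L2 T \<and> L2_norm T (\<lambda>t. l *\<^sub>R y t - a t (y t))
    \<le> q * L2_norm T y" if y: "y \<in> L2 T" for y
  proof -
    have L: "(\<lambda>t. l *\<^sub>R y t - a t (y t)) \<in> L2 T" using y a_L2(1)[OF y] by auto
    have "AE t in ?M. norm (l *\<^sub>R y t - a t (y t)) \<le> q * norm (y t)"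
      using a_apply_bound AE_time
    proof eventually_elim
      fix t assume b: "\<forall>v. norm (a t v) \<le> Ma * norm v" and t: "t \<in> {0<..<T}"
      let ?v = "y t"
      have "(norm (l *\<^sub>R ?v - a t ?v))\<^sup>2 = l\<^sup>2 * (norm ?v)\<^sup>2 - 2 * l * (a t ?v \<bullet> ?v)
        + (norm (a t ?v))\<^sup>2"
        unfolding power2_norm_eq_inner
        by (simp add: inner_diff_left inner_diff_right inner_commute[of ?v "a t ?v"] power2_eq_square
          algebra_simps)
      also have "\<dots> \<le> l\<^sup>2 * (norm ?v)\<^sup>2 - 2 * l * (\<eta> * (norm ?v)\<^sup>2) + (Ma * norm ?v)\<^sup>2"
      proof -
        have "2 * l * (\<eta> * (norm ?v)\<^sup>2) \<le> 2 * l * (a t ?v \<bullet> ?v)" using coercive[OF t, of ?v] l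
          by (intro mult_left_mono) auto
        moreover have "(norm (a t ?v))\<^sup>2 \<le> (Ma * norm ?v)\<^sup>2" using b by (intro power_mono) auto
        ultimately show ?thesis by linarith
      qed
      also have "\<dots> = (q * norm ?v)\<^sup>2"
      proof -
        have "l * \<eta> = Ma\<^sup>2" using \<eta> by (simp add: l_def)
        then have "2 * l * (\<eta> * (norm ?v)\<^sup>2) = 2 * (Ma\<^sup>2 * (norm ?v)\<^sup>2)" by (metis mult.assoc)
        moreover have "(q * norm ?v)\<^sup>2 = l\<^sup>2 * (norm ?v)\<^sup>2 - Ma\<^sup>2 * (norm ?v)\<^sup>2"
          by (simp add: power_mult_distrib q2 left_diff_distrib)
        moreover have "(Ma * norm ?v)\<^sup>2 = Ma\<^sup>2 * (norm ?v)\<^sup>2" by (rule power_mult_distrib)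
        ultimately show ?thesis by linarith
      qed
      finally show "norm (l *\<^sub>R ?v - a t ?v) \<le> q * norm ?v" by (rule power2_le_imp_le) (use q0 in auto)
    qed
    from L2_bound(2)[OF y L2_measurable[OF L] this q0] L show ?thesis by blast
  qed
  define P where "P y z \<longleftrightarrow> (\<exists>c. wpair X z (\<lambda>t. (F t + (l *\<^sub>R y t - a t (y t))) - l *\<^sub>R z t) c \<and> c 0 = h)"
    for y z
  obtain e \<mu> where "gelfand_basis T j X e \<mu>" using obtain_basis X by blast
  then interpret B: gelfand_basis T j X e \<mu> .
  have "\<exists>z. P y z" if "y \<in> L2 T" for y
    unfolding P_def using B.reference_solution[OF l L2_add[OF F conjunct1[OF shift[OF that]]] h]
      by blast
  then obtain G where G: "\<And>y. y \<in> L2 T \<Longrightarrow> P y (G y)" by metis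
  have GL: "G y \<in> L2_into T X" if "y \<in> L2 T" for y using G[OF that] wpairD(1) unfolding P_def by blast
  have contr: "L2_norm T (\<lambda>t. G y1 t - G y2 t) \<le> k * L2_norm T (\<lambda>t. y1 t - y2 t)"
    if y: "y1 \<in> L2 T" "y2 \<in> L2 T" for y1 y2
  proof -
    obtain c1 where c1: "wpair X (G y1) (\<lambda>t. (F t + (l *\<^sub>R y1 t - a t (y1 t))) - l *\<^sub>R G y1 t) c1" "c1 0
      = h"
      using G[OF y(1)] unfolding P_def by blast
    obtain c2 where c2: "wpair X (G y2) (\<lambda>t. (F t + (l *\<^sub>R y2 t - a t (y2 t))) - l *\<^sub>R G y2 t) c2" "c2 0
      = h"
      using G[OF y(2)] unfolding P_def by blast
    let ?d = "\<lambda>t. y1 t - y2 t"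
    have d: "?d \<in> L2 T" using y by auto
    have "l * L2_norm T (\<lambda>t. G y1 t - G y2 t) \<le> L2_norm T (\<lambda>t. l *\<^sub>R ?d t - a t (?d t))"
    proof (rule wpair_energy_zero[OF X wpair_diff[OF X(1) c1(1) c2(1)] _ l])
      show "(\<lambda>t. l *\<^sub>R ?d t - a t (?d t)) \<in> L2 T" using shift[OF d] by blast
      show "c1 0 - c2 0 = 0" using c1 c2 by simp
      show "AE t in ?M. (F t + (l *\<^sub>R y1 t - a t (y1 t)) - l *\<^sub>R G y1 t - (F t
        + (l *\<^sub>R y2 t - a t (y2 t)) - l *\<^sub>R G y2 t)) \<bullet> (G y1 t - G y2 t)
          \<le> (l *\<^sub>R ?d t - a t (?d t)) \<bullet> (G y1 t - G y2 t) - l * (norm (G y1 t - G y2 t))\<^sup>2"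
      proof (rule AE_I2)
        fix t
        have "F t + (l *\<^sub>R y1 t - a t (y1 t)) - l *\<^sub>R G y1 t - (F t
          + (l *\<^sub>R y2 t - a t (y2 t)) - l *\<^sub>R G y2 t)
           = (l *\<^sub>R ?d t - a t (?d t)) - l *\<^sub>R (G y1 t - G y2 t)"
          by (simp add: blinfun.diff_right algebra_simps)
        then show "(F t + (l *\<^sub>R y1 t - a t (y1 t)) - l *\<^sub>R G y1 t - (F t
          + (l *\<^sub>R y2 t - a t (y2 t)) - l *\<^sub>R G y2 t)) \<bullet> (G y1 t - G y2 t)
          \<le> (l *\<^sub>R ?d t - a t (?d t)) \<bullet> (G y1 t - G y2 t) - l * (norm (G y1 t - G y2 t))\<^sup>2"
          by (simp only: inner_diff_left[of "l *\<^sub>R ?d t - a t (?d t)"] inner_scaleR_left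
            power2_norm_eq_inner)
      qed
    qed
    also have "\<dots> \<le> q * L2_norm T ?d" using shift[OF d] by blast
    finally show ?thesis using l by (simp add: k_def field_simps)
  qed
  define ys where "ys n = (G ^^ n) (\<lambda>t. 0)" for n
  have ysL: "ys n \<in> L2_into T X" for n
  proof (induction n)
    case 0 show ?case using subspace_0[OF X(1)] by (simp add: ys_def L2_into_def)
  next
    case (Suc n)
    then have "ys n \<in> L2 T" by (rule L2_into_D)
    from GL[OF this] show ?case by (simp add: ys_def)
  qed
  have ysL2: "ys n \<in> L2 T" for n using ysL L2_into_D(1) by blast
  have ysS: "ys (Suc n) = G (ys n)" for n by (simp add: ys_def)
  define D where "D = L2_norm T (\<lambda>t. ys 1 t - ys 0 t)"
  have geo: "L2_norm T (\<lambda>t. ys (Suc n) t - ys n t) \<le> k ^ n * D" for n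
  proof (induction n)
    case 0 show ?case by (simp add: D_def)
  next
    case (Suc n)
    have "L2_norm T (\<lambda>t. ys (Suc (Suc n)) t - ys (Suc n) t) \<le> k * L2_norm T (\<lambda>t. ys (Suc n) t - ys n t)"
      using contr[OF ysL2[of "Suc n"] ysL2[of n]] by (simp only: ysS)
    also have "\<dots> \<le> k * (k ^ n * D)" using Suc k by (intro mult_left_mono) auto
    finally show ?case by simp
  qed
  have ysdiff: "L2_norm T (\<lambda>t. ys n t - ys m t) \<le> (\<Sum>i=m..<n. k ^ i * D)" if "m \<le> n" for m n
    using that
  proof (induction n rule: dec_induct)
    case base show ?case by simp
  next
    case (step n)
    have "L2_norm T (\<lambda>t. ys (Suc n) t - ys m t) \<le> L2_norm T (\<lambda>t. ys (Suc n) t - ys n t)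
      + L2_norm T (\<lambda>t. ys n t - ys m t)"
      by (rule L2_norm_diff_triangle[OF ysL2 ysL2 ysL2])
    with geo[of n] step show ?case by simp
  qed
  have "summable (\<lambda>i. k ^ i * D)" using k by (intro summable_mult2 summable_geometric) auto
  then have tail: "\<exists>N. \<forall>m\<ge>N. \<forall>n. norm (\<Sum>i=m..<n. k ^ i * D) < d" if "d > 0" for d using that
    unfolding summable_Cauchy by blast
  have cauchy: "\<exists>N. \<forall>m\<ge>N. \<forall>n\<ge>N. L2_norm T (\<lambda>t. ys m t - ys n t) < d" if d: "d > 0" for d
  proof -
    obtain N where N: "\<And>m n. m \<ge> N \<Longrightarrow> norm (\<Sum>i=m..<n. k ^ i * D) < d" using tail[OF d] by blast
    have lt: "L2_norm T (\<lambda>t. ys n t - ys m t) < d" if "N \<le> m" "m \<le> n" for m n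
      using ysdiff[OF that(2)] N[OF that(1), of n] by (simp only: real_norm_def)
    have "L2_norm T (\<lambda>t. ys m t - ys n t) < d" if "m \<ge> N" "n \<ge> N" for m n
      using lt[of m n] lt[of n m] that by (cases "m
        \<le> n") (auto simp: L2_norm_minus_commute[of T "ys m"])
    then show ?thesis by blast
  qed
  from L2_into_complete[OF T0 X(2) ysL cauchy] obtain y where y: "y \<in> L2_into T X" "(\<lambda>n. L2_norm T (\<lambda>t.
    ys n t - y t)) \<longlonglongrightarrow> 0" by blast
  have yL: "y \<in> L2 T" using y(1) L2_into_D by blast
  have zL: "G y \<in> L2 T" using GL[OF yL] L2_into_D by blast
  have "(\<lambda>n. k * L2_norm T (\<lambda>t. ys n t - y t) + L2_norm T (\<lambda>t. ys (Suc n) t - y t)) \<longlonglongrightarrow> k * 0 + 0"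
    by (intro tendsto_intros y(2) LIMSEQ_Suc[OF y(2)])
  moreover have "L2_norm T (\<lambda>t. G y t - y t) \<le> k * L2_norm T (\<lambda>t. ys n t - y t)
    + L2_norm T (\<lambda>t. ys (Suc n) t - y t)" for n
    using L2_norm_diff_triangle[OF zL ysL2[of "Suc n"] yL] contr[OF yL ysL2[of n]]
    by (simp only: ysS L2_norm_minus_commute[of T y])
  ultimately have "L2_norm T (\<lambda>t. G y t - y t) \<le> 0" by (intro LIMSEQ_le_const) auto
  then have "L2_norm T (\<lambda>t. G y t - y t) = 0" by (simp add: order_antisym)
  then have eq: "AE t in ?M. G y t - y t = 0" using L2_norm_zero_iff[OF L2_diff[OF zL yL]] by blast
  \<comment> \<open>The fixed point equation holds only almost everywhere, so the solution that is
    returned is \<open>G y\<close>, which carries a continuous representative by construction, and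
    not \<open>y\<close> itself.\<close>
  obtain c where c: "wpair X (G y) (\<lambda>t. (F t + (l *\<^sub>R y t - a t (y t))) - l *\<^sub>R G y t) c" "c 0 = h"
    using G[OF yL] unfolding P_def by blast
  have "wpair X (G y) (\<lambda>t. F t - a t (G y t)) c"
  proof (rule wpair_cong_derivative[OF c(1)])
    show "(\<lambda>t. F t - a t (G y t)) \<in> L2 T" by (intro L2_diff F a_L2 zL)
    show "AE t in ?M. \<forall>w\<in>X. (F t + (l *\<^sub>R y t - a t (y t)) - l *\<^sub>R G y t) \<bullet> w = (F t - a t (G y t)) \<bullet> w"
      using eq by eventually_elim simp
  qed
  then show ?thesis using c(2) by blast
qed

end

section \<open>Galerkin convergence\<close>

lemma L2_norm_coeff_le:
  fixes g :: "real \<Rightarrow> 'a::{real_inner, banach, second_countable_topology}"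
    and x :: "'b::{real_inner, banach, second_countable_topology}"
  assumes g: "g \<in> L2 T"
  shows "(\<lambda>t. (r * (g t \<bullet> w)) *\<^sub>R x) \<in> L2 T" "L2_norm T (\<lambda>t. (r * (g t \<bullet> w)) *\<^sub>R x)
    \<le> (\<bar>r\<bar> * norm w * norm x) * L2_norm T g"
proof -
  have L: "(\<lambda>t. (r * (g t \<bullet> w)) *\<^sub>R x) \<in> L2 T"
    by (rule L2_bounded_linear[OF g]) (intro bounded_linear_intros bounded_linear_compose[OF
      bounded_linear_mult_right])
  have "AE t in time_measure T. norm ((r * (g t \<bullet> w)) *\<^sub>R x) \<le> (\<bar>r\<bar> * norm w * norm x) * norm (g t)"
  proof (rule AE_I2)
    fix t
    have "\<bar>r\<bar> * \<bar>g t \<bullet> w\<bar> * norm x \<le> \<bar>r\<bar> * (norm (g t) * norm w) * norm x"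
      by (intro mult_right_mono mult_left_mono Cauchy_Schwarz_ineq2) auto
    then show "norm ((r * (g t \<bullet> w)) *\<^sub>R x) \<le> (\<bar>r\<bar> * norm w * norm x) * norm (g t)"
      by (simp add: abs_mult mult_ac)
  qed
  with L show "(\<lambda>t. (r * (g t \<bullet> w)) *\<^sub>R x) \<in> L2 T" "L2_norm T (\<lambda>t. (r * (g t \<bullet> w)) *\<^sub>R x)
    \<le> (\<bar>r\<bar> * norm w * norm x) * L2_norm T g"
    using L2_bound(2)[OF g L2_measurable[OF L], of "\<bar>r\<bar> * norm w * norm x"] by auto
qed

lemma subspace_UN_increasing:
  fixes Xs :: "nat \<Rightarrow> 'a::real_vector set"
  assumes Xs: "\<And>k. subspace (Xs k)" and inc: "\<And>k m. k \<le> m \<Longrightarrow> Xs k \<subseteq> Xs m"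
  shows "subspace (\<Union>k. Xs k)"
proof (rule subspaceI)
  show "0 \<in> (\<Union>k. Xs k)" using subspace_0[OF Xs] by blast
  show "x + z \<in> (\<Union>k. Xs k)" if xz: "x \<in> (\<Union>k. Xs k)" "z \<in> (\<Union>k. Xs k)" for x z
  proof -
    obtain m n where "x \<in> Xs m" "z \<in> Xs n" using xz by blast
    then have "x \<in> Xs (max m n)" "z \<in> Xs (max m n)" using inc[of m "max m n"] inc[of n "max m n"]
      by auto
    then show ?thesis using subspace_add[OF Xs] by blast
  qed
  show "r *\<^sub>R x \<in> (\<Union>k. Xs k)" if "x \<in> (\<Union>k. Xs k)" for r x using that subspace_scale[OF Xs] by blast
qed

lemma orth_proj_increasing_tendsto:
  fixes Xs :: "nat \<Rightarrow> 'a::{real_inner, banach} set"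
  assumes Xs: "\<And>k. subspace (Xs k)" "\<And>k. closed (Xs k)" and inc: "\<And>k m. k \<le> m \<Longrightarrow> Xs k \<subseteq> Xs m"
    and x: "x \<in> closure (\<Union>k. Xs k)"
  shows "(\<lambda>k. orth_proj (Xs k) x) \<longlonglongrightarrow> x"
proof (rule LIMSEQ_I)
  fix r :: real assume "r > 0"
  then obtain w where w: "w \<in> (\<Union>k. Xs k)" "dist w x < r" using x unfolding closure_approachable by blast
  then obtain k0 where k0: "w \<in> Xs k0" by blast
  have "norm (orth_proj (Xs k) x - x) < r" if "k \<ge> k0" for k
  proof -
    have "w \<in> Xs k" using inc[OF that] k0 by blast
    from orth_proj_best[OF Xs(1) Xs(2) this, of x] w(2) show ?thesis
      by (simp add: dist_norm norm_minus_commute)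
  qed
  then show "\<exists>no. \<forall>k\<ge>no. norm (orth_proj (Xs k) x - x) < r" by blast
qed

context gelfand_basis
begin

text \<open>The coefficient is read off the representative with values in \<open>H\<close>, which
  makes it continuous and meaningful at time 0; almost everywhere it is the coefficient of
  \<open>y\<close> in \<open>V\<close>.\<close>

definition coord :: "(real \<Rightarrow> 'h) \<Rightarrow> nat \<Rightarrow> real \<Rightarrow> real" where
  "coord c i t = (c t \<bullet> j (e i)) / \<mu> i"

lemma coord_continuous: "wpair X y g c \<Longrightarrow> continuous_on {0..T} (coord c i)"
  unfolding coord_def using \<mu>[of i] by (intro continuous_intros wpairD) auto

lemma coord_AE: "wpair X y g c \<Longrightarrow> AE t in time_measure T. coord c i t = y t \<bullet> e i"
proof -
  assume 1: "wpair X y g c"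
  show ?thesis using wpairD(3)[OF 1] wpairD(6)[OF 1]
  proof eventually_elim
    fix t assume "y t \<in> X" "c t = j (y t)"
    then show "coord c i t = y t \<bullet> e i"
      using je[of "y t" i] \<mu>[of i] by (simp add: coord_def inner_commute)
  qed
qed

lemma coord_eq:
  assumes 1: "wpair X y g c" and t: "t \<in> {0..T}"
  shows "coord c i t = coord c i 0 + prim T (\<lambda>s. (1 / \<mu> i) * (g s \<bullet> e i)) t"
  using wpairD(7)[OF 1 eX t, of i] unfolding prim_cmult by (simp add: coord_def add_divide_distrib)

text \<open>The coefficients are absolutely continuous scalar functions, so the basis vectors may be
  exchanged for arbitrary \<open>x i\<close> while the derivative stays square integrable. The
  functional \<open>j (x i) \<bullet> j w\<close> on \<open>V\<close> is represented through the
  adjoint of \<open>j\<close>.\<close>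

lemma wpair_finite_combination:
  assumes 1: "wpair X y g c" and Y: "subspace Y" and x: "\<And>i. i < n \<Longrightarrow> x i \<in> Y"
  shows "wpair Y (\<lambda>t. \<Sum>i<n. coord c i t *\<^sub>R x i)
    (\<lambda>t. \<Sum>i<n. ((1 / \<mu> i) * (g t \<bullet> e i)) *\<^sub>R blinfun_adjoint j (j (x i)))
    (\<lambda>t. j (\<Sum>i<n. coord c i t *\<^sub>R x i))"
proof -
  have cont: "continuous_on {0..T} (\<lambda>t. \<Sum>i<n. coord c i t *\<^sub>R x i)"
    by (intro continuous_intros coord_continuous[OF 1])
  show ?thesis
    unfolding wpair_def
  proof (intro conjI ballI)
    show "(\<lambda>t. \<Sum>i<n. coord c i t *\<^sub>R x i) \<in> L2_into T Y"
      using continuous_on_L2[OF cont] x Y by (auto simp: L2_into_def intro!: AE_I2 subspace_sum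
        subspace_scale)
    show "(\<lambda>t. \<Sum>i<n. ((1 / \<mu> i) * (g t \<bullet> e i)) *\<^sub>R blinfun_adjoint j (j (x i))) \<in> L2 T"
      by (intro L2_sum L2_norm_coeff_le(1) wpairD(4)[OF 1])
    show "continuous_on {0..T} (\<lambda>t. j (\<Sum>i<n. coord c i t *\<^sub>R x i))" by (intro continuous_intros cont)
    fix w t assume w: "w \<in> Y" and t: "t \<in> {0..T}"
    have jw: "j (\<Sum>i<n. coord c i t *\<^sub>R x i) \<bullet> j w = (\<Sum>i<n. coord c i t * (j (x i) \<bullet> j w))" for t
      by (simp add: blinfun.sum_right blinfun.scaleR_right inner_sum_left)
    have gi: "integrable (time_measure T) (\<lambda>s. g s \<bullet> e i)" for i
      by (rule inner_const_integrable[OF wpairD(4)[OF 1]])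
    have "j (\<Sum>i<n. coord c i t *\<^sub>R x i) \<bullet> j w = (\<Sum>i<n. coord c i t * (j (x i) \<bullet> j w))" by (rule jw)
    also have "\<dots> = (\<Sum>i<n. coord c i 0 * (j (x i) \<bullet> j w)
      + prim T (\<lambda>s. (j (x i) \<bullet> j w) * ((1 / \<mu> i) * (g s \<bullet> e i))) t)"
      unfolding coord_eq[OF 1 t] prim_cmult by (intro sum.cong refl) (simp add: algebra_simps)
    also have "\<dots> = j (\<Sum>i<n. coord c i 0 *\<^sub>R x i) \<bullet> j w
      + prim T (\<lambda>s. \<Sum>i<n. (j (x i) \<bullet> j w) * ((1 / \<mu> i) * (g s \<bullet> e i))) t"
      unfolding jw by (subst prim_sum) (use gi in \<open>auto simp: sum.distrib\<close>)
    also have "(\<lambda>s. \<Sum>i<n. (j (x i) \<bullet> j w) * ((1 / \<mu> i) * (g s \<bullet> e i)))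
      = (\<lambda>s. (\<Sum>i<n. ((1 / \<mu> i) * (g s \<bullet> e i)) *\<^sub>R blinfun_adjoint j (j (x i))) \<bullet> w)"
      by (rule ext) (simp add: inner_sum_left blinfun_adjoint_inner mult_ac)
    finally show "j (\<Sum>i<n. coord c i t *\<^sub>R x i) \<bullet> j w = j (\<Sum>i<n. coord c i 0 *\<^sub>R x i) \<bullet> j w
      + prim T (\<lambda>s. (\<Sum>i<n. ((1 / \<mu> i) * (g s \<bullet> e i)) *\<^sub>R blinfun_adjoint j (j (x i))) \<bullet> w) t" .
  qed auto
qed

end

context evolution
begin

text \<open>
  The Galerkin solution is compared with \<open>w n k\<close>, the \<open>n\<close>-th partial sum of the expansion
  of the limit in an adapted basis, whose basis vectors are projected onto \<open>Xs k\<close>; first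
  \<open>k\<close> and then \<open>n\<close> tends to infinity.
\<close>

lemma galerkin_convergence:
  assumes Xs: "\<And>k. subspace (Xs k)" "\<And>k. closed (Xs k)" and inc: "\<And>k m. k \<le> m \<Longrightarrow> Xs k \<subseteq> Xs m"
    and F: "F \<in> L2 T"
    and yk: "\<And>k. wpair (Xs k) (y k) (\<lambda>t. F t - a t (y k t)) (c k)"
    and ck: "\<And>k. c k 0 = orth_proj (closure (j ` Xs k)) h"
    and y: "wpair (closure (\<Union>k. Xs k)) yy (\<lambda>t. F t - a t (yy t)) cc"
    and cc: "cc 0 = orth_proj (closure (j ` closure (\<Union>k. Xs k))) h"
  shows "(\<lambda>k. L2_norm T (\<lambda>t. y k t - yy t)) \<longlonglongrightarrow> 0"
proof -
  let ?M = "time_measure T"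
  define X where "X = closure (\<Union>k. Xs k)"
  have XsX: "Xs k \<subseteq> X" for k unfolding X_def using closure_subset by fastforce
  have "subspace (\<Union>k. Xs k)" by (rule subspace_UN_increasing[OF Xs(1) inc])
  then have X: "subspace X" "closed X" unfolding X_def by (auto intro: subspace_closure)
  obtain e \<mu> where "gelfand_basis T j X e \<mu>" using obtain_basis X by blast
  then interpret B: gelfand_basis T j X e \<mu> .
  define g where "g t = F t - a t (yy t)" for t
  have y: "wpair X yy g cc" using y unfolding X_def g_def[abs_def] .
  note d = wpairD[OF y]
  \<comment> \<open>On \<open>X\<close> the derivative acts like its projection, which in addition
    has convergent Fourier sums in the adapted basis.\<close>
  define gX where "gX t = orth_proj X (g t)" for t
  have gXL: "gX \<in> L2 T" unfolding gX_def by (rule L2_bounded_linear[OF d(4) orth_proj_bounded_linear[OF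
    X]])
  have gXX: "gX \<in> L2_into T X" using gXL orth_proj_mem[OF X] by (simp add: L2_into_def gX_def)
  have gXe: "gX t \<bullet> e i = g t \<bullet> e i" for t i unfolding gX_def by (rule orth_proj_inner[OF X B.eX])
  let ?P = "\<lambda>k. orth_proj (Xs k)"
  define r where "r k i = e i - ?P k (e i)" for k i
  have r0: "(\<lambda>k. norm (r k i)) \<longlonglongrightarrow> 0" for i
  proof -
    have "(\<lambda>k. e i - ?P k (e i)) \<longlonglongrightarrow> e i - e i"
      by (intro tendsto_diff tendsto_const orth_proj_increasing_tendsto[OF Xs inc]) (use B.eX X_def in
        auto)
    then show ?thesis unfolding r_def by (simp add: tendsto_norm_zero)
  qed
  define w where "w n k t = (\<Sum>i<n. B.coord cc i t *\<^sub>R ?P k (e i))" for n k t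
  define gw where "gw n k t = (\<Sum>i<n. ((1 / \<mu> i) * (g t \<bullet> e i)) *\<^sub>R blinfun_adjoint j (j (?P k (e i))))"
    for n k t
  have w: "wpair (Xs k) (w n k) (gw n k) (\<lambda>t. j (w n k t))" for n k
    unfolding w_def[abs_def] gw_def[abs_def]
    by (rule B.wpair_finite_combination[OF y Xs(1)]) (rule orth_proj_mem[OF Xs])
  have wL: "w n k \<in> L2 T" for n k by (rule wpairD(2)[OF w])
  have yL: "yy \<in> L2 T" and gL: "g \<in> L2 T" using d by auto
  have ykL: "y k \<in> L2 T" for k by (rule wpairD(2)[OF yk])
  have rv0: "(\<lambda>k. r k i) \<longlonglongrightarrow> 0" for i using r0 tendsto_norm_zero_iff by blast
  \<comment> \<open>The six error terms alternate: those with odd number are truncation errors and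
    depend on \<open>n\<close> only, while those with even number contain the projection errors
    \<open>r k i\<close> of finitely many basis vectors and vanish in \<open>k\<close> for fixed
    \<open>n\<close>.\<close>
  define A1 where "A1 n = L2_norm T (\<lambda>t. fourier_sum e n (gX t) - gX t)" for n
  define A2 where "A2 n k = (\<Sum>i<n. (\<bar>1 / \<mu> i\<bar> * norm (e i) * norm (blinfun_adjoint j (j (r k i)))) *
    L2_norm T g)" for n k
  define A3 where "A3 n = L2_norm T (\<lambda>t. fourier_sum e n (yy t) - yy t)" for n
  define A4 where "A4 n k = (\<Sum>i<n. (\<bar>1\<bar> * norm (e i) * norm (r k i)) * L2_norm T yy)" for n k
  define A5 where "A5 n = norm (cc 0 - fourier_sum B.hbasis n (cc 0))" for n
  define A6 where "A6 n k = (\<Sum>i<n. \<bar>B.coord cc i 0\<bar> * norm (j (r k i)))" for n k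
  have A2z: "A2 n \<longlonglongrightarrow> 0" for n
  proof -
    have "A2 n \<longlonglongrightarrow> (\<Sum>i<n. (\<bar>1 / \<mu> i\<bar> * norm (e i) * norm (blinfun_adjoint j (j 0))) * L2_norm T g)"
      unfolding A2_def by (intro tendsto_intros rv0)
    then show ?thesis by simp
  qed
  have A4z: "A4 n \<longlonglongrightarrow> 0" for n
  proof -
    have "A4 n \<longlonglongrightarrow> (\<Sum>i<n. (\<bar>1\<bar> * norm (e i) * norm (0::'v)) * L2_norm T yy)"
      unfolding A4_def by (intro tendsto_intros rv0)
    then show ?thesis by simp
  qed
  have A6z: "A6 n \<longlonglongrightarrow> 0" for n
  proof -
    have "A6 n \<longlonglongrightarrow> (\<Sum>i<n. \<bar>B.coord cc i 0\<bar> * norm (j 0))"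
      unfolding A6_def by (intro tendsto_intros rv0)
    then show ?thesis by simp
  qed
  have A1z: "A1 \<longlonglongrightarrow> 0" unfolding A1_def by (rule B.fourier_L2_tendsto[OF gXX])
  have A3z: "A3 \<longlonglongrightarrow> 0" unfolding A3_def by (rule B.fourier_L2_tendsto[OF d(1)])
  have A5z: "A5 \<longlonglongrightarrow> 0"
  proof -
    have "cc 0 \<in> closure (j ` X)" using wpair_closure[OF y, of 0] T by simp
    then have "A5 \<longlonglongrightarrow> norm (cc 0 - cc 0)" unfolding A5_def by (intro tendsto_intros B.fourier_H)
    then show ?thesis by simp
  qed
  have yw: "(\<lambda>t. yy t - w n k t) \<in> L2 T" for n k by (intro L2_diff yL wL)
  have yw_le: "L2_norm T (\<lambda>t. yy t - w n k t) \<le> A3 n + A4 n k" for n k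
  proof -
    have s: "(\<lambda>t. (1 * (yy t \<bullet> e i)) *\<^sub>R r k i) \<in> L2 T" for i by (rule L2_norm_coeff_le(1)[OF yL])
    have fL: "(\<lambda>t. fourier_sum e n (yy t) - yy t) \<in> L2 T" by (intro L2_diff B.fourier_L2 yL)
    have sL: "(\<lambda>t. \<Sum>i<n. (1 * (yy t \<bullet> e i)) *\<^sub>R r k i) \<in> L2 T" by (intro L2_sum s)
    have "AE t in ?M. \<forall>i. B.coord cc i t = yy t \<bullet> e i" unfolding AE_all_countable using B.coord_AE[OF y]
      by blast
    then have "AE t in ?M. yy t - w n k t = (\<Sum>i<n. (1 * (yy t \<bullet> e i)) *\<^sub>R r k i) - (fourier_sum e n (yy
      t) - yy t)"
      by eventually_elim (simp add: w_def r_def fourier_sum_def scaleR_diff_right sum_subtractf)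
    then have "L2_norm T (\<lambda>t. yy t - w n k t) = L2_norm T (\<lambda>t. (\<Sum>i<n. (1 * (yy t \<bullet> e i)) *\<^sub>R r k i) -
      (fourier_sum e n (yy t) - yy t))"
      by (intro L2_norm_cong_AE L2_measurable yw L2_diff[OF sL fL])
    also have "\<dots> \<le> L2_norm T (\<lambda>t. \<Sum>i<n. (1 * (yy t \<bullet> e i)) *\<^sub>R r k i) + A3 n"
      unfolding A3_def by (rule L2_norm_triangle_diff[OF sL fL])
    also have "L2_norm T (\<lambda>t. \<Sum>i<n. (1 * (yy t \<bullet> e i)) *\<^sub>R r k i)
      \<le> (\<Sum>i<n. L2_norm T (\<lambda>t. (1 * (yy t \<bullet> e i)) *\<^sub>R r k i))"
      by (rule L2_norm_sum_le[OF s])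
    also have "\<dots> \<le> A4 n k" unfolding A4_def by (intro sum_mono L2_norm_coeff_le(2)[OF yL])
    finally show ?thesis by simp
  qed
  \<comment> \<open>The consistency error when \<open>w n k\<close> is inserted into the Galerkin
    equation: truncation of the derivative, exchange of basis vectors for their projections, and the
    operator applied to the distance from the limit.\<close>
  define Fd where "Fd n k t = (gX t - fourier_sum e n (gX t))
    + (\<Sum>i<n. ((1 / \<mu> i) * (g t \<bullet> e i)) *\<^sub>R blinfun_adjoint j (j (r k i)))
      + a t (yy t - w n k t)" for n k t
  have Fd_parts: "(\<lambda>t. gX t - fourier_sum e n (gX t)) \<in> L2 T"
     "(\<lambda>t. ((1 / \<mu> i) * (g t \<bullet> e i)) *\<^sub>R blinfun_adjoint j (j (r k i))) \<in> L2 T"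
     "(\<lambda>t. a t (yy t - w n k t)) \<in> L2 T" for n k i
    by (intro L2_diff B.fourier_L2 gXL, rule L2_norm_coeff_le(1)[OF gL], rule a_L2(1)[OF yw])
  have FdL: "Fd n k \<in> L2 T" for n k
    unfolding Fd_def[abs_def] by (intro L2_add L2_sum Fd_parts)
  have Fd_le: "L2_norm T (Fd n k) \<le> A1 n + A2 n k + Ma * (A3 n + A4 n k)" for n k
  proof -
    have "L2_norm T (Fd n k) \<le> L2_norm T (\<lambda>t. (gX t - fourier_sum e n (gX t))
      + (\<Sum>i<n. ((1 / \<mu> i) * (g t \<bullet> e i)) *\<^sub>R blinfun_adjoint j (j (r k i))))
      + L2_norm T (\<lambda>t. a t (yy t - w n k t))"
      unfolding Fd_def[abs_def] by (intro L2_norm_triangle L2_add L2_sum Fd_parts)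
    moreover have "L2_norm T (\<lambda>t. (gX t - fourier_sum e n (gX t))
      + (\<Sum>i<n. ((1 / \<mu> i) * (g t \<bullet> e i)) *\<^sub>R blinfun_adjoint j (j (r k i))))
        \<le> A1 n + L2_norm T (\<lambda>t. \<Sum>i<n. ((1 / \<mu> i) * (g t \<bullet> e i)) *\<^sub>R blinfun_adjoint j (j (r k i)))"
      unfolding A1_def L2_norm_minus_commute[of T "\<lambda>t. fourier_sum e n (gX t)"]
        by (intro L2_norm_triangle L2_sum Fd_parts)
    moreover have "L2_norm T (\<lambda>t. \<Sum>i<n. ((1 / \<mu> i) * (g t \<bullet> e i)) *\<^sub>R blinfun_adjoint j (j (r k i)))
      \<le> (\<Sum>i<n. L2_norm T (\<lambda>t. ((1 / \<mu> i) * (g t \<bullet> e i)) *\<^sub>R blinfun_adjoint j (j (r k i))))"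
      by (rule L2_norm_sum_le) (rule Fd_parts)
    moreover have "\<dots> \<le> A2 n k" unfolding A2_def by (intro sum_mono L2_norm_coeff_le(2)[OF gL])
    moreover have "L2_norm T (\<lambda>t. a t (yy t - w n k t)) \<le> Ma * (A3 n + A4 n k)"
      using a_L2(2)[OF yw[of n k]] mult_left_mono[OF yw_le[of n k], of Ma] Ma \<eta> by linarith
    ultimately show ?thesis by linarith
  qed
  have z_in: "AE t in ?M. y k t - w n k t \<in> Xs k" for n k
    using wpairD(3)[OF yk, of k] wpairD(3)[OF w, of n k]
      by eventually_elim (rule subspace_diff[OF Xs(1)])
  have jXs: "subspace (closure (j ` Xs k))" "closed (closure (j ` Xs k))" for k
    by (auto intro!: subspace_closure linear_subspace_image Xs bounded_linear.linear
      blinfun.bounded_linear_right)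
  have jX: "subspace (closure (j ` X))" "closed (closure (j ` X))"
    by (auto intro!: subspace_closure linear_subspace_image X bounded_linear.linear
      blinfun.bounded_linear_right)
  have c0_le: "norm (c k 0 - j (w n k 0)) \<le> A5 n + A6 n k" for n k
  proof -
    let ?Q = "orth_proj (closure (j ` Xs k))"
    have wX: "w n k 0 \<in> Xs k" unfolding w_def using orth_proj_mem[OF Xs] Xs(1)
      by (intro subspace_sum subspace_scale) auto
    \<comment> \<open>Projections onto nested spaces compose, so the discrete initial value is also
      the projection of the limit initial value.\<close>
    have 1: "c k 0 = ?Q (cc 0)"
      unfolding ck
    proof (rule orth_proj_unique[OF jXs])
      show "?Q (cc 0) \<in> closure (j ` Xs k)" by (rule orth_proj_mem[OF jXs])
      fix v assume v: "v \<in> closure (j ` Xs k)"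
      then have v': "v \<in> closure (j ` X)" using closure_mono[OF image_mono[OF XsX[of k]], of j] by blast
      have "?Q (cc 0) \<bullet> v = cc 0 \<bullet> v" by (rule orth_proj_inner[OF jXs v])
      also have "cc 0 \<bullet> v = h \<bullet> v" unfolding cc X_def[symmetric] by (rule orth_proj_inner[OF jX v'])
      finally show "?Q (cc 0) \<bullet> v = h \<bullet> v" .
    qed
    have 2: "j (w n k 0) = ?Q (j (w n k 0))"
      by (rule orth_proj_id[OF jXs, symmetric]) (rule subsetD[OF closure_subset imageI[OF wX]])
    have jw: "j (w n k 0) = fourier_sum B.hbasis n (cc 0) - (\<Sum>i<n. B.coord cc i 0 *\<^sub>R j (r k i))"
    proof -
      have "(cc 0 \<bullet> B.hbasis i) *\<^sub>R B.hbasis i = B.coord cc i 0 *\<^sub>R j (e i)" for i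
      proof -
        have "sqrt (\<mu> i) * sqrt (\<mu> i) = \<mu> i" using B.\<mu>[of i] by simp
        then show ?thesis by (simp add: B.hbasis_def B.coord_def)
      qed
      then show ?thesis
        by (simp add: w_def r_def fourier_sum_def blinfun.sum_right blinfun.scaleR_right
          blinfun.diff_right scaleR_diff_right sum_subtractf)
    qed
    have "norm (c k 0 - j (w n k 0)) = norm (?Q (cc 0 - j (w n k 0)))"
      unfolding orth_proj_diff[OF jXs] 2[symmetric] 1 by simp
    also have "\<dots> \<le> norm (cc 0 - j (w n k 0))" by (rule orth_proj_norm_le[OF jXs])
    also have "norm (cc 0 - j (w n k 0)) = norm (cc 0 - (fourier_sum B.hbasis n (cc 0) - (\<Sum>i<n. B.coord
      cc i 0 *\<^sub>R j (r k i))))"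
      by (simp only: jw)
    also have "norm (cc 0 - (fourier_sum B.hbasis n (cc 0) - (\<Sum>i<n. B.coord cc i 0 *\<^sub>R j (r k i))))
      \<le> A5 n + norm (\<Sum>i<n. B.coord cc i 0 *\<^sub>R j (r k i))"
      unfolding A5_def using norm_triangle_ineq[of "cc 0 - fourier_sum B.hbasis n (cc 0)" "\<Sum>i<n. B.coord
        cc i 0 *\<^sub>R j (r k i)"]
      by (simp add: algebra_simps)
    also have "norm (\<Sum>i<n. B.coord cc i 0 *\<^sub>R j (r k i)) \<le> A6 n k"
      unfolding A6_def by (rule order_trans[OF norm_sum]) simp
    finally show ?thesis by simp
  qed
  have z_le: "\<eta> * L2_norm T (\<lambda>t. y k t - w n k t) \<le> A1 n + A2 n k + Ma * (A3 n + A4 n k)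
    + sqrt \<eta> * (A5 n + A6 n k)" for n k
  proof -
    let ?z = "\<lambda>t. y k t - w n k t"
    have le: "AE t in ?M. (F t - a t (y k t) - gw n k t) \<bullet> ?z t \<le> Fd n k t \<bullet> ?z t - \<eta> * (norm (?z t))\<^sup>2"
      using z_in[of k n] AE_time
    proof eventually_elim
      fix t assume z: "?z t \<in> Xs k" and t: "t \<in> {0<..<T}"
      have zX: "?z t \<in> X" using z XsX by blast
      have g1: "g t \<bullet> ?z t = gX t \<bullet> ?z t" unfolding gX_def by (rule orth_proj_inner[OF X zX, symmetric])
      have gw1: "gw n k t \<bullet> ?z t = fourier_sum e n (gX t) \<bullet> ?z t - (\<Sum>i<n. ((1 / \<mu> i) * (g t \<bullet> e i)) *\<^sub>R
        blinfun_adjoint j (j (r k i))) \<bullet> ?z t"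
      proof -
        have "((1 / \<mu> i) * (g t \<bullet> e i)) * (j (?P k (e i)) \<bullet> j (?z t))
          = (gX t \<bullet> e i) * (e i \<bullet> ?z t) - ((1 / \<mu> i) * (g t \<bullet> e i)) * (j (r k i) \<bullet> j (?z t))" for i
        proof -
          have "j (?P k (e i)) \<bullet> j (?z t) = \<mu> i * (e i \<bullet> ?z t) - j (r k i) \<bullet> j (?z t)"
            using B.je[OF zX, of i] by (simp add: r_def blinfun.diff_right inner_diff_left)
          then show ?thesis using B.\<mu>[of i] by (simp add: gXe right_diff_distrib)
        qed
        then show ?thesis
          unfolding gw_def fourier_sum_def inner_sum_left inner_scaleR_left blinfun_adjoint_inner
            sum_subtractf[symmetric]
          by (intro sum.cong refl)
      qed
      have "F t - a t (y k t) = g t + a t (yy t - w n k t) - a t (?z t)"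
        by (simp add: g_def blinfun.diff_right)
      then have "(F t - a t (y k t) - gw n k t) \<bullet> ?z t = Fd n k t \<bullet> ?z t - a t (?z t) \<bullet> ?z t"
        using g1 gw1 by (simp only: Fd_def inner_add_left inner_diff_left[where z = "?z t"])
      then show "(F t - a t (y k t) - gw n k t) \<bullet> ?z t \<le> Fd n k t \<bullet> ?z t - \<eta> * (norm (?z t))\<^sup>2"
        using coercive[OF t, of "?z t"] by linarith
    qed
    have "\<eta>\<^sup>2 * (L2_norm T ?z)\<^sup>2 \<le> (L2_norm T (Fd n k))\<^sup>2 + \<eta> * (norm (c k 0 - j (w n k 0)))\<^sup>2"
      by (rule wpair_energy(1)[OF Xs wpair_diff[OF Xs(1) yk w] FdL \<eta> le])
    \<comment> \<open>The sum of squares is enlarged to a perfect square, so that the root turns the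
      energy estimate into a linear one.\<close>
    also have "\<dots> \<le> (L2_norm T (Fd n k) + sqrt \<eta> * norm (c k 0 - j (w n k 0)))\<^sup>2"
      using \<eta> by (simp add: power2_sum power_mult_distrib)
    finally have "(\<eta> * L2_norm T ?z)\<^sup>2 \<le> (L2_norm T (Fd n k) + sqrt \<eta> * norm (c k 0 - j (w n k 0)))\<^sup>2"
      by (simp add: power_mult_distrib)
    then have "\<eta> * L2_norm T ?z \<le> L2_norm T (Fd n k) + sqrt \<eta> * norm (c k 0 - j (w n k 0))"
      by (rule power2_le_imp_le) (use \<eta> in auto)
    moreover have "sqrt \<eta> * norm (c k 0 - j (w n k 0)) \<le> sqrt \<eta> * (A5 n + A6 n k)" using \<eta>
      by (intro mult_left_mono c0_le) auto
    ultimately show ?thesis using Fd_le[of n k] by linarith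
  qed
  show ?thesis
  proof (rule null_two_parameters[where K = "\<lambda>n. (A1 n + Ma * A3 n + sqrt \<eta> * A5 n) / \<eta> + A3 n" and L
    = "\<lambda>n k. (A2 n k + Ma * A4 n k + sqrt \<eta> * A6 n k) / \<eta> + A4 n k"])
    fix n k
    have "L2_norm T (\<lambda>t. y k t - yy t) \<le> L2_norm T (\<lambda>t. y k t - w n k t)
      + L2_norm T (\<lambda>t. w n k t - yy t)"
      by (rule L2_norm_diff_triangle[OF ykL wL yL])
    moreover have "L2_norm T (\<lambda>t. w n k t - yy t) \<le> A3 n + A4 n k" using yw_le
      by (simp add: L2_norm_minus_commute[of T "w n k"])
    moreover have "L2_norm T (\<lambda>t. y k t - w n k t) \<le> (A1 n + A2 n k + Ma * (A3 n + A4 n k)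
      + sqrt \<eta> * (A5 n + A6 n k)) / \<eta>"
      using z_le[of k n] \<eta> by (simp add: pos_le_divide_eq mult.commute)
    moreover have "(A1 n + A2 n k + Ma * (A3 n + A4 n k) + sqrt \<eta> * (A5 n + A6 n k)) / \<eta>
       = (A1 n + Ma * A3 n + sqrt \<eta> * A5 n) / \<eta> + (A2 n k + Ma * A4 n k + sqrt \<eta> * A6 n k) / \<eta>"
      by (simp add: add_divide_distrib distrib_left)
    ultimately show "L2_norm T (\<lambda>t. y k t - yy t) \<le> (A1 n + Ma * A3 n + sqrt \<eta> * A5 n) / \<eta> + A3 n
      + ((A2 n k + Ma * A4 n k + sqrt \<eta> * A6 n k) / \<eta> + A4 n k)"
      by linarith
  next
    have "(\<lambda>n. (A1 n + Ma * A3 n + sqrt \<eta> * A5 n) / \<eta> + A3 n) \<longlonglongrightarrow> (0 + Ma * 0 + sqrt \<eta> * 0) / \<eta> + 0"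
      using \<eta> by (intro tendsto_intros A1z A3z A5z) auto
    then show "(\<lambda>n. (A1 n + Ma * A3 n + sqrt \<eta> * A5 n) / \<eta> + A3 n) \<longlonglongrightarrow> 0" by simp
    fix n
    have "(\<lambda>k. (A2 n k + Ma * A4 n k + sqrt \<eta> * A6 n k) / \<eta> + A4 n k) \<longlonglongrightarrow> (0 + Ma * 0 + sqrt \<eta> * 0) / \<eta>
      + 0"
      using \<eta> by (intro tendsto_intros A2z A4z A6z) auto
    then show "(\<lambda>k. (A2 n k + Ma * A4 n k + sqrt \<eta> * A6 n k) / \<eta> + A4 n k) \<longlonglongrightarrow> 0" by simp
  qed simp
qed

end

section \<open>The control problem in terms of Riesz representatives\<close>

lemma dual_op_apply: "blinfun_apply (dual_op L y) x = L x y"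
  unfolding dual_op_def
  by (subst bounded_linear_Blinfun_apply) (auto intro!: bounded_linear_compose[OF
    blinfun.bounded_linear_left] blinfun.bounded_linear_right)

context gelfand
begin

text \<open>For each fixed \<open>w\<close> the lemma of du Bois-Reymond gives the integrated
  identity up to a constant and almost everywhere. Continuity of both sides extends it to all times,
  and the value at 0 identifies the constant.\<close>

lemma wpair_if_weak:
  assumes y: "y \<in> L2_into T X" and g: "g \<in> L2 T"
    and c: "continuous_on {0..T} c" "AE t in time_measure T. c t = j (y t)"
    and weak: "\<And>\<phi> w. \<phi> \<in> test_functions T \<Longrightarrow> w \<in> X \<Longrightarrow>
      (\<integral>t. deriv \<phi> t * (j (y t) \<bullet> j w) \<partial>time_measure T) = - (\<integral>t. \<phi> t * (g t \<bullet> w) \<partial>time_measure T)"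
  shows "wpair X y g c"
  unfolding wpair_def
proof (intro conjI ballI y g c)
  fix w t assume w: "w \<in> X" and t: "t \<in> {0..T}"
  let ?M = "time_measure T"
  have yL: "y \<in> L2 T" using y L2_into_D by blast
  have gi: "integrable ?M (\<lambda>s. g s \<bullet> w)" by (rule inner_const_integrable[OF g])
  have "(\<lambda>t. j (y t)) \<in> L2 T" by (rule L2_bounded_linear[OF yL blinfun.bounded_linear_right])
  then have "integrable ?M (\<lambda>s. j (y s) \<bullet> j w)" by (rule inner_const_integrable)
  from du_bois_reymond[OF T this gi weak[OF _ w]] obtain b where b: "AE s in ?M. j (y s) \<bullet> j w = b
    + prim T (\<lambda>s. g s \<bullet> w) s"
    by blast
  have eq: "c s \<bullet> j w - (b + prim T (\<lambda>s. g s \<bullet> w) s) \<in> {0}" if s: "s \<in> {0..T}" for s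
  proof (rule AE_continuous_closed[OF _ _ _ T s])
    show "continuous_on {0..T} (\<lambda>s. c s \<bullet> j w - (b + prim T (\<lambda>s. g s \<bullet> w) s))"
      by (intro continuous_intros c prim_continuous[OF gi])
    show "AE s in ?M. c s \<bullet> j w - (b + prim T (\<lambda>s. g s \<bullet> w) s) \<in> {0}"
      using b c(2) by eventually_elim simp
  qed simp
  show "c t \<bullet> j w = c 0 \<bullet> j w + prim T (\<lambda>s. g s \<bullet> w) t"
    using eq[OF t] eq[of 0] T by simp
qed

lemma wpair_weak:
  assumes 1: "wpair X y g c" and \<phi>: "\<phi> \<in> test_functions T" and w: "w \<in> X"
  shows "(\<integral>t. deriv \<phi> t * (j (y t) \<bullet> j w) \<partial>time_measure T) = - (\<integral>t. \<phi> t * (g t \<bullet> w) \<partial>time_measure T)"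
proof (rule prim_weak_deriv[OF \<phi> T])
  show "integrable (time_measure T) (\<lambda>t. g t \<bullet> w)" by (rule inner_const_integrable[OF wpairD(4)[OF 1]])
  show "AE t in time_measure T. j (y t) \<bullet> j w = c 0 \<bullet> j w + prim T (\<lambda>t. g t \<bullet> w) t"
    using wpairD(6)[OF 1] AE_time
  proof eventually_elim
    fix t assume "c t = j (y t)" "t \<in> {0<..<T}"
    then show "j (y t) \<bullet> j w = c 0 \<bullet> j w + prim T (\<lambda>t. g t \<bullet> w) t"
      using wpairD(7)[OF 1 w, of t] by simp
  qed
  have "(\<lambda>t. j (y t)) \<in> L2 T" by (rule L2_bounded_linear[OF wpairD(2)[OF 1]
    blinfun.bounded_linear_right])
  then show "(\<lambda>t. j (y t) \<bullet> j w) \<in> borel_measurable (time_measure T)"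
    using inner_const_integrable by blast
qed

end

text \<open>The constants whose existence the assumptions assert are fixed as parameters, so that
  bounds independent of the subspace can be expressed by them.\<close>

locale optimal_control =
  fixes P :: "('u::{real_inner, banach, second_countable_topology}, 'v::{real_inner, banach,
    second_countable_topology},
     'h::{real_inner, banach, second_countable_topology}) control_problem"
    and Ma \<eta> Kc :: real
  assumes horizon: "horizon P > 0" and embedding: "compact_dense_embedding (emb P)"
    and A_measurable: "\<And>v w. (\<lambda>t. opA P t v w) \<in> borel_measurable (time_measure (horizon P))"
    and A_bounded: "AE t in time_measure (horizon P). norm (opA P t) \<le> Ma"
    and A_coercive: "\<And>t v. t \<in> {0<..<horizon P} \<Longrightarrow> opA P t v v \<ge> \<eta> * (norm v)\<^sup>2"
    and \<eta>_pos: "\<eta> > 0" and \<eta>_le: "\<eta> \<le> Ma"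
    and C_measurable: "\<And>x z. (\<lambda>t. opC P t x \<bullet> z) \<in> borel_measurable (time_measure (horizon P))"
    and C_bounded: "AE t in time_measure (horizon P). norm (opC P t) \<le> Kc" and Kc: "0 \<le> Kc"
    and beta: "beta P > 0" and y_target: "y_target P \<in> L2 (horizon P)"
begin

abbreviation "T \<equiv> horizon P"
abbreviation "j \<equiv> emb P"
abbreviation "\<beta> \<equiv> beta P"

text \<open>Composition with the inverse Riesz isomorphism turns the functional valued operators
  into operators between Hilbert spaces, and dual operators into adjoints.\<close>

definition aop :: "real \<Rightarrow> 'v \<Rightarrow>\<^sub>L 'v" where
  "aop t = Blinfun (\<lambda>v. riesz_inv (opA P t v))"

definition aop_adj :: "real \<Rightarrow> 'v \<Rightarrow>\<^sub>L 'v" where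
  "aop_adj t = blinfun_adjoint (aop t)"

definition bop :: "'u \<Rightarrow>\<^sub>L 'v" where
  "bop = Blinfun (\<lambda>u. riesz_inv (opB P u))"

definition bop_adj :: "'v \<Rightarrow>\<^sub>L 'u" where
  "bop_adj = blinfun_adjoint bop"

lemma aop_apply: "aop t v = riesz_inv (opA P t v)"
  unfolding aop_def
  by (subst bounded_linear_Blinfun_apply)
    (auto intro!: bounded_linear_compose[OF bounded_linear_riesz_inv] blinfun.bounded_linear_right)

lemma bop_apply: "bop u = riesz_inv (opB P u)"
  unfolding bop_def
  by (subst bounded_linear_Blinfun_apply)
    (auto intro!: bounded_linear_compose[OF bounded_linear_riesz_inv] blinfun.bounded_linear_right)

lemma aop_inner: "aop t v \<bullet> w = opA P t v w"
  by (simp add: aop_apply)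

lemma bop_inner: "bop u \<bullet> w = opB P u w"
  by (simp add: bop_apply)

lemma norm_aop: "norm (aop t) \<le> norm (opA P t)"
  by (rule norm_blinfun_bound) (auto simp: aop_apply norm_blinfun)

lemma aop_adj_inner: "aop_adj t v \<bullet> w = opA P t w v"
  by (simp add: aop_adj_def blinfun_adjoint_inner inner_commute[of v] aop_inner)

lemma bop_adj_inner: "bop_adj v \<bullet> u = v \<bullet> bop u"
  by (simp add: bop_adj_def blinfun_adjoint_inner)

lemma riesz_dual_opB: "riesz_inv (dual_op (opB P) v) = bop_adj v"
  by (rule inner_eqI) (simp add: dual_op_apply bop_adj_inner inner_commute[of v] bop_inner)

lemma T0: "0 \<le> T" using horizon by simp

sublocale fw: evolution T j aop Ma \<eta>
proof
  show "0 < T" by (rule horizon)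
  show "inj (blinfun_apply j)" "compact (closure (blinfun_apply j ` cball 0 1))"
    using embedding by (auto simp: compact_dense_embedding_def)
  show "(\<lambda>t. aop t v \<bullet> w) \<in> borel_measurable (time_measure T)" for v w
    unfolding aop_inner by (rule A_measurable)
  show "AE t in time_measure T. norm (aop t) \<le> Ma" using A_bounded
    by eventually_elim (rule order_trans[OF norm_aop])
  show "\<eta> * (norm v)\<^sup>2 \<le> aop t v \<bullet> v" if "t \<in> {0<..<T}" for t v
    unfolding aop_inner by (rule A_coercive[OF that])
qed (rule \<eta>_pos, rule \<eta>_le)

text \<open>The adjoint problem after reversal of time. Coercivity is inherited because an operator
  and its adjoint have the same quadratic form.\<close>

sublocale bw: evolution T j "\<lambda>t. aop_adj (T - t)" Ma \<eta>
proof
  show "(\<lambda>t. aop_adj (T - t) v \<bullet> w) \<in> borel_measurable (time_measure T)" for v w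
    unfolding aop_adj_inner by (rule measurable_reflect[OF A_measurable])
  have "AE t in time_measure T. norm (aop_adj t) \<le> Ma"
    using A_bounded
    by eventually_elim (unfold aop_adj_def, rule order_trans[OF norm_blinfun_adjoint_le order_trans[OF
      norm_aop]])
  then show "AE t in time_measure T. norm (aop_adj (T - t)) \<le> Ma" by (rule AE_reflect)
  show "\<eta> * (norm v)\<^sup>2 \<le> aop_adj (T - t) v \<bullet> v" if "t \<in> {0<..<T}" for t v
    unfolding aop_adj_inner by (rule A_coercive) (use that in auto)
qed (rule \<eta>_pos, rule \<eta>_le)

lemma C_L2:
  assumes "z \<in> L2 T"
  shows "(\<lambda>t. opC P t (z t)) \<in> L2 T" "L2_norm T (\<lambda>t. opC P t (z t)) \<le> Kc * L2_norm T z"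
proof -
  have m: "(\<lambda>t. opC P t (z t)) \<in> borel_measurable (time_measure T)"
    by (rule borel_measurable_compose_linear[OF _ blinfun.bounded_linear_right L2_measurable[OF assms]])
      (rule borel_measurable_weak[OF C_measurable])
  have le: "AE t in time_measure T. norm (opC P t (z t)) \<le> Kc * norm (z t)"
    using C_bounded by eventually_elim (meson mult_right_mono norm_blinfun norm_ge_zero order_trans)
  from L2_bound[OF assms m le Kc] show "(\<lambda>t. opC P t (z t)) \<in> L2 T" "L2_norm T (\<lambda>t. opC P t (z t))
    \<le> Kc * L2_norm T z" .
qed

lemma C_adj_L2:
  assumes "z \<in> L2 T"
  shows "(\<lambda>t. blinfun_adjoint (opC P t) (z t)) \<in> L2 T" "L2_norm T (\<lambda>t. blinfun_adjoint (opC P t) (z t))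
    \<le> Kc * L2_norm T z"
proof -
  have "(\<lambda>t. blinfun_adjoint (opC P t) x \<bullet> w) \<in> borel_measurable (time_measure T)" for x w
    unfolding blinfun_adjoint_inner inner_commute[of x] by (rule C_measurable)
  then have m: "(\<lambda>t. blinfun_adjoint (opC P t) (z t)) \<in> borel_measurable (time_measure T)"
    by (rule borel_measurable_compose_linear[OF borel_measurable_weak blinfun.bounded_linear_right
      L2_measurable[OF assms]])
  have le: "AE t in time_measure T. norm (blinfun_adjoint (opC P t) (z t)) \<le> Kc * norm (z t)"
    using C_bounded by eventually_elim (meson mult_right_mono norm_blinfun norm_blinfun_adjoint_le[THEN
      order_trans] norm_ge_zero order_trans)
  from L2_bound[OF assms m le Kc] show "(\<lambda>t. blinfun_adjoint (opC P t) (z t)) \<in> L2 T" "L2_norm T (\<lambda>t.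
    blinfun_adjoint (opC P t) (z t)) \<le> Kc * L2_norm T z" .
qed

lemma L2_blinfun:
  fixes B :: "'a::{real_normed_vector} \<Rightarrow>\<^sub>L 'b::real_normed_vector"
  assumes "f \<in> L2 T"
  shows "(\<lambda>t. B (f t)) \<in> L2 T" "L2_norm T (\<lambda>t. B (f t)) \<le> norm B * L2_norm T f"
proof -
  show L: "(\<lambda>t. B (f t)) \<in> L2 T" by (rule L2_bounded_linear[OF assms blinfun.bounded_linear_right])
  show "L2_norm T (\<lambda>t. B (f t)) \<le> norm B * L2_norm T f"
    by (rule L2_bound(2)[OF assms L2_measurable[OF L]]) (auto simp: norm_blinfun)
qed

definition observation :: "(real \<Rightarrow> 'v) \<Rightarrow> real \<Rightarrow> 'h" where
  "observation y t = opC P t (j (y t))"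

text \<open>The right hand side of the adjoint equation as an element of \<open>V\<close>; the
  adjoint of \<open>j\<close> carries an element of \<open>H\<close>, acting as a functional on
  \<open>V\<close>, to its representative.\<close>

definition source :: "(real \<Rightarrow> 'v) \<Rightarrow> real \<Rightarrow> 'v" where
  "source y t = blinfun_adjoint j (blinfun_adjoint (opC P t) (observation y t - y_target P t))"

lemma observation_L2: "y \<in> L2 T \<Longrightarrow> observation y \<in> L2 T"
  unfolding observation_def[abs_def] by (intro C_L2 L2_blinfun)

lemma observation_norm: "y \<in> L2 T \<Longrightarrow> L2_norm T (observation y) \<le> Kc * norm j * L2_norm T y"
  unfolding observation_def[abs_def]
  using C_L2(2)[OF L2_blinfun(1), of y j] mult_left_mono[OF L2_blinfun(2)[of y j] Kc]
    by (simp add: mult.assoc)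

lemma observation_diff: "observation (\<lambda>t. y t - z t) t = observation y t - observation z t"
  by (simp add: observation_def blinfun.diff_right)

lemma source_L2: "y \<in> L2 T \<Longrightarrow> source y \<in> L2 T"
  unfolding source_def[abs_def] by (intro L2_blinfun C_adj_L2 L2_diff observation_L2 y_target)

lemma source_diff: "source y t - source z t = blinfun_adjoint j (blinfun_adjoint (opC P t) (observation
  (\<lambda>t. y t - z t) t))"
  by (simp add: source_def observation_diff blinfun.diff_right[symmetric])

lemma source_diff_norm:
  assumes y: "y \<in> L2 T" and z: "z \<in> L2 T"
  shows "L2_norm T (\<lambda>t. source y t - source z t) \<le> (Kc * norm j)\<^sup>2 * L2_norm T (\<lambda>t. y t - z t)"
proof -
  have d: "(\<lambda>t. y t - z t) \<in> L2 T" using y z by auto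
  let ?c = "observation (\<lambda>t. y t - z t)"
  have c: "?c \<in> L2 T" by (rule observation_L2[OF d])
  have "L2_norm T (\<lambda>t. source y t - source z t)
    \<le> norm (blinfun_adjoint j) * L2_norm T (\<lambda>t. blinfun_adjoint (opC P t) (?c t))"
    unfolding source_diff by (rule L2_blinfun(2)[OF C_adj_L2(1)[OF c]])
  also have "\<dots> \<le> norm j * (Kc * L2_norm T ?c)"
    by (intro mult_mono norm_blinfun_adjoint_le C_adj_L2(2)[OF c]) auto
  also have "\<dots> \<le> norm j * (Kc * (Kc * norm j * L2_norm T (\<lambda>t. y t - z t)))"
    by (intro mult_left_mono observation_norm[OF d] Kc) auto
  finally show ?thesis by (simp add: power2_eq_square mult_ac)
qed

definition forward :: "'v set \<Rightarrow> (real \<Rightarrow> 'u) \<Rightarrow> (real \<Rightarrow> 'v) \<Rightarrow> 'h \<Rightarrow> bool" where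
  "forward X u y h \<longleftrightarrow> (\<exists>c. fw.wpair X y (\<lambda>t. bop (u t) - aop t (y t)) c \<and> c 0 = h)"

definition backward :: "'v set \<Rightarrow> (real \<Rightarrow> 'v) \<Rightarrow> (real \<Rightarrow> 'v) \<Rightarrow> bool" where
  "backward X f p \<longleftrightarrow> (\<exists>c. fw.wpair X p (\<lambda>t. aop_adj t (p t) - f t) c \<and> c T = 0)"

lemma aop_adj_L2: "p \<in> L2 T \<Longrightarrow> (\<lambda>t. aop_adj t (p t)) \<in> L2 T"
  using L2_reflect[OF bw.a_L2(1)[OF L2_reflect, of p]] by simp

lemma has_value_iff:
  "has_value_at P y s h \<longleftrightarrow> (\<exists>c. continuous_on {0..T} c \<and> (AE t in time_measure T. c t = j (y t)) \<and> c s
    = h)"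
  by (simp add: has_value_at_def)

lemma time_deriv_wpair:
  assumes y: "y \<in> L2_into T X" and td: "time_deriv P X y g'"
    and c: "continuous_on {0..T} c" "AE t in time_measure T. c t = j (y t)"
    and g: "g \<in> L2 T" and eq: "AE t in time_measure T. \<forall>w\<in>X. g' t w = g t \<bullet> w"
  shows "fw.wpair X y g c"
proof (rule fw.wpair_if_weak[OF y g c])
  fix \<phi> w assume \<phi>: "\<phi> \<in> test_functions T" and w: "w \<in> X"
  let ?M = "time_measure T"
  have g'L: "g' \<in> L2 T" using td by (simp add: time_deriv_def)
  have ph: "\<phi> \<in> borel_measurable ?M"
    using \<phi> by (intro continuous_time_measurable smooth_continuous) (simp add: test_functions_iff)
  have "bounded_linear (\<lambda>L::'v \<Rightarrow>\<^sub>L real. L w)" by (rule blinfun.bounded_linear_left)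
  from L2_bounded_linear[OF g'L this] have m1: "(\<lambda>t. g' t w) \<in> borel_measurable ?M"
    by (rule L2_measurable)
  have m2: "(\<lambda>t. g t \<bullet> w) \<in> borel_measurable ?M" using fw.inner_const_integrable[OF g] by blast
  have "(\<integral>t. \<phi> t * g' t w \<partial>?M) = (\<integral>t. \<phi> t * (g t \<bullet> w) \<partial>?M)"
    by (rule integral_cong_AE) (use ph m1 m2 eq w in \<open>auto intro!: borel_measurable_times elim!:
      eventually_mono\<close>)
  moreover have "(\<integral>t. deriv \<phi> t * (j (y t) \<bullet> j w) \<partial>?M) = - (\<integral>t. \<phi> t * g' t w \<partial>?M)"
    using td \<phi> w by (simp add: time_deriv_def)
  ultimately show "(\<integral>t. deriv \<phi> t * (j (y t) \<bullet> j w) \<partial>?M) = - (\<integral>t. \<phi> t * (g t \<bullet> w) \<partial>?M)" by simp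
qed

lemma wpair_time_deriv:
  assumes "fw.wpair X y g c"
  shows "time_deriv P X y (\<lambda>t. blinfun_inner_right (g t))"
  unfolding time_deriv_def
  using L2_bounded_linear[OF fw.wpairD(4)[OF assms] bounded_linear_blinfun_inner_right] fw.wpair_weak[OF
    assms] by auto

lemma solves_state_iff:
  assumes u: "u \<in> L2 T"
  shows "solves_state_eq P X h u y \<longleftrightarrow> forward X u y h"
proof
  assume "solves_state_eq P X h u y"
  then obtain g c where s: "y \<in> L2_into T X" "time_deriv P X y g"
      "AE t in time_measure T. \<forall>w\<in>X. g t w + opA P t (y t) w = opB P (u t) w"
      "continuous_on {0..T} c" "AE t in time_measure T. c t = j (y t)" "c 0 = h"
    unfolding solves_state_eq_def has_value_iff by blast
  have "fw.wpair X y (\<lambda>t. bop (u t) - aop t (y t)) c"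
  proof (rule time_deriv_wpair[OF s(1,2,4,5)])
    show "(\<lambda>t. bop (u t) - aop t (y t)) \<in> L2 T"
      using s(1) L2_into_D(1) by (intro L2_diff L2_blinfun u fw.a_L2) blast
    show "AE t in time_measure T. \<forall>w\<in>X. g t w = (bop (u t) - aop t (y t)) \<bullet> w"
      using s(3) by eventually_elim (force simp: inner_diff_left bop_inner aop_inner)
  qed
  then show "forward X u y h" unfolding forward_def using s(6) by blast
next
  assume "forward X u y h"
  then obtain c where c: "fw.wpair X y (\<lambda>t. bop (u t) - aop t (y t)) c" "c 0 = h" unfolding forward_def
    by blast
  have "AE t in time_measure T. \<forall>w\<in>X. blinfun_inner_right (bop (u t) - aop t (y t)) w + opA P t (y t) w
    = opB P (u t) w"
    by (rule AE_I2) (simp add: inner_diff_left bop_inner aop_inner)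
  then show "solves_state_eq P X h u y"
    unfolding solves_state_eq_def has_value_iff
    using fw.wpairD(1,5,6)[OF c(1)] c(2) wpair_time_deriv[OF c(1)] by blast
qed

lemma source_inner: "source y t \<bullet> w = adjoint (blinfun_apply (opC P t)) (opC P t (j (y t)) - y_target P
  t) \<bullet> j w"
  by (simp add: source_def observation_def blinfun_adjoint_inner blinfun_adjoint_apply[symmetric])

lemma solves_adjoint_iff:
  assumes y: "y \<in> L2 T"
  shows "solves_adjoint_eq P (\<lambda>t. j (y t)) p \<longleftrightarrow> backward UNIV (source y) p"
proof
  assume "solves_adjoint_eq P (\<lambda>t. j (y t)) p"
  then obtain g c where s: "p \<in> L2_into T UNIV" "time_deriv P UNIV p g"
      "AE t in time_measure T. \<forall>w. - g t w + dual_op (opA P t) (p t) w =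
         adjoint (blinfun_apply (opC P t)) (opC P t (j (y t)) - y_target P t) \<bullet> j w"
      "continuous_on {0..T} c" "AE t in time_measure T. c t = j (p t)" "c T = 0"
    unfolding solves_adjoint_eq_def has_value_iff L2_into_UNIV by blast
  have "fw.wpair UNIV p (\<lambda>t. aop_adj t (p t) - source y t) c"
  proof (rule time_deriv_wpair[OF s(1,2,4,5)])
    show "(\<lambda>t. aop_adj t (p t) - source y t) \<in> L2 T"
      using s(1) by (intro L2_diff aop_adj_L2 source_L2 y) simp
    show "AE t in time_measure T. \<forall>w\<in>UNIV. g t w = (aop_adj t (p t) - source y t) \<bullet> w"
      using s(3)
    proof eventually_elim
      fix t assume eq: "\<forall>w. - g t w + dual_op (opA P t) (p t) w =
         adjoint (blinfun_apply (opC P t)) (opC P t (j (y t)) - y_target P t) \<bullet> j w"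
      show "\<forall>w\<in>UNIV. g t w = (aop_adj t (p t) - source y t) \<bullet> w"
      proof
        fix w
        show "g t w = (aop_adj t (p t) - source y t) \<bullet> w"
          using eq[rule_format, of w] by (simp add: inner_diff_left aop_adj_inner source_inner
            dual_op_apply)
      qed
    qed
  qed
  then show "backward UNIV (source y) p" unfolding backward_def using s(6) by blast
next
  assume "backward UNIV (source y) p"
  then obtain c where c: "fw.wpair UNIV p (\<lambda>t. aop_adj t (p t) - source y t) c" "c T = 0"
    unfolding backward_def by blast
  have "AE t in time_measure T. \<forall>w. - blinfun_inner_right (aop_adj t (p t) - source y t) w
    + dual_op (opA P t) (p t) w =
         adjoint (blinfun_apply (opC P t)) (opC P t (j (y t)) - y_target P t) \<bullet> j w"
    by (rule AE_I2) (simp add: inner_diff_left aop_adj_inner source_inner dual_op_apply)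
  then show "solves_adjoint_eq P (\<lambda>t. j (y t)) p"
    unfolding solves_adjoint_eq_def has_value_iff
    using fw.wpairD(2,5,6)[OF c(1)] c(2) wpair_time_deriv[OF c(1)] by blast
qed

lemma forward_exists:
  assumes "subspace X" "closed X" "u \<in> L2 T" "h \<in> closure (j ` X)"
  shows "\<exists>y. forward X u y h"
  using fw.solution_exists[OF assms(1,2) L2_blinfun(1)[OF assms(3), of bop] assms(4)]
    unfolding forward_def by blast

lemma forward_L2: "forward X u y h \<Longrightarrow> y \<in> L2 T" "forward X u y h \<Longrightarrow> y \<in> L2_into T X"
  unfolding forward_def using fw.wpairD(1,2) by blast+

lemma backward_L2: "backward X f p \<Longrightarrow> p \<in> L2 T" "backward X f p \<Longrightarrow> p \<in> L2_into T X"
  unfolding backward_def using fw.wpairD(1,2) by blast+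

lemma forward_diff:
  assumes X: "subspace X" and 1: "forward X u1 y1 h1" and 2: "forward X u2 y2 h2"
  shows "forward X (\<lambda>t. u1 t - u2 t) (\<lambda>t. y1 t - y2 t) (h1 - h2)"
proof -
  obtain c1 c2 where c: "fw.wpair X y1 (\<lambda>t. bop (u1 t) - aop t (y1 t)) c1" "c1 0 = h1"
     "fw.wpair X y2 (\<lambda>t. bop (u2 t) - aop t (y2 t)) c2" "c2 0 = h2"
    using 1 2 unfolding forward_def by blast
  have "(\<lambda>t. bop (u1 t) - aop t (y1 t) - (bop (u2 t) - aop t (y2 t)))
    = (\<lambda>t. bop (u1 t - u2 t) - aop t (y1 t - y2 t))"
    by (simp add: blinfun.diff_right fun_eq_iff)
  with fw.wpair_diff[OF X c(1) c(3)] have "fw.wpair X (\<lambda>t. y1 t - y2 t) (\<lambda>t. bop (u1 t - u2 t) - aop t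
    (y1 t - y2 t)) (\<lambda>t. c1 t - c2 t)"
    by simp
  then show ?thesis unfolding forward_def using c(2,4) by blast
qed

lemma forward_scaleR:
  assumes X: "subspace X" and 1: "forward X u y h"
  shows "forward X (\<lambda>t. r *\<^sub>R u t) (\<lambda>t. r *\<^sub>R y t) (r *\<^sub>R h)"
proof -
  obtain c where c: "fw.wpair X y (\<lambda>t. bop (u t) - aop t (y t)) c" "c 0 = h"
    using 1 unfolding forward_def by blast
  have "(\<lambda>t. r *\<^sub>R (bop (u t) - aop t (y t))) = (\<lambda>t. bop (r *\<^sub>R u t) - aop t (r *\<^sub>R y t))"
    by (simp add: blinfun.scaleR_right scaleR_diff_right fun_eq_iff)
  with fw.wpair_scaleR[OF X c(1), of r] have "fw.wpair X (\<lambda>t. r *\<^sub>R y t) (\<lambda>t. bop (r *\<^sub>R u t) - aop t (r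
    *\<^sub>R y t)) (\<lambda>t. r *\<^sub>R c t)"
    by simp
  then show ?thesis unfolding forward_def using c(2) by blast
qed

lemma forward_zero_bound:
  assumes X: "subspace X" "closed X" and 1: "forward X u y 0" and u: "u \<in> L2 T"
  shows "\<eta> * L2_norm T y \<le> norm bop * L2_norm T u"
proof -
  obtain c where c: "fw.wpair X y (\<lambda>t. bop (u t) - aop t (y t)) c" "c 0 = 0" using 1
    unfolding forward_def by blast
  have "\<eta> * L2_norm T y \<le> L2_norm T (\<lambda>t. bop (u t))"
  proof (rule fw.wpair_energy_zero[OF X c(1) L2_blinfun(1)[OF u] \<eta>_pos c(2)])
    show "AE t in time_measure T. (bop (u t) - aop t (y t)) \<bullet> y t
      \<le> bop (u t) \<bullet> y t - \<eta> * (norm (y t))\<^sup>2"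
      using AE_time by eventually_elim (use fw.coercive in \<open>simp add: inner_diff_left\<close>)
  qed
  also have "\<dots> \<le> norm bop * L2_norm T u" by (rule L2_blinfun(2)[OF u])
  finally show ?thesis .
qed

lemma forward_unique:
  assumes X: "subspace X" "closed X" and 1: "forward X u y1 h" and 2: "forward X u y2 h"
  shows "AE t in time_measure T. y1 t = y2 t"
proof -
  have "forward X (\<lambda>t. 0) (\<lambda>t. y1 t - y2 t) 0" using forward_diff[OF X(1) 1 2] by simp
  from forward_zero_bound[OF X this] have "L2_norm T (\<lambda>t. y1 t - y2 t) \<le> 0" using \<eta>_pos
    by (simp add: mult_le_0_iff)
  then show ?thesis by (rule AE_eq_if_L2_norm_le_zero[OF forward_L2(1)[OF 1] forward_L2(1)[OF 2]])
qed

lemma backward_reflect: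
  "backward X f p \<longleftrightarrow> (\<exists>c. fw.wpair X (\<lambda>t. p (T - t)) (\<lambda>t. f (T - t) - aop_adj (T - t) (p (T - t))) c
    \<and> c 0 = 0)"
proof
  assume "backward X f p"
  then obtain c where c: "fw.wpair X p (\<lambda>t. aop_adj t (p t) - f t) c" "c T = 0" unfolding backward_def
    by blast
  then show "\<exists>c. fw.wpair X (\<lambda>t. p (T - t)) (\<lambda>t. f (T - t) - aop_adj (T - t) (p (T - t))) c \<and> c 0 = 0"
    using fw.wpair_reflect[OF c(1)] by auto
next
  assume "\<exists>c. fw.wpair X (\<lambda>t. p (T - t)) (\<lambda>t. f (T - t) - aop_adj (T - t) (p (T - t))) c \<and> c 0 = 0"
  then obtain c where c: "fw.wpair X (\<lambda>t. p (T - t)) (\<lambda>t. f (T - t) - aop_adj (T - t) (p (T - t))) c" "c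
    0 = 0" by blast
  then show "backward X f p"
    unfolding backward_def using fw.wpair_reflect[OF c(1)] by auto
qed

lemma backward_exists:
  assumes X: "subspace X" "closed X" and f: "f \<in> L2 T"
  shows "\<exists>p. backward X f p"
proof -
  have "0 \<in> closure (j ` X)" using subspace_0[OF X(1)] closure_subset[of "j ` X"] blinfun.zero_right[of
    j] by force
  from bw.solution_exists[OF X L2_reflect[OF f] this] obtain q c where
    q: "fw.wpair X q (\<lambda>t. f (T - t) - aop_adj (T - t) (q t)) c" "c 0 = 0" by blast
  then have "backward X f (\<lambda>t. q (T - t))" unfolding backward_reflect by auto
  then show ?thesis by blast
qed

lemma backward_bound:
  assumes X: "subspace X" "closed X" and 1: "backward X f1 p1" and 2: "backward X f2 p2"
    and f: "f1 \<in> L2 T" "f2 \<in> L2 T"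
  shows "\<eta> * L2_norm T (\<lambda>t. p1 t - p2 t) \<le> L2_norm T (\<lambda>t. f1 t - f2 t)"
proof -
  obtain c1 c2 where c: "fw.wpair X (\<lambda>t. p1 (T - t)) (\<lambda>t. f1 (T - t) - aop_adj (T - t) (p1 (T - t))) c1"
    "c1 0 = 0"
    "fw.wpair X (\<lambda>t. p2 (T - t)) (\<lambda>t. f2 (T - t) - aop_adj (T - t) (p2 (T - t))) c2" "c2 0 = 0"
    using 1 2 unfolding backward_reflect by blast
  have "c1 0 = c2 0" using c by simp
  from bw.solution_unique[OF X c(1) c(3) L2_reflect[OF f(1)] L2_reflect[OF f(2)] this]
  have "\<eta> * L2_norm T (\<lambda>t. p1 (T - t) - p2 (T - t)) \<le> L2_norm T (\<lambda>t. f1 (T - t) - f2 (T - t))" .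
  then show ?thesis
    using L2_norm_reflect[of "\<lambda>t. p1 t - p2 t" T] L2_norm_reflect[of "\<lambda>t. f1 t - f2 t" T] f
      backward_L2(1)[OF 1] backward_L2(1)[OF 2] by (simp add: L2_diff)
qed

text \<open>The product rule for \<open>z\<close> and \<open>p\<close> has no boundary terms, since
  one function vanishes at time 0 and the other at \<open>T\<close>, and the two operators cancel as
  mutual adjoints.\<close>

lemma duality:
  assumes X: "subspace X" "closed X" and p: "backward X f p" and z: "forward X w z 0" and f: "f \<in> L2 T"
    and w: "w \<in> L2 T"
  shows "L2_inner T (\<lambda>t. bop_adj (p t)) w = L2_inner T f z"
proof -
  obtain cp where cp: "fw.wpair X p (\<lambda>t. aop_adj t (p t) - f t) cp" "cp T = 0" using p
    unfolding backward_def by blast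
  obtain cz where cz: "fw.wpair X z (\<lambda>t. bop (w t) - aop t (z t)) cz" "cz 0 = 0" using z
    unfolding forward_def by blast
  note L = fw.wpairD(2)[OF cp(1)] fw.wpairD(2)[OF cz(1)]
  have "0 = L2_inner T (\<lambda>t. bop (w t) - aop t (z t)) p + L2_inner T z (\<lambda>t. aop_adj t (p t) - f t)"
    using fw.wpair_product[OF X cz(1) cp(1)] cp(2) cz(2) by simp
  also have "\<dots> = (L2_inner T (\<lambda>t. bop (w t)) p - L2_inner T (\<lambda>t. aop t (z t)) p)
    + (L2_inner T z (\<lambda>t. aop_adj t (p t)) - L2_inner T z f)"
    using L2_inner_diff_left[OF L2_blinfun(1)[OF w, of bop] fw.a_L2(1)[OF L(2)] L(1)]
      L2_inner_diff_right[OF aop_adj_L2[OF L(1)] f L(2)] by simp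
  also have "L2_inner T z (\<lambda>t. aop_adj t (p t)) = L2_inner T (\<lambda>t. aop t (z t)) p"
    by (simp add: L2_inner_def inner_commute[of "z _"] aop_adj_inner aop_inner)
  also have "L2_inner T (\<lambda>t. bop (w t)) p = L2_inner T (\<lambda>t. bop_adj (p t)) w"
    by (simp add: L2_inner_def bop_adj_inner inner_commute[of "bop _"])
  finally show ?thesis by (simp add: L2_inner_commute[of T z])
qed

end

section \<open>Reduced cost functions and their gradients\<close>

context optimal_control
begin

definition init :: "'v set \<Rightarrow> 'h" where
  "init X = orth_proj (closure (j ` X)) (y_init P)"

definition dual_state :: "'v set \<Rightarrow> (real \<Rightarrow> 'u) \<Rightarrow> real \<Rightarrow> 'v" where
  "dual_state X u = (SOME p. backward X (source (red_state P X u)) p)"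

text \<open>The adjoint is solved in the same subspace as the state. This makes it the exact
  gradient of the reduced cost, rather than an approximation of the full gradient.\<close>

definition red_gradient :: "'v set \<Rightarrow> (real \<Rightarrow> 'u) \<Rightarrow> real \<Rightarrow> 'u" where
  "red_gradient X u t = bop_adj (dual_state X u t) + \<beta> *\<^sub>R u t"

lemma closure_image_subspace:
  assumes "subspace X" shows "subspace (closure (j ` X))" "closed (closure (j ` X))"
  by (auto intro!: subspace_closure linear_subspace_image assms bounded_linear.linear
    blinfun.bounded_linear_right)

lemma solves_state_eq_forward: "u \<in> L2 T \<Longrightarrow> solves_state_eq P X h u = (\<lambda>y. forward X u y h)"
  by (rule ext) (rule solves_state_iff)

lemma state_from_forward:
  assumes X: "subspace X" "closed X" and u: "u \<in> L2 T" and h: "h \<in> closure (j ` X)"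
  shows "forward X u (state_from P X h u) h"
  unfolding state_from_def solves_state_eq_forward[OF u] by (rule someI_ex[OF forward_exists[OF X u h]])

lemma red_state_forward:
  assumes X: "subspace X" "closed X" and u: "u \<in> L2 T"
  shows "forward X u (red_state P X u) (init X)"
  unfolding red_state_def init_def
  by (rule state_from_forward[OF X u orth_proj_mem[OF closure_image_subspace[OF X(1)]]])

lemma init_UNIV: "init UNIV = y_init P"
  using embedding by (simp add: init_def compact_dense_embedding_def)

text \<open>Taking \<open>X = UNIV\<close> makes the full problem an instance of the reduced one, as
  density of the embedding turns the projection of the initial value into the identity. All
  estimates below therefore cover both.\<close>

lemma state_eq_red_state: "state P = red_state P UNIV"
  unfolding state_def red_state_def init_UNIV[unfolded init_def] ..

lemma lin_state_forward:
  assumes u: "u \<in> L2 T" shows "forward UNIV u (lin_state P u) 0"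
  unfolding lin_state_def
  by (rule state_from_forward[OF _ _ u]) (use embedding in \<open>auto simp: compact_dense_embedding_def\<close>)

lemma red_state_L2: "subspace X \<Longrightarrow> closed X \<Longrightarrow> u \<in> L2 T \<Longrightarrow> red_state P X u \<in> L2 T"
  using forward_L2(1)[OF red_state_forward] .

lemma dual_state_backward:
  assumes X: "subspace X" "closed X" and u: "u \<in> L2 T"
  shows "backward X (source (red_state P X u)) (dual_state X u)"
  unfolding dual_state_def by (rule someI_ex[OF backward_exists[OF X source_L2[OF red_state_L2[OF X
    u]]]])

lemma red_gradient_L2:
  assumes X: "subspace X" "closed X" and u: "u \<in> L2 T"
  shows "red_gradient X u \<in> L2 T"
  unfolding red_gradient_def[abs_def]
  by (intro L2_add L2_scaleR L2_blinfun u backward_L2(1)[OF dual_state_backward[OF X u]])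

text \<open>The two solution predicates are equal as functions, hence both choices select the same
  element and not just the same class.\<close>

lemma adjoint_of_control_eq:
  assumes u: "u \<in> L2 T" shows "adjoint_of_control P u = dual_state UNIV u"
proof -
  have "red_state P UNIV u \<in> L2 T" by (rule red_state_L2[OF _ _ u]) auto
  then have "solves_adjoint_eq P (\<lambda>t. j (red_state P UNIV u t))
    = backward UNIV (source (red_state P UNIV u))"
    by (intro ext solves_adjoint_iff)
  then show ?thesis
    unfolding adjoint_of_control_def adjoint_state_def dual_state_def state_eq_red_state by (simp only:)
qed

lemma gradient_eq: "u \<in> L2 T \<Longrightarrow> gradient P u = red_gradient UNIV u"
  unfolding gradient_def red_gradient_def[abs_def] by (simp add: adjoint_of_control_eq riesz_dual_opB)

lemma cost_eq:
  assumes y: "y \<in> L2 T" and u: "u \<in> L2 T"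
  shows "cost P y u = (L2_norm T (\<lambda>t. observation y t - y_target P t))\<^sup>2 / 2 + \<beta> / 2 * (L2_norm T u)\<^sup>2"
proof -
  have "integrable (time_measure T) (\<lambda>t. (norm (observation y t - y_target P t))\<^sup>2)"
    by (intro L2_integrable L2_diff observation_L2 y y_target)
  moreover have "integrable (time_measure T) (\<lambda>t. (norm (u t))\<^sup>2)" by (rule L2_integrable[OF u])
  ultimately show ?thesis unfolding cost_def by (simp add: L2_norm_sq observation_def)
qed

lemma source_observation_inner: "source y t \<bullet> z t = (observation y t - y_target P t) \<bullet> observation z t"
  by (simp add: source_def blinfun_adjoint_inner observation_def)

lemma source_diff_observation_inner: "(source y1 t - source y2 t) \<bullet> z t
  = observation (\<lambda>t. y1 t - y2 t) t \<bullet> observation z t"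
  by (simp add: source_diff blinfun_adjoint_inner) (simp add: observation_def)

section \<open>Quadratic structure of the reduced cost\<close>

text \<open>The state depends affinely on the control, so the difference of gradients is the Hessian
  applied to \<open>u - v\<close>. Paired with \<open>w\<close> it is an inner product of observed
  responses, \<open>z\<close> being the response to \<open>w\<close>, plus the
  regularization.\<close>

lemma red_gradient_diff_inner:
  assumes X: "subspace X" "closed X" and u: "u \<in> L2 T" and v: "v \<in> L2 T" and w: "w \<in> L2 T"
    and z: "forward X w z 0"
  shows "L2_inner T (\<lambda>t. red_gradient X u t - red_gradient X v t) w
    = L2_inner T (observation (\<lambda>t. red_state P X u t - red_state P X v t)) (observation z)
      + \<beta> * L2_inner T (\<lambda>t. u t - v t) w"
proof -
  note yu = red_state_L2[OF X u] and yv = red_state_L2[OF X v]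
  note pu = dual_state_backward[OF X u] and pv = dual_state_backward[OF X v]
  have b: "(\<lambda>t. bop_adj (dual_state X u t)) \<in> L2 T" "(\<lambda>t. bop_adj (dual_state X v t)) \<in> L2 T"
    by (intro L2_blinfun backward_L2(1)[OF pu] backward_L2(1)[OF pv])+
  have zL: "z \<in> L2 T" by (rule forward_L2(1)[OF z])
  have eq: "(\<lambda>t. red_gradient X u t - red_gradient X v t)
    = (\<lambda>t. (bop_adj (dual_state X u t) - bop_adj (dual_state X v t)) + \<beta> *\<^sub>R (u t - v t))"
    by (auto simp: red_gradient_def algebra_simps)
  have "L2_inner T (\<lambda>t. red_gradient X u t - red_gradient X v t) w
     = L2_inner T (\<lambda>t. bop_adj (dual_state X u t) - bop_adj (dual_state X v t)) w
       + \<beta> * L2_inner T (\<lambda>t. u t - v t) w"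
    unfolding eq L2_inner_add_left[OF L2_diff[OF b] L2_scaleR[OF L2_diff[OF u v]] w]
      L2_inner_scaleR_left ..
  also have "L2_inner T (\<lambda>t. bop_adj (dual_state X u t) - bop_adj (dual_state X v t)) w
     = L2_inner T (source (red_state P X u)) z - L2_inner T (source (red_state P X v)) z"
    unfolding L2_inner_diff_left[OF b w]
      duality[OF X pu z source_L2[OF yu] w] duality[OF X pv z source_L2[OF yv] w] ..
  also have "\<dots> = L2_inner T (\<lambda>t. source (red_state P X u) t - source (red_state P X v) t) z"
    by (rule L2_inner_diff_left[OF source_L2[OF yu] source_L2[OF yv] zL, symmetric])
  also have "\<dots> = L2_inner T (observation (\<lambda>t. red_state P X u t - red_state P X v t)) (observation z)"
    unfolding L2_inner_def source_diff_observation_inner ..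
  finally show ?thesis .
qed

lemma red_state_diff_forward:
  assumes X: "subspace X" "closed X" and u: "u \<in> L2 T" and v: "v \<in> L2 T"
  shows "forward X (\<lambda>t. u t - v t) (\<lambda>t. red_state P X u t - red_state P X v t) 0"
  using forward_diff[OF X(1) red_state_forward[OF X u] red_state_forward[OF X v]] by simp

text \<open>An exact Taylor expansion: the cost is quadratic in an affine state. Duality converts
  the linear term in the state into one in the control.\<close>

lemma red_cost_expansion:
  assumes X: "subspace X" "closed X" and u: "u \<in> L2 T" and v: "v \<in> L2 T"
  shows "red_cost P X v = red_cost P X u + L2_inner T (red_gradient X u) (\<lambda>t. v t - u t)
    + (L2_norm T (observation (\<lambda>t. red_state P X v t - red_state P X u t)))\<^sup>2 / 2
      + \<beta> / 2 * (L2_norm T (\<lambda>t. v t - u t))\<^sup>2"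
proof -
  note yu = red_state_L2[OF X u] and yv = red_state_L2[OF X v]
  note pu = dual_state_backward[OF X u]
  define z where "z t = red_state P X v t - red_state P X u t" for t
  define d where "d t = v t - u t" for t
  have dL: "d \<in> L2 T" unfolding d_def by (rule L2_diff[OF v u])
  have zL: "z \<in> L2 T" unfolding z_def by (rule L2_diff[OF yv yu])
  have fz: "forward X d z 0" unfolding d_def z_def by (rule red_state_diff_forward[OF X v u])
  have r: "(\<lambda>t. observation (red_state P X u) t - y_target P t) \<in> L2 T"
    by (intro L2_diff observation_L2 yu y_target)
  have split: "(\<lambda>t. observation (red_state P X v) t - y_target P t)
    = (\<lambda>t. (observation (red_state P X u) t - y_target P t) + observation z t)"
    by (rule ext) (simp add: observation_def z_def blinfun.diff_right)
  have 1: "(L2_norm T (\<lambda>t. observation (red_state P X v) t - y_target P t))\<^sup>2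
    = (L2_norm T (\<lambda>t. observation (red_state P X u) t - y_target P t))\<^sup>2
      + 2 * L2_inner T (\<lambda>t. observation (red_state P X u) t - y_target P t) (observation z)
        + (L2_norm T (observation z))\<^sup>2"
    unfolding split by (rule L2_norm_add_sq[OF r observation_L2[OF zL]])
  have "L2_inner T (\<lambda>t. observation (red_state P X u) t - y_target P t) (observation z)
    = L2_inner T (source (red_state P X u)) z"
    unfolding L2_inner_def source_observation_inner ..
  also have "\<dots> = L2_inner T (\<lambda>t. bop_adj (dual_state X u t)) d"
    by (rule duality[OF X pu fz source_L2[OF yu] dL, symmetric])
  finally have 2: "L2_inner T (\<lambda>t. observation (red_state P X u) t - y_target P t) (observation z)
    = L2_inner T (\<lambda>t. bop_adj (dual_state X u t)) d" .
  have "v = (\<lambda>t. u t + d t)" by (simp add: d_def)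
  then have 3: "(L2_norm T v)\<^sup>2 = (L2_norm T u)\<^sup>2 + 2 * L2_inner T u d + (L2_norm T d)\<^sup>2"
    using L2_norm_add_sq[OF u dL] by simp
  have 4: "L2_inner T (red_gradient X u) d = L2_inner T (\<lambda>t. bop_adj (dual_state X u t)) d
    + \<beta> * L2_inner T u d"
    unfolding red_gradient_def[abs_def]
    by (subst L2_inner_add_left) (auto intro!: L2_blinfun backward_L2(1)[OF pu] dL L2_scaleR u simp:
      L2_inner_scaleR_left)
  have zz: "observation (\<lambda>t. red_state P X v t - red_state P X u t) = observation z"
    by (simp add: z_def[abs_def])
  have dd: "(\<lambda>t. v t - u t) = d" by (simp add: d_def[abs_def])
  show ?thesis unfolding red_cost_def cost_eq[OF yu u] cost_eq[OF yv v] zz dd 1 2 3 4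
    by (simp add: algebra_simps add_divide_distrib)
qed

text \<open>The product of the norms of observation, embedding and control operator over the
  coercivity constant; it bounds the response operator on every subspace.\<close>

definition observation_bound :: real where
  "observation_bound = Kc * norm j * norm bop / \<eta>"

lemma observation_forward_bound:
  assumes X: "subspace X" "closed X" and z: "forward X w z 0" and w: "w \<in> L2 T"
  shows "L2_norm T (observation z) \<le> observation_bound * L2_norm T w"
proof -
  have "L2_norm T z \<le> norm bop * L2_norm T w / \<eta>"
    using forward_zero_bound[OF X z w] \<eta>_pos by (simp add: pos_le_divide_eq mult.commute)
  then have "Kc * norm j * L2_norm T z \<le> Kc * norm j * (norm bop * L2_norm T w / \<eta>)"
    using Kc by (intro mult_left_mono) auto
  with observation_norm[OF forward_L2(1)[OF z]] show ?thesis by (simp add: observation_bound_def)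
qed

lemma observation_bound_nonneg: "0 \<le> observation_bound"
  using Kc \<eta>_pos by (simp add: observation_bound_def)

text \<open>The difference of gradients is tested with itself. The bound \<open>N\<close> is a
  parameter because \<open>observation_bound\<close> is needed uniformly in the subspace, whereas
  the lower error bound requires \<open>norm_CS P\<close> on the whole space.\<close>

lemma red_gradient_lipschitz:
  assumes X: "subspace X" "closed X" and u: "u \<in> L2 T" and v: "v \<in> L2 T"
    and N: "\<And>w z. w \<in> L2 T \<Longrightarrow> forward X w z 0 \<Longrightarrow> L2_norm T (observation z) \<le> N * L2_norm T w" "0 \<le> N"
  shows "L2_norm T (\<lambda>t. red_gradient X u t - red_gradient X v t) \<le> (\<beta>
    + N\<^sup>2) * L2_norm T (\<lambda>t. u t - v t)"
proof -
  define w where "w t = red_gradient X u t - red_gradient X v t" for t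
  define d where "d t = u t - v t" for t
  have w: "w \<in> L2 T" unfolding w_def by (intro L2_diff red_gradient_L2 X u v)
  have d: "d \<in> L2 T" unfolding d_def by (intro L2_diff u v)
  define zd where "zd t = red_state P X u t - red_state P X v t" for t
  have zd: "forward X d zd 0" unfolding d_def zd_def by (rule red_state_diff_forward[OF X u v])
  have "0 \<in> closure (j ` X)" using subspace_0[OF closure_image_subspace(1)[OF X(1)]] .
  then obtain zw where zw: "forward X w zw 0" using forward_exists[OF X w] by blast
  let ?n = "L2_norm T w"
  have "?n\<^sup>2 = L2_inner T (observation zd) (observation zw) + \<beta> * L2_inner T d w"
    using red_gradient_diff_inner[OF X u v w zw]
      by (simp add: L2_inner_self[symmetric] w_def[abs_def] d_def[abs_def] zd_def[abs_def])
  also have "\<dots> \<le> (N * L2_norm T d) * (N * ?n) + \<beta> * (L2_norm T d * ?n)"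
  proof -
    have "L2_inner T (observation zd) (observation zw)
      \<le> L2_norm T (observation zd) * L2_norm T (observation zw)"
      using L2_cauchy_schwarz[OF observation_L2[OF forward_L2(1)[OF zd]] observation_L2[OF
        forward_L2(1)[OF zw]]] by linarith
    also have "\<dots> \<le> (N * L2_norm T d) * (N * ?n)"
      using N(1)[OF d zd] N(1)[OF w zw] N(2) by (intro mult_mono) auto
    finally have 1: "L2_inner T (observation zd) (observation zw) \<le> (N * L2_norm T d) * (N * ?n)" .
    have "\<beta> * L2_inner T d w \<le> \<beta> * (L2_norm T d * ?n)"
      using L2_cauchy_schwarz[OF d w] beta by (intro mult_left_mono) auto
    with 1 show ?thesis by linarith
  qed
  also have "\<dots> = ((\<beta> + N\<^sup>2) * L2_norm T d) * ?n" by (simp add: power2_eq_square algebra_simps)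
  finally have le: "?n * ?n \<le> ((\<beta> + N\<^sup>2) * L2_norm T d) * ?n" by (simp add: power2_eq_square)
  have "?n \<le> (\<beta> + N\<^sup>2) * L2_norm T d"
  proof (cases "?n = 0")
    case True then show ?thesis using beta by simp
  next
    case False
    then have "?n > 0" using L2_norm_nonneg[of T w] by linarith
    with le show ?thesis by simp
  qed
  then show ?thesis by (simp add: w_def[abs_def] d_def[abs_def])
qed

lemma red_gradient_monotone:
  assumes X: "subspace X" "closed X" and u: "u \<in> L2 T" and v: "v \<in> L2 T"
  shows "\<beta> * L2_norm T (\<lambda>t. u t - v t) \<le> L2_norm T (\<lambda>t. red_gradient X u t - red_gradient X v t)"
proof -
  define w where "w t = red_gradient X u t - red_gradient X v t" for t
  define d where "d t = u t - v t" for t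
  have w: "w \<in> L2 T" unfolding w_def by (intro L2_diff red_gradient_L2 X u v)
  have d: "d \<in> L2 T" unfolding d_def by (intro L2_diff u v)
  have eq: "L2_inner T w d = (L2_norm T (observation (\<lambda>t. red_state P X u t - red_state P X v t)))\<^sup>2
    + \<beta> * (L2_norm T d)\<^sup>2"
    using red_gradient_diff_inner[OF X u v L2_diff[OF u v] red_state_diff_forward[OF X u v]]
    by (simp add: L2_inner_self w_def[abs_def] d_def[abs_def])
  have "0 \<le> (L2_norm T (observation (\<lambda>t. red_state P X u t - red_state P X v t)))\<^sup>2" by simp
  then have "\<beta> * (L2_norm T d)\<^sup>2 \<le> L2_inner T w d" using eq by linarith
  also have "\<dots> \<le> L2_norm T w * L2_norm T d" using L2_cauchy_schwarz[OF w d] by linarith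
  finally have le: "(\<beta> * L2_norm T d) * L2_norm T d \<le> L2_norm T w * L2_norm T d"
    by (simp add: power2_eq_square)
  have "\<beta> * L2_norm T d \<le> L2_norm T w"
  proof (cases "L2_norm T d = 0")
    case False
    then have "L2_norm T d > 0" using L2_norm_nonneg[of T d] by linarith
    with le show ?thesis by simp
  qed simp
  then show ?thesis by (simp add: w_def[abs_def] d_def[abs_def])
qed

lemma red_cost_nonneg:
  assumes X: "subspace X" "closed X" and u: "u \<in> L2 T"
  shows "0 \<le> red_cost P X u"
  unfolding red_cost_def cost_eq[OF red_state_L2[OF X u] u] using beta by simp

section \<open>Existence and characterization of reduced optima\<close>

lemma red_minimizer_exists:
  assumes X: "subspace X" "closed X"
  shows "\<exists>u\<in>L2 T. \<forall>w\<in>L2 T. red_cost P X u \<le> red_cost P X w"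
proof (rule strongly_convex_minimizer[where d = "\<lambda>u v. L2_norm T (\<lambda>t. u t - v t)" and \<kappa> = "\<beta> / 8" and m
  = 0])
  show "(L2 T :: (real \<Rightarrow> 'u) set) \<noteq> {}" using L2_zero by blast
  show "0 \<le> red_cost P X u" if "u \<in> L2 T" for u by (rule red_cost_nonneg[OF X that])
  show "\<beta> / 8 > 0" using beta by simp
  fix u v :: "real \<Rightarrow> 'u" assume u: "u \<in> L2 T" and v: "v \<in> L2 T"
  \<comment> \<open>Both costs are expanded around the midpoint \<open>m\<close>. The linear terms
    cancel in the average, and half the difference of the controls turns \<open>\<beta> / 2\<close>
    into \<open>\<beta> / 8\<close>.\<close>
  define d where "d t = (1/2) *\<^sub>R (u t - v t)" for t
  define m where "m t = v t + d t" for t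
  have d: "d \<in> L2 T" unfolding d_def by (intro L2_scaleR L2_diff u v)
  have m: "m \<in> L2 T" unfolding m_def by (intro L2_add d v)
  have um: "(\<lambda>t. u t - m t) = d"
  proof
    fix t
    have "u t - m t = (u t - v t) - (1/2) *\<^sub>R (u t - v t)" by (simp add: m_def d_def)
    also have "\<dots> = (1 - 1/2) *\<^sub>R (u t - v t)" by (simp only: scaleR_diff_left scaleR_one)
    finally show "u t - m t = d t" by (simp add: d_def)
  qed
  have vm: "(\<lambda>t. v t - m t) = (\<lambda>t. (-1) *\<^sub>R d t)" by (simp add: m_def)
  have dn: "L2_norm T d = L2_norm T (\<lambda>t. u t - v t) / 2" unfolding d_def[abs_def] L2_norm_scaleR by simp
  have "red_cost P X u \<ge> red_cost P X m + L2_inner T (red_gradient X m) d + \<beta> / 2 * (L2_norm T d)\<^sup>2"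
    unfolding red_cost_expansion[OF X m u] um by simp
  have "red_cost P X v \<ge> red_cost P X m - L2_inner T (red_gradient X m) d + \<beta> / 2 * (L2_norm T d)\<^sup>2"
    unfolding red_cost_expansion[OF X m v] vm L2_inner_scaleR_right L2_norm_scaleR by simp
  have "\<beta> / 8 * (L2_norm T (\<lambda>t. u t - v t))\<^sup>2 = \<beta> / 2 * (L2_norm T d)\<^sup>2" unfolding dn
    by (simp add: power2_eq_square)
  have "red_cost P X m + \<beta> / 8 * (L2_norm T (\<lambda>t. u t - v t))\<^sup>2 \<le> (red_cost P X u + red_cost P X v) / 2"
  proof -
    have "a + b \<le> (p + q) / 2" if "a + i + b' \<le> p" "a - i + b' \<le> q" "b = b'" for a b b' i p q :: real
      using that by (simp add: field_simps)
    from this[OF \<open>red_cost P X u \<ge> _\<close> \<open>red_cost P X v \<ge> _\<close> \<open>\<beta> / 8 * _ = _\<close>] show ?thesis .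
  qed
  then show "\<exists>z\<in>L2 T. red_cost P X z + \<beta> / 8 * (L2_norm T (\<lambda>t. u t - v t))\<^sup>2 \<le> (red_cost P X u
    + red_cost P X v) / 2"
    using m by blast
next
  fix s :: "nat \<Rightarrow> real \<Rightarrow> 'u"
  assume s: "\<And>n. s n \<in> L2 T" and cau: "\<And>e. e > 0 \<Longrightarrow> \<exists>N. \<forall>m\<ge>N. \<forall>n\<ge>N. L2_norm T (\<lambda>t. s m t - s n t) < e"
  from L2_complete[OF T0 s cau] obtain u where u: "u \<in> L2 T" and lim: "(\<lambda>n. L2_norm T (\<lambda>t. s n t - u t))
    \<longlonglongrightarrow> 0" by blast
  let ?d = "\<lambda>n. L2_norm T (\<lambda>t. s n t - u t)"
  have g: "(\<lambda>n. L2_inner T (red_gradient X u) (\<lambda>t. s n t - u t)) \<longlonglongrightarrow> 0"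
  proof (rule Lim_null_comparison)
    show "\<forall>\<^sub>F n in sequentially. norm (L2_inner T (red_gradient X u) (\<lambda>t. s n t - u t))
      \<le> L2_norm T (red_gradient X u) * ?d n"
      using L2_cauchy_schwarz[OF red_gradient_L2[OF X u] L2_diff[OF s u]] by simp
    show "(\<lambda>n. L2_norm T (red_gradient X u) * ?d n) \<longlonglongrightarrow> 0" by (rule tendsto_mult_right_zero[OF lim])
  qed
  have c: "(\<lambda>n. L2_norm T (observation (\<lambda>t. red_state P X (s n) t - red_state P X u t))) \<longlonglongrightarrow> 0"
  proof (rule Lim_null_comparison)
    show "\<forall>\<^sub>F n in sequentially. norm (L2_norm T (observation (\<lambda>t. red_state P X (s n) t - red_state P X
      u t))) \<le> observation_bound * ?d n"
      using observation_forward_bound[OF X red_state_diff_forward[OF X s u] L2_diff[OF s u]] by simp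
    show "(\<lambda>n. observation_bound * ?d n) \<longlonglongrightarrow> 0" by (rule tendsto_mult_right_zero[OF lim])
  qed
  have "(\<lambda>n. red_cost P X u + L2_inner T (red_gradient X u) (\<lambda>t. s n t - u t)
      + (L2_norm T (observation (\<lambda>t. red_state P X (s n) t - red_state P X u t)))\<^sup>2 / 2
        + \<beta> / 2 * (?d n)\<^sup>2) \<longlonglongrightarrow> red_cost P X u + 0 + 0\<^sup>2 / 2 + \<beta> / 2 * 0\<^sup>2"
    by (intro tendsto_intros g c lim) auto
  then have "(\<lambda>n. red_cost P X (s n)) \<longlonglongrightarrow> red_cost P X u" using red_cost_expansion[OF X u s] by simp
  then show "\<exists>u\<in>L2 T. (\<lambda>n. red_cost P X (s n)) \<longlonglongrightarrow> red_cost P X u" using u by blast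
qed

text \<open>The cost is compared along the direction of the gradient itself, where the first order
  coefficient is its squared norm.\<close>

lemma red_minimizer_gradient:
  assumes X: "subspace X" "closed X" and u: "u \<in> L2 T" and min: "\<And>w. w \<in> L2 T \<Longrightarrow> red_cost P X u
    \<le> red_cost P X w"
  shows "L2_norm T (red_gradient X u) = 0"
proof -
  let ?g = "red_gradient X u"
  have g: "?g \<in> L2 T" by (rule red_gradient_L2[OF X u])
  \<comment> \<open>An upper bound for the second order coefficient of the cost along this
    line.\<close>
  define k where "k = ((observation_bound * L2_norm T ?g)\<^sup>2 + \<beta> * (L2_norm T ?g)\<^sup>2) / 2"
  have "(L2_norm T ?g)\<^sup>2 * r + k * r\<^sup>2 \<ge> 0" for r
  proof -
    define v where "v t = u t + r *\<^sub>R ?g t" for t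
    have v: "v \<in> L2 T" unfolding v_def by (intro L2_add L2_scaleR u g)
    have vu: "(\<lambda>t. v t - u t) = (\<lambda>t. r *\<^sub>R ?g t)" by (simp add: v_def)
    have "L2_norm T (observation (\<lambda>t. red_state P X v t - red_state P X u t))
      \<le> observation_bound * (\<bar>r\<bar> * L2_norm T ?g)"
      using observation_forward_bound[OF X red_state_diff_forward[OF X v u] L2_diff[OF v u]]
        unfolding vu L2_norm_scaleR .
    then have "(L2_norm T (observation (\<lambda>t. red_state P X v t - red_state P X u t)))\<^sup>2
      \<le> (observation_bound * (\<bar>r\<bar> * L2_norm T ?g))\<^sup>2"
      by (intro power_mono) auto
    also have "\<dots> = (observation_bound * L2_norm T ?g)\<^sup>2 * r\<^sup>2" by (simp add: power_mult_distrib)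
    finally have "red_cost P X v \<le> red_cost P X u + r * (L2_norm T ?g)\<^sup>2
      + (observation_bound * L2_norm T ?g)\<^sup>2 * r\<^sup>2 / 2 + \<beta> / 2 * (r\<^sup>2 * (L2_norm T ?g)\<^sup>2)"
      unfolding red_cost_expansion[OF X u v] vu L2_inner_scaleR_right L2_norm_scaleR L2_inner_self
        by (simp add: power_mult_distrib)
    moreover have "\<dots> = red_cost P X u + ((L2_norm T ?g)\<^sup>2 * r + k * r\<^sup>2)"
      by (simp add: k_def field_simps)
    ultimately show ?thesis using min[OF v] by linarith
  qed
  from quadratic_nonneg_imp_linear_zero[OF this] show ?thesis by simp
qed

lemma red_optimal_exists:
  assumes X: "subspace X" "closed X"
  shows "\<exists>u\<in>L2 T. L2_norm T (red_gradient X u) = 0"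
  using red_minimizer_exists[OF X] red_minimizer_gradient[OF X] by blast

text \<open>The set \<open>K\<close> is arbitrary: a control with zero gradient minimizes over all
  controls, hence over any set that contains it. With \<open>K\<close> the reduced control space
  this removes the constraint from the reduced problem.\<close>

lemma red_optimal_minimizer:
  assumes X: "subspace X" "closed X" and u: "u \<in> L2 T" and g: "L2_norm T (red_gradient X u) = 0"
    and K: "K \<subseteq> L2 T" "u \<in> K"
  shows "unique_minimizer T K (red_cost P X) u"
proof -
  have le: "red_cost P X u + \<beta> / 2 * (L2_norm T (\<lambda>t. w t - u t))\<^sup>2 \<le> red_cost P X w" if w: "w \<in> L2 T"
    for w
  proof -
    have "\<bar>L2_inner T (red_gradient X u) (\<lambda>t. w t - u t)\<bar> \<le> 0"
      using L2_cauchy_schwarz[OF red_gradient_L2[OF X u] L2_diff[OF w u]] g by simp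
    then show ?thesis unfolding red_cost_expansion[OF X u w] by simp
  qed
  show ?thesis
    unfolding unique_minimizer_def
  proof (intro conjI ballI impI K)
    fix w assume "w \<in> K"
    then have w: "w \<in> L2 T" using K by blast
    have "0 \<le> \<beta> / 2 * (L2_norm T (\<lambda>t. w t - u t))\<^sup>2" using beta by simp
    then show "red_cost P X u \<le> red_cost P X w" using le[OF w] by linarith
    assume "red_cost P X w = red_cost P X u"
    then have "\<beta> / 2 * (L2_norm T (\<lambda>t. w t - u t))\<^sup>2 \<le> 0" using le[OF w] by linarith
    then have "L2_norm T (\<lambda>t. w t - u t) = 0" using beta by (simp add: mult_le_0_iff)
    then show "AE t in time_measure T. w t = u t" using AE_eq_if_L2_norm_le_zero[OF w u] by simp
  qed
qed

lemma red_gradient_cong: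
  assumes X: "subspace X" "closed X" and u: "u \<in> L2 T" and v: "v \<in> L2 T"
    and eq: "AE t in time_measure T. u t = v t"
  shows "L2_norm T (\<lambda>t. red_gradient X u t - red_gradient X v t) = 0"
proof -
  have "L2_norm T (\<lambda>t. u t - v t) = 0"
    unfolding L2_norm_zero_iff[OF L2_diff[OF u v]] using eq by eventually_elim simp
  then show ?thesis
    using red_gradient_lipschitz[OF X u v observation_forward_bound[OF X] observation_bound_nonneg]
      by (simp add: order_antisym)
qed

lemma red_gradient_norm_cong:
  assumes X: "subspace X" "closed X" and u: "u \<in> L2 T" and v: "v \<in> L2 T"
    and eq: "AE t in time_measure T. u t = v t"
  shows "L2_norm T (red_gradient X u) = L2_norm T (red_gradient X v)"
proof (rule L2_norm_cong_AE)
  show "AE t in time_measure T. red_gradient X u t = red_gradient X v t"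
    by (rule AE_eq_if_L2_norm_le_zero) (auto intro!: red_gradient_L2 X u v simp: red_gradient_cong[OF X
      u v eq])
qed (intro L2_measurable red_gradient_L2 X u v)+

text \<open>The supremum is finite by \<open>observation_bound\<close>, and scaling passes from the
  unit ball to arbitrary \<open>w\<close>. Uniqueness of the response allows any solution
  \<open>z\<close> in place of the chosen \<open>lin_state\<close>.\<close>

lemma norm_CS_bound:
  assumes w: "w \<in> L2 T" and z: "forward UNIV w z 0"
  shows "L2_norm T (observation z) \<le> norm_CS P * L2_norm T w"
proof -
  have UN: "subspace (UNIV :: 'v set)" "closed (UNIV :: 'v set)" by auto
  define S where "S = {L2_norm T (\<lambda>t. opC P t (j (lin_state P u t))) | u. u \<in> L2 T \<and> L2_norm T u \<le> 1}"
  have bdd: "bdd_above S"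
  proof (rule bdd_aboveI[of _ observation_bound])
    fix x assume "x \<in> S"
    then obtain u where u: "u \<in> L2 T" "L2_norm T u \<le> 1" "x = L2_norm T (observation (lin_state P u))"
      unfolding S_def observation_def[abs_def] by blast
    have "x \<le> observation_bound * L2_norm T u" unfolding u(3)
      by (rule observation_forward_bound[OF UN lin_state_forward[OF u(1)] u(1)])
    also have "\<dots> \<le> observation_bound * 1" using u(2) observation_bound_nonneg
      by (intro mult_left_mono) auto
    finally show "x \<le> observation_bound" by simp
  qed
  show ?thesis
  proof (cases "L2_norm T w = 0")
    case True
    then show ?thesis using observation_forward_bound[OF UN z w] by simp
  next
    case False
    then have n: "L2_norm T w > 0" using L2_norm_nonneg[of T w] by linarith
    define r where "r = 1 / L2_norm T w"
    let ?w = "\<lambda>t. r *\<^sub>R w t"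
    have w': "?w \<in> L2 T" using w by auto
    have "L2_norm T ?w \<le> 1" using n by (simp add: L2_norm_scaleR r_def)
    then have "L2_norm T (observation (lin_state P ?w)) \<in> S" unfolding S_def observation_def[abs_def]
      using w' by blast
    then have le: "L2_norm T (observation (lin_state P ?w)) \<le> norm_CS P" unfolding norm_CS_def
      using cSup_upper[OF _ bdd] by (simp add: S_def)
    have fz: "forward UNIV ?w (\<lambda>t. r *\<^sub>R z t) 0" using forward_scaleR[OF UN(1) z, of r] by simp
    have ae: "AE t in time_measure T. lin_state P ?w t = r *\<^sub>R z t"
      by (rule forward_unique[OF UN lin_state_forward[OF w'] fz])
    have "L2_norm T (observation (lin_state P ?w)) = L2_norm T (observation (\<lambda>t. r *\<^sub>R z t))"
    proof (rule L2_norm_cong_AE)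
      show "AE t in time_measure T. observation (lin_state P ?w) t = observation (\<lambda>t. r *\<^sub>R z t) t"
        using ae by eventually_elim (simp add: observation_def)
    qed (intro L2_measurable observation_L2 forward_L2(1)[OF fz] forward_L2(1)[OF lin_state_forward[OF
      w']])+
    also have "observation (\<lambda>t. r *\<^sub>R z t) = (\<lambda>t. r *\<^sub>R observation z t)"
      by (simp add: observation_def[abs_def] blinfun.scaleR_right)
    also have "L2_norm T \<dots> = L2_norm T (observation z) / L2_norm T w" using n
      by (simp add: L2_norm_scaleR r_def)
    finally show ?thesis using le n by (simp add: pos_divide_le_eq)
  qed
qed

text \<open>A full state with values in \<open>X\<close> also solves the equation tested on
  \<open>X\<close> only, so uniqueness identifies it with the reduced state; the same holds for the
  adjoint with the corresponding source.\<close>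

lemma red_gradient_consistent:
  assumes X: "subspace X" "closed X" and u: "u \<in> L2 T"
    and y: "AE t in time_measure T. red_state P UNIV u t \<in> X"
      and p: "AE t in time_measure T. dual_state UNIV u t \<in> X"
  shows "AE t in time_measure T. red_gradient X u t = red_gradient UNIV u t"
proof -
  have UN: "subspace (UNIV :: 'v set)" "closed (UNIV :: 'v set)" by auto
  let ?y = "red_state P UNIV u" and ?yX = "red_state P X u"
  note yL = red_state_L2[OF UN u] and yXL = red_state_L2[OF X u]
  obtain c where c: "fw.wpair UNIV ?y (\<lambda>t. bop (u t) - aop t (?y t)) c" "c 0 = y_init P"
    using red_state_forward[OF UN u] unfolding forward_def init_UNIV by blast
  have cX: "fw.wpair X ?y (\<lambda>t. bop (u t) - aop t (?y t)) c"
    by (rule fw.wpair_restrict[OF c(1) _ y]) simp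
  \<comment> \<open>The continuous representative stays in the closure of the image of
    \<open>X\<close> up to time 0, so the projection of the initial value has no effect.\<close>
  have "y_init P \<in> closure (j ` X)" using fw.wpair_closure[OF cX, of 0] c(2) T0 by simp
  then have "init X = y_init P" unfolding init_def
    by (rule orth_proj_id[OF closure_image_subspace[OF X(1)]])
  then have "forward X u ?y (init X)" unfolding forward_def using cX c(2) by auto
  then have ae: "AE t in time_measure T. ?yX t = ?y t"
    by (rule forward_unique[OF X red_state_forward[OF X u]])
  have y0: "L2_norm T (\<lambda>t. ?yX t - ?y t) = 0"
    unfolding L2_norm_zero_iff[OF L2_diff[OF yXL yL]] using ae by eventually_elim simp
  obtain d where d: "fw.wpair UNIV (dual_state UNIV u) (\<lambda>t. aop_adj t (dual_state UNIV u t) - source ?y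
    t) d" "d T = 0"
    using dual_state_backward[OF UN u] unfolding backward_def by blast
  have "fw.wpair X (dual_state UNIV u) (\<lambda>t. aop_adj t (dual_state UNIV u t) - source ?y t) d"
    by (rule fw.wpair_restrict[OF d(1) _ p]) simp
  then have bX: "backward X (source ?y) (dual_state UNIV u)" unfolding backward_def using d(2) by blast
  have "\<eta> * L2_norm T (\<lambda>t. dual_state X u t - dual_state UNIV u t)
    \<le> L2_norm T (\<lambda>t. source ?yX t - source ?y t)"
    by (rule backward_bound[OF X dual_state_backward[OF X u] bX source_L2[OF yXL] source_L2[OF yL]])
  also have "\<dots> \<le> 0" using source_diff_norm[OF yXL yL] y0 by simp
  finally have "L2_norm T (\<lambda>t. dual_state X u t - dual_state UNIV u t) \<le> 0" using \<eta>_pos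
    by (simp add: mult_le_0_iff)
  then have "AE t in time_measure T. dual_state X u t = dual_state UNIV u t"
    by (rule AE_eq_if_L2_norm_le_zero[OF backward_L2(1)[OF dual_state_backward[OF X u]]
      backward_L2(1)[OF bX]])
  then show ?thesis by eventually_elim (simp add: red_gradient_def)
qed

text \<open>Galerkin convergence applies directly to the state. The adjoint has a source that
  changes with \<open>k\<close>, so its error is split with the help of an intermediate adjoint that
  has the limit source.\<close>

lemma red_gradient_galerkin:
  assumes Xs: "\<And>k. subspace (Xs k)" "\<And>k. closed (Xs k)" and inc: "\<And>k m. k \<le> m \<Longrightarrow> Xs k \<subseteq> Xs m"
    and X: "X = closure (\<Union>k. Xs k)" "subspace X" and u: "u \<in> L2 T"
  shows "(\<lambda>k. L2_norm T (\<lambda>t. red_gradient (Xs k) u t - red_gradient X u t)) \<longlonglongrightarrow> 0"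
proof -
  have X': "subspace X" "closed X" using X by auto
  let ?y = "\<lambda>k. red_state P (Xs k) u" and ?yy = "red_state P X u"
  note ykL = red_state_L2[OF Xs u] and yL = red_state_L2[OF X' u]
  have "\<exists>c. \<forall>k. fw.wpair (Xs k) (?y k) (\<lambda>t. bop (u t) - aop t (?y k t)) (c k) \<and> c k 0 = init (Xs k)"
    by (rule choice) (use red_state_forward[OF Xs u] in \<open>simp add: forward_def\<close>)
  then obtain c where c: "\<And>k. fw.wpair (Xs k) (?y k) (\<lambda>t. bop (u t) - aop t (?y k t)) (c k)" "\<And>k. c k 0
    = init (Xs k)" by blast
  obtain cc where cc: "fw.wpair X ?yy (\<lambda>t. bop (u t) - aop t (?yy t)) cc" "cc 0 = init X"
    using red_state_forward[OF X' u] unfolding forward_def by blast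
  have y_lim: "(\<lambda>k. L2_norm T (\<lambda>t. ?y k t - ?yy t)) \<longlonglongrightarrow> 0"
  proof (rule fw.galerkin_convergence[OF Xs inc L2_blinfun(1)[OF u] c(1) c(2)[unfolded init_def]])
    show "fw.wpair (closure (\<Union>k. Xs k)) ?yy (\<lambda>t. bop (u t) - aop t (?yy t)) cc"
      by (fold X(1)) (rule cc(1))
    show "cc 0 = orth_proj (closure (j ` closure (\<Union>k. Xs k))) (y_init P)"
      by (fold X(1) init_def) (rule cc(2))
  qed
  let ?f = "source ?yy"
  have fL: "?f \<in> L2 T" by (rule source_L2[OF yL])
  \<comment> \<open>These adjoints share the source of the limit and converge by the Galerkin result
    for reversed time; their distance to the reduced adjoints is bounded by the error of the
    states.\<close>
  have "\<exists>q. \<forall>k. backward (Xs k) ?f (q k)" by (rule choice) (use backward_exists[OF Xs fL] in blast)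
  then obtain q where q: "\<And>k. backward (Xs k) ?f (q k)" by blast
  let ?p = "\<lambda>k. dual_state (Xs k) u" and ?pp = "dual_state X u"
  note pk = dual_state_backward[OF Xs u] and pp = dual_state_backward[OF X' u]
  note pkL = backward_L2(1)[OF pk] and ppL = backward_L2(1)[OF pp] and qL = backward_L2(1)[OF q]
  have "\<exists>d. \<forall>k. fw.wpair (Xs k) (\<lambda>t. q k (T - t)) (\<lambda>t. ?f (T - t) - aop_adj (T - t) (q k (T - t))) (d k)
    \<and> d k 0 = 0"
    by (rule choice) (use q in \<open>simp add: backward_reflect\<close>)
  then obtain d where d: "\<And>k. fw.wpair (Xs k) (\<lambda>t. q k (T - t)) (\<lambda>t. ?f (T - t) - aop_adj (T - t) (q k
    (T - t))) (d k)" "\<And>k. d k 0 = 0"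
    by blast
  obtain dd where dd: "fw.wpair X (\<lambda>t. ?pp (T - t)) (\<lambda>t. ?f (T - t) - aop_adj (T - t) (?pp (T - t))) dd"
    "dd 0 = 0"
    using pp unfolding backward_reflect by blast
  have o0: "orth_proj (closure (j ` Y)) 0 = 0" if "subspace Y" for Y
    by (rule orth_proj_id[OF closure_image_subspace[OF that]]) (rule subspace_0[OF
      closure_image_subspace(1)[OF that]])
  have "(\<lambda>k. L2_norm T (\<lambda>t. q k (T - t) - ?pp (T - t))) \<longlonglongrightarrow> 0"
  proof (rule bw.galerkin_convergence[OF Xs inc L2_reflect[OF fL] d(1)])
    show "d k 0 = orth_proj (closure (j ` Xs k)) 0" for k using d(2) o0[OF Xs(1)] by simp
    show "fw.wpair (closure (\<Union>k. Xs k)) (\<lambda>t. ?pp (T - t)) (\<lambda>t. ?f (T - t) - aop_adj (T - t) (?pp (T -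
      t))) dd"
      by (fold X(1)) (rule dd(1))
    show "dd 0 = orth_proj (closure (j ` closure (\<Union>k. Xs k))) 0"
      by (fold X(1)) (simp add: dd(2) o0[OF X(2)])
  qed
  then have q_lim: "(\<lambda>k. L2_norm T (\<lambda>t. q k t - ?pp t)) \<longlonglongrightarrow> 0"
    using L2_norm_reflect[OF L2_diff[OF qL ppL]] by simp
  have pq: "L2_norm T (\<lambda>t. ?p k t - q k t) \<le> (Kc * norm j)\<^sup>2 / \<eta> * L2_norm T (\<lambda>t. ?y k t - ?yy t)" for k
  proof -
    have "\<eta> * L2_norm T (\<lambda>t. ?p k t - q k t) \<le> L2_norm T (\<lambda>t. source (?y k) t - ?f t)"
      by (rule backward_bound[OF Xs pk q source_L2[OF ykL] fL])
    also have "\<dots> \<le> (Kc * norm j)\<^sup>2 * L2_norm T (\<lambda>t. ?y k t - ?yy t)"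
      by (rule source_diff_norm[OF ykL yL])
    finally show ?thesis using \<eta>_pos by (simp add: pos_le_divide_eq mult.commute)
  qed
  have bnd: "L2_norm T (\<lambda>t. red_gradient (Xs k) u t - red_gradient X u t)
      \<le> norm bop_adj * ((Kc * norm j)\<^sup>2 / \<eta> * L2_norm T (\<lambda>t. ?y k t - ?yy t)
        + L2_norm T (\<lambda>t. q k t - ?pp t))" for k
  proof -
    have "(\<lambda>t. red_gradient (Xs k) u t - red_gradient X u t) = (\<lambda>t. bop_adj (?p k t - ?pp t))"
      by (simp add: red_gradient_def blinfun.diff_right)
    then have "L2_norm T (\<lambda>t. red_gradient (Xs k) u t - red_gradient X u t)
      \<le> norm bop_adj * L2_norm T (\<lambda>t. ?p k t - ?pp t)"
      using L2_blinfun(2)[OF L2_diff[OF pkL ppL]] by simp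
    also have "\<dots> \<le> norm bop_adj * ((Kc * norm j)\<^sup>2 / \<eta> * L2_norm T (\<lambda>t. ?y k t - ?yy t)
      + L2_norm T (\<lambda>t. q k t - ?pp t))"
      using L2_norm_diff_triangle[OF pkL[of k] qL[of k] ppL] pq[of k] by (intro mult_left_mono) auto
    finally show ?thesis .
  qed
  have "(\<lambda>k. norm bop_adj * ((Kc * norm j)\<^sup>2 / \<eta> * L2_norm T (\<lambda>t. ?y k t - ?yy t)
    + L2_norm T (\<lambda>t. q k t - ?pp t)))
      \<longlonglongrightarrow> norm bop_adj * ((Kc * norm j)\<^sup>2 / \<eta> * 0 + 0)"
    by (intro tendsto_intros y_lim q_lim)
  then have lim: "(\<lambda>k. norm bop_adj * ((Kc * norm j)\<^sup>2 / \<eta> * L2_norm T (\<lambda>t. ?y k t - ?yy t)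
    + L2_norm T (\<lambda>t. q k t - ?pp t))) \<longlonglongrightarrow> 0"
    by simp
  show ?thesis
    by (rule Lim_null_comparison[OF always_eventually[OF allI] lim]) (simp only: real_norm_def
      abs_of_nonneg[OF L2_norm_nonneg] bnd)
qed

lemma optimal_controls_converge:
  assumes Xs: "\<And>k. subspace (Xs k)" "\<And>k. closed (Xs k)" and inc: "\<And>k m. k \<le> m \<Longrightarrow> Xs k \<subseteq> Xs m"
    and u: "\<And>k. u k \<in> L2 T" "\<And>k. L2_norm T (red_gradient (Xs k) (u k)) = 0"
  shows "\<exists>v\<in>L2 T. (\<lambda>k. L2_norm T (\<lambda>t. u k t - v t)) \<longlonglongrightarrow> 0"
proof -
  define X where "X = closure (\<Union>k. Xs k)"
  have X: "subspace X" unfolding X_def by (rule subspace_closure[OF subspace_UN_increasing[OF Xs(1)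
    inc]])
  have Xc: "closed X" by (simp add: X_def)
  obtain v where v: "v \<in> L2 T" "L2_norm T (red_gradient X v) = 0" using red_optimal_exists[OF X Xc]
    by blast
  have "(\<lambda>k. L2_norm T (\<lambda>t. red_gradient (Xs k) v t - red_gradient X v t)) \<longlonglongrightarrow> 0"
    by (rule red_gradient_galerkin[OF Xs inc X_def X v(1)])
  then have lim: "(\<lambda>k. (1 / \<beta>) * L2_norm T (\<lambda>t. red_gradient (Xs k) v t - red_gradient X v t)) \<longlonglongrightarrow> 0"
    by (rule tendsto_mult_right_zero)
  have le: "\<beta> * L2_norm T (\<lambda>t. u k t - v t) \<le> L2_norm T (\<lambda>t. red_gradient (Xs k) v t - red_gradient X v
    t)" for k
  proof -
    note g1 = red_gradient_L2[OF Xs u(1)] and g2 = red_gradient_L2[OF Xs v(1)] and g3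
      = red_gradient_L2[OF X Xc v(1)]
    have "\<beta> * L2_norm T (\<lambda>t. u k t - v t) \<le> L2_norm T (\<lambda>t. red_gradient (Xs k) (u k) t - red_gradient
      (Xs k) v t)"
      by (rule red_gradient_monotone[OF Xs u(1) v(1)])
    also have "\<dots> \<le> L2_norm T (red_gradient (Xs k) (u k)) + L2_norm T (red_gradient (Xs k) v)"
      by (rule L2_norm_triangle_diff[OF g1 g2])
    also have "L2_norm T (red_gradient (Xs k) v)
      \<le> L2_norm T (\<lambda>t. red_gradient (Xs k) v t - red_gradient X v t) + L2_norm T (red_gradient X v)"
      using L2_norm_triangle[OF L2_diff[OF g2 g3] g3] by simp
    finally show ?thesis using u(2) v(2) by simp
  qed
  have "L2_norm T (\<lambda>t. u k t - v t) \<le> (1 / \<beta>) * L2_norm T (\<lambda>t. red_gradient (Xs k) v t - red_gradient X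
    v t)" for k
    using le[of k] beta by (simp add: pos_le_divide_eq mult.commute)
  then have "(\<lambda>k. L2_norm T (\<lambda>t. u k t - v t)) \<longlonglongrightarrow> 0"
    by (intro Lim_null_comparison[OF always_eventually[OF allI] lim]) (simp only: real_norm_def
      abs_of_nonneg[OF L2_norm_nonneg])
  then show ?thesis using v(1) by blast
qed

end

section \<open>POD spaces and the adaptive algorithm\<close>

text \<open>A diagonal sequence makes the inner products with a countable dense set converge, and
  boundedness of the sequence extends this to all vectors.\<close>

lemma bounded_weakly_convergent_subsequence:
  fixes x :: "nat \<Rightarrow> 'a::{real_inner, second_countable_topology}"
  assumes x: "\<And>n. norm (x n) \<le> B"
  shows "\<exists>r::nat\<Rightarrow>nat. strict_mono r \<and> (\<forall>w. convergent (\<lambda>n. x (r n) \<bullet> w))"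
proof -
  obtain D :: "'a set" where D: "countable D" "\<And>U. open U \<Longrightarrow> U \<noteq> {} \<Longrightarrow> \<exists>d\<in>D. d \<in> U"
    using countable_dense_setE by blast
  have Dne: "D \<noteq> {}" using D(2)[of UNIV] by auto
  define d where "d = from_nat_into D"
  have dr: "range d = D" unfolding d_def by (rule range_from_nat_into[OF Dne D(1)])
  interpret subseqs "\<lambda>n s. convergent (\<lambda>k. x (s k) \<bullet> d n)"
  proof
    fix n :: nat and s :: "nat \<Rightarrow> nat" assume "strict_mono s"
    have "bounded (range (\<lambda>k. x (s k) \<bullet> d n))"
    proof (rule boundedI)
      fix y assume "y \<in> range (\<lambda>k. x (s k) \<bullet> d n)"
      then obtain k where y: "y = x (s k) \<bullet> d n" by blast
      have "norm y \<le> norm (x (s k)) * norm (d n)" unfolding y real_norm_def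
        by (rule Cauchy_Schwarz_ineq2)
      also have "\<dots> \<le> B * norm (d n)" by (intro mult_right_mono x) auto
      finally show "norm y \<le> B * norm (d n)" .
    qed
    from bounded_imp_convergent_subsequence[OF this] obtain l r where
      "strict_mono r" "((\<lambda>k. x (s k) \<bullet> d n) \<circ> r) \<longlonglongrightarrow> l" by blast
    then show "\<exists>r'. strict_mono r' \<and> convergent (\<lambda>k. x ((s \<circ> r') k) \<bullet> d n)"
      by (intro exI[of _ r]) (auto simp: convergent_def comp_def)
  qed
  have conv: "convergent (\<lambda>k. x (diagseq k) \<bullet> d n)" for n
  proof -
    have "convergent (\<lambda>k. x ((diagseq \<circ> (+) (Suc n)) k) \<bullet> d n)"
    proof (rule diagseq_holds)
      fix m :: nat and s r :: "nat \<Rightarrow> nat" assume "strict_mono r" "convergent (\<lambda>k. x (s k) \<bullet> d m)"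
      then show "convergent (\<lambda>k. x ((s \<circ> r) k) \<bullet> d m)"
        using convergent_subseq_convergent[of "\<lambda>k. x (s k) \<bullet> d m" r] by (simp add: comp_def)
    qed
    then show ?thesis
      using convergent_ignore_initial_segment[of "\<lambda>k. x (diagseq k) \<bullet> d n" "Suc n"]
        by (simp add: comp_def add.commute)
  qed
  have "convergent (\<lambda>k. x (diagseq k) \<bullet> w)" for w
  proof -
    have B0: "0 \<le> B" using x[of 0] norm_ge_zero order_trans by blast
    have "Cauchy (\<lambda>k. x (diagseq k) \<bullet> w)"
    proof (rule CauchyI)
      fix e :: real assume e: "e > 0"
      \<comment> \<open>Replacing \<open>w\<close> by a point of the dense set costs at most
        \<open>e / 4\<close> on either side, which leaves \<open>e / 2\<close> for the Cauchy
        property at that point; adding 1 to \<open>B\<close> avoids division by zero.\<close>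
      define \<delta> where "\<delta> = e / (4 * (B + 1))"
      have \<delta>: "\<delta> > 0" "B * \<delta> \<le> e / 4" using e B0 by (auto simp: \<delta>_def field_simps)
      obtain v where "v \<in> D" "v \<in> ball w \<delta>" using D(2)[of "ball w \<delta>"] \<delta> by auto
      then obtain n where n: "dist w (d n) < \<delta>" using dr by auto
      have "Cauchy (\<lambda>k. x (diagseq k) \<bullet> d n)" using conv by (simp add: Cauchy_convergent_iff)
      then obtain M where M: "\<And>p q. p \<ge> M \<Longrightarrow> q \<ge> M
        \<Longrightarrow> norm (x (diagseq p) \<bullet> d n - x (diagseq q) \<bullet> d n) < e / 2"
        using CauchyD[of _ "e/2"] e by (metis half_gt_zero)
      have near: "\<bar>x k \<bullet> w - x k \<bullet> d n\<bar> \<le> e / 4" for k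
      proof -
        have "\<bar>x k \<bullet> (w - d n)\<bar> \<le> norm (x k) * norm (w - d n)" by (rule Cauchy_Schwarz_ineq2)
        also have "\<dots> \<le> B * \<delta>" using x[of k] n B0 by (intro mult_mono) (auto simp: dist_norm)
        finally show ?thesis using \<delta>(2) by (simp add: inner_diff_right)
      qed
      have "norm (x (diagseq p) \<bullet> w - x (diagseq q) \<bullet> w) < e" if "p \<ge> M" "q \<ge> M" for p q
        using M[OF that] near[of "diagseq p"] near[of "diagseq q"] unfolding real_norm_def by linarith
      then show "\<exists>M. \<forall>m\<ge>M. \<forall>n\<ge>M. norm (x (diagseq m) \<bullet> w - x (diagseq n) \<bullet> w) < e" by blast
    qed
    then show ?thesis by (simp add: Cauchy_convergent_iff)
  qed
  then show ?thesis using subseq_diagseq by blast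
qed

section \<open>The POD operator of a finite snapshot set\<close>

locale snapshot_set =
  fixes T :: real and S :: "(real \<Rightarrow> 'v::{real_inner, banach, second_countable_topology}) set"
  assumes finite_S: "finite S" and S_L2: "S \<subseteq> L2 T"
begin

lemma snapshot_scaled:
  assumes s: "s \<in> S"
  shows "integrable (time_measure T) (\<lambda>t. (s t \<bullet> v) *\<^sub>R s t)" "norm ((s t \<bullet> v) *\<^sub>R s t)
    \<le> norm v * (norm (s t))\<^sup>2"
proof -
  have sL: "s \<in> L2 T" using s S_L2 by blast
  have [measurable]: "s \<in> borel_measurable (time_measure T)" by (rule L2_measurable[OF sL])
  have b: "norm ((s t \<bullet> v) *\<^sub>R s t) \<le> norm v * (norm (s t))\<^sup>2" for t
  proof -
    have "\<bar>s t \<bullet> v\<bar> * norm (s t) \<le> (norm (s t) * norm v) * norm (s t)"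
      by (intro mult_right_mono Cauchy_Schwarz_ineq2) auto
    then show ?thesis by (simp add: power2_eq_square mult_ac)
  qed
  show "norm ((s t \<bullet> v) *\<^sub>R s t) \<le> norm v * (norm (s t))\<^sup>2" by (rule b)
  have m: "(\<lambda>t. (s t \<bullet> v) *\<^sub>R s t) \<in> borel_measurable (time_measure T)" by measurable
  show "integrable (time_measure T) (\<lambda>t. (s t \<bullet> v) *\<^sub>R s t)"
    by (rule Bochner_Integration.integrable_bound[OF integrable_mult_right[OF L2_integrable[OF sL], of
      "norm v"] m])
      (use b in auto)
qed

lemma pod_inner: "pod_operator T S v \<bullet> w = (\<Sum>s\<in>S. \<integral>t. (s t \<bullet> v) * (s t \<bullet> w) \<partial>time_measure T)"
  unfolding pod_operator_def inner_sum_left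
proof (rule sum.cong[OF refl])
  fix s assume s: "s \<in> S"
  show "(\<integral>t. (s t \<bullet> v) *\<^sub>R s t \<partial>time_measure T) \<bullet> w = (\<integral>t. (s t \<bullet> v) * (s t \<bullet> w) \<partial>time_measure T)"
    using integral_inner_left[OF snapshot_scaled(1)[OF s], of v w] by simp
qed

lemma pod_bounded_linear: "bounded_linear (pod_operator T S)"
proof (rule bounded_linear_intro[where K = "\<Sum>s\<in>S. \<integral>t. (norm (s t))\<^sup>2 \<partial>time_measure T"])
  fix v w :: 'v and r :: real
  show "pod_operator T S (v + w) = pod_operator T S v + pod_operator T S w"
    unfolding pod_operator_def sum.distrib[symmetric]
    by (rule sum.cong) (auto simp: inner_add_right scaleR_add_left snapshot_scaled(1))
  show "pod_operator T S (r *\<^sub>R v) = r *\<^sub>R pod_operator T S v"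
    unfolding pod_operator_def scaleR_sum_right
    by (rule sum.cong) (auto simp: scaleR_scaleR[symmetric] simp del: scaleR_scaleR)
  have "norm (pod_operator T S v) \<le> (\<Sum>s\<in>S. norm v * (\<integral>t. (norm (s t))\<^sup>2 \<partial>time_measure T))"
    unfolding pod_operator_def
  proof (rule sum_norm_le)
    fix s assume s: "s \<in> S"
    then have sL: "s \<in> L2 T" using S_L2 by blast
    have "norm (\<integral>t. (s t \<bullet> v) *\<^sub>R s t \<partial>time_measure T) \<le> (\<integral>t. norm ((s t \<bullet> v) *\<^sub>R s t) \<partial>time_measure T)"
      by (rule integral_norm_bound)
    also have "\<dots> \<le> (\<integral>t. norm v * (norm (s t))\<^sup>2 \<partial>time_measure T)"
      by (intro integral_mono integrable_norm snapshot_scaled(1)[OF s] integrable_mult_right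
        L2_integrable[OF sL] snapshot_scaled(2)[OF s])
    also have "\<dots> = norm v * (\<integral>t. (norm (s t))\<^sup>2 \<partial>time_measure T)" by simp
    finally show "norm (\<integral>t. (s t \<bullet> v) *\<^sub>R s t \<partial>time_measure T)
      \<le> norm v * (\<integral>t. (norm (s t))\<^sup>2 \<partial>time_measure T)" .
  qed
  then show "norm (pod_operator T S v) \<le> norm v * (\<Sum>s\<in>S. \<integral>t. (norm (s t))\<^sup>2 \<partial>time_measure T)"
    by (simp add: sum_distrib_left)
qed

text \<open>Compactness follows without finite rank approximation: along a weakly convergent
  subsequence the integrands converge pointwise in norm, dominated by the squared norm of the
  snapshot.\<close>

sublocale R: compact_nonneg_operator "pod_operator T S"
proof (rule compact_nonneg_operator.intro[OF pod_bounded_linear])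
  show "pod_operator T S x \<bullet> y = x \<bullet> pod_operator T S y" for x y
    unfolding inner_commute[of x "pod_operator T S y"] pod_inner by (simp add: mult.commute)
  show "0 \<le> pod_operator T S x \<bullet> x" for x
    unfolding pod_inner by (intro sum_nonneg integral_nonneg_AE AE_I2) auto
  fix x :: "nat \<Rightarrow> 'v" assume x: "\<And>n. norm (x n) \<le> 1"
  obtain r where r: "strict_mono (r::nat\<Rightarrow>nat)" "\<And>w. convergent (\<lambda>n. x (r n) \<bullet> w)"
    using bounded_weakly_convergent_subsequence[of x 1, OF x] by blast
  have "\<exists>l. (\<lambda>n. \<integral>t. (s t \<bullet> x (r n)) *\<^sub>R s t \<partial>time_measure T) \<longlonglongrightarrow> l" if s: "s \<in> S" for s
  proof -
    have sL: "s \<in> L2 T" using s S_L2 by blast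
    define f where "f t = lim (\<lambda>n. (s t \<bullet> x (r n)) *\<^sub>R s t)" for t
    have lim: "(\<lambda>n. (s t \<bullet> x (r n)) *\<^sub>R s t) \<longlonglongrightarrow> f t" for t
    proof -
      obtain l where "(\<lambda>n. x (r n) \<bullet> s t) \<longlonglongrightarrow> l" using r(2) unfolding convergent_def by blast
      then have "(\<lambda>n. (s t \<bullet> x (r n)) *\<^sub>R s t) \<longlonglongrightarrow> l *\<^sub>R s t"
        unfolding inner_commute[of "s t"] by (intro tendsto_intros)
      then have "convergent (\<lambda>n. (s t \<bullet> x (r n)) *\<^sub>R s t)" unfolding convergent_def by blast
      then show ?thesis unfolding f_def by (simp add: convergent_LIMSEQ_iff)
    qed
    have m: "(\<lambda>t. (s t \<bullet> x (r n)) *\<^sub>R s t) \<in> borel_measurable (time_measure T)" for n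
      using borel_measurable_integrable[OF snapshot_scaled(1)[OF s]] .
    have "(\<lambda>n. \<integral>t. (s t \<bullet> x (r n)) *\<^sub>R s t \<partial>time_measure T) \<longlonglongrightarrow> (\<integral>t. f t \<partial>time_measure T)"
    proof (rule integral_dominated_convergence[where w = "\<lambda>t. (norm (s t))\<^sup>2"])
      show "f \<in> borel_measurable (time_measure T)" by (rule borel_measurable_LIMSEQ_metric[OF m lim])
      show "AE t in time_measure T. norm ((s t \<bullet> x (r n)) *\<^sub>R s t) \<le> (norm (s t))\<^sup>2" for n
      proof (rule AE_I2)
        fix t
        have "norm ((s t \<bullet> x (r n)) *\<^sub>R s t) \<le> norm (x (r n)) * (norm (s t))\<^sup>2"
          by (rule snapshot_scaled(2)[OF s])
        also have "\<dots> \<le> 1 * (norm (s t))\<^sup>2" by (intro mult_right_mono x) auto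
        finally show "norm ((s t \<bullet> x (r n)) *\<^sub>R s t) \<le> (norm (s t))\<^sup>2" by simp
      qed
    qed (use m lim L2_integrable[OF sL] in auto)
    then show ?thesis by blast
  qed
  then have "\<forall>s\<in>S. \<exists>l. (\<lambda>n. \<integral>t. (s t \<bullet> x (r n)) *\<^sub>R s t \<partial>time_measure T) \<longlonglongrightarrow> l" by blast
  from bchoice[OF this] obtain l where l: "\<And>s. s \<in> S \<Longrightarrow> (\<lambda>n. \<integral>t. (s t \<bullet> x (r n)) *\<^sub>R s t \<partial>time_measure T)
    \<longlonglongrightarrow> l s" by blast
  have "(\<lambda>n. pod_operator T S (x (r n))) \<longlonglongrightarrow> (\<Sum>s\<in>S. l s)"
    unfolding pod_operator_def by (intro tendsto_sum l)
  then show "\<exists>l r. strict_mono (r::nat\<Rightarrow>nat) \<and> (\<lambda>n. pod_operator T S (x (r n))) \<longlonglongrightarrow> l" using r(1) by blast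
qed

text \<open>The quadratic form of the POD operator is the sum of the integrals of
  \<open>(s t \<bullet> z)\<^sup>2\<close>, so it vanishes only if every snapshot is orthogonal to
  \<open>z\<close> almost everywhere.\<close>

lemma kernel_iff: "pod_operator T S z = 0 \<longleftrightarrow> (\<forall>s\<in>S. AE t in time_measure T. s t \<bullet> z = 0)"
proof
  assume "pod_operator T S z = 0"
  then have "(\<Sum>s\<in>S. \<integral>t. (s t \<bullet> z) * (s t \<bullet> z) \<partial>time_measure T) = 0" using pod_inner[of z z] by simp
  moreover have "0 \<le> (\<integral>t. (s t \<bullet> z) * (s t \<bullet> z) \<partial>time_measure T)" for s :: "real \<Rightarrow> 'v"
    by (intro integral_nonneg_AE AE_I2) auto
  ultimately have z: "\<And>s. s \<in> S \<Longrightarrow> (\<integral>t. (s t \<bullet> z) * (s t \<bullet> z) \<partial>time_measure T) = 0"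
    using finite_S by (simp add: sum_nonneg_eq_0_iff)
  show "\<forall>s\<in>S. AE t in time_measure T. s t \<bullet> z = 0"
  proof
    fix s assume s: "s \<in> S"
    have "integrable (time_measure T) (\<lambda>t. ((s t \<bullet> z) *\<^sub>R s t) \<bullet> z)"
      by (rule integrable_inner_left) (rule snapshot_scaled(1)[OF s])
    then have i: "integrable (time_measure T) (\<lambda>t. (s t \<bullet> z) * (s t \<bullet> z))" by simp
    have "AE t in time_measure T. (s t \<bullet> z) * (s t \<bullet> z) = 0"
      using integral_nonneg_eq_0_iff_AE[OF i] z[OF s] by simp
    then show "AE t in time_measure T. s t \<bullet> z = 0" by eventually_elim simp
  qed
next
  assume ae: "\<forall>s\<in>S. AE t in time_measure T. s t \<bullet> z = 0"
  have "(\<integral>t. (s t \<bullet> z) *\<^sub>R s t \<partial>time_measure T) = 0" if "s \<in> S" for s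
  proof (rule integral_eq_zero_AE)
    show "AE t in time_measure T. (s t \<bullet> z) *\<^sub>R s t = 0" using ae that by (auto elim!: eventually_mono)
  qed
  then show "pod_operator T S z = 0" by (simp add: pod_operator_def)
qed

text \<open>The closure of the range of the self-adjoint POD operator, described as the orthogonal
  complement of its kernel; in this form monotonicity in the snapshot set is immediate.\<close>

definition W :: "'v set" where
  "W = {x. \<forall>z. pod_operator T S z = 0 \<longrightarrow> x \<bullet> z = 0}"

lemma W_subspace: "subspace W"
  by (auto simp: W_def subspace_def inner_add_left)

lemma W_closed: "closed W"
proof -
  have "W = (\<Inter>z\<in>{z. pod_operator T S z = 0}. {x. x \<bullet> z = 0})" by (auto simp: W_def)
  moreover have "closed {x. x \<bullet> z = 0}" for z :: 'v by (intro closed_Collect_eq continuous_intros)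
  ultimately show ?thesis by (simp only:) (intro closed_INT ballI)
qed

lemma max_pod_rank_eq: "max_pod_rank T S = R.rank"
  unfolding max_pod_rank_def by (rule R.edim_range)

lemma pod_eigensystem_exists: "pod_eigensystem T S R.eigenval R.eigenvec"
  unfolding pod_eigensystem_def max_pod_rank_eq R.less_rank_iff
proof (intro conjI allI impI; (elim conjE)?)
  show "R.eigenval i > 0" for i by (rule R.eigenval_pos)
  show "pod_operator T S (R.eigenvec i) = R.eigenval i *\<^sub>R R.eigenvec i" for i by (rule R.R_eigenvec)
  show "R.eigenval k \<le> R.eigenval i" if "i \<le> k" "R.eigenvec k \<noteq> 0" for i k using that
    by (rule R.eigenval_decreasing)
  show "R.eigenvec i \<bullet> R.eigenvec k = (if i = k then 1 else 0)" if "R.eigenvec i \<noteq> 0" for i k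
    using that by (simp add: ons_inner[OF R.ons_eigenvec])
  show "w \<in> span {R.eigenvec i |i. R.eigenvec i \<noteq> 0 \<and> R.eigenval i = \<mu>}"
    if "\<mu> > 0" "pod_operator T S w = \<mu> *\<^sub>R w" for \<mu> w
    using that by (rule R.eigenvector_in_span)
qed

text \<open>Eigenvectors for positive eigenvalues are orthogonal to the kernel, and together they
  exhaust its complement. Hence the reduced space does not depend on the eigensystem selected in a
  step.\<close>

lemma pod_space_eq:
  assumes es: "pod_eigensystem T S lam v"
  shows "pod_space (max_pod_rank T S) v = W"
proof
  let ?r = "max_pod_rank T S" and ?X = "pod_space (max_pod_rank T S) v"
  have ev: "\<And>i. enat i < ?r \<Longrightarrow> lam i > 0 \<and> pod_operator T S (v i) = lam i *\<^sub>R v i"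
    and all: "\<And>\<mu> w. \<mu> > 0 \<Longrightarrow> pod_operator T S w = \<mu> *\<^sub>R w \<Longrightarrow> w \<in> span {v i | i. enat i < ?r \<and> lam i = \<mu>}"
    using es unfolding pod_eigensystem_def by blast+
  have "v i \<in> W" if i: "enat i < ?r" for i
    unfolding W_def
  proof safe
    fix z assume z: "pod_operator T S z = 0"
    have "lam i * (v i \<bullet> z) = pod_operator T S (v i) \<bullet> z" using ev[OF i] by simp
    also have "\<dots> = 0" by (simp add: R.sym z)
    finally show "v i \<bullet> z = 0" using ev[OF i] by simp
  qed
  then have "span {v i | i. enat i < ?r} \<subseteq> W" by (intro span_minimal W_subspace) auto
  then show "?X \<subseteq> W" unfolding pod_space_def by (rule closure_minimal[OF _ W_closed])
  show "W \<subseteq> ?X"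
  proof
    fix x assume x: "x \<in> W"
    show "x \<in> ?X"
    proof (rule R.orthogonal_closed_span_kernel)
      show "subspace ?X" unfolding pod_space_def by (intro subspace_closure subspace_span)
      show "closed ?X" by (simp add: pod_space_def)
      fix \<mu> w assume "\<mu> > 0" "pod_operator T S w = \<mu> *\<^sub>R w"
      then have "w \<in> span {v i | i. enat i < ?r \<and> lam i = \<mu>}" by (rule all)
      then have "w \<in> span {v i | i. enat i < ?r}"
        using span_mono[of "{v i | i. enat i < ?r \<and> lam i = \<mu>}" "{v i | i. enat i < ?r}"] by blast
      then show "w \<in> ?X" unfolding pod_space_def using closure_subset by blast
    next
      show "x \<bullet> z = 0" if "pod_operator T S z = 0" for z using x that by (simp add: W_def)
    qed
  qed
qed

text \<open>For each kernel element the orthogonality fails on a null set that may depend on the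
  element. A countable dense subset of the kernel provides a common null set, and closedness covers
  the rest.\<close>

lemma snapshot_in_W:
  assumes s: "s \<in> S"
  shows "AE t in time_measure T. s t \<in> W"
proof -
  obtain D where D: "countable D" "D \<subseteq> {z. pod_operator T S z = 0}" "{z. pod_operator T S z
    = 0} \<subseteq> closure D"
    using separable by metis
  have "AE t in time_measure T. \<forall>z\<in>D. s t \<bullet> z = 0"
    using D kernel_iff s by (subst AE_ball_countable) auto
  then show ?thesis
  proof eventually_elim
    fix t assume t: "\<forall>z\<in>D. s t \<bullet> z = 0"
    have cl: "closed {z. s t \<bullet> z = 0}" by (intro closed_Collect_eq continuous_intros)
    have "D \<subseteq> {z. s t \<bullet> z = 0}" using t by blast
    then have "closure D \<subseteq> {z. s t \<bullet> z = 0}" by (rule closure_minimal[OF _ cl])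
    with D(3) show "s t \<in> W" by (auto simp: W_def)
  qed
qed

end

text \<open>More snapshots impose more orthogonality conditions, so the kernel shrinks and its
  complement grows.\<close>

lemma snapshot_W_mono:
  assumes "snapshot_set T S" "snapshot_set T S'" "S \<subseteq> S'"
  shows "snapshot_set.W T S \<subseteq> snapshot_set.W T S'"
proof -
  interpret A: snapshot_set T S by fact
  interpret B: snapshot_set T S' by fact
  show ?thesis unfolding A.W_def B.W_def using A.kernel_iff B.kernel_iff assms(3) by blast
qed

section \<open>Steps and runs of the algorithm\<close>

context optimal_control
begin

lemma bop_adj_closure_span:
  assumes "x \<in> closure (span A)"
  shows "bop_adj x \<in> closure (span (bop_adj ` A))"
proof -
  have lin: "linear (blinfun_apply bop_adj)" by (simp add: bounded_linear.linear
    blinfun.bounded_linear_right)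
  obtain f where f: "\<And>n. f n \<in> span A" "f \<longlonglongrightarrow> x" using assms unfolding closure_sequential by blast
  have "(\<lambda>n. bop_adj (f n)) \<longlonglongrightarrow> bop_adj x" by (intro blinfun.tendsto tendsto_const f)
  moreover have "bop_adj (f n) \<in> span (bop_adj ` A)" for n using f(1) span_linear_image[OF lin, of A]
    by blast
  ultimately show ?thesis unfolding closure_sequential
    by (intro exI[of _ "\<lambda>n. bop_adj (f n)"] conjI allI)
qed

lemma bop_adj_pod_space:
  "x \<in> pod_space r v \<Longrightarrow> bop_adj x \<in> closure (span (bop_adj ` {v i |i. enat i < r}))"
  unfolding pod_space_def by (rule bop_adj_closure_span)

text \<open>A vanishing gradient expresses the control almost everywhere as
  \<open>- (1 / \<beta>)\<close> times the image of the adjoint state under \<open>bop_adj\<close>.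
  The adjoint state lies in the POD space, whose basis generates the reduced control space under the
  same map.\<close>

lemma red_optimal_in_control_space:
  assumes u: "u \<in> L2 T" "L2_norm T (red_gradient (pod_space r v) u) = 0"
  shows "u \<in> L2_into T (red_control_space P r v)"
proof -
  let ?X = "pod_space r v" and ?U = "red_control_space P r v"
  have X: "subspace ?X" "closed ?X" unfolding pod_space_def by (auto intro: subspace_closure)
  have U: "subspace ?U" unfolding red_control_space_def by (intro subspace_closure subspace_span)
  have Ueq: "?U = closure (span (bop_adj ` {v i |i. enat i < r}))"
    unfolding red_control_space_def riesz_dual_opB
      by (rule arg_cong[where f = "\<lambda>A. closure (span A)"]) blast
  have g0: "AE t in time_measure T. red_gradient ?X u t = 0"
    using u(2) L2_norm_zero_iff[OF red_gradient_L2[OF X u(1)]] by blast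
  have "AE t in time_measure T. dual_state ?X u t \<in> ?X"
    by (rule L2_into_D(2)[OF backward_L2(2)[OF dual_state_backward[OF X u(1)]]])
  with g0 have "AE t in time_measure T. u t \<in> ?U"
  proof eventually_elim
    fix t assume g: "red_gradient ?X u t = 0" and p: "dual_state ?X u t \<in> ?X"
    have "bop_adj (dual_state ?X u t) \<in> ?U" unfolding Ueq by (rule bop_adj_pod_space[OF p])
    then have "(- (1 / \<beta>)) *\<^sub>R bop_adj (dual_state ?X u t) \<in> ?U" by (rule subspace_scale[OF U])
    moreover have "bop_adj (dual_state ?X u t) = - (\<beta> *\<^sub>R u t)" using g
      by (simp add: red_gradient_def eq_neg_iff_add_eq_0)
    ultimately show "u t \<in> ?U" using beta by simp
  qed
  with u(1) show ?thesis by (simp add: L2_into_def)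
qed

lemma algorithm_step_exists:
  assumes S: "snapshot_set T S"
  shows "\<exists>w. algorithm_step P S w"
proof -
  interpret S: snapshot_set T S by fact
  let ?X = "pod_space (max_pod_rank T S) S.R.eigenvec"
  have X: "subspace ?X" "closed ?X" unfolding pod_space_def by (auto intro: subspace_closure)
  obtain u where u: "u \<in> L2 T" "L2_norm T (red_gradient ?X u) = 0" using red_optimal_exists[OF X]
    by blast
  have "unique_minimizer T (L2_into T (red_control_space P (max_pod_rank T S) S.R.eigenvec)) (red_cost P
    ?X) u"
    by (rule red_optimal_minimizer[OF X u _ red_optimal_in_control_space[OF u]]) (auto dest: L2_into_D)
  then show ?thesis unfolding algorithm_step_def Let_def using S.pod_eigensystem_exists by blast
qed

text \<open>The optimum over all controls lies in the reduced control space, so the uniqueness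
  clause of the step identifies it with \<open>w\<close> up to a null set, and the gradient norm
  does not see null sets.\<close>

lemma algorithm_step_optimal:
  assumes S: "snapshot_set T S" and w: "algorithm_step P S w"
  shows "w \<in> L2 T" "L2_norm T (red_gradient (snapshot_set.W T S) w) = 0"
proof -
  interpret S: snapshot_set T S by fact
  obtain lam v where es: "pod_eigensystem T S lam v"
    and min: "unique_minimizer T (L2_into T (red_control_space P (max_pod_rank T S) v)) (red_cost P
      (pod_space (max_pod_rank T S) v)) w"
    using w unfolding algorithm_step_def Let_def by blast
  let ?r = "max_pod_rank T S"
  have XW: "pod_space ?r v = S.W" by (rule S.pod_space_eq[OF es])
  have X: "subspace (pod_space ?r v)" "closed (pod_space ?r v)" unfolding pod_space_def
    by (auto intro: subspace_closure)
  obtain u where u: "u \<in> L2 T" "L2_norm T (red_gradient (pod_space ?r v) u) = 0"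
    using red_optimal_exists[OF X] by blast
  have uK: "u \<in> L2_into T (red_control_space P ?r v)" by (rule red_optimal_in_control_space[OF u])
  have wK: "w \<in> L2_into T (red_control_space P ?r v)" using min by (simp add: unique_minimizer_def)
  then show wL: "w \<in> L2 T" by (rule L2_into_D)
  have "red_cost P (pod_space ?r v) u \<le> red_cost P (pod_space ?r v) w"
    using red_optimal_minimizer[OF X u subset_refl u(1)] wL unfolding unique_minimizer_def by blast
  moreover have "red_cost P (pod_space ?r v) w \<le> red_cost P (pod_space ?r v) u" using min uK
    unfolding unique_minimizer_def by blast
  ultimately have "AE t in time_measure T. u t = w t" using min uK unfolding unique_minimizer_def
    by force
  from red_gradient_norm_cong[OF X u(1) wL this] u(2) show "L2_norm T (red_gradient S.W w) = 0"
    by (simp add: XW)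
qed

lemma UNIV_closed_subspace: "subspace (UNIV :: 'v set)" "closed (UNIV :: 'v set)"
  by auto

lemma snapshots_set:
  assumes "\<And>i. i < k \<Longrightarrow> u i \<in> L2 T"
  shows "snapshot_set T (snapshots P u k)"
  using assms
proof (induction k)
  case 0 show ?case by unfold_locales auto
next
  case (Suc k)
  then have "snapshot_set T (snapshots P u k)" and u: "u k \<in> L2 T" by auto
  then have S: "finite (snapshots P u k)" "snapshots P u k \<subseteq> L2 T" by (auto simp: snapshot_set_def)
  have "state P (u k) \<in> L2 T" unfolding state_eq_red_state
    by (rule red_state_L2[OF UNIV_closed_subspace u])
  moreover have "adjoint_of_control P (u k) \<in> L2 T"
    unfolding adjoint_of_control_eq[OF u] by (rule backward_L2(1)[OF dual_state_backward[OF
      UNIV_closed_subspace u]])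
  ultimately show ?case using S by unfold_locales auto
qed

lemma snapshots_mono: "k \<le> m \<Longrightarrow> snapshots P u k \<subseteq> snapshots P u m"
  by (induction m rule: dec_induct) auto

text \<open>Complete induction is used because the snapshot set of a step involves all earlier
  iterates; values beyond the stopping index are unconstrained, hence the bound on
  \<open>k\<close>.\<close>

lemma run_L2:
  assumes run: "algorithm_run P \<epsilon> u0 u N" and u0: "u0 \<in> L2 T" and k: "enat k \<le> N"
  shows "u k \<in> L2 T"
  using k
proof (induction k rule: less_induct)
  case (less k)
  show ?case
  proof (cases k)
    case 0 then show ?thesis using run u0 by (simp add: algorithm_run_def)
  next
    case (Suc m)
    have mN: "enat m < N" using less.prems Suc by (metis Suc_ile_eq)
    have "u i \<in> L2 T" if "i < Suc m" for i
    proof (rule less.IH)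
      show "i < k" using that Suc by simp
      have "enat i \<le> enat k" using that Suc by simp
      then show "enat i \<le> N" using less.prems by (rule order_trans)
    qed
    then have "snapshot_set T (snapshots P u (Suc m))" by (rule snapshots_set)
    moreover have "algorithm_step P (snapshots P u (Suc m)) (u (Suc m))" using run mN
      by (simp add: algorithm_run_def)
    ultimately show ?thesis using algorithm_step_optimal(1) Suc by blast
  qed
qed

text \<open>
  The state and adjoint state of an iterate lie in the next POD space, where the reduced
  gradient therefore agrees with the full one; as it vanishes at the next iterate, the
  full gradient is controlled by the difference of both iterates.
\<close>

lemma infinite_run_gradient:
  assumes run: "algorithm_run P \<epsilon> u0 u \<infinity>" and u0: "u0 \<in> L2 T"
  shows "(\<lambda>k. L2_norm T (gradient P (u k))) \<longlonglongrightarrow> 0"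
proof -
  have uL: "u k \<in> L2 T" for k by (rule run_L2[OF run u0]) simp
  have SS: "snapshot_set T (snapshots P u k)" for k by (rule snapshots_set[OF uL])
  define X where "X k = snapshot_set.W T (snapshots P u (Suc k))" for k
  have X: "subspace (X k)" "closed (X k)" for k
    unfolding X_def by (rule snapshot_set.W_subspace[OF SS], rule snapshot_set.W_closed[OF SS])
  have inc: "X k \<subseteq> X m" if "k \<le> m" for k m
    unfolding X_def by (rule snapshot_W_mono[OF SS SS snapshots_mono]) (use that in simp)
  have opt: "L2_norm T (red_gradient (X k) (u (Suc k))) = 0" for k
    unfolding X_def by (rule algorithm_step_optimal(2)[OF SS]) (use run in \<open>simp add:
      algorithm_run_def\<close>)
  obtain v where v: "v \<in> L2 T" "(\<lambda>k. L2_norm T (\<lambda>t. u (Suc k) t - v t)) \<longlonglongrightarrow> 0"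
    using optimal_controls_converge[of X "\<lambda>k. u (Suc k)", OF X inc uL opt] by auto
  have grad: "L2_norm T (gradient P (u (Suc k))) \<le> (\<beta>
    + observation_bound\<^sup>2) * (L2_norm T (\<lambda>t. u (Suc k) t - v t)
    + L2_norm T (\<lambda>t. u (Suc (Suc k)) t - v t))" for k
  proof -
    let ?X = "X (Suc k)"
    have "state P (u (Suc k)) \<in> snapshots P u (Suc (Suc k))" "adjoint_of_control P (u (Suc k)) \<in>
      snapshots P u (Suc (Suc k))" by auto
    then have "AE t in time_measure T. state P (u (Suc k)) t \<in> ?X" "AE t in time_measure T.
      adjoint_of_control P (u (Suc k)) t \<in> ?X"
      unfolding X_def using snapshot_set.snapshot_in_W[OF SS] by blast+
    then have ae: "AE t in time_measure T. red_gradient ?X (u (Suc k)) t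
      = red_gradient UNIV (u (Suc k)) t"
      unfolding state_eq_red_state adjoint_of_control_eq[OF uL]
        by (rule red_gradient_consistent[OF X uL])
    have L: "red_gradient ?X (u i) \<in> L2 T" for i by (rule red_gradient_L2[OF X uL])
    note LU = red_gradient_L2[OF UNIV_closed_subspace uL]
    have "L2_norm T (gradient P (u (Suc k))) = L2_norm T (red_gradient ?X (u (Suc k)))"
      unfolding gradient_eq[OF uL] by (rule L2_norm_cong_AE[OF L2_measurable[OF L] L2_measurable[OF LU]
        ae, symmetric])
    also have "\<dots> \<le> L2_norm T (\<lambda>t. red_gradient ?X (u (Suc k)) t - red_gradient ?X (u (Suc (Suc k))) t)
      + L2_norm T (red_gradient ?X (u (Suc (Suc k))))"
      using L2_norm_triangle[OF L2_diff[OF L[of "Suc k"] L[of "Suc (Suc k)"]] L[of "Suc (Suc k)"]]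
        by simp
    also have "\<dots> \<le> (\<beta> + observation_bound\<^sup>2) * L2_norm T (\<lambda>t. u (Suc k) t - u (Suc (Suc k)) t)"
      using red_gradient_lipschitz[OF X uL uL observation_forward_bound[OF X] observation_bound_nonneg]
        opt[of "Suc k"] by simp
    also have "\<dots> \<le> (\<beta> + observation_bound\<^sup>2) * (L2_norm T (\<lambda>t. u (Suc k) t - v t)
      + L2_norm T (\<lambda>t. u (Suc (Suc k)) t - v t))"
      using L2_norm_diff_triangle[OF uL v(1) uL, of "Suc k" "Suc (Suc k)"] beta
      by (intro mult_left_mono) (auto simp: L2_norm_minus_commute[of T v])
    finally show ?thesis .
  qed
  have "(\<lambda>k. (\<beta> + observation_bound\<^sup>2) * (L2_norm T (\<lambda>t. u (Suc k) t - v t)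
    + L2_norm T (\<lambda>t. u (Suc (Suc k)) t - v t))) \<longlonglongrightarrow> (\<beta> + observation_bound\<^sup>2) * (0 + 0)"
    by (intro tendsto_intros v(2) LIMSEQ_Suc[OF v(2)])
  then have lim: "(\<lambda>k. (\<beta> + observation_bound\<^sup>2) * (L2_norm T (\<lambda>t. u (Suc k) t - v t)
    + L2_norm T (\<lambda>t. u (Suc (Suc k)) t - v t))) \<longlonglongrightarrow> 0" by simp
  have "(\<lambda>k. L2_norm T (gradient P (u (Suc k)))) \<longlonglongrightarrow> 0"
    by (rule Lim_null_comparison[OF always_eventually[OF allI] lim]) (simp only: real_norm_def
      abs_of_nonneg[OF L2_norm_nonneg] grad)
  then show ?thesis by (rule LIMSEQ_imp_Suc)
qed

text \<open>The snapshot set is carried along with the iterate, since a step depends on the whole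
  history.\<close>

primrec run_iterate :: "(real \<Rightarrow> 'u) \<Rightarrow> nat \<Rightarrow> (real \<Rightarrow> 'v) set \<times> (real \<Rightarrow> 'u)" where
  "run_iterate u0 0 = ({}, u0)"
| "run_iterate u0 (Suc k) =
    (let S = fst (run_iterate u0 k) \<union> {state P (snd (run_iterate u0 k)), adjoint_of_control P (snd
      (run_iterate u0 k))}
     in (S, SOME w. algorithm_step P S w))"

lemma run_exists:
  assumes u0: "u0 \<in> L2 T"
  shows "\<exists>u N. algorithm_run P \<epsilon> u0 u N"
proof -
  define u where "u k = snd (run_iterate u0 k)" for k
  have fst: "fst (run_iterate u0 k) = snapshots P u k" for k
    by (induction k) (auto simp: u_def Let_def)
  have uS: "u (Suc k) = (SOME w. algorithm_step P (snapshots P u (Suc k)) w)" for k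
    by (simp add: u_def Let_def fst[symmetric])
  have step: "u k \<in> L2 T \<and> algorithm_step P (snapshots P u (Suc k)) (u (Suc k))" for k
  proof (induction k rule: less_induct)
    case (less k)
    have uk: "u i \<in> L2 T" if "i \<le> k" for i
    proof (cases i)
      case 0 then show ?thesis using u0 by (simp add: u_def)
    next
      case (Suc m)
      then have "snapshot_set T (snapshots P u (Suc m))" using less that by (intro snapshots_set) auto
      moreover have "algorithm_step P (snapshots P u (Suc m)) (u (Suc m))" using less that Suc by auto
      ultimately show ?thesis using algorithm_step_optimal(1) Suc by blast
    qed
    then have "snapshot_set T (snapshots P u (Suc k))" by (intro snapshots_set) auto
    from someI_ex[OF algorithm_step_exists[OF this]] show ?case using uk uS[of k] by simp
  qed
  \<comment> \<open>The iteration is constructed without a stopping test; the stopping index is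
    determined afterwards as the first index that passes it.\<close>
  define N where "N = (if \<exists>k. Delta_upper P (u k) \<le> \<epsilon> then enat (LEAST k. Delta_upper P (u k)
    \<le> \<epsilon>) else \<infinity>)"
  have "algorithm_run P \<epsilon> u0 u N"
    unfolding algorithm_run_def
  proof (intro conjI allI impI)
    show "u 0 = u0" by (simp add: u_def)
    fix k
    show "algorithm_step P (snapshots P u (Suc k)) (u (Suc k))" using step by blast
    show "\<not> Delta_upper P (u k) \<le> \<epsilon>" if "enat k < N"
    proof (cases "\<exists>k. Delta_upper P (u k) \<le> \<epsilon>")
      case True
      then have "k < (LEAST k. Delta_upper P (u k) \<le> \<epsilon>)" using that by (simp add: N_def)
      then show ?thesis by (rule not_less_Least)
    next
      case False then show ?thesis by blast
    qed
    show "Delta_upper P (u k) \<le> \<epsilon>" if "N = enat k"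
    proof -
      have ex: "\<exists>k. Delta_upper P (u k) \<le> \<epsilon>" using that by (auto simp: N_def split: if_splits)
      then have "k = (LEAST k. Delta_upper P (u k) \<le> \<epsilon>)" using that by (simp add: N_def)
      then show ?thesis using LeastI_ex[OF ex] by simp
    qed
  qed
  then show ?thesis by blast
qed

text \<open>The gradient vanishes at \<open>v\<close>, so its norm at \<open>u\<close> is that of a
  difference of gradients. Strong monotonicity bounds this from below, and Lipschitz continuity with
  \<open>norm_CS P\<close> bounds it from above.\<close>

lemma error_bounds:
  assumes v: "v \<in> L2 T" "L2_norm T (red_gradient UNIV v) = 0" and u: "u \<in> L2 T" and N: "0 \<le> norm_CS P"
  shows "L2_norm T (\<lambda>t. v t - u t) \<le> Delta_upper P u" "Delta_lower P u \<le> L2_norm T (\<lambda>t. v t - u t)" "0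
    \<le> Delta_lower P u"
proof -
  note UN = UNIV_closed_subspace
  let ?d = "L2_norm T (\<lambda>t. v t - u t)"
  note Lv = red_gradient_L2[OF UN v(1)] and Lu = red_gradient_L2[OF UN u]
  have g: "L2_norm T (gradient P u) = L2_norm T (red_gradient UNIV u)" by (simp add: gradient_eq[OF u])
  have "\<beta> * ?d \<le> L2_norm T (\<lambda>t. red_gradient UNIV v t - red_gradient UNIV u t)"
    by (rule red_gradient_monotone[OF UN v(1) u])
  also have "\<dots> \<le> L2_norm T (red_gradient UNIV u)" using L2_norm_triangle_diff[OF Lv Lu] v(2) by simp
  finally show "?d \<le> Delta_upper P u" unfolding Delta_upper_def g using beta
    by (simp add: pos_le_divide_eq mult.commute)
  have "L2_norm T (red_gradient UNIV u) \<le> L2_norm T (\<lambda>t. red_gradient UNIV u t - red_gradient UNIV v t)"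
    using L2_norm_triangle[OF L2_diff[OF Lu Lv] Lv] v(2) by simp
  also have "\<dots> \<le> (\<beta> + (norm_CS P)\<^sup>2) * L2_norm T (\<lambda>t. u t - v t)"
    by (rule red_gradient_lipschitz[OF UN u v(1) norm_CS_bound N])
  finally have le: "L2_norm T (red_gradient UNIV u) \<le> (\<beta> + (norm_CS P)\<^sup>2) * ?d"
    by (simp add: L2_norm_minus_commute[of T u])
  have pos: "\<beta> + (norm_CS P)\<^sup>2 > 0" using beta by (simp add: add_pos_nonneg)
  show "Delta_lower P u \<le> ?d" unfolding Delta_lower_def g using le pos
    by (simp add: pos_divide_le_eq mult.commute)
  show "0 \<le> Delta_lower P u" unfolding Delta_lower_def using pos by simp
qed

lemma full_cost_eq: "full_cost P = red_cost P UNIV"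
  by (rule ext) (simp add: full_cost_def red_cost_def state_eq_red_state)

end

theorem theorem14:
  fixes P :: "('u::{real_inner, banach, second_countable_topology},
               'v::{real_inner, banach, second_countable_topology},
               'h::{real_inner, banach, second_countable_topology}) control_problem"
    and u\<^sub>0 :: "real \<Rightarrow> 'u"
    and \<epsilon> :: real
  assumes "horizon P > 0"
    and "compact_dense_embedding (emb P)"
    and "assumption_A1 P"
    and "assumption_A2 P"
    and "norm_CS P > 0"
    and "u\<^sub>0 \<in> L2 (horizon P)"
    and "\<epsilon> \<ge> 0"
  shows "\<exists>u_opt. unique_minimizer (horizon P) (L2 (horizon P)) (full_cost P) u_opt \<and>
    (\<exists>u N. algorithm_run P \<epsilon> u\<^sub>0 u N) \<and>
    (\<forall>u N. algorithm_run P \<epsilon> u\<^sub>0 u N \<longrightarrow>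
       (\<epsilon> = 0 \<longrightarrow>
          (case N of
             enat k \<Rightarrow> (AE t in time_measure (horizon P). u k t = u_opt t)
           | \<infinity> \<Rightarrow> (\<forall>k. u k \<in> L2 (horizon P)) \<and>
                 (\<lambda>k. L2_norm (horizon P) (\<lambda>t. u k t - u_opt t)) \<longlonglongrightarrow> 0)) \<and>
       (\<epsilon> > 0 \<longrightarrow>
          (\<exists>k. N = enat k \<and>
               u k \<in> L2 (horizon P) \<and>
               L2_norm (horizon P) (gradient P (u k)) \<le> beta P * \<epsilon> \<and>
               0 \<le> Delta_lower P (u k) \<and>
               Delta_lower P (u k) \<le> L2_norm (horizon P) (\<lambda>t. u_opt t - u k t) \<and>
               L2_norm (horizon P) (\<lambda>t. u_opt t - u k t) \<le> Delta_upper P (u k) \<and>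
               Delta_upper P (u k) \<le> \<epsilon>)))"
proof -
  obtain KA \<eta> where A: "\<And>v w. (\<lambda>t. opA P t v w) \<in> borel_measurable (time_measure (horizon P))"
      "AE t in time_measure (horizon P). norm (opA P t) \<le> KA" "\<eta> > 0"
      "\<And>t v. t \<in> {0<..<horizon P} \<Longrightarrow> opA P t v v \<ge> \<eta> * (norm v)\<^sup>2"
    using assms(3) unfolding assumption_A1_def by blast
  obtain KC where C: "\<And>x z. (\<lambda>t. opC P t x \<bullet> z) \<in> borel_measurable (time_measure (horizon P))"
      "AE t in time_measure (horizon P). norm (opC P t) \<le> KC" "beta P > 0" "y_target P \<in> L2 (horizon P)"
    using assms(4) unfolding assumption_A2_def by blast
  \<comment> \<open>The maxima enforce the normalizations of the locale, namely that the bound on A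
    is at least the coercivity constant and that the bound on C is nonnegative.\<close>
  interpret optimal_control P "max KA \<eta>" \<eta> "max KC 0"
  proof
    show "AE t in time_measure (horizon P). norm (opA P t) \<le> max KA \<eta>" using A(2)
      by eventually_elim simp
    show "AE t in time_measure (horizon P). norm (opC P t) \<le> max KC 0" using C(2)
      by eventually_elim simp
  qed (fact assms A C | simp)+
  note UN = UNIV_closed_subspace
  obtain v where v: "v \<in> L2 T" "L2_norm T (red_gradient UNIV v) = 0" using red_optimal_exists[OF UN]
    by blast
  have min: "unique_minimizer T (L2 T) (full_cost P) v"
    unfolding full_cost_eq by (rule red_optimal_minimizer[OF UN v subset_refl v(1)])
  have N0: "0 \<le> norm_CS P" using assms(5) by simp
  have upper: "L2_norm T (\<lambda>t. v t - w t) \<le> Delta_upper P w" if "w \<in> L2 T" for w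
    by (rule error_bounds(1)[OF v that N0])
  have runs: "(\<epsilon> = 0 \<longrightarrow>
          (case N of
             enat k \<Rightarrow> (AE t in time_measure T. u k t = v t)
           | \<infinity> \<Rightarrow> (\<forall>k. u k \<in> L2 T) \<and> (\<lambda>k. L2_norm T (\<lambda>t. u k t - v t)) \<longlonglongrightarrow> 0)) \<and>
       (\<epsilon> > 0 \<longrightarrow>
          (\<exists>k. N = enat k \<and> u k \<in> L2 T \<and>
               L2_norm T (gradient P (u k)) \<le> \<beta> * \<epsilon> \<and>
               0 \<le> Delta_lower P (u k) \<and>
               Delta_lower P (u k) \<le> L2_norm T (\<lambda>t. v t - u k t) \<and>
               L2_norm T (\<lambda>t. v t - u k t) \<le> Delta_upper P (u k) \<and>
               Delta_upper P (u k) \<le> \<epsilon>))"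
    if run: "algorithm_run P \<epsilon> u\<^sub>0 u N" for u N
  proof (cases N)
    case (enat k)
    have uk: "u k \<in> L2 T" by (rule run_L2[OF run assms(6)]) (simp add: enat)
    have D: "Delta_upper P (u k) \<le> \<epsilon>" using run enat by (simp add: algorithm_run_def)
    have "AE t in time_measure T. u k t = v t" if "\<epsilon> = 0"
    proof -
      have "L2_norm T (\<lambda>t. u k t - v t) \<le> 0" using upper[OF uk] D that
        by (simp add: L2_norm_minus_commute[of T "u k"])
      then show ?thesis by (rule AE_eq_if_L2_norm_le_zero[OF uk v(1)])
    qed
    moreover have "L2_norm T (gradient P (u k)) \<le> \<beta> * \<epsilon>"
      using D beta by (simp add: Delta_upper_def pos_divide_le_eq mult.commute)
    ultimately show ?thesis using enat uk D upper[OF uk] error_bounds(2,3)[OF v uk N0] by simp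
  next
    case infinity
    note run' = run[unfolded infinity]
    have uL: "u k \<in> L2 T" for k by (rule run_L2[OF run' assms(6)]) simp
    have "(\<lambda>k. 1 / \<beta> * L2_norm T (gradient P (u k))) \<longlonglongrightarrow> 0"
      by (rule tendsto_mult_right_zero[OF infinite_run_gradient[OF run' assms(6)]])
    then have D0: "(\<lambda>k. Delta_upper P (u k)) \<longlonglongrightarrow> 0" by (simp add: Delta_upper_def)
    have "(\<lambda>k. L2_norm T (\<lambda>t. u k t - v t)) \<longlonglongrightarrow> 0"
    proof (rule Lim_null_comparison[OF always_eventually[OF allI] D0])
      show "norm (L2_norm T (\<lambda>t. u k t - v t)) \<le> Delta_upper P (u k)" for k
        using upper[OF uL[of k]] by (simp add: L2_norm_minus_commute[of T "u k"])
    qed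
    \<comment> \<open>Along an infinite run the upper error bound tends to zero, so it would pass
      the stopping test for any positive tolerance.\<close>
    moreover have False if eps: "\<epsilon> > 0"
    proof -
      obtain k where "Delta_upper P (u k) < \<epsilon>"
        using order_tendstoD(2)[OF D0 eps] by (auto simp: eventually_sequentially)
      moreover have "\<not> Delta_upper P (u k) \<le> \<epsilon>" using run' by (simp add: algorithm_run_def)
      ultimately show False by simp
    qed
    ultimately show ?thesis using infinity uL by auto
  qed
  show ?thesis
    by (rule exI[of _ v]) (use min run_exists[OF assms(6)] runs in blast)
qed

end
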